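(* Let $\Bbbk$ be a field of characteristic $0$, let $n\ge3$, and let $\Omega\in\Bbbk^{[n+1]}=\Bbbk[t_1,\dots,t_{n+1}]$ be an i.s. potential of degree $\ge n+3$. Then, for every $\xi\in\Bbbk$, both $P_{\Omega-\xi}$ and $Q(P_{\Omega-\xi})$ satisfy the Dixmier property.
   Context: A Nambu-Poisson algebra ($n$-Lie Poisson algebra) is a commutative $\Bbbk$-algebra $P$ with an $n$-ary $\Bbbk$-multilinear bracket $\{-,\dots,-\}$ that vanishes whenever two arguments are equal, satisfies $\{\{u_1,\dots,u_n\},v_1,\dots,v_{n-1}\}=\sum_{s=1}^n\{u_1,\dots,u_{s-1},\{u_s,v_1,\dots,v_{n-1}\},u_{s+1},\dots,u_n\}$, and satisfies the Leibniz rule in each argument. The bracket of a Nambu-Poisson domain $A$ extends uniquely to its fraction field $Q(A)$. Morphisms are $\Bbbk$-algebra maps preserving brackets. A Nambu-Poisson algebra $B$ satisfies the Dixmier property if every injective Nambu-Poisson algebra morphism $B\to B$ is bijective. An i.s. potential is a homogeneous element $\Omega\in\Bbbk^{[n+1]}$ (with $\deg t_i=1$ for all $i$) such that $\Bbbk^{[n+1]}/(\Omega_{t_1},\dots,\Omega_{t_{n+1}})$ is finite-dimensional over $\Bbbk$, where $\Omega_{t_i}=\partial\Omega/\partial t_i$. $A_\Omega$ denotes $\Bbbk^{[n+1]}$ with the Nambu-Poisson bracket $\{f_1,\dots,f_n\}=\det\frac{\partial(f_1,\dots,f_n,\Omega)}{\partial(t_1,\dots,t_{n+1})}$ (the Jacobian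 determinant whose last row is the gradient of $\Omega$). For $\xi\in\Bbbk$, $P_{\Omega-\xi}=A_\Omega/(\Omega-\xi)$ with the induced bracket. *)

theory Defs
  imports
    "HOL-Library.Poly_Mapping"
    "HOL-Library.FuncSet"
    "HOL-Algebra.QuotRing"
    "Jordan_Normal_Form.VS_Connect"
    "Jordan_Normal_Form.Determinant"
begin

section \<open>Nambu-Poisson algebras\<close>

text \<open>Algebras over the ground field \<open>'k\<close> are algebras in the sense of \<^theory>\<open>HOL-Algebra.Module\<close>
  over \<^term>\<open>class_ring\<close>, the field \<open>'k\<close> regarded as a ring with a carrier. The arguments of an
  n-ary bracket form a list of length n; the bracket is irrelevant on all other lists.\<close>

record ('k, 'a) nambu = "('k, 'a) module" +
  bracket :: "'a list \<Rightarrow> 'a"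

locale nambu_poisson_algebra = algebra class_ring P
  for n :: nat and P :: "('k::field, 'a, 'm) nambu_scheme" (structure) +
  assumes bracket_closed:
      "\<lbrakk>set us \<subseteq> carrier P; length us = n\<rbrakk> \<Longrightarrow> bracket P us \<in> carrier P"
    and bracket_add:
      "\<lbrakk>set us \<subseteq> carrier P; length us = n; i < n; x \<in> carrier P; y \<in> carrier P\<rbrakk> \<Longrightarrow>
        bracket P (us[i := x \<oplus>\<^bsub>P\<^esub> y]) = bracket P (us[i := x]) \<oplus>\<^bsub>P\<^esub> bracket P (us[i := y])"
    and bracket_smult:
      "\<lbrakk>set us \<subseteq> carrier P; length us = n; i < n; x \<in> carrier P\<rbrakk> \<Longrightarrow>
        bracket P (us[i := c \<odot>\<^bsub>P\<^esub> x]) = c \<odot>\<^bsub>P\<^esub> bracket P (us[i := x])"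
    and bracket_alternating:
      "\<lbrakk>set us \<subseteq> carrier P; length us = n; i < n; j < n; i \<noteq> j; us ! i = us ! j\<rbrakk> \<Longrightarrow>
        bracket P us = \<zero>\<^bsub>P\<^esub>"
    and fundamental_identity:
      "\<lbrakk>set us \<subseteq> carrier P; length us = n; set vs \<subseteq> carrier P; length vs = n - 1\<rbrakk> \<Longrightarrow>
        bracket P (bracket P us # vs) =
          (\<Oplus>\<^bsub>P\<^esub>s\<in>{..<n}. bracket P (us[s := bracket P (us ! s # vs)]))"
    and leibniz:
      "\<lbrakk>set us \<subseteq> carrier P; length us = n; i < n; x \<in> carrier P; y \<in> carrier P\<rbrakk> \<Longrightarrow>
        bracket P (us[i := x \<otimes>\<^bsub>P\<^esub> y]) =
          x \<otimes>\<^bsub>P\<^esub> bracket P (us[i := y]) \<oplus>\<^bsub>P\<^esub> y \<otimes>\<^bsub>P\<^esub> bracket P (us[i := x])"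

definition nambu_hom ::
  "nat \<Rightarrow> ('k, 'a, 'm) nambu_scheme \<Rightarrow> ('k, 'b, 'l) nambu_scheme \<Rightarrow> ('a \<Rightarrow> 'b) set" where
  "nambu_hom n A B = {h \<in> Ring.ring_hom A B.
     (\<forall>c. \<forall>x\<in>carrier A. h (c \<odot>\<^bsub>A\<^esub> x) = c \<odot>\<^bsub>B\<^esub> h x) \<and>
     (\<forall>us. set us \<subseteq> carrier A \<and> length us = n \<longrightarrow> h (bracket A us) = bracket B (map h us))}"

definition dixmier_property :: "nat \<Rightarrow> ('k::field, 'a, 'm) nambu_scheme \<Rightarrow> bool" where
  "dixmier_property n B \<longleftrightarrow> nambu_poisson_algebra n B \<and>
     (\<forall>h\<in>nambu_hom n B B. inj_on h (carrier B) \<longrightarrow> bij_betw h (carrier B) (carrier B))"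


section \<open>Quotient algebras and fraction fields\<close>

definition quotient_algebra ::
  "('k, 'a, 'm) module_scheme \<Rightarrow> 'a set \<Rightarrow> ('k, 'a set) module" where
  "quotient_algebra A I =
     ring.extend (A Quot I) (module.fields (\<lambda>c X. \<Union>x\<in>X. I +>\<^bsub>A\<^esub> (c \<odot>\<^bsub>A\<^esub> x)))"

definition quotient_nambu ::
  "('k, 'a, 'm) nambu_scheme \<Rightarrow> 'a set \<Rightarrow> ('k, 'a set) nambu" where
  "quotient_nambu A I =
     module.extend (quotient_algebra A I)
       (nambu.fields (\<lambda>Xs. \<Union>xs\<in>{xs. list_all2 (\<in>) xs Xs}. I +>\<^bsub>A\<^esub> bracket A xs))"

text \<open>The fraction field of a domain \<open>A\<close>; the fraction \<open>a / b\<close> is the class of the pair \<open>(a, b)\<close>.\<close>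

definition fraction_rel :: "('a, 'm) ring_scheme \<Rightarrow> (('a \<times> 'a) \<times> ('a \<times> 'a)) set" where
  "fraction_rel A = {((a, b), (c, d)).
     a \<in> carrier A \<and> b \<in> carrier A - {\<zero>\<^bsub>A\<^esub>} \<and> c \<in> carrier A \<and> d \<in> carrier A - {\<zero>\<^bsub>A\<^esub>} \<and>
     a \<otimes>\<^bsub>A\<^esub> d = c \<otimes>\<^bsub>A\<^esub> b}"

definition fraction :: "('a, 'm) ring_scheme \<Rightarrow> 'a \<Rightarrow> 'a \<Rightarrow> ('a \<times> 'a) set" where
  "fraction A a b = fraction_rel A `` {(a, b)}"

definition fraction_field ::
  "('k, 'a, 'm) module_scheme \<Rightarrow> ('k, ('a \<times> 'a) set) module" where
  "fraction_field A = \<lparr>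
     carrier = (carrier A \<times> (carrier A - {\<zero>\<^bsub>A\<^esub>})) // fraction_rel A,
     mult = (\<lambda>X Y. \<Union>(a, b)\<in>X. \<Union>(c, d)\<in>Y. fraction A (a \<otimes>\<^bsub>A\<^esub> c) (b \<otimes>\<^bsub>A\<^esub> d)),
     one = fraction A \<one>\<^bsub>A\<^esub> \<one>\<^bsub>A\<^esub>,
     zero = fraction A \<zero>\<^bsub>A\<^esub> \<one>\<^bsub>A\<^esub>,
     add = (\<lambda>X Y. \<Union>(a, b)\<in>X. \<Union>(c, d)\<in>Y.
              fraction A (a \<otimes>\<^bsub>A\<^esub> d \<oplus>\<^bsub>A\<^esub> c \<otimes>\<^bsub>A\<^esub> b) (b \<otimes>\<^bsub>A\<^esub> d)),
     smult = (\<lambda>k X. \<Union>(a, b)\<in>X. fraction A (k \<odot>\<^bsub>A\<^esub> a) b)\<rparr>"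

text \<open>The bracket of a Nambu-Poisson domain extends uniquely to a Nambu-Poisson bracket on its
  fraction field; the values on lists that are not n-tuples of elements are fixed by extensionality
  so that the description below is unique.\<close>

definition fraction_bracket ::
  "nat \<Rightarrow> ('k::field, 'a, 'm) nambu_scheme \<Rightarrow> ('a \<times> 'a) set list \<Rightarrow> ('a \<times> 'a) set" where
  "fraction_bracket n A = (THE br.
     br \<in> extensional {Xs. set Xs \<subseteq> carrier (fraction_field A) \<and> length Xs = n} \<and>
     nambu_poisson_algebra n (module.extend (fraction_field A) (nambu.fields br)) \<and>
     (\<forall>us. set us \<subseteq> carrier A \<and> length us = n \<longrightarrow>
        br (map (\<lambda>a. fraction A a \<one>\<^bsub>A\<^esub>) us) = fraction A (bracket A us) \<one>\<^bsub>A\<^esub>))"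

definition fraction_nambu ::
  "nat \<Rightarrow> ('k::field, 'a, 'm) nambu_scheme \<Rightarrow> ('k, ('a \<times> 'a) set) nambu" where
  "fraction_nambu n A = module.extend (fraction_field A) (nambu.fields (fraction_bracket n A))"


section \<open>Polynomials in several variables\<close>

text \<open>A polynomial maps exponent vectors to coefficients. The variables are indexed from 0, so that
  the polynomials in n variables are those involving only the variables of index less than n.\<close>

type_synonym 'k mpoly = "(nat \<Rightarrow>\<^sub>0 nat) \<Rightarrow>\<^sub>0 'k"

definition mpoly_const :: "'k::zero \<Rightarrow> 'k mpoly" where
  "mpoly_const c = Poly_Mapping.single 0 c"

definition mpoly_algebra :: "nat \<Rightarrow> ('k::field, 'k mpoly) module" where
  "mpoly_algebra n = \<lparr>
     carrier = {p. \<forall>m\<in>Poly_Mapping.keys p. Poly_Mapping.keys m \<subseteq> {..<n}},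
     mult = (*), one = 1, zero = 0, add = (+),
     smult = (\<lambda>c p. mpoly_const c * p)\<rparr>"

definition mpderiv :: "nat \<Rightarrow> 'k::field mpoly \<Rightarrow> 'k mpoly" where
  "mpderiv i p = (\<Sum>m\<in>Poly_Mapping.keys p.
     Poly_Mapping.single (m - Poly_Mapping.single i 1)
       (of_nat (Poly_Mapping.lookup m i) * Poly_Mapping.lookup p m))"

definition monomial_degree :: "(nat \<Rightarrow>\<^sub>0 nat) \<Rightarrow> nat" where
  "monomial_degree m = (\<Sum>i\<in>Poly_Mapping.keys m. Poly_Mapping.lookup m i)"

definition homogeneous :: "nat \<Rightarrow> 'k::zero mpoly \<Rightarrow> bool" where
  "homogeneous d p \<longleftrightarrow> (\<forall>m\<in>Poly_Mapping.keys p. monomial_degree m = d)"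

definition total_degree :: "'k::zero mpoly \<Rightarrow> nat" where
  "total_degree p = Max (insert 0 (monomial_degree ` Poly_Mapping.keys p))"


section \<open>Isolated singularity potentials\<close>

text \<open>In the next two definitions n is the number of variables; a potential for an n-ary bracket
  has n + 1 of them.\<close>

definition jacobian_ideal :: "nat \<Rightarrow> 'k::field mpoly \<Rightarrow> 'k mpoly set" where
  "jacobian_ideal n \<Omega> = genideal (mpoly_algebra n) ((\<lambda>i. mpderiv i \<Omega>) ` {..<n})"

definition isolated_singularity_potential :: "nat \<Rightarrow> 'k::field mpoly \<Rightarrow> bool" where
  "isolated_singularity_potential n \<Omega> \<longleftrightarrow>
     \<Omega> \<in> carrier (mpoly_algebra n :: ('k, 'k mpoly) module) \<and>
     (\<exists>d. homogeneous d \<Omega>) \<and>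
     vectorspace.fin_dim class_ring (quotient_algebra (mpoly_algebra n) (jacobian_ideal n \<Omega>))"

text \<open>The polynomial ring in n + 1 variables with the n-ary bracket given by the Jacobian
  determinant of the n arguments and \<open>\<Omega>\<close>.\<close>

definition jacobian_nambu :: "nat \<Rightarrow> 'k::field mpoly \<Rightarrow> ('k, 'k mpoly) nambu" where
  "jacobian_nambu n \<Omega> = module.extend (mpoly_algebra (n + 1))
     (nambu.fields (\<lambda>fs. det (mat (n + 1) (n + 1) (\<lambda>(i, j). mpderiv j ((fs @ [\<Omega>]) ! i)))))"

definition fibre_nambu :: "nat \<Rightarrow> 'k::field mpoly \<Rightarrow> 'k \<Rightarrow> ('k, 'k mpoly set) nambu" where
  "fibre_nambu n \<Omega> \<xi> = quotient_nambu (jacobian_nambu n \<Omega>)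
     (genideal (jacobian_nambu n \<Omega>) {\<Omega> - mpoly_const \<xi>})"

end

theory Submission
  imports Defs "HOL-Computational_Algebra.Computational_Algebra" "HOL-Algebra.Algebraic_Closure_Type"
    "Jordan_Normal_Form.Char_Poly"
begin

text \<open>Let \<open>t\<^sub>j\<close> be sent to \<open>Y\<^sub>j\<close> by an injective endomorphism. Since the brackets of the variables
  are up to sign the partial derivatives \<open>\<Omega>\<^sub>i\<close> of \<open>\<Omega>\<close>, the elements \<open>\<Omega>\<^sub>i(Y)\<close> are brackets of the \<open>Y\<^sub>j\<close>,
  and a power \<open>t\<^sub>j\<^sup>N\<close> of each variable is a combination of the \<open>\<Omega>\<^sub>i\<close>.

  Degrees: a bracket of n elements of degree at most r has degree at most \<open>n(r - 1) + d - 1\<close> where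
  \<open>d = deg \<Omega> \<ge> n + 3\<close>, which is less than the degree \<open>(d - 1)r\<close> that \<open>\<Omega>\<^sub>i(Y)\<close> would need for \<open>Y\<^sub>j\<^sup>N\<close> to
  have degree \<open>Nr\<close>, unless \<open>r \<le> 1\<close>. Hence an injective endomorphism of the fibre is given by polynomials of degree
  at most 1, and it is surjective by linear algebra.

  Poles: for an endomorphism of the fraction field the same comparison, applied to pole orders
  along a divisor of the fibre, shows that the \<open>Y\<^sub>j\<close> have no poles, so that the endomorphism
  restricts to the fibre. To avoid normality of the fibre, the divisors are those of the affine
  space onto which the fibre projects along a line; the fibre is reduced over them away from the
  zeros of the derivative of \<open>\<Omega>\<close> along the line, and these derivatives generate an ideal
  containing powers of all the variables, while two of the variables form a regular sequence on
  the fibre.\<close>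

section \<open>The polynomial ring: substitutions, derivatives, degree in one direction and total
  degree\<close>

section \<open>Polynomials as a universal algebra\<close>

text \<open>The condition \<open>n + 3 \<le> d\<close> comes from the pole count.
  \<open>pow_homog\<close> writes t_j^N with coefficients of degree N - (d - 1), so a common pole
  order r >= 1 of the Y_j bounds the pole order of Y_j^N by r(N - (d - 1)) + nr + 1. This is below
  rN exactly when r(d - 1 - n) >= 2, which for r = 1 is the bound on d. All of this presupposes that
  F = \<Omega> - \<xi> is prime. That follows from primality of its leading form \<Omega>: a proper
  factorization would put the derivatives of \<Omega> into an ideal generated by two forms, which a
  dimension count excludes in three or more variables, and irreducible elements are prime by Gauss's
  lemma, one variable at a time. The fraction field is treated as the residue field of a
  localization of the polynomial ring at F. There brackets are Jacobian determinants of actual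
  fractions, and F is a Casimir, so the multiples of F are stable under the bracket. The polynomial
  type has infinitely many variables. Divisibility is studied in the whole ring, and results are cut
  down to t_0, ..., t_n by \<open>factor_in\<close> and \<open>restrict_vars\<close>.\<close>

definition mpvar :: "nat \<Rightarrow> 'k::field mpoly" where
  "mpvar i = Poly_Mapping.single (Poly_Mapping.single i 1) 1"

definition polys_in :: "nat set \<Rightarrow> 'k::field mpoly set" where
  "polys_in V = {p. \<forall>m\<in>Poly_Mapping.keys p. Poly_Mapping.keys m \<subseteq> V}"

definition mono_eval :: "(nat \<Rightarrow> 'r::comm_ring_1) \<Rightarrow> (nat \<Rightarrow>\<^sub>0 nat) \<Rightarrow> 'r" where
  "mono_eval x m = (\<Prod>i\<in>Poly_Mapping.keys m. x i ^ Poly_Mapping.lookup m i)"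

definition mpeval :: "('k::field \<Rightarrow> 'r::comm_ring_1) \<Rightarrow> (nat \<Rightarrow> 'r) \<Rightarrow> 'k mpoly \<Rightarrow> 'r" where
  "mpeval g x p = (\<Sum>m\<in>Poly_Mapping.keys p. g (Poly_Mapping.lookup p m) * mono_eval x m)"

lemma poly_mapping_sum_single:
  "p = (\<Sum>m\<in>Poly_Mapping.keys p. Poly_Mapping.single m (Poly_Mapping.lookup p m))"
  by (rule poly_mapping_eqI)
    (simp add: lookup_sum lookup_single when_def sum.delta in_keys_iff)

lemma single_eq_const_mult:
  "Poly_Mapping.single m c = mpoly_const c * Poly_Mapping.single m (1::'k::field)"
  by (simp add: mpoly_const_def mult_single)

lemma mpoly_const_hom: "comm_ring_hom (mpoly_const :: 'k::field \<Rightarrow> 'k mpoly)"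
  by unfold_locales (simp_all add: mpoly_const_def single_add mult_single)

lemma mpoly_const_0 [simp]: "mpoly_const 0 = 0"
  and mpoly_const_1 [simp]: "mpoly_const 1 = 1"
  and mpoly_const_add: "mpoly_const (a + b) = mpoly_const a + mpoly_const b"
  and mpoly_const_mult: "mpoly_const (a * b) = mpoly_const a * mpoly_const b"
  and mpoly_const_uminus: "mpoly_const (- a) = - mpoly_const a"
  and mpoly_const_diff: "mpoly_const (a - b) = mpoly_const a - mpoly_const b"
  for a b :: "'k::field"
  by (simp_all add: mpoly_const_def single_add mult_single single_uminus single_diff)

lemma mpoly_const_eq_iff [simp]: "mpoly_const a = mpoly_const b \<longleftrightarrow> a = b"
  unfolding mpoly_const_def by (metis lookup_single_eq)

lemma mpoly_const_eq_0_iff [simp]: "mpoly_const a = 0 \<longleftrightarrow> a = (0::'k::field)"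
  using mpoly_const_eq_iff[of a 0] by simp

lemma mpoly_const_inverse:
  "c \<noteq> (0::'k::field) \<Longrightarrow> mpoly_const c * mpoly_const (inverse c) = 1"
  by (simp flip: mpoly_const_mult)

lemma is_unit_mpoly_const: "c \<noteq> (0::'k::field) \<Longrightarrow> mpoly_const c dvd 1"
  by (metis dvdI mpoly_const_inverse)

lemma single_monomial_induct [case_names one var]:
  assumes "P (1::'k::field mpoly)"
    and "\<And>i q. i \<in> Poly_Mapping.keys m \<Longrightarrow> P q \<Longrightarrow> P (mpvar i * q)"
  shows "P (Poly_Mapping.single m 1)"
  using assms(2)
proof (induction "monomial_degree m" arbitrary: m)
  case 0
  have "m = 0"
    using 0(1) by (intro poly_mapping_eqI) (auto simp: monomial_degree_def in_keys_iff)
  then show ?case using assms(1) by simp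
next
  case (Suc d m)
  then obtain i where i: "i \<in> Poly_Mapping.keys m"
    unfolding monomial_degree_def by (metis all_not_in_conv sum.empty nat.distinct(1))
  define m' where "m' = m - Poly_Mapping.single i 1"
  have m: "m = Poly_Mapping.single i 1 + m'"
    using i by (intro poly_mapping_eqI)
      (auto simp: m'_def lookup_add lookup_minus lookup_single when_def in_keys_iff)
  have keys: "Poly_Mapping.keys m' \<subseteq> Poly_Mapping.keys m"
    by (auto simp: m'_def lookup_minus in_keys_iff)
  have "monomial_degree m = (\<Sum>j\<in>Poly_Mapping.keys m. Poly_Mapping.lookup m j)"
    by (simp add: monomial_degree_def)
  also have "\<dots> = (\<Sum>j\<in>Poly_Mapping.keys m. (1 when i = j) + Poly_Mapping.lookup m' j)"
    by (subst m) (simp add: lookup_add lookup_single)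
  also have "\<dots> = 1 + (\<Sum>j\<in>Poly_Mapping.keys m. Poly_Mapping.lookup m' j)"
    using i by (simp add: sum.distrib when_def)
  also have "(\<Sum>j\<in>Poly_Mapping.keys m. Poly_Mapping.lookup m' j) = monomial_degree m'"
    unfolding monomial_degree_def
    by (rule sum.mono_neutral_right) (use keys in \<open>auto simp: in_keys_iff\<close>)
  finally have d: "d = monomial_degree m'" using Suc(2) by simp
  have "P (Poly_Mapping.single m' 1)"
    by (rule Suc(1)[OF d]) (use Suc(3) keys in auto)
  from Suc(3)[OF i this] show ?case by (subst m) (simp add: mult_single mpvar_def)
qed

lemma polys_in_induct [consumes 1, case_names const var add mult]:
  fixes p :: "'k::field mpoly"
  assumes "p \<in> polys_in V"
    and c: "\<And>c. P (mpoly_const c)"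
    and v: "\<And>i. i \<in> V \<Longrightarrow> P (mpvar i)"
    and a: "\<And>p q. P p \<Longrightarrow> P q \<Longrightarrow> P (p + q)"
    and t: "\<And>p q. P p \<Longrightarrow> P q \<Longrightarrow> P (p * q)"
  shows "P p"
proof -
  have 1: "P (Poly_Mapping.single m 1)" if "Poly_Mapping.keys m \<subseteq> V" for m
  proof (rule single_monomial_induct)
    show "P 1" using c[of 1] by simp
    show "P (mpvar i * q)" if "i \<in> Poly_Mapping.keys m" "P q" for i q
      using v[of i] t[of "mpvar i" q] that \<open>Poly_Mapping.keys m \<subseteq> V\<close> by blast
  qed
  have 2: "P (\<Sum>m\<in>A. Poly_Mapping.single m (Poly_Mapping.lookup p m))"
    if "A \<subseteq> Poly_Mapping.keys p" for A
    using finite_subset[OF that finite_keys] that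
  proof (induction A rule: finite_induct)
    case empty
    then show ?case using c[of 0] by simp
  next
    case (insert m A)
    have "Poly_Mapping.keys m \<subseteq> V" using assms(1) insert.prems by (auto simp: polys_in_def)
    then have "P (Poly_Mapping.single m (Poly_Mapping.lookup p m))"
      by (subst single_eq_const_mult) (rule t[OF c 1])
    then show ?case using insert.IH insert.hyps insert.prems by (simp add: a)
  qed
  show ?thesis by (subst poly_mapping_sum_single) (rule 2[OF subset_refl])
qed

lemma polys_in_UNIV [simp]: "polys_in UNIV = UNIV"
  by (simp add: polys_in_def)

lemmas mpoly_induct [case_names const var add mult] =
  polys_in_induct[of _ UNIV, simplified]

lemma mono_eval_superset:
  assumes "finite A" "Poly_Mapping.keys m \<subseteq> A"
  shows "mono_eval x m = (\<Prod>i\<in>A. x i ^ Poly_Mapping.lookup m i)"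
  unfolding mono_eval_def
  by (rule prod.mono_neutral_left) (use assms in \<open>auto simp: in_keys_iff\<close>)

lemma mono_eval_add: "mono_eval x (m + m') = mono_eval x m * mono_eval x m'"
proof -
  let ?A = "Poly_Mapping.keys m \<union> Poly_Mapping.keys m'"
  have "Poly_Mapping.keys (m + m') \<subseteq> ?A" by (rule keys_add)
  then show ?thesis
    by (simp add: mono_eval_superset[of ?A] lookup_add power_add prod.distrib)
qed

context
  fixes g :: "'k::field \<Rightarrow> 'r::comm_ring_1"
  assumes g: "comm_ring_hom g"
begin

interpretation g: comm_ring_hom g by (rule g)

lemma mpeval_superset:
  assumes "finite A" "Poly_Mapping.keys p \<subseteq> A"
  shows "mpeval g x p = (\<Sum>m\<in>A. g (Poly_Mapping.lookup p m) * mono_eval x m)"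
  unfolding mpeval_def
  by (rule sum.mono_neutral_left) (use assms in \<open>auto simp: in_keys_iff\<close>)

lemma mpeval_add: "mpeval g x (p + q) = mpeval g x p + mpeval g x q"
proof -
  let ?A = "Poly_Mapping.keys p \<union> Poly_Mapping.keys q"
  have "Poly_Mapping.keys (p + q) \<subseteq> ?A" by (rule keys_add)
  then show ?thesis
    by (simp add: mpeval_superset[of ?A] lookup_add g.hom_add distrib_right sum.distrib)
qed

lemma mpeval_0: "mpeval g x 0 = 0"
  by (simp add: mpeval_def)

lemma mpeval_sum: "mpeval g x (sum f A) = (\<Sum>a\<in>A. mpeval g x (f a))"
  by (induction A rule: infinite_finite_induct) (simp_all add: mpeval_add mpeval_0)

lemma mpeval_single: "mpeval g x (Poly_Mapping.single m c) = g c * mono_eval x m"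
  by (subst mpeval_superset[of "{m}"]) auto

lemma mpeval_mult: "mpeval g x (p * q) = mpeval g x p * mpeval g x q"
proof -
  have s: "mpeval g x (Poly_Mapping.single m c * q) = g c * mono_eval x m * mpeval g x q" for m c
  proof -
    have "mpeval g x (Poly_Mapping.single m c * q) =
      mpeval g x (\<Sum>k\<in>Poly_Mapping.keys q. Poly_Mapping.single (m + k) (c * Poly_Mapping.lookup q k))"
      by (subst (1) poly_mapping_sum_single[of q]) (simp add: sum_distrib_left mult_single)
    also have "\<dots> = (\<Sum>k\<in>Poly_Mapping.keys q.
        g c * mono_eval x m * (g (Poly_Mapping.lookup q k) * mono_eval x k))"
      unfolding mpeval_sum
      by (rule sum.cong) (simp_all add: mpeval_single mono_eval_add g.hom_mult)
    also have "\<dots> = g c * mono_eval x m * mpeval g x q"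
      by (simp only: mpeval_def[of g x q] sum_distrib_left)
    finally show ?thesis .
  qed
  have "mpeval g x (p * q) =
      mpeval g x (\<Sum>m\<in>Poly_Mapping.keys p. Poly_Mapping.single m (Poly_Mapping.lookup p m) * q)"
    by (subst (1) poly_mapping_sum_single[of p]) (simp add: sum_distrib_right)
  also have "\<dots> = mpeval g x p * mpeval g x q"
    by (simp add: mpeval_sum s sum_distrib_right mpeval_def[of g x p])
  finally show ?thesis .
qed

lemma mpeval_const [simp]: "mpeval g x (mpoly_const c) = g c"
  by (simp add: mpoly_const_def mpeval_single mono_eval_def)

lemma mpeval_var [simp]: "mpeval g x (mpvar i) = x i"
  by (simp add: mpvar_def mpeval_single mono_eval_def)

lemma mpeval_hom: "comm_ring_hom (mpeval g x)"
proof
  show "mpeval g x 1 = 1" using mpeval_const[of x 1] by simp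
  show "mpeval g x 0 = 0" using mpeval_const[of x 0] by simp
qed (simp_all add: mpeval_add mpeval_mult)

end

text \<open>The uniqueness half of the universal property of polynomials. Identities between
  composed substitutions are later checked only on constants and variables by means of it.\<close>

lemma comm_ring_hom_eq_on:
  fixes p :: "'k::field mpoly"
  assumes "comm_ring_hom f" "comm_ring_hom h" "p \<in> polys_in V"
    and "\<And>c. f (mpoly_const c) = h (mpoly_const c)"
    and "\<And>i. i \<in> V \<Longrightarrow> f (mpvar i) = h (mpvar i)"
  shows "f p = h p"
proof -
  interpret f: comm_ring_hom f by fact
  interpret h: comm_ring_hom h by fact
  show ?thesis using assms(3)
  proof (induction rule: polys_in_induct)
    case (const c) show ?case by (rule assms(4))
  next
    case (var i) then show ?case by (rule assms(5))
  qed (simp_all only: f.hom_add f.hom_mult h.hom_add h.hom_mult)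
qed

lemma comm_ring_hom_eq:
  fixes f h :: "'k::field mpoly \<Rightarrow> 'r::comm_ring_1"
  assumes "comm_ring_hom f" "comm_ring_hom h"
    and "\<And>c. f (mpoly_const c) = h (mpoly_const c)" "\<And>i. f (mpvar i) = h (mpvar i)"
  shows "f = h"
  by (rule ext, rule comm_ring_hom_eq_on[of f h _ UNIV]) (simp_all only: assms polys_in_UNIV UNIV_I)

lemma polys_in_const [simp]: "mpoly_const c \<in> polys_in V"
  by (simp add: polys_in_def mpoly_const_def)

lemma polys_in_0 [simp]: "0 \<in> polys_in V" and polys_in_1 [simp]: "1 \<in> polys_in V"
  using polys_in_const[of 0 V] polys_in_const[of 1 V] by simp_all

lemma polys_in_var [simp]: "mpvar i \<in> polys_in V \<longleftrightarrow> i \<in> V"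
  by (auto simp: polys_in_def mpvar_def)

lemma polys_in_add: "p \<in> polys_in V \<Longrightarrow> q \<in> polys_in V \<Longrightarrow> p + q \<in> polys_in V"
  unfolding polys_in_def using keys_add[of p q] by blast

lemma polys_in_mult: "p \<in> polys_in V \<Longrightarrow> q \<in> polys_in V \<Longrightarrow> p * q \<in> polys_in V"
proof -
  assume pq: "p \<in> polys_in V" "q \<in> polys_in V"
  show "p * q \<in> polys_in V"
    unfolding polys_in_def
  proof clarify
    fix m i assume "m \<in> Poly_Mapping.keys (p * q)" and i: "i \<in> Poly_Mapping.keys m"
    then obtain a b where "m = a + b" "a \<in> Poly_Mapping.keys p" "b \<in> Poly_Mapping.keys q"
      using keys_mult[of p q] by blast
    then show "i \<in> V" using i pq keys_add[of a b] unfolding polys_in_def by blast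
  qed
qed

lemma polys_in_uminus [simp]: "- p \<in> polys_in V \<longleftrightarrow> p \<in> polys_in V"
  by (simp add: polys_in_def)

lemma polys_in_diff: "p \<in> polys_in V \<Longrightarrow> q \<in> polys_in V \<Longrightarrow> p - q \<in> polys_in V"
  using polys_in_add[of p V "- q"] by simp

lemma polys_in_power: "p \<in> polys_in V \<Longrightarrow> p ^ k \<in> polys_in V"
  by (induction k) (auto intro: polys_in_mult)

lemma polys_in_sum: "(\<And>i. i \<in> A \<Longrightarrow> f i \<in> polys_in V) \<Longrightarrow> sum f A \<in> polys_in V"
  by (induction A rule: infinite_finite_induct) (auto intro: polys_in_add)

lemma polys_in_mono: "V \<subseteq> V' \<Longrightarrow> polys_in V \<subseteq> polys_in V'"
  by (auto simp: polys_in_def)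

lemma finite_support_mpoly: "\<exists>V. finite V \<and> p \<in> polys_in V"
  by (rule exI[of _ "\<Union> (Poly_Mapping.keys ` Poly_Mapping.keys p)"]) (auto simp: polys_in_def)

lemma polys_in_empty: "p \<in> polys_in {} \<Longrightarrow> \<exists>c. p = mpoly_const c"
proof (induction rule: polys_in_induct)
  case (add p q) then show ?case by (metis mpoly_const_add)
next
  case (mult p q) then show ?case by (metis mpoly_const_mult)
qed auto

lemma carrier_mpoly_algebra [simp]: "carrier (mpoly_algebra n) = polys_in {..<n}"
  by (simp add: mpoly_algebra_def polys_in_def)

lemma mpeval_in:
  assumes "comm_ring_hom g" "p \<in> polys_in V"
    and "\<And>c. g c \<in> S" "\<And>i. i \<in> V \<Longrightarrow> x i \<in> S"
    and "\<And>a b. a \<in> S \<Longrightarrow> b \<in> S \<Longrightarrow> a + b \<in> S" "\<And>a b. a \<in> S \<Longrightarrow> b \<in> S \<Longrightarrow> a * b \<in> S"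
  shows "mpeval g x p \<in> S"
  using assms(2)
  by (induction rule: polys_in_induct)
    (simp_all add: assms(3-) mpeval_add[OF assms(1)] mpeval_mult[OF assms(1)] mpeval_const[OF assms(1)]
      mpeval_var[OF assms(1)])


section \<open>Derivations\<close>

text \<open>No ground field appears, so the same locale serves partial derivatives, their extensions
  to fractions, and a bracket as a function of one argument. Vanishing on constants is supplied
  separately where it matters.\<close>

locale derivation =
  fixes D :: "'r::comm_ring_1 \<Rightarrow> 'r"
  assumes add: "D (a + b) = D a + D b"
    and leibniz: "D (a * b) = a * D b + b * D a"
begin

lemma zero [simp]: "D 0 = 0"
  using add[of 0 0] by simp

lemma one [simp]: "D 1 = 0"
  using leibniz[of 1 1] by simp

lemma uminus: "D (- a) = - D a"
  using add[of a "- a"] by (simp add: eq_neg_iff_add_eq_0 add.commute)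

lemma diff: "D (a - b) = D a - D b"
  using add[of a "- b"] by (simp add: uminus)

lemma sum: "D (sum f A) = (\<Sum>a\<in>A. D (f a))"
  by (induction A rule: infinite_finite_induct) (simp_all add: add)

lemma prod:
  "finite A \<Longrightarrow> D (prod f A) = (\<Sum>s\<in>A. \<Prod>i\<in>A. if i = s then D (f i) else f i)"
proof (induction A rule: finite_induct)
  case (insert a A)
  have 1: "(\<Prod>i\<in>A. if i = a then D (f i) else f i) = prod f A"
    using insert by (intro prod.cong) auto
  have 2: "(\<Prod>i\<in>insert a A. if i = s then D (f i) else f i) =
      f a * (\<Prod>i\<in>A. if i = s then D (f i) else f i)" if "s \<in> A" for s
    using insert that by auto
  have "D (prod f (insert a A)) = f a * D (prod f A) + prod f A * D (f a)"
    using insert by (simp add: leibniz)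
  then show ?case
    using insert 1 2 by (simp add: sum_distrib_left mult.commute add.commute)
qed simp

lemma power: "D (a ^ Suc k) = of_nat (Suc k) * a ^ k * D a"
proof (induction k)
  case (Suc k)
  have "D (a ^ Suc (Suc k)) = a * D (a ^ Suc k) + a ^ Suc k * D a"
    by (metis leibniz power_Suc)
  then show ?case by (subst (asm) Suc) (simp add: algebra_simps)
qed simp

end

lemma keys_mpderiv_superset:
  assumes "finite A" "Poly_Mapping.keys p \<subseteq> A"
  shows "mpderiv i p = (\<Sum>m\<in>A. Poly_Mapping.single (m - Poly_Mapping.single i 1)
     (of_nat (Poly_Mapping.lookup m i) * Poly_Mapping.lookup p m))"
  unfolding mpderiv_def
  by (rule sum.mono_neutral_left) (use assms in \<open>auto simp: in_keys_iff\<close>)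

lemma mpderiv_add: "mpderiv i (p + q) = mpderiv i p + mpderiv i q"
proof -
  let ?A = "Poly_Mapping.keys p \<union> Poly_Mapping.keys q"
  have "Poly_Mapping.keys (p + q) \<subseteq> ?A" by (rule keys_add)
  then show ?thesis
    by (simp add: keys_mpderiv_superset[of ?A] lookup_add distrib_left single_add sum.distrib)
qed

lemma mpderiv_sum: "mpderiv i (sum f A) = (\<Sum>a\<in>A. mpderiv i (f a))"
  by (induction A rule: infinite_finite_induct) (simp_all add: mpderiv_add, simp_all add: mpderiv_def)

lemma mpderiv_single:
  "mpderiv i (Poly_Mapping.single m c) =
     Poly_Mapping.single (m - Poly_Mapping.single i 1) (of_nat (Poly_Mapping.lookup m i) * c)"
  by (subst keys_mpderiv_superset[of "{m}"]) auto

lemma mpderiv_single_mult: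
  "mpderiv i (Poly_Mapping.single m c * Poly_Mapping.single k d) =
     Poly_Mapping.single m c * mpderiv i (Poly_Mapping.single k d) +
     Poly_Mapping.single k d * mpderiv i (Poly_Mapping.single m c)"
proof -
  have *: "m + (k - Poly_Mapping.single i 1) = m + k - Poly_Mapping.single i 1"
    if "Poly_Mapping.lookup k i \<noteq> 0" for m k :: "nat \<Rightarrow>\<^sub>0 nat"
    using that by (intro poly_mapping_eqI) (auto simp: lookup_add lookup_minus lookup_single when_def)
  \<comment> \<open>When variable i is absent from k, the truncated subtraction makes the two
    exponents differ, but then the coefficient is 0.\<close>
  have 1: "Poly_Mapping.single (m + (k - Poly_Mapping.single i 1)) (of_nat (Poly_Mapping.lookup k i) * (c * d)) =
      Poly_Mapping.single (m + k - Poly_Mapping.single i 1) (of_nat (Poly_Mapping.lookup k i) * (c * d))"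
    by (cases "Poly_Mapping.lookup k i = 0") (simp_all add: * del: One_nat_def)
  have 2: "Poly_Mapping.single (k + (m - Poly_Mapping.single i 1)) (of_nat (Poly_Mapping.lookup m i) * (c * d)) =
      Poly_Mapping.single (m + k - Poly_Mapping.single i 1) (of_nat (Poly_Mapping.lookup m i) * (c * d))"
    by (cases "Poly_Mapping.lookup m i = 0") (simp_all add: * add.commute[of k m] del: One_nat_def)
  have "mpderiv i (Poly_Mapping.single m c * Poly_Mapping.single k d) =
      Poly_Mapping.single (m + k - Poly_Mapping.single i 1)
        (of_nat (Poly_Mapping.lookup k i) * (c * d) + of_nat (Poly_Mapping.lookup m i) * (c * d))"
    by (simp add: mult_single mpderiv_single lookup_add algebra_simps)
  also have "\<dots> = Poly_Mapping.single (m + (k - Poly_Mapping.single i 1)) (of_nat (Poly_Mapping.lookup k i) * (c * d))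
      + Poly_Mapping.single (k + (m - Poly_Mapping.single i 1)) (of_nat (Poly_Mapping.lookup m i) * (c * d))"
    unfolding 1 2 single_add ..
  also have "\<dots> = Poly_Mapping.single m c * mpderiv i (Poly_Mapping.single k d) +
     Poly_Mapping.single k d * mpderiv i (Poly_Mapping.single m c)"
    unfolding mpderiv_single mult_single by (simp only: mult_ac)
  finally show ?thesis .
qed

lemma mpderiv_mult: "mpderiv i (p * q) = p * mpderiv i q + q * mpderiv i p"
proof -
  have s: "mpderiv i (Poly_Mapping.single m c * (\<Sum>k\<in>A. Poly_Mapping.single k (l k))) =
      Poly_Mapping.single m c * mpderiv i (\<Sum>k\<in>A. Poly_Mapping.single k (l k)) +
      (\<Sum>k\<in>A. Poly_Mapping.single k (l k)) * mpderiv i (Poly_Mapping.single m c)"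
    for m and c :: 'a and A l
    unfolding sum_distrib_left sum_distrib_right mpderiv_sum mpderiv_single_mult sum.distrib ..
  have s': "mpderiv i (Poly_Mapping.single m c * q) =
      Poly_Mapping.single m c * mpderiv i q + q * mpderiv i (Poly_Mapping.single m c)" for m c
    using s[of m c "Poly_Mapping.lookup q" "Poly_Mapping.keys q"]
    by (simp only: poly_mapping_sum_single[symmetric])
  have "mpderiv i ((\<Sum>k\<in>A. Poly_Mapping.single k (l k)) * q) =
      (\<Sum>k\<in>A. Poly_Mapping.single k (l k)) * mpderiv i q +
      q * mpderiv i (\<Sum>k\<in>A. Poly_Mapping.single k (l k))" for A l
    unfolding sum_distrib_left sum_distrib_right mpderiv_sum s' sum.distrib ..
  from this[of "Poly_Mapping.lookup p" "Poly_Mapping.keys p"] show ?thesis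
    by (simp only: poly_mapping_sum_single[symmetric])
qed

lemma derivation_mpderiv: "derivation (mpderiv i)"
  by unfold_locales (simp_all add: mpderiv_add mpderiv_mult)

lemma mpderiv_const [simp]: "mpderiv i (mpoly_const c) = 0"
  by (simp add: mpoly_const_def mpderiv_single)

lemma mpderiv_var: "mpderiv i (mpvar j) = (if i = j then 1 else 0)"
  by (auto simp: mpvar_def mpderiv_single lookup_single when_def)

lemma mpderiv_commute: "mpderiv i (mpderiv j p) = mpderiv j (mpderiv i p)"
  by (induction p rule: mpoly_induct)
    (auto simp: mpderiv_var mpderiv_add mpderiv_mult derivation.zero[OF derivation_mpderiv]
      derivation.one[OF derivation_mpderiv])

lemma mpderiv_in:
  assumes "p \<in> polys_in V"
  shows "mpderiv i p \<in> polys_in V"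
proof -
  have "p \<in> polys_in V \<and> mpderiv i p \<in> polys_in V"
    using assms
    by (induction rule: polys_in_induct)
      (auto simp: mpderiv_var mpderiv_add mpderiv_mult intro: polys_in_add polys_in_mult)
  then show ?thesis ..
qed

section \<open>Changes of coordinates\<close>

lemma comm_ring_hom_comp:
  assumes "comm_ring_hom f" "comm_ring_hom g"
  shows "comm_ring_hom (\<lambda>x. g (f x))"
proof -
  interpret f: comm_ring_hom f by fact
  interpret g: comm_ring_hom g by fact
  show ?thesis by unfold_locales (simp_all add: f.hom_add g.hom_add f.hom_mult g.hom_mult)
qed

lemma comm_ring_hom_id: "comm_ring_hom (\<lambda>x. x)"
  by unfold_locales simp_all

lemma map_poly_pCons_hom:
  assumes "comm_ring_hom f"
  shows "map_poly f (pCons a p) = pCons (f a) (map_poly f p)"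
proof -
  interpret f: comm_ring_hom f by fact
  show ?thesis by (rule poly_eqI) (simp add: coeff_map_poly coeff_pCons split: nat.split)
qed

lemma comm_ring_hom_poly: "comm_ring_hom (\<lambda>p::'a::comm_ring_1 poly. poly p a)"
  by unfold_locales simp_all

lemma comm_ring_hom_map_poly:
  assumes "comm_ring_hom f"
  shows "comm_ring_hom (map_poly f)"
proof -
  interpret f: comm_ring_hom f by fact
  interpret mp: map_poly_comm_ring_hom f ..
  show ?thesis by (rule mp.comm_ring_hom_axioms)
qed

lemma comm_ring_hom_const_poly: "comm_ring_hom (\<lambda>c::'a::comm_ring_1. [:c:])"
  by unfold_locales (simp_all add: one_pCons)

lemma const_poly_const_hom: "comm_ring_hom (\<lambda>c::'k::field. [:mpoly_const c:])"
  by (rule comm_ring_hom_comp[OF mpoly_const_hom comm_ring_hom_const_poly])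

text \<open>Along the direction \<open>e\<close> (with \<open>e\<^sub>i = 1\<close>, whatever \<open>e i\<close> is) the polynomials are
  univariate polynomials in the i-th variable, whose coefficients do not involve that variable:
  \<open>psi\<close> reads off the univariate polynomial, \<open>chi\<close> is its inverse.\<close>

definition psi :: "nat \<Rightarrow> (nat \<Rightarrow> 'k::field) \<Rightarrow> 'k mpoly \<Rightarrow> 'k mpoly poly" where
  "psi i e = mpeval (\<lambda>c. [:mpoly_const c:])
     (\<lambda>l. if l = i then [:0, 1:] else [:mpvar l, mpoly_const (e l):])"

text \<open>The functions t_l - e_l t_i are constant along the direction. \<open>tau\<close>
  rewrites a coefficient read off by \<open>psi\<close> as a polynomial in them; for e = 0 it just
  sets t_i to 0.\<close>

definition tau :: "nat \<Rightarrow> (nat \<Rightarrow> 'k::field) \<Rightarrow> 'k mpoly \<Rightarrow> 'k mpoly" where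
  "tau i e = mpeval mpoly_const
     (\<lambda>l. if l = i then 0 else mpvar l - mpoly_const (e l) * mpvar i)"

definition chi :: "nat \<Rightarrow> (nat \<Rightarrow> 'k::field) \<Rightarrow> 'k mpoly poly \<Rightarrow> 'k mpoly" where
  "chi i e P = poly (map_poly (tau i e) P) (mpvar i)"

abbreviation pdeg :: "nat \<Rightarrow> (nat \<Rightarrow> 'k::field) \<Rightarrow> 'k mpoly \<Rightarrow> nat" where
  "pdeg i e p \<equiv> Polynomial.degree (psi i e p)"

lemma psi_hom: "comm_ring_hom (psi i e)"
  unfolding psi_def by (rule mpeval_hom[OF const_poly_const_hom])

lemma tau_hom: "comm_ring_hom (tau i e)"
  unfolding tau_def by (rule mpeval_hom[OF mpoly_const_hom])

lemma chi_hom: "comm_ring_hom (chi i e)"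
  unfolding chi_def
  by (rule comm_ring_hom_comp[OF comm_ring_hom_map_poly[OF tau_hom] comm_ring_hom_poly])

interpretation psi: comm_ring_hom "psi i e" for i e by (rule psi_hom)
interpretation tau: comm_ring_hom "tau i e" for i e by (rule tau_hom)
interpretation chi: comm_ring_hom "chi i e" for i e by (rule chi_hom)

lemma psi_const [simp]: "psi i e (mpoly_const c) = [:mpoly_const c:]"
  by (simp add: psi_def mpeval_const[OF const_poly_const_hom])

lemma psi_var: "psi i e (mpvar l) = (if l = i then [:0, 1:] else [:mpvar l, mpoly_const (e l):])"
  by (simp add: psi_def mpeval_var[OF const_poly_const_hom])

lemma tau_const [simp]: "tau i e (mpoly_const c) = mpoly_const c"
  by (simp add: tau_def mpeval_const[OF mpoly_const_hom])

lemma tau_var: "tau i e (mpvar l) = (if l = i then 0 else mpvar l - mpoly_const (e l) * mpvar i)"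
  by (simp add: tau_def mpeval_var[OF mpoly_const_hom])

lemma chi_const_poly [simp]: "chi i e [:c:] = tau i e c"
  by (simp add: chi_def map_poly_pCons_hom[OF tau_hom])

lemma chi_linear: "chi i e [:a, b:] = tau i e a + mpvar i * tau i e b"
  by (simp add: chi_def map_poly_pCons_hom[OF tau_hom])

lemma chi_psi [simp]: "chi i e (psi i e p) = p"
proof -
  have "(\<lambda>p. chi i e (psi i e p)) = (\<lambda>p. p)"
    by (rule comm_ring_hom_eq[OF comm_ring_hom_comp[OF psi_hom chi_hom] comm_ring_hom_id])
      (simp_all add: psi_var chi_linear tau_var)
  from fun_cong[OF this, of p] show ?thesis .
qed

lemma psi_eq_iff [simp]: "psi i e p = psi i e q \<longleftrightarrow> p = q"
  by (metis chi_psi)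

lemma psi_eq_0_iff [simp]: "psi i e p = 0 \<longleftrightarrow> p = 0"
  using psi_eq_iff[of i e p 0] by (simp del: psi_eq_iff)

lemma pdeg_mult: "p \<noteq> 0 \<Longrightarrow> q \<noteq> 0 \<Longrightarrow> pdeg i e (p * q) = pdeg i e p + pdeg i e q"
  by (simp add: psi.hom_mult degree_mult_eq)

lemma psi_tau: "psi i e (tau i e c) = [:tau i (\<lambda>_. 0) c:]"
proof -
  have "(\<lambda>c. psi i e (tau i e c)) = (\<lambda>c. [:tau i (\<lambda>_. 0) c:])"
  proof (rule comm_ring_hom_eq)
    show "comm_ring_hom (\<lambda>c. psi i e (tau i e c))"
      by (rule comm_ring_hom_comp[OF tau_hom psi_hom])
    show "comm_ring_hom (\<lambda>c. [:tau i (\<lambda>_. 0) c:])"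
      by (rule comm_ring_hom_comp[OF tau_hom comm_ring_hom_const_poly])
  qed (auto simp add: psi_var psi.hom_minus psi.hom_mult tau_var)
  from fun_cong[OF this, of c] show ?thesis .
qed

lemma map_poly_rho_psi: "map_poly (tau i (\<lambda>_. 0)) (psi i e p) = psi i e p"
proof -
  have "(\<lambda>p. map_poly (tau i (\<lambda>_. 0)) (psi i e p)) = psi i e"
  proof (rule comm_ring_hom_eq)
    show "comm_ring_hom (\<lambda>p. map_poly (tau i (\<lambda>_. 0)) (psi i e p))"
      by (rule comm_ring_hom_comp[OF psi_hom comm_ring_hom_map_poly[OF tau_hom]])
  qed (auto simp add: psi_hom psi_var tau_var map_poly_pCons_hom[OF tau_hom])
  from fun_cong[OF this, of p] show ?thesis .
qed

lemma rho_coeff_psi: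
  "tau i (\<lambda>_. 0) (Polynomial.coeff (psi i e p) k) = Polynomial.coeff (psi i e p) k"
  by (metis coeff_map_poly map_poly_rho_psi tau.hom_zero)

lemma psi_tau_coeff_psi:
  "psi i e (tau i e (Polynomial.coeff (psi i e p) k)) = [:Polynomial.coeff (psi i e p) k:]"
  by (simp add: psi_tau rho_coeff_psi)

lemma pdeg_0_iff: "pdeg i e p = 0 \<longleftrightarrow> (\<exists>c. psi i e p = [:c:])"
  by (metis degree_pCons_0 degree_eq_zeroE)

lemma tau_fixes: "p \<in> polys_in (- {i}) \<Longrightarrow> tau i (\<lambda>_. 0) p = p"
  by (rule comm_ring_hom_eq_on[of _ "\<lambda>p. p"])
    (auto simp: tau_hom tau_var comm_ring_hom_id)

lemma psi_fixes: "p \<in> polys_in (- {i}) \<Longrightarrow> psi i (\<lambda>_. 0) p = [:p:]"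
  by (rule comm_ring_hom_eq_on[OF psi_hom comm_ring_hom_const_poly]) (auto simp: psi_var)

lemma coeff_psi_in:
  assumes "p \<in> polys_in V"
  shows "Polynomial.coeff (psi i (\<lambda>_. 0) p) k \<in> polys_in (V - {i})"
  using assms
proof (induction arbitrary: k rule: polys_in_induct)
  case (const c) show ?case by (cases k) auto
next
  case (var l) then show ?case by (auto simp: psi_var coeff_pCons split: nat.splits)
next
  case (add p q) then show ?case by (simp add: psi.hom_add polys_in_add)
next
  case (mult p q) then show ?case
    by (auto simp: psi.hom_mult coeff_mult intro!: polys_in_sum polys_in_mult)
qed

lemma pdeg_0_in:
  assumes "p \<in> polys_in V" "pdeg i (\<lambda>_. 0) p = 0"
  shows "p \<in> polys_in (V - {i})"
proof -
  obtain c where c: "psi i (\<lambda>_. 0) p = [:c:]" using assms(2) pdeg_0_iff by blast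
  have "c \<in> polys_in (V - {i})" using coeff_psi_in[OF assms(1), of i 0] c by simp
  then have "tau i (\<lambda>_. 0) c = c" by (intro tau_fixes) (use polys_in_mono[of "V - {i}" "- {i}"] in auto)
  then have "p = c" using chi_psi[of i "\<lambda>_. 0" p] c by simp
  then show ?thesis using \<open>c \<in> _\<close> by simp
qed

lemma in_pdeg_0:
  assumes "p \<in> polys_in V" "i \<notin> V"
  shows "pdeg i (\<lambda>_. 0) p = 0"
proof -
  have "p \<in> polys_in (- {i})" using polys_in_mono[of V "- {i}"] assms by auto
  then show ?thesis by (simp add: psi_fixes)
qed

lemma polys_in_if_pdeg_0:
  assumes "\<And>j. j \<notin> V \<Longrightarrow> pdeg j (\<lambda>_. 0) a = 0"
  shows "a \<in> polys_in V"
proof -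
  have "a \<in> polys_in (- {j})" if "j \<notin> V" for j
    using pdeg_0_in[of a UNIV j] assms[OF that] by (simp add: Compl_eq_Diff_UNIV)
  then show ?thesis unfolding polys_in_def by blast
qed

text \<open>The degree in each variable is additive on nonzero products, so a factor cannot involve
  a variable that the product lacks. This is what transfers divisibility in the whole ring to
  \<open>polys_in V\<close>.\<close>

lemma factor_in:
  assumes "a * b \<in> polys_in V" "a * b \<noteq> 0"
  shows "a \<in> polys_in V"
proof (rule polys_in_if_pdeg_0)
  fix j assume "j \<notin> V"
  then have "pdeg j (\<lambda>_. 0) (a * b) = 0" by (rule in_pdeg_0[OF assms(1)])
  then show "pdeg j (\<lambda>_. 0) a = 0" using assms(2) by (simp add: pdeg_mult)
qed

section \<open>The total degree\<close>

text \<open>The substitution of X t_l for t_l: the coefficient of X^k is the homogeneous component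
  of degree k. Total degree and leading form thereby become degree and leading coefficient of a
  univariate polynomial over a domain.\<close>

definition theta :: "'k::field mpoly \<Rightarrow> 'k mpoly poly" where
  "theta = mpeval (\<lambda>c. [:mpoly_const c:]) (\<lambda>l. [:0, mpvar l:])"

abbreviation tdeg :: "'k::field mpoly \<Rightarrow> nat" where
  "tdeg p \<equiv> Polynomial.degree (theta p)"

lemma theta_hom: "comm_ring_hom theta"
  unfolding theta_def by (rule mpeval_hom[OF const_poly_const_hom])

interpretation theta: comm_ring_hom theta by (rule theta_hom)

lemma theta_const [simp]: "theta (mpoly_const c) = [:mpoly_const c:]"
  by (simp add: theta_def mpeval_const[OF const_poly_const_hom])

lemma theta_var [simp]: "theta (mpvar l) = [:0, mpvar l:]"
  by (simp add: theta_def mpeval_var[OF const_poly_const_hom])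

lemma poly_theta_1 [simp]: "poly (theta p) 1 = p"
proof -
  have "(\<lambda>p. poly (theta p) 1) = (\<lambda>p. p)"
    by (rule comm_ring_hom_eq[OF comm_ring_hom_comp[OF theta_hom comm_ring_hom_poly] comm_ring_hom_id])
      simp_all
  from fun_cong[OF this, of p] show ?thesis .
qed

lemma theta_eq_iff [simp]: "theta p = theta q \<longleftrightarrow> p = q"
  by (metis poly_theta_1)

lemma theta_eq_0_iff [simp]: "theta p = 0 \<longleftrightarrow> p = 0"
  using theta_eq_iff[of p 0] by (simp del: theta_eq_iff)

lemma tdeg_mult: "p \<noteq> 0 \<Longrightarrow> q \<noteq> 0 \<Longrightarrow> tdeg (p * q) = tdeg p + tdeg q"
  by (simp add: theta.hom_mult degree_mult_eq)

lemma coeff_theta_0: "\<exists>c. Polynomial.coeff (theta p) 0 = mpoly_const c"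
proof (induction p rule: mpoly_induct)
  case (add p q) then show ?case by (metis coeff_add mpoly_const_add theta.hom_add)
next
  case (mult p q) then show ?case by (metis coeff_mult_0 mpoly_const_mult theta.hom_mult)
next
  case (var i)
  show ?case by (rule exI[of _ 0]) simp
qed simp

lemma tdeg_0: "tdeg p = 0 \<Longrightarrow> \<exists>c. p = mpoly_const c"
  by (metis coeff_theta_0 degree_eq_zeroE coeff_pCons_0 poly_theta_1 poly_const_conv)

lemma is_unit_mpoly_iff:
  fixes p :: "'k::field mpoly"
  shows "p dvd 1 \<longleftrightarrow> (\<exists>c. c \<noteq> 0 \<and> p = mpoly_const c)"
proof
  assume "p dvd 1"
  then obtain q where q: "p * q = 1" by (metis dvdE)
  then have "p \<noteq> 0" "q \<noteq> 0" by auto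
  then have "tdeg p + tdeg q = 0" using tdeg_mult[of p q] q by simp
  then show "\<exists>c. c \<noteq> 0 \<and> p = mpoly_const c" using tdeg_0[of p] \<open>p \<noteq> 0\<close> by auto
qed (auto simp: is_unit_mpoly_const)

lemma tdeg_factor_less:
  fixes p :: "'k::field mpoly"
  assumes "p = q * r" "p \<noteq> 0" "\<not> q dvd 1"
  shows "tdeg r < tdeg p"
proof -
  have "q \<noteq> 0" "r \<noteq> 0" using assms by auto
  then have "tdeg p = tdeg q + tdeg r" using assms tdeg_mult by blast
  moreover have "tdeg q \<noteq> 0"
    using tdeg_0[of q] assms(3) \<open>q \<noteq> 0\<close> is_unit_mpoly_const[where 'k='k]
    by (cases "tdeg q = 0") fastforce+
  ultimately show ?thesis by simp
qed

lemma irreducible_factor_exists: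
  fixes p :: "'k::field mpoly"
  assumes "p \<noteq> 0" "\<not> p dvd 1"
  shows "\<exists>q. comm_semiring_1_class.irreducible q \<and> q dvd p"
  using assms
proof (induction "tdeg p" arbitrary: p rule: less_induct)
  case less
  show ?case
  proof (cases "comm_semiring_1_class.irreducible p")
    case False
    then obtain a b where ab: "p = a * b" "\<not> a dvd 1" "\<not> b dvd 1"
      using less.prems by (auto simp: comm_semiring_1_class.irreducible_def)
    have "tdeg b < tdeg p" using tdeg_factor_less[OF ab(1) less.prems(1) ab(2)] .
    moreover have "b \<noteq> 0" using ab less.prems by auto
    ultimately show ?thesis using less.hyps[of b] ab by (auto intro: dvd_mult)
  qed auto
qed


section \<open>Unique factorization, by adjoining one variable at a time\<close>

section \<open>Unique factorization\<close>

text \<open>Euclidean division along the direction over the fraction field of the coefficients, with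
  the denominators cleared by a power of the leading coefficient of the divisor.\<close>

lemma pseudo_division:
  assumes "g \<noteq> 0"
  shows "\<exists>k Q r. tau i e (Polynomial.lead_coeff (psi i e g)) ^ k * f = Q * g + r \<and>
    (r = 0 \<or> pdeg i e r < pdeg i e g)"
proof -
  obtain q r where qr: "pseudo_divmod (psi i e f) (psi i e g) = (q, r)"
    by (cases "pseudo_divmod (psi i e f) (psi i e g)")
  define k where "k = Suc (pdeg i e f) - pdeg i e g"
  have g: "psi i e g \<noteq> 0" using assms by simp
  have 1: "Polynomial.smult (Polynomial.lead_coeff (psi i e g) ^ k) (psi i e f) = psi i e g * q + r"
    using pseudo_divmod(1)[OF g qr] by (simp add: k_def)
  have 2: "r = 0 \<or> Polynomial.degree r < pdeg i e g"
    using pseudo_divmod(2)[OF g qr] .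
  have "chi i e ([:Polynomial.lead_coeff (psi i e g) ^ k:] * psi i e f) = g * chi i e q + chi i e r"
    using arg_cong[OF 1, of "chi i e"] by (simp add: chi.hom_add chi.hom_mult)
  then have 3: "tau i e (Polynomial.lead_coeff (psi i e g)) ^ k * f = chi i e q * g + chi i e r"
    unfolding chi.hom_mult chi_const_poly tau.hom_power chi_psi by (simp only: mult.commute)
  \<comment> \<open>The remainder is an arbitrary univariate polynomial, whose coefficients may
    contain t_i. Passing through \<open>chi\<close> and \<open>psi\<close> sets t_i to 0 in them,
    which can only lower the degree.\<close>
  have "psi i e (chi i e r) = map_poly (tau i (\<lambda>_. 0)) r" for r
    by (induction r) (auto simp: psi.hom_add psi.hom_mult psi_tau psi_var map_poly_pCons_hom[OF tau_hom] chi_def)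
  then have "pdeg i e (chi i e r) \<le> Polynomial.degree r"
    by (simp add: degree_map_poly_le)
  then have "chi i e r = 0 \<or> pdeg i e (chi i e r) < pdeg i e g" using 2 by auto
  with 3 show ?thesis by blast
qed

lemma tau_lead_coeff:
  assumes "g \<noteq> 0"
  shows "tau i e (Polynomial.lead_coeff (psi i e g)) ^ k \<noteq> 0"
    and "pdeg i e (tau i e (Polynomial.lead_coeff (psi i e g)) ^ k) = 0"
proof -
  have *: "psi i e (tau i e (Polynomial.lead_coeff (psi i e g)) ^ k) = [:Polynomial.lead_coeff (psi i e g) ^ k:]"
    unfolding psi.hom_power psi_tau_coeff_psi by (rule poly_const_pow)
  show "pdeg i e (tau i e (Polynomial.lead_coeff (psi i e g)) ^ k) = 0"
    unfolding * by simp
  show "tau i e (Polynomial.lead_coeff (psi i e g)) ^ k \<noteq> 0"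
  proof
    assume "tau i e (Polynomial.lead_coeff (psi i e g)) ^ k = 0"
    then have "[:Polynomial.lead_coeff (psi i e g) ^ k:] = 0" using * psi.hom_zero by metis
    then show False using assms by simp
  qed
qed

definition restrict_vars :: "nat set \<Rightarrow> 'k::field mpoly \<Rightarrow> 'k mpoly" where
  "restrict_vars V = mpeval mpoly_const (\<lambda>l. if l \<in> V then mpvar l else 0)"

lemma restrict_vars_hom: "comm_ring_hom (restrict_vars V)"
  unfolding restrict_vars_def by (rule mpeval_hom[OF mpoly_const_hom])

interpretation restrict_vars: comm_ring_hom "restrict_vars V" for V by (rule restrict_vars_hom)

lemma restrict_vars_const [simp]: "restrict_vars V (mpoly_const c) = mpoly_const c"
  by (simp add: restrict_vars_def mpeval_const[OF mpoly_const_hom])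

lemma restrict_vars_var: "restrict_vars V (mpvar l) = (if l \<in> V then mpvar l else 0)"
  by (simp add: restrict_vars_def mpeval_var[OF mpoly_const_hom])

lemma restrict_vars_in: "restrict_vars V p \<in> polys_in V"
  by (induction p rule: mpoly_induct)
    (auto simp: restrict_vars_var restrict_vars.hom_add restrict_vars.hom_mult polys_in_add polys_in_mult)

lemma restrict_vars_fixes [simp]: "p \<in> polys_in V \<Longrightarrow> restrict_vars V p = p"
  by (induction rule: polys_in_induct)
    (auto simp: restrict_vars_var restrict_vars.hom_add restrict_vars.hom_mult)

lemma psi_restrict_vars:
  fixes p :: "'k::field mpoly"
  assumes i: "i \<in> V"
  shows "psi i (\<lambda>_. 0) (restrict_vars V p) = map_poly (restrict_vars V) (psi i (\<lambda>_. 0) p)"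
proof -
  have "(\<lambda>p::'k mpoly. psi i (\<lambda>_. 0) (restrict_vars V p)) = (\<lambda>p. map_poly (restrict_vars V) (psi i (\<lambda>_. 0) p))"
  proof (rule comm_ring_hom_eq)
    show "comm_ring_hom (\<lambda>p::'k mpoly. psi i (\<lambda>_. 0) (restrict_vars V p))"
      by (rule comm_ring_hom_comp[OF restrict_vars_hom psi_hom])
    show "comm_ring_hom (\<lambda>p::'k mpoly. map_poly (restrict_vars V) (psi i (\<lambda>_. 0) p))"
      by (rule comm_ring_hom_comp[OF psi_hom comm_ring_hom_map_poly[OF restrict_vars_hom]])
  qed (use i in \<open>auto simp add: psi_var restrict_vars_var map_poly_pCons_hom[OF restrict_vars_hom]\<close>)
  from fun_cong[OF this, of p] show ?thesis .
qed

text \<open>Setting all variables outside V to 0 is a ring homomorphism that fixes f, g and the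
  multiplier and does not raise the degree in t_i, so it moves a division in the whole ring into
  \<open>polys_in V\<close>.\<close>

lemma pseudo_division_in:
  assumes "g \<noteq> 0" "f \<in> polys_in V" "g \<in> polys_in V" "i \<in> V"
  shows "\<exists>l Q r. l \<in> polys_in (V - {i}) \<and> l \<noteq> 0 \<and> Q \<in> polys_in V \<and> r \<in> polys_in V \<and>
    l * f = Q * g + r \<and> (r = 0 \<or> pdeg i (\<lambda>_. 0) r < pdeg i (\<lambda>_. 0) g)"
proof -
  let ?l = "tau i (\<lambda>_. 0) (Polynomial.lead_coeff (psi i (\<lambda>_. 0) g))"
  obtain k Q r where 1: "?l ^ k * f = Q * g + r"
    and 2: "r = 0 \<or> pdeg i (\<lambda>_. 0) r < pdeg i (\<lambda>_. 0) g"
    using pseudo_division[OF assms(1)] by blast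
  have "?l \<in> polys_in (V - {i})"
    using coeff_psi_in[OF assms(3)] by (simp add: rho_coeff_psi)
  then have l: "?l ^ k \<in> polys_in (V - {i})" by (rule polys_in_power)
  then have "?l ^ k \<in> polys_in V" using polys_in_mono[of "V - {i}" V] by auto
  then have 3: "?l ^ k * f = restrict_vars V Q * g + restrict_vars V r"
    using arg_cong[OF 1, of "restrict_vars V"] assms
    by (simp add: restrict_vars.hom_add restrict_vars.hom_mult)
  have "pdeg i (\<lambda>_. 0) (restrict_vars V r) \<le> pdeg i (\<lambda>_. 0) r"
    by (simp add: psi_restrict_vars assms(4) degree_map_poly_le)
  then have 4: "restrict_vars V r = 0 \<or> pdeg i (\<lambda>_. 0) (restrict_vars V r) < pdeg i (\<lambda>_. 0) g"
    using 2 by auto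
  show ?thesis
    by (rule exI[of _ "?l ^ k"], rule exI[of _ "restrict_vars V Q"], rule exI[of _ "restrict_vars V r"])
      (intro conjI l tau_lead_coeff(1)[OF assms(1)] restrict_vars_in 3 4)
qed

text \<open>Primality tested only against products from \<open>polys_in V\<close>, while
  divisibility remains that of the whole ring. This relative form is what an induction on V can
  carry.\<close>

definition prime_in :: "nat set \<Rightarrow> 'k::field mpoly \<Rightarrow> bool" where
  "prime_in V p \<longleftrightarrow> (\<forall>a\<in>polys_in V. \<forall>b\<in>polys_in V. p dvd a * b \<longrightarrow> p dvd a \<or> p dvd b)"

lemma dvd_iff_coeffs_psi:
  assumes "p \<in> polys_in (- {i})"
  shows "p dvd a \<longleftrightarrow> (\<forall>k. p dvd Polynomial.coeff (psi i (\<lambda>_. 0) a) k)"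
proof -
  have "p dvd a \<longleftrightarrow> [:p:] dvd psi i (\<lambda>_. 0) a"
  proof
    assume "p dvd a"
    then have "psi i (\<lambda>_. 0) p dvd psi i (\<lambda>_. 0) a" by (rule psi.hom_dvd)
    then show "[:p:] dvd psi i (\<lambda>_. 0) a" by (simp only: psi_fixes[OF assms])
  next
    assume "[:p:] dvd psi i (\<lambda>_. 0) a"
    then have "chi i (\<lambda>_. 0) [:p:] dvd chi i (\<lambda>_. 0) (psi i (\<lambda>_. 0) a)" by (rule chi.hom_dvd)
    then show "p dvd a" by (simp add: tau_fixes[OF assms])
  qed
  then show ?thesis by (simp add: const_poly_dvd_iff)
qed

text \<open>Gauss's argument: if p divides neither polynomial, consider in each the lowest
  coefficient that p does not divide.\<close>

lemma prime_in_insert: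
  assumes "prime_in V p" "p \<in> polys_in V" "i \<notin> V"
  shows "prime_in (insert i V) p"
  unfolding prime_in_def
proof (intro ballI impI)
  fix a b assume a: "a \<in> polys_in (insert i V)" and b: "b \<in> polys_in (insert i V)" and ab: "p dvd a * b"
  have p: "p \<in> polys_in (- {i})" using polys_in_mono[of V "- {i}"] assms by auto
  let ?A = "Polynomial.coeff (psi i (\<lambda>_. 0) a)" and ?B = "Polynomial.coeff (psi i (\<lambda>_. 0) b)"
  have AB: "?A k \<in> polys_in V" "?B k \<in> polys_in V" for k
    using coeff_psi_in[OF a, of i k] coeff_psi_in[OF b, of i k] assms(3)
    by (simp_all add: Diff_insert_absorb)
  show "p dvd a \<or> p dvd b"
  proof (rule ccontr)
    assume "\<not> (p dvd a \<or> p dvd b)"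
    then have ex: "\<exists>k. \<not> p dvd ?A k" "\<exists>k. \<not> p dvd ?B k"
      using dvd_iff_coeffs_psi[OF p] by blast+
    \<comment> \<open>In the coefficient of index k + l of the product every term other than ?A k *
      ?B l has a factor of smaller index on one side, hence is divisible by p.\<close>
    define k where "k = (LEAST k. \<not> p dvd ?A k)"
    define l where "l = (LEAST l. \<not> p dvd ?B l)"
    have k: "\<not> p dvd ?A k" "\<And>j. j < k \<Longrightarrow> p dvd ?A j"
      unfolding k_def using LeastI_ex[OF ex(1)] not_less_Least by blast+
    have l: "\<not> p dvd ?B l" "\<And>j. j < l \<Longrightarrow> p dvd ?B j"
      unfolding l_def using LeastI_ex[OF ex(2)] not_less_Least by blast+
    have "p dvd Polynomial.coeff (psi i (\<lambda>_. 0) (a * b)) (k + l)"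
      using ab dvd_iff_coeffs_psi[OF p] by blast
    then have "p dvd (\<Sum>j\<le>k + l. ?A j * ?B (k + l - j))"
      by (simp add: psi.hom_mult coeff_mult)
    also have "(\<Sum>j\<le>k + l. ?A j * ?B (k + l - j)) =
        ?A k * ?B l + (\<Sum>j\<in>{..k + l} - {k}. ?A j * ?B (k + l - j))"
      by (subst sum.remove[of _ k]) auto
    finally have "p dvd ?A k * ?B l + (\<Sum>j\<in>{..k + l} - {k}. ?A j * ?B (k + l - j))" .
    moreover have "p dvd (\<Sum>j\<in>{..k + l} - {k}. ?A j * ?B (k + l - j))"
    proof (rule dvd_sum)
      fix j assume j: "j \<in> {..k + l} - {k}"
      show "p dvd ?A j * ?B (k + l - j)"
      proof (cases "j < k")
        case True then show ?thesis using k(2) by (simp add: dvd_mult2)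
      next
        case False
        then have "k + l - j < l" using j by auto
        then show ?thesis using l(2) by (simp add: dvd_mult)
      qed
    qed
    ultimately have "p dvd ?A k * ?B l" by (simp add: dvd_add_left_iff)
    then show False using assms(1) AB k(1) l(1) unfolding prime_in_def by blast
  qed
qed

context
  fixes V :: "nat set" and i :: nat
  assumes i: "i \<notin> V"
    and primes: "\<And>p::'k::field mpoly. p \<in> polys_in V \<Longrightarrow> comm_semiring_1_class.irreducible p \<Longrightarrow> prime_in V p"
begin

lemma irreducible_prime_insert:
  fixes p :: "'k::field mpoly"
  shows "p \<in> polys_in V \<Longrightarrow> comm_semiring_1_class.irreducible p \<Longrightarrow> prime_in (insert i V) p"
  by (rule prime_in_insert[OF primes _ i])

lemma factor_exists_in:
  fixes l :: "'k mpoly"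
  assumes "l \<in> polys_in V" "l \<noteq> 0" "\<not> l dvd 1"
  obtains p l' where "l = p * l'" "p \<in> polys_in V" "l' \<in> polys_in V" "l' \<noteq> 0" "tdeg l' < tdeg l"
    "prime_in (insert i V) p" "comm_semiring_1_class.irreducible p"
proof -
  obtain p where p: "comm_semiring_1_class.irreducible p" "p dvd l"
    using irreducible_factor_exists assms by blast
  then obtain l' where l': "l = p * l'" by (auto elim: dvdE)
  have "p \<in> polys_in V" "l' \<in> polys_in V"
    using factor_in[of p l' V] factor_in[of l' p V] assms l' by (auto simp: mult.commute)
  moreover have "tdeg l' < tdeg l"
    using tdeg_factor_less[OF l' assms(2)] p by (simp add: comm_semiring_1_class.irreducible_def)
  ultimately show ?thesis using that l' p irreducible_prime_insert assms(2) by auto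
qed

text \<open>The prime factors of l are cancelled one at a time. Such a prime p cannot divide f: by
  irreducibility f would be a constant multiple of p, which does not involve t_i. Hence p divides
  the cofactor.\<close>

lemma cancel_irreducible:
  fixes f :: "'k mpoly"
  assumes "comm_semiring_1_class.irreducible f" "pdeg i (\<lambda>_. 0) f > 0" "f \<in> polys_in (insert i V)"
    and "l \<in> polys_in V" "l \<noteq> 0" "g \<in> polys_in (insert i V)" "f dvd l * g"
  shows "f dvd g"
  using assms(4-)
proof (induction "tdeg l" arbitrary: l rule: less_induct)
  case less
  show ?case
  proof (cases "l dvd 1")
    case True
    then show ?thesis using less.prems(4) by (simp add: dvd_mult_unit_iff')
  next
    case False
    then obtain p l' where p: "l = p * l'" "p \<in> polys_in V" "l' \<in> polys_in V" "l' \<noteq> 0" "tdeg l' < tdeg l"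
      "prime_in (insert i V) p" "comm_semiring_1_class.irreducible p"
      using factor_exists_in less.prems by blast
    obtain Z where Z: "l * g = f * Z" using less.prems(4) by (auto elim: dvdE)
    show ?thesis
    proof (cases "g = 0")
      case g: False
      have lV: "l \<in> polys_in (insert i V)" using less.prems(1) polys_in_mono[of V "insert i V"] by auto
      have "Z * f \<in> polys_in (insert i V)" "Z * f \<noteq> 0"
        using Z polys_in_mult[OF lV less.prems(3)] less.prems(2) g
        by (auto simp: mult.commute)
      then have "Z \<in> polys_in (insert i V)" by (rule factor_in)
      moreover have "p dvd f * Z" using Z[symmetric] p(1) by (simp add: mult.assoc)
      ultimately have "p dvd f \<or> p dvd Z" using p(6) assms(3) by (auto simp: prime_in_def)
      moreover have "\<not> p dvd f"
      proof
        assume "p dvd f"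
        then obtain c where c: "f = p * c" by (auto elim: dvdE)
        then have "c dvd 1" using assms(1) p(7) by (auto simp: comm_semiring_1_class.irreducible_def)
        then obtain k where "c = mpoly_const k" "k \<noteq> 0" by (auto simp: is_unit_mpoly_iff)
        moreover have "p \<noteq> 0" using p(7) by auto
        ultimately have "pdeg i (\<lambda>_. 0) f = 0"
          using c in_pdeg_0[OF p(2) i] by (simp add: pdeg_mult del: mult_pCons_right)
        then show False using assms(2) by simp
      qed
      ultimately obtain Z' where "Z = p * Z'" by (auto elim: dvdE)
      then have "p * (l' * g) = p * (f * Z')" using Z p(1) by (simp add: mult_ac)
      moreover have "p \<noteq> 0" using p(7) by auto
      ultimately have "l' * g = f * Z'" by simp
      then show ?thesis using less.hyps[OF p(5) p(3,4) less.prems(3)] by auto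
    qed auto
  qed
qed

text \<open>Each prime factor of l divides Q or x and is removed from whichever it divides; those
  removed from x are collected in u. What remains is a genuine factorization of f.\<close>

lemma strip_content:
  fixes f :: "'k mpoly"
  assumes "l \<in> polys_in V" "l \<noteq> 0" "f \<noteq> 0" "f \<in> polys_in (insert i V)" "l * f = Q * x"
  shows "\<exists>Q' x' u. f = Q' * x' \<and> x = u * x' \<and> u \<in> polys_in V \<and> u \<noteq> 0"
  using assms
proof (induction "tdeg l" arbitrary: l Q x rule: less_induct)
  case less
  show ?case
  proof (cases "l dvd 1")
    case True
    then obtain l' where l': "1 = l * l'" by (rule dvdE)
    have "f = (l * l') * f" by (simp add: l'[symmetric])
    also have "\<dots> = (l' * Q) * x" using less.prems(5) by (simp add: mult_ac)
    finally have "f = (l' * Q) * x" .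
    then show ?thesis by (intro exI[of _ "l' * Q"] exI[of _ x] exI[of _ 1]) auto
  next
    case False
    then obtain p l' where p: "l = p * l'" "p \<in> polys_in V" "l' \<in> polys_in V" "l' \<noteq> 0" "tdeg l' < tdeg l"
      "prime_in (insert i V) p" "comm_semiring_1_class.irreducible p"
      using factor_exists_in less.prems by blast
    have p0: "p \<noteq> 0" using p(7) by auto
    have "l \<in> polys_in (insert i V)" using less.prems(1) polys_in_mono[of V "insert i V"] by auto
    then have lf: "Q * x \<in> polys_in (insert i V)" "Q * x \<noteq> 0"
      using polys_in_mult[OF _ less.prems(4)] less.prems by (auto simp: less.prems(5)[symmetric])
    then have Qx: "Q \<in> polys_in (insert i V)" "x \<in> polys_in (insert i V)"
      using factor_in[of Q x] factor_in[of x Q] by (auto simp: mult.commute)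
    have "p dvd Q * x" using less.prems(5)[symmetric] p(1) by (simp add: mult.assoc)
    then consider "p dvd Q" | "p dvd x" using p(6) Qx by (auto simp: prime_in_def)
    then show ?thesis
    proof cases
      case 1
      then obtain Q1 where "Q = p * Q1" by (auto elim: dvdE)
      then have "p * (l' * f) = p * (Q1 * x)" using less.prems(5) p(1) by (simp add: mult_ac)
      then have "l' * f = Q1 * x" using p0 by simp
      then show ?thesis using less.hyps[OF p(5) p(3,4) less.prems(3,4)] by blast
    next
      case 2
      then obtain x1 where x1: "x = p * x1" by (auto elim: dvdE)
      then have "p * (l' * f) = p * (Q * x1)" using less.prems(5) p(1) by (simp add: mult_ac)
      then have "l' * f = Q * x1" using p0 by simp
      from less.hyps[OF p(5) p(3,4) less.prems(3,4) this]
      obtain Q' x' u where "f = Q' * x'" "x1 = u * x'" "u \<in> polys_in V" "u \<noteq> 0" by blast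
      then show ?thesis using x1 p(2) p0
        by (intro exI[of _ Q'] exI[of _ x'] exI[of _ "p * u"]) (auto simp: mult.assoc polys_in_mult)
    qed
  qed
qed

text \<open>Among the elements \<open>x\<close> with \<open>f dvd x * h\<close> one of minimal degree in the i-th variable divides
  all the others up to factors not involving that variable; it is associated with \<open>f\<close>.\<close>

lemma irreducible_prime_in_step:
  fixes f :: "'k mpoly"
  assumes f: "f \<in> polys_in (insert i V)" "comm_semiring_1_class.irreducible f"
  shows "prime_in (insert i V) f"
proof (cases "pdeg i (\<lambda>_. 0) f = 0")
  case True
  then have "f \<in> polys_in V" using pdeg_0_in[OF f(1) True] i by simp
  then show ?thesis using irreducible_prime_insert f(2) by blast
next
  case deg: False
  have f0: "f \<noteq> 0" using f by auto
  show ?thesis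
    unfolding prime_in_def
  proof (intro ballI impI)
    fix g h assume g: "g \<in> polys_in (insert i V)" and h: "h \<in> polys_in (insert i V)" and gh: "f dvd g * h"
    show "f dvd g \<or> f dvd h"
    proof (rule ccontr)
      assume n: "\<not> (f dvd g \<or> f dvd h)"
      \<comment> \<open>An ideal relative to the chosen variables, containing both f and g because f
        divides g h.\<close>
      define I where "I = {x \<in> polys_in (insert i V). f dvd x * h}"
      define S where "S = I - {0}"
      have "f \<in> S" using f f0 by (auto simp: S_def I_def)
      obtain x where x: "x \<in> S" "\<And>y. y \<in> S \<Longrightarrow> pdeg i (\<lambda>_. 0) x \<le> pdeg i (\<lambda>_. 0) y"
        using ex_has_least_nat[of "\<lambda>x. x \<in> S" f "pdeg i (\<lambda>_. 0)"] \<open>f \<in> S\<close> by blast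
      have xI: "x \<in> polys_in (insert i V)" "f dvd x * h" "x \<noteq> 0" using x(1) by (auto simp: S_def I_def)
      have div: "\<exists>l Q. l \<in> polys_in V \<and> l \<noteq> 0 \<and> l * y = Q * x" if "y \<in> I" for y
      proof -
        have y: "y \<in> polys_in (insert i V)" "f dvd y * h" using that by (auto simp: I_def)
        obtain l Q r where lqr: "l \<in> polys_in (insert i V - {i})" "l \<noteq> 0" "Q \<in> polys_in (insert i V)"
          "r \<in> polys_in (insert i V)" "l * y = Q * x + r" "r = 0 \<or> pdeg i (\<lambda>_. 0) r < pdeg i (\<lambda>_. 0) x"
          using pseudo_division_in[OF xI(3) y(1) xI(1)] by blast
        have "r * h = l * (y * h) - Q * (x * h)" using lqr(5) by (simp add: algebra_simps)
        then have "f dvd r * h" using y xI by simp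
        then have "r \<in> I" using lqr by (simp add: I_def)
        then have "r = 0" using lqr(6) x(2)[of r] unfolding S_def by force
        then show ?thesis using lqr i by auto
      qed
      have "f \<in> I" "g \<in> I" using f g gh by (auto simp: I_def)
      obtain l Q where lQ: "l \<in> polys_in V" "l \<noteq> 0" "l * f = Q * x" using div[OF \<open>f \<in> I\<close>] by blast
      \<comment> \<open>An x free of t_i could be cancelled from the divisibility of x h by f, and f
        would divide h.\<close>
      have degx: "pdeg i (\<lambda>_. 0) x \<noteq> 0"
      proof
        assume "pdeg i (\<lambda>_. 0) x = 0"
        then have "x \<in> polys_in (insert i V - {i})" by (rule pdeg_0_in[OF xI(1)])
        then have "x \<in> polys_in V" using i by (simp add: Diff_insert_absorb)
        from cancel_irreducible[OF f(2) _ f(1) this xI(3) h xI(2)] have "f dvd h" using deg by simp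
        then show False using n by simp
      qed
      obtain Q' x' u where u: "f = Q' * x'" "x = u * x'" "u \<in> polys_in V" "u \<noteq> 0"
        using strip_content[OF lQ(1,2) f0 f(1) lQ(3)] by blast
      have "\<not> x' dvd 1"
      proof
        assume "x' dvd 1"
        then obtain k where "x' = mpoly_const k" "k \<noteq> 0" by (auto simp: is_unit_mpoly_iff)
        then have "pdeg i (\<lambda>_. 0) x = 0"
          using u in_pdeg_0[OF u(3) i] by (simp add: pdeg_mult del: mult_pCons_right)
        then show False using degx by simp
      qed
      then have "Q' dvd 1" using f(2) u(1) by (auto simp: comm_semiring_1_class.irreducible_def)
      then have "f dvd x'" using u(1) by (simp add: mult_unit_dvd_iff')
      then have "f dvd x" using u(2) by simp
      obtain l Q where lQ: "l \<in> polys_in V" "l \<noteq> 0" "l * g = Q * x" using div[OF \<open>g \<in> I\<close>] by blast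
      then have "f dvd l * g" using \<open>f dvd x\<close> by simp
      from cancel_irreducible[OF f(2) _ f(1) lQ(1,2) g this] have "f dvd g" using deg by simp
      then show False using n by simp
    qed
  qed
qed

end

lemma irreducible_prime_in:
  fixes f :: "'k::field mpoly"
  assumes "finite V" "f \<in> polys_in V" "comm_semiring_1_class.irreducible f"
  shows "prime_in V f"
  using assms
proof (induction V arbitrary: f rule: finite_induct)
  case empty
  then obtain c where c: "f = mpoly_const c" using polys_in_empty by blast
  moreover have "f \<noteq> 0" "\<not> f dvd 1" using empty by auto
  ultimately show ?case using is_unit_mpoly_const by auto
next
  case (insert i V)
  show ?case
    by (rule irreducible_prime_in_step[OF insert.hyps(2) insert.IH]) (use insert.prems in auto)
qed

theorem mpoly_irreducible_imp_prime_elem: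
  fixes f :: "'k::field mpoly"
  assumes "comm_semiring_1_class.irreducible f"
  shows "prime_elem f"
proof (rule prime_elemI)
  fix a b assume "f dvd a * b"
  obtain A B C where V: "finite A" "a \<in> polys_in A" "finite B" "b \<in> polys_in B" "finite C" "f \<in> polys_in C"
    using finite_support_mpoly by metis
  let ?V = "A \<union> B \<union> C"
  have "a \<in> polys_in ?V" "b \<in> polys_in ?V" "f \<in> polys_in ?V"
    using V polys_in_mono[of A ?V] polys_in_mono[of B ?V] polys_in_mono[of C ?V] by blast+
  moreover have "prime_in ?V f" by (rule irreducible_prime_in) (use V \<open>f \<in> polys_in ?V\<close> assms in auto)
  ultimately show "f dvd a \<or> f dvd b" using \<open>f dvd a * b\<close> unfolding prime_in_def by blast
qed (use assms in auto)

section \<open>Elimination of a variable, and reducedness of a projection over a prime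
  divisor\<close>

interpretation mpoly_const: comm_ring_hom "mpoly_const :: 'k::field \<Rightarrow> 'k mpoly" by (rule mpoly_const_hom)

lemma prime_factor_induct [consumes 1, case_names unit prime]:
  fixes p :: "'k::field mpoly"
  assumes "p \<noteq> 0"
    and unit: "\<And>u. u dvd 1 \<Longrightarrow> P u"
    and prime: "\<And>q p. prime_elem q \<Longrightarrow> p \<noteq> 0 \<Longrightarrow> P p \<Longrightarrow> P (q * p)"
  shows "P p"
  using assms(1)
proof (induction "tdeg p" arbitrary: p rule: less_induct)
  case less
  show ?case
  proof (cases "p dvd 1")
    case False
    then obtain q where q: "comm_semiring_1_class.irreducible q" "q dvd p"
      using irreducible_factor_exists less.prems by blast
    then obtain r where r: "p = q * r" by (auto elim: dvdE)
    have "tdeg r < tdeg p"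
      using tdeg_factor_less[OF r less.prems] q(1) by (simp add: comm_semiring_1_class.irreducible_def)
    moreover have "r \<noteq> 0" using r less.prems by auto
    ultimately show ?thesis unfolding r
      by (intro prime mpoly_irreducible_imp_prime_elem q(1) less.hyps) (simp_all add: r)
  qed (rule unit)
qed

text \<open>Over the fraction field of the coefficients, b and F generate the unit ideal. An element
  c of least degree in (b, F) divides both up to multipliers l of degree 0. If c had positive
  degree, then l F = Q c would force F to divide Q, so that c divides l, or F to divide c, so that F
  divides b.\<close>

lemma elimination:
  fixes F b :: "'k::field mpoly"
  assumes F: "prime_elem F" and deg: "pdeg i e F > 0" and b: "\<not> F dvd b"
  obtains x z where "b * x + F * z \<noteq> 0" "pdeg i e (b * x + F * z) = 0"
proof -
  define I where "I = {b * x + F * z | x z. True}"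
  have Imult: "u * y \<in> I" if y: "y \<in> I" for u y
  proof -
    obtain x z where "y = b * x + F * z" using y by (auto simp: I_def)
    then have "u * y = b * (u * x) + F * (u * z)" by (simp add: algebra_simps)
    then show ?thesis by (auto simp: I_def)
  qed
  have Idiff: "y - y' \<in> I" if y: "y \<in> I" "y' \<in> I" for y y'
  proof -
    obtain x z x' z' where "y = b * x + F * z" "y' = b * x' + F * z'" using y by (auto simp: I_def)
    then have "y - y' = b * (x - x') + F * (z - z')" by (simp add: algebra_simps)
    then show ?thesis by (auto simp: I_def)
  qed
  have "F = b * 0 + F * 1" "b = b * 1 + F * 0" by simp_all
  then have FI: "F \<in> I" "b \<in> I" unfolding I_def by blast+
  have F0: "F \<noteq> 0" using F by auto
  obtain c where c: "c \<in> I - {0}" "\<And>y. y \<in> I - {0} \<Longrightarrow> pdeg i e c \<le> pdeg i e y"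
    using ex_has_least_nat[of "\<lambda>x. x \<in> I - {0}" F "pdeg i e"] FI F0 by blast
  then have c0: "c \<noteq> 0" "c \<in> I" by auto
  have div: "\<exists>l Q. l \<noteq> 0 \<and> pdeg i e l = 0 \<and> l * y = Q * c" if "y \<in> I" for y
  proof -
    define l0 where "l0 = tau i e (Polynomial.lead_coeff (psi i e c))"
    obtain k Q r where kQr: "l0 ^ k * y = Q * c + r" "r = 0 \<or> pdeg i e r < pdeg i e c"
      using pseudo_division[OF c0(1)] unfolding l0_def by blast
    have "r = l0 ^ k * y - Q * c" using kQr(1) by (simp add: algebra_simps)
    then have "r \<in> I" using Imult Idiff c0 that by simp
    then have "r = 0" using kQr(2) c(2)[of r] by force
    then have "l0 ^ k * y = Q * c" using kQr(1) by simp
    moreover have "l0 ^ k \<noteq> 0" "pdeg i e (l0 ^ k) = 0"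
      unfolding l0_def by (rule tau_lead_coeff[OF c0(1)])+
    ultimately show ?thesis by blast
  qed
  have "pdeg i e c = 0"
  proof (rule ccontr)
    assume degc: "pdeg i e c \<noteq> 0"
    obtain l Q where l: "l \<noteq> 0" "pdeg i e l = 0" "l * F = Q * c" using div[OF FI(1)] by blast
    have "F dvd Q * c" unfolding l(3)[symmetric] by simp
    then consider "F dvd Q" | "F dvd c" using prime_elem_dvd_multD[OF F] by blast
    then show False
    proof cases
      case 1
      then obtain Q' where Q': "Q = F * Q'" by (auto elim: dvdE)
      have "F * l = F * (Q' * c)" using l(3) unfolding Q' by (simp add: mult_ac)
      then have "l = Q' * c" using F0 by simp
      then have "pdeg i e c = 0" using l pdeg_mult[of Q' c i e] by auto
      then show False using degc by simp
    next
      case 2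
      obtain l Q where l: "l \<noteq> 0" "pdeg i e l = 0" "l * b = Q * c" using div[OF FI(2)] by blast
      have "F dvd l * b" unfolding l(3) using 2 by simp
      then have "F dvd l" using prime_elem_dvd_multD[OF F] b by blast
      then obtain m where "l = F * m" by (auto elim: dvdE)
      then have "pdeg i e F = 0" using l pdeg_mult[of F m i e] by auto
      then show False using deg by simp
    qed
  qed
  moreover obtain x z where "c = b * x + F * z" using c0 by (auto simp: I_def)
  ultimately show ?thesis using that c0 by auto
qed

text \<open>The field is an algebraic closure of the fraction field of all polynomials: send one of the
  variables occurring in \<open>q\<close> to a root of \<open>q\<close> and fix the others.\<close>

lemma prime_elem_kernel:
  fixes q :: "'k::field mpoly"
  assumes "prime_elem q"
  obtains ev :: "'k mpoly \<Rightarrow> 'k mpoly fract alg_closure"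
  where "comm_ring_hom ev" "\<And>f. ev f = 0 \<longleftrightarrow> q dvd f"
proof -
  have "\<exists>i. pdeg i (\<lambda>_. 0) q \<noteq> 0"
  proof (rule ccontr)
    assume "\<not> ?thesis"
    then have "q \<in> polys_in {}" by (intro polys_in_if_pdeg_0) auto
    then obtain c where "q = mpoly_const c" using polys_in_empty by blast
    then show False using assms is_unit_mpoly_const[of c] by (cases "c = 0") (auto simp: prime_elem_def)
  qed
  then obtain i where i: "pdeg i (\<lambda>_. 0) q > 0" by auto
  define emb :: "'k mpoly \<Rightarrow> 'k mpoly fract alg_closure" where "emb x = to_ac (to_fract x)" for x
  have emb: "comm_ring_hom emb"
    by unfold_locales (simp_all add: emb_def to_ac_add to_ac_mult to_ac_0 to_ac_1)
  have emb0: "emb x = 0 \<longleftrightarrow> x = 0" for x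
    by (simp add: emb_def to_ac_eq_0_iff)
  have "Polynomial.degree (map_poly emb (psi i (\<lambda>_. 0) q)) = pdeg i (\<lambda>_. 0) q"
    using emb0 by (intro degree_map_poly) auto
  then obtain a where a: "poly (map_poly emb (psi i (\<lambda>_. 0) q)) a = 0"
    using alg_closed_imp_poly_has_root[of "map_poly emb (psi i (\<lambda>_. 0) q)"] i by auto
  define ev where "ev f = poly (map_poly emb (psi i (\<lambda>_. 0) f)) a" for f
  have ev: "comm_ring_hom ev"
    unfolding ev_def
    by (rule comm_ring_hom_comp[OF comm_ring_hom_comp[OF psi_hom comm_ring_hom_map_poly[OF emb]] comm_ring_hom_poly])
  interpret ev: comm_ring_hom ev by fact
  have evq: "ev q = 0" using a by (simp add: ev_def)
  have "ev f = 0 \<longleftrightarrow> q dvd f" for f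
  proof
    assume "q dvd f"
    then show "ev f = 0" using evq by (auto elim!: dvdE simp: ev.hom_mult)
  next
    assume f: "ev f = 0"
    show "q dvd f"
    proof (rule ccontr)
      assume "\<not> q dvd f"
      \<comment> \<open>Elimination turns f and q into a nonzero element of (f, q) that does not
        involve t_i. Its image under \<open>ev\<close> is its nonzero image in the field, although
        \<open>ev\<close> kills both f and q.\<close>
      then obtain x z where xz: "f * x + q * z \<noteq> 0" "pdeg i (\<lambda>_. 0) (f * x + q * z) = 0"
        using elimination[OF assms i] by blast
      then obtain c where c: "psi i (\<lambda>_. 0) (f * x + q * z) = [:c:]" using pdeg_0_iff by blast
      then have "c \<noteq> 0" using xz(1) psi_eq_0_iff[of i "\<lambda>_. 0" "f * x + q * z"] by auto
      moreover have "ev (f * x + q * z) = emb c"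
        unfolding ev_def c by (simp add: map_poly_pCons_hom[OF emb])
      ultimately show False using f evq emb0 by (simp add: ev.hom_add ev.hom_mult)
    qed
  qed
  then show ?thesis using that ev by blast
qed

text \<open>F divides F' times the radical of F, and the radical divides f. The induction splits off
  one linear factor of F at a time, so that multiplicities never have to be named.\<close>

lemma dvd_power_imp_dvd_pderiv_mult:
  fixes F f :: "'a::alg_closed_field poly"
  assumes "F \<noteq> 0" "F dvd f ^ m"
  shows "F dvd pderiv F * f"
  using assms
proof (induction "Polynomial.degree F" arbitrary: F)
  case 0
  then have "F dvd 1" using is_unit_iff_degree by auto
  then show ?case by (rule dvd_trans) simp
next
  case (Suc d)
  then obtain a where a: "poly F a = 0" using alg_closed_imp_poly_has_root[of F] by auto
  then obtain F1 where F1: "F = [:- a, 1:] * F1" by (metis poly_eq_0_iff_dvd dvdE)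
  have F10: "F1 \<noteq> 0" using Suc.prems F1 by auto
  then have "Polynomial.degree F = Suc (Polynomial.degree F1)"
    unfolding F1 by (subst degree_mult_eq) auto
  then have d: "d = Polynomial.degree F1" using Suc.hyps(2) by simp
  have "poly (f ^ m) a = 0" using Suc.prems(2) a by (metis dvdE mult_zero_left poly_mult)
  then have "poly f a = 0" by simp
  then obtain f1 where f1: "f = [:- a, 1:] * f1" by (metis poly_eq_0_iff_dvd dvdE)
  have "F1 dvd f ^ m" using Suc.prems(2) F1 by (metis dvd_mult_right)
  from Suc.hyps(1)[OF d F10 this] obtain h where h: "pderiv F1 * f = F1 * h" by (rule dvdE)
  have "pderiv F * f = ([:- a, 1:] * pderiv F1 + F1 * pderiv [:- a, 1:]) * f"
    unfolding F1 by (simp only: pderiv_mult)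
  also have "\<dots> = [:- a, 1:] * (pderiv F1 * f) + F1 * f"
    by (simp add: pderiv_pCons algebra_simps)
  also have "[:- a, 1:] * (pderiv F1 * f) = F * h" by (simp only: h F1 mult.assoc)
  also have "F1 * f = F * f1" by (simp only: f1 F1 mult_ac)
  finally show ?case by (simp flip: distrib_left)
qed

lemma comm_ring_hom_map_poly_pderiv:
  assumes "comm_ring_hom f"
  shows "map_poly f (pderiv p) = pderiv (map_poly f p)"
proof -
  interpret f: comm_ring_hom f by fact
  show ?thesis
    by (rule poly_eqI) (simp add: coeff_map_poly coeff_pderiv f.hom_mult f.hom_add f.hom_of_nat)
qed

definition dirderiv :: "nat \<Rightarrow> (nat \<Rightarrow> 'k::field) \<Rightarrow> 'k mpoly \<Rightarrow> 'k mpoly" where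
  "dirderiv i e p = chi i e (pderiv (psi i e p))"

text \<open>Geometrically, the projection of the hypersurface F = 0 along the direction is finite:
  division by F needs no denominators.\<close>

definition monic_along :: "nat \<Rightarrow> (nat \<Rightarrow> 'k::field) \<Rightarrow> 'k mpoly \<Rightarrow> bool" where
  "monic_along i e F \<longleftrightarrow> (\<exists>a. a \<noteq> 0 \<and> Polynomial.lead_coeff (psi i e F) = mpoly_const a)"

lemma psi_chi: "psi i e (chi i e r) = map_poly (tau i (\<lambda>_. 0)) r"
  by (induction r) (auto simp: psi.hom_add psi.hom_mult psi_tau psi_var map_poly_pCons_hom[OF tau_hom] chi_def)

lemma monic_division:
  assumes "monic_along i e F"
  obtains Q R where "f = F * Q + chi i e R" "Polynomial.degree R < pdeg i e F \<or> R = 0"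
    and "psi i e f = psi i e F * psi i e Q + R"
proof -
  obtain a where a: "a \<noteq> 0" "Polynomial.lead_coeff (psi i e F) = mpoly_const a"
    using assms by (auto simp: monic_along_def)
  have F0: "psi i e F \<noteq> 0" using a by auto
  obtain q r where qr: "pseudo_divmod (psi i e f) (psi i e F) = (q, r)"
    by (cases "pseudo_divmod (psi i e f) (psi i e F)")
  define k where "k = Suc (pdeg i e f) - pdeg i e F"
  define u where "u = mpoly_const (inverse (a ^ k))"
  have u: "u * mpoly_const a ^ k = 1"
    unfolding u_def mpoly_const.hom_power[symmetric]
    using a(1) mpoly_const_inverse[of "a ^ k"] by (simp add: mult.commute)
  have 1: "Polynomial.smult (mpoly_const a ^ k) (psi i e f) = psi i e F * q + r"
    using pseudo_divmod(1)[OF F0 qr] a(2) by (simp add: k_def)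
  have 2: "r = 0 \<or> Polynomial.degree r < pdeg i e F"
    using pseudo_divmod(2)[OF F0 qr] .
  define Q where "Q = Polynomial.smult u q"
  define R where "R = Polynomial.smult u r"
  have "psi i e f = Polynomial.smult u (Polynomial.smult (mpoly_const a ^ k) (psi i e f))"
    using u by simp
  also have "\<dots> = psi i e F * Q + R" unfolding 1 Q_def R_def by (simp add: smult_add_right)
  finally have 3: "psi i e f = psi i e F * Q + R" .
  have deg: "Polynomial.degree R < pdeg i e F \<or> R = 0" using 2 by (auto simp: R_def)
  \<comment> \<open>Removing t_i from the coefficients of the remainder makes \<open>psi\<close>
    after \<open>chi\<close> act on it as the identity, as required for the third equation to be
    exact.\<close>
  let ?r = "map_poly (tau i (\<lambda>_. 0))"
  have 4: "f = F * chi i e Q + chi i e R"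
    using arg_cong[OF 3, of "chi i e"] by (simp add: chi.hom_add chi.hom_mult)
  have "psi i e f = psi i e F * psi i e (chi i e Q) + ?r R"
    using arg_cong[OF 4, of "psi i e"] by (simp add: psi.hom_add psi.hom_mult psi_chi)
  moreover have "chi i e (?r R) = chi i e R"
    by (simp flip: psi_chi[of i e])
  moreover have "Polynomial.degree (?r R) < pdeg i e F \<or> ?r R = 0"
    using deg degree_map_poly_le[of "tau i (\<lambda>_. 0)" R] by auto
  ultimately show ?thesis using that[of "chi i e Q" "?r R"] 4 by simp
qed

lemma psi_dirderiv: "psi i e (dirderiv i e F) = pderiv (psi i e F)"
  by (simp add: dirderiv_def psi_chi comm_ring_hom_map_poly_pderiv[OF tau_hom] map_poly_rho_psi)

text \<open>A fibre of the generically etale projection along \<open>e\<close> over the generic point of \<open>q = 0\<close> is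
  reduced where the derivative of \<open>F\<close> along \<open>e\<close> does not vanish.\<close>

lemma reduced_along:
  fixes F q f :: "'k::field mpoly"
  assumes F: "monic_along i e F" and q: "prime_elem q" "pdeg i e q = 0"
    and f: "f ^ m = F * g + q * h"
  shows "\<exists>g' h'. dirderiv i e F * f = F * g' + q * h'"
proof -
  obtain ev :: "'k mpoly \<Rightarrow> 'k mpoly fract alg_closure"
    where ev: "comm_ring_hom ev" "\<And>f. ev f = 0 \<longleftrightarrow> q dvd f"
    using prime_elem_kernel[OF q(1)] by blast
  \<comment> \<open>Evaluation of the coefficients at the generic point of q = 0 in the affine space
    below. Since q has degree 0 along the direction, all of \<open>psi i e q\<close> is
    killed.\<close>
  define ev2 where "ev2 = (\<lambda>p. ev (tau i e p))"
  have ev2: "comm_ring_hom ev2" unfolding ev2_def by (rule comm_ring_hom_comp[OF tau_hom ev(1)])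
  interpret ev: comm_ring_hom ev by fact
  interpret ev2: comm_ring_hom ev2 by fact
  interpret M: comm_ring_hom "map_poly ev2" by (rule comm_ring_hom_map_poly[OF ev2])
  let ?M = "map_poly ev2"
  obtain a where a: "a \<noteq> 0" "Polynomial.lead_coeff (psi i e F) = mpoly_const a"
    using F by (auto simp: monic_along_def)
  have "ev2 (mpoly_const a) * ev2 (mpoly_const (inverse a)) = 1"
    by (simp flip: ev2.hom_mult add: mpoly_const_inverse a)
  then have lc: "ev2 (Polynomial.lead_coeff (psi i e F)) \<noteq> 0" using a(2) by auto
  then have degM: "Polynomial.degree (?M (psi i e F)) = pdeg i e F"
    by (intro map_poly_degree_eq) simp
  have M0: "?M (psi i e F) \<noteq> 0" using lc by (metis coeff_0 coeff_map_poly ev2.hom_zero)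
  obtain q' where q': "psi i e q = [:q':]" using q(2) pdeg_0_iff by blast
  have "tau i e q' = q" using chi_psi[of i e q] unfolding q' by simp
  then have "ev2 q' = 0" using ev(2)[of q] by (simp add: ev2_def)
  then have "?M (psi i e q) = 0" by (simp add: q' map_poly_pCons_hom[OF ev2])
  then have "?M (psi i e f) ^ m = ?M (psi i e F) * ?M (psi i e g)"
    using arg_cong[OF f, of "\<lambda>p. ?M (psi i e p)"]
    by (simp add: psi.hom_add psi.hom_mult psi.hom_power M.hom_add M.hom_mult M.hom_power)
  then have "?M (psi i e F) dvd ?M (psi i e f) ^ m" by simp
  then have "?M (psi i e F) dvd pderiv (?M (psi i e F)) * ?M (psi i e f)"
    by (rule dvd_power_imp_dvd_pderiv_mult[OF M0])
  then have dvd: "?M (psi i e F) dvd ?M (pderiv (psi i e F) * psi i e f)"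
    by (simp add: M.hom_mult comm_ring_hom_map_poly_pderiv[OF ev2])
  obtain Q R where QR: "dirderiv i e F * f = F * Q + chi i e R"
    "Polynomial.degree R < pdeg i e F \<or> R = 0"
    "psi i e (dirderiv i e F * f) = psi i e F * psi i e Q + R"
    using monic_division[OF F] by blast
  have "psi i e (dirderiv i e F * f) = pderiv (psi i e F) * psi i e f"
    by (simp add: psi.hom_mult psi_dirderiv)
  then have "?M (pderiv (psi i e F) * psi i e f) = ?M (psi i e F) * ?M (psi i e Q) + ?M R"
    using arg_cong[OF QR(3), of ?M] by (simp add: M.hom_add M.hom_mult)
  then have "?M (psi i e F) dvd ?M R" using dvd by (metis dvd_add_right_iff dvd_triv_left)
  moreover have "Polynomial.degree (?M R) \<le> Polynomial.degree R" by (rule degree_map_poly_le)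
  \<comment> \<open>The image of F keeps its degree because its leading coefficient is a nonzero
    constant; it divides the image of a remainder of smaller degree, which must vanish. So every
    coefficient of the remainder is divisible by q.\<close>
  ultimately have "?M R = 0"
    using QR(2) degM dvd_imp_degree_le[of "?M (psi i e F)" "?M R"] by (cases "R = 0") force+
  then have "ev2 (Polynomial.coeff R k) = 0" for k
    by (metis coeff_0 coeff_map_poly ev2.hom_zero)
  then have "q dvd tau i e (Polynomial.coeff R k)" for k using ev(2) by (simp add: ev2_def)
  then have "[:q:] dvd map_poly (tau i e) R"
    by (simp add: const_poly_dvd_iff coeff_map_poly)
  then obtain S where "map_poly (tau i e) R = [:q:] * S" by (auto elim: dvdE)
  then have "chi i e R = q * poly S (mpvar i)" by (simp add: chi_def)
  then show ?thesis using QR(1) by auto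
qed

lemma prime_mpvar: "prime_elem (mpvar i :: 'k::field mpoly)"
proof -
  have dvd: "mpvar i dvd a \<longleftrightarrow> tau i (\<lambda>_. 0) a = 0" for a :: "'k mpoly"
  proof
    assume "mpvar i dvd a"
    then show "tau i (\<lambda>_. 0) a = 0" by (auto elim!: dvdE simp: tau.hom_mult tau_var)
  next
    assume a: "tau i (\<lambda>_. 0) a = 0"
    obtain c p where cp: "psi i (\<lambda>_. 0) a = pCons c p" by (metis pCons_cases)
    have c: "tau i (\<lambda>_. 0) c = c" using rho_coeff_psi[of i "\<lambda>_. 0" a 0] cp by simp
    have "a = chi i (\<lambda>_. 0) (pCons c p)" by (simp flip: cp)
    also have "\<dots> = c + mpvar i * chi i (\<lambda>_. 0) p"
      by (simp add: chi_def map_poly_pCons_hom[OF tau_hom] c)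
    finally have a': "a = c + mpvar i * chi i (\<lambda>_. 0) p" .
    then have "tau i (\<lambda>_. 0) a = c" using c by (metis add.right_neutral mult_zero_left tau.hom_add tau.hom_mult tau_var)
    then show "mpvar i dvd a" using a a' by simp
  qed
  show ?thesis
  proof (rule prime_elemI)
    show "(mpvar i :: 'k mpoly) \<noteq> 0"
      unfolding mpvar_def by (metis keys_single keys_zero one_neq_zero singleton_insert_inj_eq' insert_not_empty)
    show "\<not> (mpvar i :: 'k mpoly) dvd 1" unfolding dvd by simp
    fix a b :: "'k mpoly" assume "mpvar i dvd a * b"
    then show "mpvar i dvd a \<or> mpvar i dvd b" unfolding dvd by (simp add: tau.hom_mult)
  qed
qed

lemma prime_elem_power_dvd_cancel:
  fixes p :: "'a::idom"
  assumes "prime_elem p" "\<not> p dvd s" "p ^ m dvd s * c"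
  shows "p ^ m dvd c"
  using assms(3)
proof (induction m)
  case (Suc m)
  then have "p ^ m dvd c" by (metis dvd_mult_right power_Suc)
  then obtain c' where c': "c = p ^ m * c'" by (auto elim: dvdE)
  obtain h where h: "s * c = p ^ Suc m * h" using Suc.prems by (auto elim: dvdE)
  have p0: "p \<noteq> 0" using assms(1) by auto
  have "p ^ m * (s * c') = p ^ m * (p * h)" using h c' by (simp add: mult_ac)
  then have "s * c' = p * h" using p0 by simp
  then have "p dvd c'" using assms(1,2) prime_elem_dvd_multD[OF assms(1), of s c'] by auto
  then show ?case using c' by (auto elim!: dvdE simp: mult_ac)
qed simp

section \<open>Homogeneous components, and two forms in three variables\<close>

section \<open>Homogeneous polynomials\<close>

text \<open>Stated through \<open>theta\<close>, so that products and components of forms reduce to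
  arithmetic of univariate monomials. The zero polynomial is homogeneous of every degree.\<close>

definition homog :: "nat \<Rightarrow> 'k::field mpoly \<Rightarrow> bool" where
  "homog k p \<longleftrightarrow> theta p = Polynomial.monom p k"

abbreviation hcomp :: "nat \<Rightarrow> 'k::field mpoly \<Rightarrow> 'k mpoly" where
  "hcomp k p \<equiv> Polynomial.coeff (theta p) k"

lemma mono_eval_mpvar: "mono_eval mpvar m = (Poly_Mapping.single m 1 :: 'k::field mpoly)"
proof -
  have "mpeval mpoly_const mpvar = (\<lambda>p::'k mpoly. p)"
    by (rule comm_ring_hom_eq[OF mpeval_hom[OF mpoly_const_hom] comm_ring_hom_id])
      (simp_all add: mpeval_const[OF mpoly_const_hom] mpeval_var[OF mpoly_const_hom])
  from fun_cong[OF this, of "Poly_Mapping.single m 1"] show ?thesis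
    by (simp add: mpeval_single[OF mpoly_const_hom])
qed

lemma prod_monom:
  "(\<Prod>i\<in>A. Polynomial.monom (x i) (k i)) = Polynomial.monom (\<Prod>i\<in>A. x i) (\<Sum>i\<in>A. k i)"
  for x :: "'a \<Rightarrow> 'b::comm_ring_1"
  by (induction A rule: infinite_finite_induct) (simp_all add: mult_monom monom_eq_1)

lemma theta_single:
  "theta (Poly_Mapping.single m c) = Polynomial.monom (Poly_Mapping.single m c) (monomial_degree m)"
proof -
  have "theta (Poly_Mapping.single m c) = [:mpoly_const c:] *
      (\<Prod>i\<in>Poly_Mapping.keys m. Polynomial.monom (mpvar i) 1 ^ Poly_Mapping.lookup m i)"
    unfolding theta_def mpeval_single[OF const_poly_const_hom] mono_eval_def
    by (simp add: monom_Suc monom_0)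
  also have "\<dots> = [:mpoly_const c:] * Polynomial.monom (Poly_Mapping.single m 1) (monomial_degree m)"
    by (simp add: monom_power prod_monom monomial_degree_def mono_eval_mpvar[symmetric] mono_eval_def)
  also have "\<dots> = Polynomial.monom (Poly_Mapping.single m c) (monomial_degree m)"
    by (subst (2) single_eq_const_mult) (simp add: smult_monom)
  finally show ?thesis .
qed

lemma hcomp_eq_sum:
  "hcomp k p = (\<Sum>m\<in>{m \<in> Poly_Mapping.keys p. monomial_degree m = k}. Poly_Mapping.single m (Poly_Mapping.lookup p m))"
proof -
  have "theta p = (\<Sum>m\<in>Poly_Mapping.keys p. theta (Poly_Mapping.single m (Poly_Mapping.lookup p m)))"
    by (subst (1) poly_mapping_sum_single[of p]) (rule theta.hom_sum)
  then have "hcomp k p = (\<Sum>m\<in>Poly_Mapping.keys p.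
      if monomial_degree m = k then Poly_Mapping.single m (Poly_Mapping.lookup p m) else 0)"
    by (simp add: theta_single coeff_sum)
  also have "\<dots> = (\<Sum>m\<in>{m \<in> Poly_Mapping.keys p. monomial_degree m = k}. Poly_Mapping.single m (Poly_Mapping.lookup p m))"
    by (simp add: sum.inter_filter)
  finally show ?thesis .
qed

lemma homog_iff: "homog k p \<longleftrightarrow> homogeneous k p"
proof
  assume h: "homogeneous k p"
  show "homog k p"
    unfolding homog_def
  proof (rule poly_eqI)
    fix j
    have "{m \<in> Poly_Mapping.keys p. monomial_degree m = j} = (if j = k then Poly_Mapping.keys p else {})"
      using h by (auto simp: homogeneous_def)
    then show "hcomp j p = Polynomial.coeff (Polynomial.monom p k) j"
      using poly_mapping_sum_single[of p] by (simp add: hcomp_eq_sum)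
  qed
next
  assume h: "homog k p"
  have "monomial_degree m = k" if m: "m \<in> Poly_Mapping.keys p" for m
  proof (rule ccontr)
    assume "monomial_degree m \<noteq> k"
    then have "hcomp (monomial_degree m) p = 0" using h by (simp add: homog_def)
    moreover have "Poly_Mapping.lookup (hcomp (monomial_degree m) p) m = Poly_Mapping.lookup p m"
      using m by (simp add: hcomp_eq_sum lookup_sum lookup_single when_def sum.delta')
    ultimately show False using m by (simp add: in_keys_iff)
  qed
  then show "homogeneous k p" by (simp add: homogeneous_def)
qed

lemma homog_0 [simp]: "homog k 0"
  by (simp add: homog_def)

lemma homog_add: "homog k p \<Longrightarrow> homog k q \<Longrightarrow> homog k (p + q)"
  by (simp add: homog_def theta.hom_add add_monom)

lemma homog_sum: "(\<And>i. i \<in> A \<Longrightarrow> homog k (f i)) \<Longrightarrow> homog k (sum f A)"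
  by (induction A rule: infinite_finite_induct) (auto intro: homog_add)

lemma homog_mult: "homog j p \<Longrightarrow> homog k q \<Longrightarrow> homog (j + k) (p * q)"
  by (simp add: homog_def theta.hom_mult mult_monom)

lemma homog_const [simp]: "homog 0 (mpoly_const c)"
  by (simp add: homog_def monom_0)

lemma homog_1 [simp]: "homog 0 1"
  using homog_const[of 1] by simp

lemma homog_var [simp]: "homog 1 (mpvar i)"
  by (simp add: homog_def monom_Suc monom_0)

lemma homog_power: "homog k p \<Longrightarrow> homog (m * k) (p ^ m)"
  by (induction m) (auto intro: homog_mult)

lemma homog_hcomp: "homog k (hcomp k p)"
proof (induction p arbitrary: k rule: mpoly_induct)
  case (const c) show ?case by (cases k) auto
next
  case (var i)
  have "homog (Suc 0) (mpvar i)" using homog_var[of i] by simp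
  then show ?case by (auto simp: coeff_pCons split: nat.split)
next
  case (add p q) then show ?case by (simp add: theta.hom_add homog_add)
next
  case (mult p q)
  show ?case
    unfolding theta.hom_mult coeff_mult
  proof (rule homog_sum)
    fix i assume "i \<in> {..k}"
    then show "homog k (hcomp i p * hcomp (k - i) q)"
      using homog_mult[OF mult.IH(1)[of i] mult.IH(2)[of "k - i"]] by simp
  qed
qed

lemma homog_hcomp_eq: "homog k p \<Longrightarrow> hcomp j p = (if j = k then p else 0)"
  by (simp add: homog_def)

lemma hcomp_mult_homog:
  assumes "homog a f"
  shows "hcomp k (c * f) = (if a \<le> k then hcomp (k - a) c * f else 0)"
proof -
  have "theta (c * f) = Polynomial.monom f a * theta c"
    using assms by (simp add: homog_def theta.hom_mult mult.commute)
  then show ?thesis by (simp only: coeff_monom_mult) (simp add: mult.commute)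
qed

lemma hcomp_in: "p \<in> polys_in V \<Longrightarrow> hcomp k p \<in> polys_in V"
  unfolding hcomp_eq_sum by (intro polys_in_sum) (auto simp: polys_in_def)

lemma homog_tdeg: "homog k p \<Longrightarrow> p \<noteq> 0 \<Longrightarrow> tdeg p = k"
  by (simp add: homog_def degree_monom_eq)

lemma total_degree_homogeneous:
  assumes "homogeneous d p" "total_degree p > 0"
  shows "total_degree p = d"
proof -
  have "monomial_degree ` Poly_Mapping.keys p \<subseteq> {d}" using assms(1) by (auto simp: homogeneous_def)
  then have "monomial_degree ` Poly_Mapping.keys p = {d} \<or> monomial_degree ` Poly_Mapping.keys p = {}" by blast
  then show ?thesis using assms(2) unfolding total_degree_def by auto
qed

text \<open>The chain rule: the j-th derivative of p(X t) is X times the j-th derivative of p taken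
  at X t.\<close>

lemma theta_mpderiv: "map_poly (mpderiv j) (theta p) = [:0, 1:] * theta (mpderiv j p)"
proof -
  interpret D: derivation "mpderiv j" by (rule derivation_mpderiv)
  have coeff: "Polynomial.coeff (map_poly (mpderiv j) P) k = mpderiv j (Polynomial.coeff P k)"
    for P :: "'a mpoly poly" and k
    by (simp add: coeff_map_poly)
  have mult: "map_poly (mpderiv j) (P * Q) = P * map_poly (mpderiv j) Q + Q * map_poly (mpderiv j) P"
    for P Q :: "'a mpoly poly"
  proof (rule poly_eqI)
    fix k
    have "(\<Sum>i\<le>k. Polynomial.coeff Q (k - i) * mpderiv j (Polynomial.coeff P i)) =
        (\<Sum>i\<le>k. Polynomial.coeff Q i * mpderiv j (Polynomial.coeff P (k - i)))"
      by (rule sum.reindex_bij_witness[of _ "\<lambda>i. k - i" "\<lambda>i. k - i"]) auto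
    then show "Polynomial.coeff (map_poly (mpderiv j) (P * Q)) k =
        Polynomial.coeff (P * map_poly (mpderiv j) Q + Q * map_poly (mpderiv j) P) k"
      by (simp add: coeff coeff_mult D.sum D.leibniz sum.distrib)
  qed
  have add: "map_poly (mpderiv j) (P + Q) = map_poly (mpderiv j) P + map_poly (mpderiv j) Q"
    for P Q :: "'a mpoly poly"
    by (rule poly_eqI) (simp add: coeff D.add)
  have "map_poly (mpderiv j) [:a, b:] = [:mpderiv j a, mpderiv j b:]" for a b :: "'a mpoly"
    by (rule poly_eqI) (simp add: coeff coeff_pCons split: nat.split)
  note lin = this
  have const1: "map_poly (mpderiv j) [:a:] = [:mpderiv j a:]" for a :: "'a mpoly"
    by (rule poly_eqI) (simp add: coeff coeff_pCons split: nat.split)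
  show ?thesis
  proof (induction p rule: mpoly_induct)
    case (const c) show ?case unfolding theta_const const1 by simp
  next
    case (var i) show ?case by (simp add: lin mpderiv_var theta.hom_zero)
  next
    case (add p q) then show ?case
      by (simp only: theta.hom_add \<open>\<And>P Q. map_poly (mpderiv j) (P + Q) = _\<close> mpderiv_add distrib_left)
  next
    case (mult p q) then show ?case
      by (simp only: theta.hom_mult theta.hom_add \<open>\<And>P Q. map_poly (mpderiv j) (P * Q) = _\<close> mpderiv_mult distrib_left mult.left_commute)
  qed
qed

lemma hcomp_mpderiv: "hcomp k (mpderiv j p) = mpderiv j (hcomp (Suc k) p)"
proof -
  have "Polynomial.coeff (map_poly (mpderiv j) (theta p)) (Suc k) = hcomp k (mpderiv j p)"
    by (simp add: theta_mpderiv)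
  then show ?thesis by (simp add: coeff_map_poly derivation.zero[OF derivation_mpderiv])
qed

lemma homog_mpderiv: "homog (Suc k) p \<Longrightarrow> homog k (mpderiv j p)"
  unfolding homog_def
  by (rule poly_eqI) (simp add: hcomp_mpderiv derivation.zero[OF derivation_mpderiv])

lemma tdeg_mpderiv: "tdeg p \<le> Suc k \<Longrightarrow> tdeg (mpderiv j p) \<le> k"
  by (rule degree_le) (simp add: hcomp_mpderiv coeff_eq_0 derivation.zero[OF derivation_mpderiv])

text \<open>The order at 0 never exceeds the degree, and both add up to k over the two factors;
  hence they agree for each factor.\<close>

lemma mult_eq_monom:
  fixes p q :: "'a::idom poly"
  assumes "p * q = Polynomial.monom c k" "c \<noteq> 0"
  obtains a j where "p = Polynomial.monom a j"
proof -
  have pq0: "p * q \<noteq> 0" using assms by simp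
  then have "order 0 p + order 0 q = k" using order_mult[OF pq0, of 0] assms
    by (simp add: order_0_monom)
  moreover have "Polynomial.degree p + Polynomial.degree q = k"
    using pq0 degree_mult_eq[of p q] assms degree_monom_eq[of c k] by (metis mult_zero_left mult_zero_right)
  moreover have "order 0 p \<le> Polynomial.degree p" "order 0 q \<le> Polynomial.degree q"
    using pq0 by (auto intro: order_degree)
  ultimately have o: "order 0 p = Polynomial.degree p" by simp
  obtain r where r: "p = [:- 0, 1:] ^ order 0 p * r" using order_1[of 0 p] by (auto elim: dvdE)
  then have "r \<noteq> 0" using pq0 by auto
  have "Polynomial.degree p = Polynomial.degree ([:- 0, 1::'a:] ^ order 0 p) + Polynomial.degree r"
    by (subst r, rule degree_mult_eq) (use \<open>r \<noteq> 0\<close> in auto)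
  then have "Polynomial.degree r = 0" using o by (simp add: degree_power_eq)
  then obtain a where "r = [:a:]" by (metis degree_eq_zeroE)
  then have "p = Polynomial.monom a (order 0 p)"
    by (subst r) (simp add: monom_altdef mult.commute)
  then show ?thesis using that by blast
qed

lemma homog_factor:
  assumes "homog k (p * q)" "p * q \<noteq> 0"
  obtains j where "homog j p"
proof -
  have "theta p * theta q = Polynomial.monom (p * q) k"
    using assms by (simp add: homog_def theta.hom_mult)
  then obtain a j where a: "theta p = Polynomial.monom a j" using mult_eq_monom assms(2) by blast
  then have "p = a" using poly_theta_1[of p] by (simp add: poly_monom)
  then show ?thesis using that a by (simp add: homog_def)
qed


section \<open>Two forms in three or more variables have a common zero\<close>

interpretation mpoly_vs: vector_space "\<lambda>c p. mpoly_const c * p :: 'k::field mpoly"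
  by unfold_locales (simp_all add: algebra_simps mpoly_const_add mpoly_const_mult)

lemma independent_monomials:
  "mpoly_vs.independent ((\<lambda>m. Poly_Mapping.single m (1::'k::field)) ` M)"
proof -
  have inj: "inj (\<lambda>m. Poly_Mapping.single m (1::'k))"
    by (metis (no_types, lifting) injI keys_single singleton_inject one_neq_zero)
  show ?thesis
    unfolding mpoly_vs.dependent_explicit
  proof clarify
    fix T u v
    assume T: "finite T" "T \<subseteq> (\<lambda>m. Poly_Mapping.single m (1::'k)) ` M"
      and s: "(\<Sum>v\<in>T. mpoly_const (u v) * v) = 0" and v: "v \<in> T" and uv: "u v \<noteq> (0::'k)"
    obtain m where m: "v = Poly_Mapping.single m 1" using T v by auto
    have "Poly_Mapping.lookup (mpoly_const (u w) * w) m = (if w = v then u v else 0)" if w: "w \<in> T" for w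
    proof -
      obtain m' where m': "w = Poly_Mapping.single m' 1" using T(2) w by blast
      have "w = v \<longleftrightarrow> m' = m" using inj by (auto simp: m m' inj_def)
      then show ?thesis unfolding m' m
        by (subst single_eq_const_mult[symmetric]) (auto simp: lookup_single when_def)
    qed
    then have "Poly_Mapping.lookup (\<Sum>v\<in>T. mpoly_const (u v) * v) m = (\<Sum>w\<in>T. if w = v then u v else 0)"
      by (simp add: lookup_sum)
    also have "\<dots> = u v" using T v by simp
    finally show False using s uv by simp
  qed
qed

lemma monomial_degree_add: "monomial_degree (m + m') = monomial_degree m + monomial_degree m'"
proof -
  have "monomial_degree m = (\<Sum>i\<in>A. Poly_Mapping.lookup m i)"
    if "finite A" "Poly_Mapping.keys m \<subseteq> A" for m A
    unfolding monomial_degree_def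
    by (rule sum.mono_neutral_left) (use that in \<open>auto simp: in_keys_iff\<close>)
  note * = this[of "Poly_Mapping.keys m \<union> Poly_Mapping.keys m'"]
  show ?thesis using keys_add[of m m'] by (simp add: * lookup_add sum.distrib)
qed

lemma monomial_degree_single: "monomial_degree (Poly_Mapping.single i k) = k"
  by (simp add: monomial_degree_def)

lemma mpvar_power: "mpvar i ^ k = Poly_Mapping.single (Poly_Mapping.single i k) (1::'k::field)"
  by (induction k) (simp_all add: mpvar_def mult_single flip: single_add)

text \<open>A quotient by two forms is finite-dimensional only if every polynomial lies in the span of
  the products of powers of these forms with finitely many monomials; this bounds the dimension of
  the polynomials of degree at most \<open>3M\<close> by a quadratic polynomial in \<open>M\<close>.\<close>

context
  fixes V :: "nat set" and f g :: "'k::field mpoly" and a b N :: nat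
  assumes V: "finite V"
    and f: "homog a f" "a > 0" "f \<in> polys_in V" and g: "homog b g" "b > 0" "g \<in> polys_in V"
    and N: "\<And>j. j \<in> V \<Longrightarrow> \<exists>u v. mpvar j ^ N = u * f + v * g"
begin

text \<open>A monomial outside the box contains some t_j^N and can be rewritten through f and g, so
  the box generates all polynomials in V as a module over the polynomials in f and g.\<close>

definition box :: "'k mpoly set" where
  "box = (\<lambda>m. Poly_Mapping.single m 1) ` {m. Poly_Mapping.keys m \<subseteq> V \<and> (\<forall>i. Poly_Mapping.lookup m i \<le> N)}"

definition gens :: "nat \<Rightarrow> 'k mpoly set" where
  "gens e = (\<lambda>(u, v, s). f ^ u * g ^ v * s) ` ({..e} \<times> {..e} \<times> box)"

lemma finite_box: "finite box"
proof -
  let ?S = "{m. Poly_Mapping.keys m \<subseteq> V \<and> (\<forall>i. Poly_Mapping.lookup m i \<le> N)}"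
  have "Poly_Mapping.lookup ` ?S \<subseteq> {h. \<forall>i. (i \<in> V \<longrightarrow> h i \<in> {..N}) \<and> (i \<notin> V \<longrightarrow> h i = 0)}"
    by (auto simp: in_keys_iff)
  moreover have "finite \<dots>" by (rule finite_set_of_finite_funs) (use V in auto)
  ultimately have "finite (Poly_Mapping.lookup ` ?S)" by (rule finite_subset)
  then have "finite ?S" by (rule finite_imageD) (auto intro: inj_onI simp: poly_mapping.lookup_inject)
  then show ?thesis unfolding box_def by simp
qed

lemma card_gens: "card (gens e) \<le> (e + 1)\<^sup>2 * card box"
proof -
  have "card (gens e) \<le> card ({..e} \<times> {..e} \<times> box)"
    unfolding gens_def by (rule card_image_le) (use finite_box in auto)
  then show ?thesis by (simp add: card_cartesian_product power2_eq_square algebra_simps)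
qed

lemma finite_gens: "finite (gens e)"
  unfolding gens_def using finite_box by auto

lemma gens_mono: "e \<le> e' \<Longrightarrow> gens e \<subseteq> gens e'"
  unfolding gens_def by (intro image_mono Sigma_mono) auto

lemma span_mult:
  assumes "p \<in> mpoly_vs.span (gens e)" "h = f \<or> h = g"
  shows "h * p \<in> mpoly_vs.span (gens (Suc e))"
  using assms(1)
proof (induction rule: mpoly_vs.span_induct_alt)
  case base show ?case by (simp add: mpoly_vs.span_zero)
next
  case (step c x y)
  obtain u v s where x: "x = f ^ u * g ^ v * s" "u \<le> e" "v \<le> e" "s \<in> box"
    using step(1) by (auto simp: gens_def)
  have "h * x \<in> gens (Suc e)"
  proof (cases "h = f")
    case True
    then have "h * x = f ^ Suc u * g ^ v * s" using x by (simp add: mult_ac)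
    moreover have "(Suc u, v, s) \<in> {..Suc e} \<times> {..Suc e} \<times> box" using x by auto
    ultimately show ?thesis unfolding gens_def by (metis (mono_tags, lifting) case_prod_conv image_eqI)
  next
    case False
    then have "h * x = f ^ u * g ^ Suc v * s" using x assms(2) by (simp add: mult_ac)
    moreover have "(u, Suc v, s) \<in> {..Suc e} \<times> {..Suc e} \<times> box" using x by auto
    ultimately show ?thesis unfolding gens_def by (metis (mono_tags, lifting) case_prod_conv image_eqI)
  qed
  then have "mpoly_const c * (h * x) + h * y \<in> mpoly_vs.span (gens (Suc e))"
    by (intro mpoly_vs.span_add mpoly_vs.span_scale mpoly_vs.span_base step(2))
  then show ?case by (simp add: algebra_simps)
qed

text \<open>A monomial with a large exponent is replaced by means of t_j^N = u f + v g. Only the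
  components of degree N matter, so the cofactors of f and g become forms of degree smaller than e,
  to which the induction applies.\<close>

lemma homog_in_span:
  assumes "p \<in> polys_in V" "homog e p"
  shows "p \<in> mpoly_vs.span (gens e)"
  using assms
proof (induction e arbitrary: p rule: less_induct)
  case (less e)
  have mono: "Poly_Mapping.single m 1 \<in> mpoly_vs.span (gens e)"
    if m: "Poly_Mapping.keys m \<subseteq> V" "monomial_degree m = e" for m
  proof (cases "\<forall>i. Poly_Mapping.lookup m i \<le> N")
    case True
    then have "Poly_Mapping.single m 1 \<in> box" using m by (auto simp: box_def)
    then have "f ^ 0 * g ^ 0 * Poly_Mapping.single m 1 \<in> gens e"
      unfolding gens_def by (intro image_eqI[of _ _ "(0, 0, Poly_Mapping.single m 1)"]) auto
    then show ?thesis by (auto intro: mpoly_vs.span_base)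
  next
    case False
    then obtain j where j: "Poly_Mapping.lookup m j > N" by (auto simp: not_le)
    then have jV: "j \<in> V" using m by (auto simp: in_keys_iff)
    define m' where "m' = m - Poly_Mapping.single j N"
    have mm: "m = Poly_Mapping.single j N + m'"
      using j by (intro poly_mapping_eqI) (auto simp: m'_def lookup_add lookup_minus lookup_single when_def)
    let ?s = "Poly_Mapping.single m' (1::'k)"
    have "Poly_Mapping.keys m' \<subseteq> Poly_Mapping.keys m" by (auto simp: m'_def lookup_minus in_keys_iff)
    then have sV: "?s \<in> polys_in V" using m by (auto simp: polys_in_def)
    have sh: "homog (e - N) ?s"
      using m(2) unfolding mm monomial_degree_add monomial_degree_single by (auto simp: homog_def theta_single)
    have eN: "N \<le> e" using m(2) unfolding mm monomial_degree_add monomial_degree_single by simp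
    obtain u v where uv: "mpvar j ^ N = u * f + v * g" using N jV by blast
    have hN: "homog N (mpvar j ^ N :: 'k mpoly)" using homog_power[OF homog_var, of N j] by simp
    have "(mpvar j ^ N :: 'k mpoly) = hcomp N (mpvar j ^ N)" using homog_hcomp_eq[OF hN] by simp
    also have "\<dots> = hcomp N (restrict_vars V (mpvar j ^ N))"
      using jV by (simp add: restrict_vars.hom_power restrict_vars_var)
    also have "\<dots> = hcomp N (restrict_vars V u * f) + hcomp N (restrict_vars V v * g)"
      unfolding uv using f(3) g(3) by (simp add: restrict_vars.hom_add restrict_vars.hom_mult theta.hom_add)
    finally have 1: "mpvar j ^ N = hcomp N (restrict_vars V u * f) + hcomp N (restrict_vars V v * g)" .
    have key: "hcomp N (restrict_vars V w * h) * ?s \<in> mpoly_vs.span (gens e)"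
      if h: "(h = f \<and> c = a) \<or> (h = g \<and> c = b)" for w h c
    proof (cases "c \<le> N")
      case False
      then show ?thesis using h f g by (auto simp: hcomp_mult_homog mpoly_vs.span_zero)
    next
      case True
      let ?w = "hcomp (N - c) (restrict_vars V w)"
      have c: "homog c h" "c > 0" "h \<in> polys_in V" using h f g by auto
      have "?w * ?s \<in> polys_in V" by (intro polys_in_mult hcomp_in restrict_vars_in sV)
      moreover have "homog (N - c + (e - N)) (?w * ?s)" by (intro homog_mult homog_hcomp sh)
      then have "homog (e - c) (?w * ?s)" using True eN by simp
      moreover have "e - c < e" using c(2) True eN by simp
      ultimately have "?w * ?s \<in> mpoly_vs.span (gens (e - c))" using less.IH by blast
      then have "h * (?w * ?s) \<in> mpoly_vs.span (gens (Suc (e - c)))" using span_mult h by blast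
      moreover have "Suc (e - c) \<le> e" using c(2) True eN by simp
      ultimately have "h * (?w * ?s) \<in> mpoly_vs.span (gens e)"
        using mpoly_vs.span_mono[OF gens_mono] by blast
      moreover have "hcomp N (restrict_vars V w * h) * ?s = h * (?w * ?s)"
        using True unfolding hcomp_mult_homog[OF c(1)] by (simp add: mult_ac)
      ultimately show ?thesis by (simp only:)
    qed
    have "Poly_Mapping.single m 1 = mpvar j ^ N * ?s"
      by (subst mm) (simp add: mpvar_power mult_single)
    also have "\<dots> = hcomp N (restrict_vars V u * f) * ?s + hcomp N (restrict_vars V v * g) * ?s"
      by (subst 1) (rule distrib_right)
    also have "\<dots> \<in> mpoly_vs.span (gens e)" by (intro mpoly_vs.span_add key[of f a] key[of g b]) auto
    finally show ?thesis .
  qed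
  have "(\<Sum>m\<in>Poly_Mapping.keys p. mpoly_const (Poly_Mapping.lookup p m) * Poly_Mapping.single m 1) \<in> mpoly_vs.span (gens e)"
  proof (intro mpoly_vs.span_sum mpoly_vs.span_scale mono)
    fix m assume m: "m \<in> Poly_Mapping.keys p"
    show "Poly_Mapping.keys m \<subseteq> V" using less.prems(1) m by (auto simp: polys_in_def)
    show "monomial_degree m = e" using less.prems(2) m by (auto simp: homog_iff homogeneous_def)
  qed
  then show ?case
    by (simp only: single_eq_const_mult[symmetric] poly_mapping_sum_single[symmetric])
qed

lemma card_vars_le_2: "\<not> {x, y, z} \<subseteq> V \<or> x = y \<or> y = z \<or> x = z"
proof (rule ccontr)
  assume "\<not> ?thesis"
  then have xyz: "x \<in> V" "y \<in> V" "z \<in> V" "x \<noteq> y" "y \<noteq> z" "x \<noteq> z" by auto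
  define K where "K = card box"
  \<comment> \<open>The M^3 monomials with exponents below M have degree at most 3M and would lie in
    a space of dimension at most (3M + 1)^2 K, which is at most 16 M^2 K. Any M above 16 K
    contradicts this.\<close>
  define M where "M = 16 * K + 1"
  define mm where "mm = (\<lambda>(i, j, k). Poly_Mapping.single x i + Poly_Mapping.single y j + Poly_Mapping.single z k :: nat \<Rightarrow>\<^sub>0 nat)"
  define E where "E = {..<M} \<times> {..<M} \<times> {..<M}"
  have lk: "Poly_Mapping.lookup (mm (i, j, k)) x = i" "Poly_Mapping.lookup (mm (i, j, k)) y = j"
    "Poly_Mapping.lookup (mm (i, j, k)) z = k" for i j k
    using xyz by (auto simp: mm_def lookup_add lookup_single when_def)
  have inj: "inj_on mm E"
    by (rule inj_onI, clarify) (metis lk)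
  let ?S = "(\<lambda>m. Poly_Mapping.single m (1::'k)) ` (mm ` E)"
  have inj2: "inj (\<lambda>m. Poly_Mapping.single m (1::'k))"
    by (metis (no_types, lifting) injI keys_single singleton_inject one_neq_zero)
  have "card ?S = card (mm ` E)" by (rule card_image) (use inj2 in \<open>auto intro: inj_on_subset\<close>)
  also have "\<dots> = card E" by (rule card_image[OF inj])
  also have "\<dots> = M ^ 3" by (simp add: E_def card_cartesian_product power3_eq_cube)
  finally have cardS: "card ?S = M ^ 3" .
  have "?S \<subseteq> mpoly_vs.span (gens (3 * M))"
  proof clarify
    fix i j k assume E: "(i, j, k) \<in> E"
    have deg: "monomial_degree (mm (i, j, k)) = i + j + k"
      by (simp add: mm_def monomial_degree_add monomial_degree_single)
    have "Poly_Mapping.keys (mm (i, j, k)) \<subseteq> V"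
      using xyz by (auto simp: mm_def in_keys_iff lookup_add lookup_single when_def split: if_splits)
    then have "Poly_Mapping.single (mm (i, j, k)) 1 \<in> polys_in V" by (auto simp: polys_in_def)
    moreover have "homog (i + j + k) (Poly_Mapping.single (mm (i, j, k)) (1::'k))"
      by (simp add: homog_def theta_single deg)
    ultimately have "Poly_Mapping.single (mm (i, j, k)) 1 \<in> mpoly_vs.span (gens (i + j + k))"
      by (rule homog_in_span)
    moreover have "i + j + k \<le> 3 * M" using E by (auto simp: E_def)
    ultimately show "Poly_Mapping.single (mm (i, j, k)) 1 \<in> mpoly_vs.span (gens (3 * M))"
      using mpoly_vs.span_mono[OF gens_mono] by blast
  qed
  then have "card ?S \<le> card (gens (3 * M))"
    using mpoly_vs.independent_span_bound[OF finite_gens independent_monomials] by blast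
  then have "M ^ 3 \<le> (3 * M + 1)\<^sup>2 * K"
    using cardS card_gens[of "3 * M"] by (simp add: K_def)
  also have "\<dots> \<le> (4 * M)\<^sup>2 * K"
    by (intro mult_right_mono power_mono) (auto simp: M_def)
  finally have "M\<^sup>2 * M \<le> M\<^sup>2 * (16 * K)" by (simp add: power2_eq_square power3_eq_cube mult_ac)
  then have "M \<le> 16 * K" by (simp add: M_def)
  then show False by (simp add: M_def)
qed

end

section \<open>The Jacobian bracket on polynomials and on fractions\<close>

section \<open>Determinants and derivations\<close>

text \<open>Rows are functions, so that replacing row s is the function update
  \<open>r(s := v)\<close>.\<close>

definition rdet :: "nat \<Rightarrow> (nat \<Rightarrow> nat \<Rightarrow> 'r::comm_ring_1) \<Rightarrow> 'r" where
  "rdet m r = det (mat m m (\<lambda>(i, j). r i j))"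

definition rcof :: "nat \<Rightarrow> (nat \<Rightarrow> nat \<Rightarrow> 'r::comm_ring_1) \<Rightarrow> nat \<Rightarrow> nat \<Rightarrow> 'r" where
  "rcof m r s j = cofactor (mat m m (\<lambda>(i, j). r i j)) s j"

lemma rdet_cong: "(\<And>i j. i < m \<Longrightarrow> j < m \<Longrightarrow> r i j = r' i j) \<Longrightarrow> rdet m r = rdet m r'"
  unfolding rdet_def by (intro arg_cong[of _ _ det] cong_mat) auto

lemma rcof_upd: "s < m \<Longrightarrow> rcof m (r(s := v)) s j = rcof m r s j"
  unfolding rcof_def cofactor_def mat_delete_def
  by (intro arg_cong2[of _ _ _ _ "(*)"] arg_cong[of _ _ det] cong_mat) (auto simp: insert_index_def)

lemma rdet_expand:
  assumes "s < m"
  shows "rdet m (r(s := v)) = (\<Sum>j<m. v j * rcof m r s j)"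
proof -
  have "rdet m (r(s := v)) = (\<Sum>j<m. (r(s := v)) s j * rcof m (r(s := v)) s j)"
    unfolding rdet_def rcof_def
    by (subst laplace_expansion_row[of _ m s]) (use assms in \<open>auto intro!: sum.cong\<close>)
  then show ?thesis by (simp add: rcof_upd assms)
qed

lemma rcof_rdet: "s < m \<Longrightarrow> j < m \<Longrightarrow> rcof m r s j = rdet m (r(s := (\<lambda>l. if l = j then 1 else 0)))"
  by (simp add: rdet_expand if_distrib[of "\<lambda>x. x * _"] cong: if_cong)

lemma rdet_add:
  "s < m \<Longrightarrow> rdet m (r(s := (\<lambda>j. v j + w j))) = rdet m (r(s := v)) + rdet m (r(s := w))"
  by (simp add: rdet_expand distrib_right sum.distrib)

lemma rdet_scale: "s < m \<Longrightarrow> rdet m (r(s := (\<lambda>j. c * v j))) = c * rdet m (r(s := v))"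
  by (simp add: rdet_expand sum_distrib_left mult.assoc)

lemma rdet_alternating:
  assumes "i < m" "k < m" "i \<noteq> k" "\<And>j. j < m \<Longrightarrow> r i j = r k j"
  shows "rdet m r = 0"
  unfolding rdet_def
  by (rule det_identical_rows[of _ m i k]) (use assms in \<open>auto intro!: eq_vecI\<close>)

lemma rdet_swap:
  assumes "i < m" "k < m" "i \<noteq> k"
  shows "rdet m (r(i := v, k := w)) = - rdet m (r(i := w, k := v))"
proof -
  let ?u = "\<lambda>j. v j + w j"
  have z: "rdet m (r(i := x, k := x)) = 0" for x
    by (rule rdet_alternating[of i m k]) (use assms in auto)
  have "0 = rdet m ((r(i := ?u))(k := ?u))" by (simp add: z)
  also have "\<dots> = rdet m ((r(i := ?u))(k := v)) + rdet m ((r(i := ?u))(k := w))"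
    by (rule rdet_add) (use assms in auto)
  also have "\<dots> = rdet m ((r(k := v))(i := ?u)) + rdet m ((r(k := w))(i := ?u))"
    using assms by (simp add: fun_upd_twist)
  also have "\<dots> = rdet m (r(k := v, i := w)) + rdet m (r(k := w, i := v))"
    using z[of v] z[of w] assms by (simp add: rdet_add fun_upd_twist)
  finally show ?thesis using assms by (simp add: fun_upd_twist eq_neg_iff_add_eq_0 add.commute)
qed

lemma rdet_adjugate:
  assumes "j < m" "l < m"
  shows "(\<Sum>s<m. r s l * rcof m r s j) = (if j = l then rdet m r else 0)"
proof -
  let ?A = "mat m m (\<lambda>(i, j). r i j)"
  have "(adj_mat ?A * ?A) $$ (j, l) = (det ?A \<cdot>\<^sub>m 1\<^sub>m m) $$ (j, l)"
    by (subst adj_mat(3)[of ?A m]) auto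
  moreover have "(adj_mat ?A * ?A) $$ (j, l) = (\<Sum>s<m. r s l * rcof m r s j)"
    using assms adj_mat(1)[of ?A m]
    by (auto simp: times_mat_def scalar_prod_def adj_mat_def rcof_def lessThan_atLeast0 mult.commute
        intro!: sum.cong)
  ultimately show ?thesis using assms by (auto simp: rdet_def)
qed

text \<open>The infinitesimal form of multiplicativity: letting a linear map act on one row at a
  time and summing multiplies the determinant by the trace. The adjugate identity isolates the
  diagonal entries of b.\<close>

lemma rdet_trace:
  "(\<Sum>s<m. rdet m (r(s := (\<lambda>j. \<Sum>l<m. b j l * r s l)))) = (\<Sum>j<m. b j j) * rdet m r"
proof -
  have "(\<Sum>s<m. rdet m (r(s := (\<lambda>j. \<Sum>l<m. b j l * r s l)))) =
      (\<Sum>s<m. \<Sum>j<m. \<Sum>l<m. b j l * (r s l * rcof m r s j))"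
    by (simp add: rdet_expand sum_distrib_right mult.assoc)
  also have "\<dots> = (\<Sum>j<m. \<Sum>s<m. \<Sum>l<m. b j l * (r s l * rcof m r s j))" by (rule sum.swap)
  also have "\<dots> = (\<Sum>j<m. \<Sum>l<m. b j l * (\<Sum>s<m. r s l * rcof m r s j))"
    by (subst sum.swap) (simp add: sum_distrib_left)
  also have "\<dots> = (\<Sum>j<m. b j j * rdet m r)"
    by (simp add: rdet_adjugate if_distrib[of "\<lambda>x. _ * x"] cong: if_cong)
  finally show ?thesis by (simp add: sum_distrib_right)
qed

lemma (in derivation) rdet:
  "D (rdet m r) = (\<Sum>s<m. rdet m (r(s := (\<lambda>j. D (r s j)))))"
proof -
  let ?P = "{p. p permutes {0..<m}}"
  have det: "rdet m r = (\<Sum>p\<in>?P. signof p * (\<Prod>i<m. r i (p i)))" for r :: "nat \<Rightarrow> nat \<Rightarrow> 'r"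
    unfolding rdet_def det_def'[OF mat_carrier]
    by (intro sum.cong refl arg_cong2[of _ _ _ _ "(*)"] prod.cong)
       (auto simp: atLeast0LessThan)
  have sgn: "D (signof p * x) = signof p * D x" for p x
    by (auto simp: sign_def uminus)
  have "D (rdet m r) = (\<Sum>p\<in>?P. signof p * (\<Sum>s<m. \<Prod>i<m. if i = s then D (r i (p i)) else r i (p i)))"
    by (simp add: det sum sgn prod)
  also have "\<dots> = (\<Sum>s<m. \<Sum>p\<in>?P. signof p * (\<Prod>i<m. if i = s then D (r i (p i)) else r i (p i)))"
    by (simp add: sum_distrib_left sum.swap[of _ ?P])
  also have "\<dots> = (\<Sum>s<m. rdet m (r(s := (\<lambda>j. D (r s j)))))"
    unfolding det by (intro sum.cong refl arg_cong2[of _ _ _ _ "(*)"] prod.cong) auto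
  finally show ?thesis .
qed

text \<open>The diagonal is a separate assumption because g j j = - g j j does not give 0 in the
  presence of 2-torsion.\<close>

lemma sum_antisymmetric:
  fixes g :: "nat \<Rightarrow> nat \<Rightarrow> 'a::ab_group_add"
  assumes "\<And>j l. g j l = - g l j" "\<And>j. g j j = 0"
  shows "(\<Sum>j<m. \<Sum>l<m. g j l) = 0"
proof (induction m)
  case (Suc m)
  have "(\<Sum>j<m. g j m) = - (\<Sum>l<m. g m l)"
    by (subst assms(1)) (simp add: sum_negf)
  then show ?case using Suc assms(2) by (simp add: sum.distrib)
qed simp

locale commuting_derivations =
  fixes D :: "nat \<Rightarrow> 'r::comm_ring_1 \<Rightarrow> 'r"
  assumes derivation: "derivation (D j)"
    and commute: "D i (D j x) = D j (D i x)"
begin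

sublocale D: derivation "D j" for j by (rule derivation)

definition jacobian :: "nat \<Rightarrow> 'r list \<Rightarrow> 'r" where
  "jacobian m us = rdet m (\<lambda>i j. D j (us ! i))"

lemma jacobian_update:
  "length us = m \<Longrightarrow> s < m \<Longrightarrow>
    jacobian m (us[s := x]) = rdet m ((\<lambda>i j. D j (us ! i))(s := (\<lambda>j. D j x)))"
  unfolding jacobian_def by (rule rdet_cong) (auto simp: nth_list_update)

lemma derivation_jacobian:
  assumes "length us = m" "s < m"
  shows "derivation (\<lambda>x. jacobian m (us[s := x]))"
  by unfold_locales
    (simp_all add: jacobian_update assms D.add D.leibniz rdet_add rdet_scale)

lemma jacobian_alternating:
  "length us = m \<Longrightarrow> i < m \<Longrightarrow> k < m \<Longrightarrow> i \<noteq> k \<Longrightarrow> us ! i = us ! k \<Longrightarrow> jacobian m us = 0"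
  unfolding jacobian_def by (rule rdet_alternating[of i m k]) auto

text \<open>The Piola identity. Differentiating the cofactors of row 0 produces second derivatives,
  symmetric in j and l because the derivations commute, times determinants that are antisymmetric in
  j and l.\<close>

lemma divergence_cofactors:
  assumes "0 < m"
  shows "(\<Sum>j<m. D j (rcof m (\<lambda>i l. D l (us ! i)) 0 j)) = 0"
proof -
  let ?r = "\<lambda>i l. D l (us ! i)"
  let ?e = "\<lambda>j l. if l = j then 1 else (0::'r)"
  define E where "E s j l = rdet m (?r(0 := ?e j, s := ?e l))" for s j l
  have "D j (rcof m ?r 0 j) = (\<Sum>s\<in>{1..<m}. \<Sum>l<m. D j (D l (us ! s)) * E s j l)" if j: "j < m" for j
  proof -
    let ?r' = "?r(0 := ?e j)"
    have z: "rdet m (?r'(0 := (\<lambda>l. D j (?r' 0 l)))) = 0"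
    proof -
      have "(\<lambda>l. D j (?r' 0 l)) = (\<lambda>l. 0)" by auto
      then show ?thesis by (simp only: rdet_expand[OF assms]) simp
    qed
    have s: "rdet m (?r'(s := (\<lambda>l. D j (?r' s l)))) = (\<Sum>l<m. D j (D l (us ! s)) * E s j l)"
      if "s \<in> {1..<m}" for s
    proof -
      have sm: "s < m" "s \<noteq> 0" using that by auto
      have "rdet m (?r'(s := (\<lambda>l. D j (?r' s l)))) = (\<Sum>l<m. D j (?r' s l) * rcof m ?r' s l)"
        by (rule rdet_expand[OF sm(1)])
      also have "\<dots> = (\<Sum>l<m. D j (D l (us ! s)) * E s j l)"
        by (rule sum.cong) (use sm in \<open>simp_all add: E_def rcof_rdet\<close>)
      finally show ?thesis .
    qed
    have "{..<m} = insert 0 {1..<m}" using assms by auto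
    then have "D j (rdet m ?r') =
        rdet m (?r'(0 := (\<lambda>l. D j (?r' 0 l)))) + (\<Sum>s\<in>{1..<m}. rdet m (?r'(s := (\<lambda>l. D j (?r' s l)))))"
      unfolding D.rdet by simp
    then have "D j (rdet m ?r') = (\<Sum>s\<in>{1..<m}. \<Sum>l<m. D j (D l (us ! s)) * E s j l)"
      using z s by simp
    then show ?thesis using j assms by (simp add: rcof_rdet)
  qed
  then have "(\<Sum>j<m. D j (rcof m ?r 0 j)) = (\<Sum>j<m. \<Sum>s\<in>{1..<m}. \<Sum>l<m. D j (D l (us ! s)) * E s j l)"
    by simp
  also have "\<dots> = (\<Sum>s\<in>{1..<m}. \<Sum>j<m. \<Sum>l<m. D j (D l (us ! s)) * E s j l)" by (rule sum.swap)
  also have "\<dots> = 0"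
  proof (rule sum.neutral, rule ballI, rule sum_antisymmetric)
    fix s j l assume s: "s \<in> {1..<m}"
    have "E s j l = - E s l j" unfolding E_def by (rule rdet_swap) (use s in auto)
    then show "D j (D l (us ! s)) * E s j l = - (D l (D j (us ! s)) * E s l j)"
      by (simp add: commute[of j l])
    have "E s j j = 0" unfolding E_def by (rule rdet_alternating[of 0 m s]) (use s in auto)
    then show "D j (D j (us ! s)) * E s j j = 0" by simp
  qed
  finally show ?thesis .
qed

text \<open>Bracketing with \<open>vs\<close> is the vector field \<delta> whose coefficients a are
  cofactors. Moving \<delta> past D j costs the matrix of the - D j (a l), whose total contribution
  to the determinant is its trace, minus the divergence of a; this is 0 by
  \<open>divergence_cofactors\<close>.\<close>

lemma jacobian_fundamental_identity:
  assumes us: "length us = m" and vs: "length vs = m - 1" and m: "0 < m"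
  shows "jacobian m (jacobian m us # vs) = (\<Sum>s<m. jacobian m (us[s := jacobian m (us ! s # vs)]))"
proof -
  define a where "a = rcof m (\<lambda>i j. D j ((0 # vs) ! i)) 0"
  define \<delta> where "\<delta> x = jacobian m (x # vs)" for x
  have \<delta>: "\<delta> x = (\<Sum>j<m. a j * D j x)" for x
  proof -
    have "\<delta> x = jacobian m ((0 # vs)[0 := x])" by (simp add: \<delta>_def)
    also have "\<dots> = (\<Sum>j<m. D j x * a j)"
      using m vs by (subst jacobian_update) (auto simp: rdet_expand a_def)
    finally show ?thesis by (simp add: mult.commute)
  qed
  have der: "derivation \<delta>"
    using derivation_jacobian[of "0 # vs" m 0] m vs by (simp add: \<delta>_def[abs_def])
  interpret \<delta>: derivation \<delta> by (rule der)
  have div: "(\<Sum>j<m. D j (a j)) = 0"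
    unfolding a_def by (rule divergence_cofactors[OF m])
  let ?r = "\<lambda>i j. D j (us ! i)"
  have comm: "\<delta> (D j x) = D j (\<delta> x) + (\<Sum>l<m. - D j (a l) * D l x)" for j x
  proof -
    have "D j (\<delta> x) = (\<Sum>l<m. a l * D l (D j x)) + (\<Sum>l<m. D l x * D j (a l))"
      by (simp add: \<delta> D.sum D.leibniz sum.distrib commute[of j])
    then show ?thesis by (simp add: \<delta> sum_negf mult.commute)
  qed
  have "\<delta> (jacobian m us) = (\<Sum>s<m. rdet m (?r(s := (\<lambda>j. \<delta> (D j (us ! s))))))"
    unfolding jacobian_def by (rule \<delta>.rdet)
  also have "\<dots> = (\<Sum>s<m. rdet m (?r(s := (\<lambda>j. D j (\<delta> (us ! s)))))) +
      (\<Sum>s<m. rdet m (?r(s := (\<lambda>j. \<Sum>l<m. - D j (a l) * ?r s l))))"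
    unfolding comm by (simp add: rdet_add sum.distrib)
  also have "(\<Sum>s<m. rdet m (?r(s := (\<lambda>j. \<Sum>l<m. - D j (a l) * ?r s l)))) =
      (\<Sum>j<m. - D j (a j)) * rdet m ?r"
    by (rule rdet_trace)
  also have "(\<Sum>j<m. - D j (a j)) = 0" using div by (simp add: sum_negf)
  also have "(\<Sum>s<m. rdet m (?r(s := (\<lambda>j. D j (\<delta> (us ! s)))))) = (\<Sum>s<m. jacobian m (us[s := \<delta> (us ! s)]))"
    by (intro sum.cong refl) (simp add: jacobian_update us)
  finally show ?thesis by (simp add: \<delta>_def)
qed

definition jac :: "nat \<Rightarrow> 'r \<Rightarrow> 'r list \<Rightarrow> 'r" where
  "jac n w us = jacobian (n + 1) (us @ [w])"

lemma derivation_jac: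
  assumes "length us = n" "s < n"
  shows "derivation (\<lambda>x. jac n w (us[s := x]))"
  using derivation_jacobian[of "us @ [w]" "n + 1" s] assms
  by (simp add: jac_def list_update_append)

lemma jac_alternating:
  "length us = n \<Longrightarrow> i < n \<Longrightarrow> k < n \<Longrightarrow> i \<noteq> k \<Longrightarrow> us ! i = us ! k \<Longrightarrow> jac n w us = 0"
  unfolding jac_def by (rule jacobian_alternating[of _ "n + 1" i k]) (auto simp: nth_append)

lemma jac_casimir: "length us = n \<Longrightarrow> i < n \<Longrightarrow> us ! i = w \<Longrightarrow> jac n w us = 0"
  unfolding jac_def by (rule jacobian_alternating[of _ "n + 1" i n]) (auto simp: nth_append)

lemma jac_constant:
  assumes "length us = n" "s < n" "\<And>j. D j c = 0"
  shows "jac n w (us[s := c]) = 0"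
proof -
  have "jac n w (us[s := c]) = jacobian (n + 1) ((us @ [w])[s := c])"
    using assms by (simp add: jac_def list_update_append)
  also have "\<dots> = 0"
    using assms by (subst jacobian_update) (simp_all add: rdet_expand)
  finally show ?thesis .
qed

text \<open>The identity for n + 1 arguments with w appended to both lists. In the additional
  summand the last entry is the bracket of w with w as a further row, which is 0.\<close>

lemma jac_fundamental_identity:
  assumes us: "length us = n" and vs: "length vs = n - 1" and n: "0 < n"
  shows "jac n w (jac n w us # vs) = (\<Sum>s<n. jac n w (us[s := jac n w (us ! s # vs)]))"
proof -
  have "jac n w (jac n w us # vs) =
      (\<Sum>s<n+1. jacobian (n+1) ((us @ [w])[s := jacobian (n+1) ((us @ [w]) ! s # vs @ [w])]))"
    unfolding jac_def append_Cons by (rule jacobian_fundamental_identity) (use us vs n in auto)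
  also have "\<dots> = (\<Sum>s<n. jacobian (n+1) ((us @ [w])[s := jacobian (n+1) ((us @ [w]) ! s # vs @ [w])])) +
      jacobian (n+1) ((us @ [w])[n := jac n w (w # vs)])"
    using us by (simp add: jac_def nth_append)
  also have "jac n w (w # vs) = 0" by (rule jac_casimir[of _ n 0]) (use vs n in auto)
  also have "jacobian (n+1) ((us @ [w])[n := 0]) = 0"
    using derivation.zero[OF derivation_jacobian[of "us @ [w]" "n+1" n]] us by simp
  also have "(\<Sum>s<n. jacobian (n+1) ((us @ [w])[s := jacobian (n+1) ((us @ [w]) ! s # vs @ [w])])) =
      (\<Sum>s<n. jac n w (us[s := jac n w (us ! s # vs)]))"
    using us by (intro sum.cong refl) (simp add: jac_def nth_append list_update_append)
  finally show ?thesis by simp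
qed

lemma jac_in:
  assumes "\<And>a b. a \<in> C \<Longrightarrow> b \<in> C \<Longrightarrow> a + b \<in> C" "\<And>a b. a \<in> C \<Longrightarrow> b \<in> C \<Longrightarrow> a * b \<in> C"
    "\<And>a. a \<in> C \<Longrightarrow> - a \<in> C" "0 \<in> C" "1 \<in> C" "\<And>j a. j \<le> n \<Longrightarrow> a \<in> C \<Longrightarrow> D j a \<in> C"
    "set us \<subseteq> C" "w \<in> C" "length us = n"
  shows "jac n w us \<in> C"
proof -
  have s: "sum f A \<in> C" if "\<And>a. a \<in> A \<Longrightarrow> f a \<in> C" for f :: "'x \<Rightarrow> 'r" and A
    using that by (induction A rule: infinite_finite_induct) (auto intro: assms)
  have p: "prod f A \<in> C" if "\<And>a. a \<in> A \<Longrightarrow> f a \<in> C" for f :: "'x \<Rightarrow> 'r" and A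
    using that by (induction A rule: infinite_finite_induct) (auto intro: assms)
  have sg: "signof q \<in> C" for q :: "nat \<Rightarrow> nat" by (auto simp: sign_def intro: assms)
  have "(us @ [w]) ! i \<in> C" if "i < n + 1" for i
    using that assms(7-9) by (cases "i < n") (auto simp: nth_append subset_iff)
  then have e: "D j ((us @ [w]) ! i) \<in> C" if "i < n + 1" "j < n + 1" for i j
    using that assms(6) by simp
  show ?thesis
    unfolding jac_def jacobian_def rdet_def det_def'[OF mat_carrier]
    by (intro s assms(2) sg p) (use e in \<open>auto\<close>)
qed

end


section \<open>Multiderivations\<close>

locale multiderivation =
  fixes n :: nat and B :: "'r::comm_ring_1 list \<Rightarrow> 'r"
  assumes deriv: "length us = n \<Longrightarrow> s < n \<Longrightarrow> derivation (\<lambda>x. B (us[s := x]))"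
    and alternating: "length us = n \<Longrightarrow> i < n \<Longrightarrow> k < n \<Longrightarrow> i \<noteq> k \<Longrightarrow> us ! i = us ! k \<Longrightarrow> B us = 0"
begin

text \<open>Each entry in \<open>q\<^sup>-\<^sup>rR\<close> contributes a pole of order \<open>r\<close>, and one more order arises from
  differentiating \<open>q\<close> itself, but only once since the bracket is alternating.\<close>

lemma denominators:
  assumes R: "\<And>a b. a \<in> R \<Longrightarrow> b \<in> R \<Longrightarrow> a + b \<in> R" "\<And>a b. a \<in> R \<Longrightarrow> b \<in> R \<Longrightarrow> a * b \<in> R"
    "\<And>a. a \<in> R \<Longrightarrow> - a \<in> R" "0 \<in> R" "1 \<in> R"
    and B: "\<And>us. set us \<subseteq> R \<Longrightarrow> length us = n \<Longrightarrow> B us \<in> R"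
    and q: "q \<in> R" and xs: "length xs = n" "\<And>x. x \<in> set xs \<Longrightarrow> q ^ r * x \<in> R"
  shows "q ^ (n * r + 1) * B xs \<in> R"
proof -
  have pw: "q ^ k \<in> R" for k by (induction k) (auto intro: R q)
  have nat: "of_nat k \<in> R" for k by (induction k) (auto intro: R)
  \<comment> \<open>Induction on the number k of leading entries that may have poles. The second
    clause records the gain of one order when q is itself a later entry: the term that
    differentiates q then has two equal arguments and disappears.\<close>
  have "(\<forall>xs. length xs = n \<longrightarrow> (\<forall>i<k. q ^ r * xs ! i \<in> R) \<longrightarrow> (\<forall>i. k \<le> i \<and> i < n \<longrightarrow> xs ! i \<in> R) \<longrightarrow>
      q ^ (k * r + 1) * B xs \<in> R \<and> ((\<exists>l. k \<le> l \<and> l < n \<and> xs ! l = q) \<longrightarrow> q ^ (k * r) * B xs \<in> R))"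
    if "k \<le> n" for k
    using that
  proof (induction k)
    case 0
    have "B xs \<in> R" if "length xs = n" "\<forall>i. i < n \<longrightarrow> xs ! i \<in> R" for xs
      by (rule B) (use that in \<open>auto simp: in_set_conv_nth\<close>)
    then show ?case using R(2)[OF pw[of 1]] by auto
  next
    case (Suc k)
    show ?case
    proof (intro allI impI)
      fix xs assume len: "length xs = n" and lo: "\<forall>i<Suc k. q ^ r * xs ! i \<in> R"
        and hi: "\<forall>i. Suc k \<le> i \<and> i < n \<longrightarrow> xs ! i \<in> R"
      have k: "k < n" "k \<le> n" using Suc.prems by auto
      let ?x = "xs ! k" and ?B = "\<lambda>y. B (xs[k := y])"
      interpret d: derivation ?B by (rule deriv[OF len k(1)])
      have IH1: "q ^ (k * r + 1) * ?B y \<in> R" if "y \<in> R" for y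
        using Suc.IH[OF k(2), rule_format, of "xs[k := y]"] len lo hi that k
        by (auto simp: nth_list_update)
      have IH2: "q ^ (k * r) * ?B y \<in> R"
        if "y \<in> R" "y = q \<or> (\<exists>l. Suc k \<le> l \<and> l < n \<and> xs ! l = q)" for y
      proof -
        have "\<exists>l. k \<le> l \<and> l < n \<and> xs[k := y] ! l = q"
          using that(2) k len by (metis Suc_leD Suc_n_not_le_n le_refl nth_list_update_eq nth_list_update_neq)
        then show ?thesis
          using Suc.IH[OF k(2), rule_format, of "xs[k := y]"] len lo hi that(1) k
          by (auto simp: nth_list_update)
      qed
      have xs: "?B ?x = B xs" by simp
      have u: "q ^ r * ?x \<in> R" using lo by simp
      have pwr: "q * ?B (q ^ r) = of_nat r * q ^ r * ?B q"
      proof (cases r)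
        case (Suc r') then show ?thesis by (simp only: d.power) (simp add: mult_ac)
      qed simp
      \<comment> \<open>The product q^r x is regular, and the Leibniz rule expresses the unknown
        bracket through the bracket with it and the bracket with q^r.\<close>
      have main: "q ^ r * B xs = ?B (q ^ r * ?x) - ?x * ?B (q ^ r)"
        by (simp add: d.leibniz xs)
      have "q ^ (Suc k * r + 1) * B xs = q ^ (k * r + 1) * (q ^ r * B xs)"
        by (simp add: power_add mult_ac)
      also have "\<dots> = q ^ (k * r + 1) * ?B (q ^ r * ?x) - q ^ (k * r) * ?x * (q * ?B (q ^ r))"
        unfolding main by (simp add: algebra_simps)
      also have "\<dots> = q ^ (k * r + 1) * ?B (q ^ r * ?x) + - (of_nat r * (q ^ r * ?x) * (q ^ (k * r) * ?B q))"
        unfolding pwr by (simp add: algebra_simps)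
      also have "\<dots> \<in> R"
        by (rule R(1)[OF IH1[OF u] R(3)[OF R(2)[OF R(2)[OF nat u] IH2[OF q]]]]) simp
      finally have 1: "q ^ (Suc k * r + 1) * B xs \<in> R" .
      have 2: "q ^ (Suc k * r) * B xs \<in> R" if l: "\<exists>l. Suc k \<le> l \<and> l < n \<and> xs ! l = q"
      proof -
        obtain l where l': "Suc k \<le> l" "l < n" "xs ! l = q" using l by blast
        have "?B q = 0"
          by (rule alternating[of _ k l]) (use l' k len in auto)
        then have Br: "?B (q ^ r) = 0"
        proof (cases r)
          case (Suc r') then show ?thesis using \<open>?B q = 0\<close> by (simp only: d.power) simp
        qed simp
        have "q ^ (Suc k * r) * B xs = q ^ (k * r) * (q ^ r * B xs)"
          by (simp add: power_add mult_ac)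
        also have "\<dots> = q ^ (k * r) * ?B (q ^ r * ?x)" unfolding main Br by simp
        also have "\<dots> \<in> R" by (rule IH2[OF u]) (use l in blast)
        finally show ?thesis .
      qed
      show "q ^ (Suc k * r + 1) * B xs \<in> R \<and>
          ((\<exists>l. Suc k \<le> l \<and> l < n \<and> xs ! l = q) \<longrightarrow> q ^ (Suc k * r) * B xs \<in> R)"
        using 1 2 by blast
    qed
  qed
  note all = this[OF le_refl, THEN spec, of xs]
  have 1: "\<forall>i<n. q ^ r * xs ! i \<in> R" using xs by (simp add: nth_mem)
  have 2: "\<forall>i. n \<le> i \<and> i < n \<longrightarrow> xs ! i \<in> R" by auto
  from mp[OF mp[OF mp[OF all xs(1)] 1] 2] show ?thesis by (rule conjunct1)
qed

text \<open>The entries are exchanged one at a time, and the differences telescope along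
  \<open>take k ys @ drop k xs\<close>. This is how the bracket descends to residue classes.\<close>

lemma congruence:
  assumes I: "\<And>a b. a \<in> I \<Longrightarrow> b \<in> I \<Longrightarrow> a + b \<in> I" "0 \<in> I"
    and BI: "\<And>us k z. set us \<subseteq> W \<Longrightarrow> length us = n \<Longrightarrow> k < n \<Longrightarrow> z \<in> I \<Longrightarrow> B (us[k := z]) \<in> I"
    and xs: "length xs = n" "set xs \<subseteq> W" and ys: "length ys = n" "set ys \<subseteq> W"
    and xy: "\<And>i. i < n \<Longrightarrow> xs ! i - ys ! i \<in> I"
  shows "B xs - B ys \<in> I"
proof -
  have "B xs - B (take k ys @ drop k xs) \<in> I" if "k \<le> n" for k
    using that
  proof (induction k)
    case (Suc k)
    then have k: "k < n" by simp
    let ?us = "take k ys @ drop k xs"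
    have len: "length ?us = n" using xs ys k by simp
    interpret d: derivation "\<lambda>x. B (?us[k := x])" by (rule deriv[OF len k])
    have 1: "?us = ?us[k := xs ! k]"
    proof -
      have "?us ! k = xs ! k" using k xs ys by (simp add: nth_append)
      then show ?thesis by (metis list_update_id)
    qed
    have 2: "take (Suc k) ys @ drop (Suc k) xs = ?us[k := ys ! k]"
      by (rule nth_equalityI) (use k xs ys in \<open>auto simp: nth_append nth_list_update min_def less_Suc_eq not_less_eq\<close>)
    have "B ?us - B (take (Suc k) ys @ drop (Suc k) xs) = B (?us[k := xs ! k - ys ! k])"
      unfolding 2 by (subst 1) (simp only: d.diff)
    also have "\<dots> \<in> I"
    proof (rule BI)
      show "set ?us \<subseteq> W" using xs ys set_take_subset[of k ys] set_drop_subset[of k xs] by auto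
    qed (use len k xy in auto)
    finally have "(B xs - B ?us) + (B ?us - B (take (Suc k) ys @ drop (Suc k) xs)) \<in> I"
      using Suc by (intro I) auto
    then show ?case by simp
  qed (simp add: I)
  from this[of n] show ?thesis using xs ys by simp
qed

end

lemma (in commuting_derivations) multiderivation_jac: "multiderivation n (jac n w)"
  by (rule multiderivation.intro) (rule derivation_jac, assumption+, rule jac_alternating)


section \<open>Derivations of a fraction field\<close>

text \<open>The quotient rule in the form (Da - x Db)/b for x = a/b. Its independence of the
  representing pair is shown in \<open>fract_deriv_quotient\<close>, which makes the choice
  harmless.\<close>

definition fract_deriv :: "('a::idom \<Rightarrow> 'a) \<Rightarrow> 'a fract \<Rightarrow> 'a fract" where
  "fract_deriv D x = (SOME y. \<exists>a b. b \<noteq> 0 \<and> x = to_fract a / to_fract b \<and>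
     y = (to_fract (D a) - x * to_fract (D b)) / to_fract b)"

lemma fract_cases_to_fract:
  obtains a b where "b \<noteq> 0" "x = to_fract a / to_fract b"
  by (cases x) (auto simp: Fract_conv_to_fract)

lemma to_fract_hom: "comm_ring_hom to_fract"
  by unfold_locales simp_all

interpretation to_fract: comm_ring_hom to_fract by (rule to_fract_hom)

lemma fract_deriv_quotient:
  assumes "derivation D" "b \<noteq> 0"
  shows "fract_deriv D (to_fract a / to_fract b) =
    (to_fract (D a) - to_fract a / to_fract b * to_fract (D b)) / to_fract b"
proof -
  interpret derivation D by fact
  have *: "(to_fract (D a') - x * to_fract (D b')) / to_fract b' = (to_fract (D a) - x * to_fract (D b)) / to_fract b"
    if "b' \<noteq> 0" "x = to_fract a' / to_fract b'" "x = to_fract a / to_fract b" for a' b' x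
  proof -
    have nz: "to_fract b \<noteq> 0" "to_fract b' \<noteq> 0"
      using that(1) assms(2) by (simp_all add: to_fract_eq_0_iff)
    have xa: "to_fract a = x * to_fract b"
      by (subst that(3)) (use assms(2) in simp)
    have xa': "to_fract a' = x * to_fract b'"
      by (subst that(2)) (use that(1) in simp)
    have "to_fract (a * b') = to_fract (a' * b)" unfolding to_fract_mult xa xa' by (simp only: mult_ac)
    then have "a * b' = a' * b" by (simp only: to_fract_eq_iff)
    then have "D (a * b') = D (a' * b)" by simp
    then have "a * D b' + b' * D a = a' * D b + b * D a'" by (simp only: leibniz)
    then have "to_fract (a * D b' + b' * D a) = to_fract (a' * D b + b * D a')" by simp
    then have "to_fract b' * (to_fract (D a) - x * to_fract (D b)) = to_fract b * (to_fract (D a') - x * to_fract (D b'))"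
      unfolding to_fract_add to_fract_mult xa xa' by (simp add: algebra_simps)
    then show ?thesis using nz by (simp add: frac_eq_eq mult.commute)
  qed
  show ?thesis
    unfolding fract_deriv_def
    by (rule some_equality) (use assms(2) * in blast)+
qed

lemma fract_deriv_to_fract [simp]: "derivation D \<Longrightarrow> fract_deriv D (to_fract a) = to_fract (D a)"
  using fract_deriv_quotient[of D 1 a] by (simp add: derivation.one)

lemma mult_fract_deriv:
  assumes "derivation D" "b \<noteq> 0" "to_fract a = x * to_fract b"
  shows "to_fract b * fract_deriv D x = to_fract (D a) - x * to_fract (D b)"
proof -
  have b: "to_fract b \<noteq> 0" using assms(2) by simp
  have x: "x = to_fract a / to_fract b"
    unfolding assms(3) by (rule nonzero_mult_div_cancel_right[OF b, symmetric])
  show ?thesis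
    by (subst (1 2) x, subst fract_deriv_quotient[OF assms(1,2)]) (use assms(2) in simp)
qed

lemma derivation_fract_deriv:
  fixes D :: "'a::idom \<Rightarrow> 'a"
  assumes "derivation D"
  shows "derivation (fract_deriv D)"
proof
  interpret derivation D by fact
  fix x y :: "'a fract"
  obtain a b where b: "b \<noteq> 0" and x0: "x = to_fract a / to_fract b" by (rule fract_cases_to_fract)
  obtain c d where d: "d \<noteq> 0" and y0: "y = to_fract c / to_fract d" by (rule fract_cases_to_fract)
  have x: "to_fract a = x * to_fract b" unfolding x0 using b by simp
  have y: "to_fract c = y * to_fract d" unfolding y0 using d by simp
  have bd: "b * d \<noteq> 0" using b d by simp
  define u v where "u = fract_deriv D x" and "v = fract_deriv D y"
  define a' b' c' d' where "a' = to_fract (D a)" and "b' = to_fract (D b)"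
    and "c' = to_fract (D c)" and "d' = to_fract (D d)"
  define B E where "B = to_fract b" and "E = to_fract d"
  have u: "a' = B * u + x * b'" using mult_fract_deriv[OF assms b x] by (simp add: u_def a'_def b'_def B_def)
  have v: "c' = E * v + y * d'" using mult_fract_deriv[OF assms d y] by (simp add: v_def c'_def d'_def E_def)
  have BE: "B * E \<noteq> 0" using bd by (simp add: B_def E_def)
  have "to_fract (a * d + c * b) = (x + y) * to_fract (b * d)"
    unfolding to_fract_add to_fract_mult x y by (simp only: algebra_simps)
  from mult_fract_deriv[OF assms bd this]
  have "B * E * fract_deriv D (x + y) =
      (x * B * d' + E * a') + (y * E * b' + B * c') - (x + y) * (B * d' + E * b')"
    by (simp only: add leibniz to_fract_add to_fract_mult x y a'_def b'_def c'_def d'_def B_def E_def)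
  also have "\<dots> = B * E * (u + v)" unfolding u v by (simp add: algebra_simps)
  finally show "fract_deriv D (x + y) = fract_deriv D x + fract_deriv D y"
    using BE by (simp add: u_def v_def)
  have "to_fract (a * c) = (x * y) * to_fract (b * d)"
    unfolding to_fract_mult x y by (simp only: mult_ac)
  from mult_fract_deriv[OF assms bd this]
  have "B * E * fract_deriv D (x * y) = (x * B * c' + y * E * a') - (x * y) * (B * d' + E * b')"
    by (simp only: leibniz to_fract_add to_fract_mult x y a'_def b'_def c'_def d'_def B_def E_def)
  also have "\<dots> = B * E * (x * v + y * u)" unfolding u v by (simp add: algebra_simps)
  finally show "fract_deriv D (x * y) = x * fract_deriv D y + y * fract_deriv D x"
    using BE by (simp add: u_def v_def)
qed

text \<open>The commutator of two derivations is again a derivation. It vanishes on the images of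
  ring elements, hence on all their quotients.\<close>

lemma fract_deriv_commute:
  fixes D E :: "'a::idom \<Rightarrow> 'a"
  assumes D: "derivation D" and E: "derivation E" and c: "\<And>a. D (E a) = E (D a)"
  shows "fract_deriv D (fract_deriv E x) = fract_deriv E (fract_deriv D x)"
proof -
  interpret D: derivation "fract_deriv D" by (rule derivation_fract_deriv[OF D])
  interpret E: derivation "fract_deriv E" by (rule derivation_fract_deriv[OF E])
  define C where "C x = fract_deriv D (fract_deriv E x) - fract_deriv E (fract_deriv D x)" for x
  have C: "C (x * y) = x * C y + y * C x" for x y
    by (simp add: C_def D.leibniz E.leibniz D.add E.add algebra_simps)
  have C0: "C (to_fract a) = 0" for a using c by (simp add: C_def D E)
  obtain a b where b: "b \<noteq> 0" and x: "x = to_fract a / to_fract b" by (rule fract_cases_to_fract)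
  have "C (to_fract b * x) = 0" using b C0 by (simp add: x to_fract_eq_0_iff)
  then have "to_fract b * C x = 0" by (simp add: C C0)
  then show ?thesis using b by (simp add: C_def to_fract_eq_0_iff)
qed

lemma commuting_derivations_mpderiv: "commuting_derivations mpderiv"
  by (rule commuting_derivations.intro) (rule derivation_mpderiv, rule mpderiv_commute)

lemma commuting_derivations_fract_deriv:
  "commuting_derivations (\<lambda>j. fract_deriv (mpderiv j :: 'k::field mpoly \<Rightarrow> 'k mpoly))"
proof (rule commuting_derivations.intro)
  fix i j x
  show "derivation (fract_deriv (mpderiv j :: 'k mpoly \<Rightarrow> 'k mpoly))"
    by (rule derivation_fract_deriv[OF derivation_mpderiv])
  show "fract_deriv (mpderiv i) (fract_deriv (mpderiv j) x) =
      fract_deriv (mpderiv j) (fract_deriv (mpderiv i :: 'k mpoly \<Rightarrow> 'k mpoly) x)"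
    by (rule fract_deriv_commute[OF derivation_mpderiv derivation_mpderiv]) (rule mpderiv_commute)
qed

interpretation mp: commuting_derivations mpderiv
  by (rule commuting_derivations_mpderiv)

interpretation fr: commuting_derivations "\<lambda>j. fract_deriv (mpderiv j)"
  by (rule commuting_derivations_fract_deriv)

section \<open>Good directions, primality of the fibre equation, and the degree bound\<close>

section \<open>Points and directions\<close>

lemma coeff_mult_top:
  assumes "Polynomial.degree p \<le> a" "Polynomial.degree q \<le> b"
  shows "Polynomial.coeff (p * q) (a + b) = Polynomial.coeff p a * Polynomial.coeff q b"
proof -
  have "Polynomial.coeff (p * q) (a + b) = (\<Sum>i\<le>a + b. Polynomial.coeff p i * Polynomial.coeff q (a + b - i))"
    by (rule coeff_mult)
  also have "\<dots> = (\<Sum>i\<in>{a}. Polynomial.coeff p i * Polynomial.coeff q (a + b - i))"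
  proof (rule sum.mono_neutral_right)
    show "\<forall>i\<in>{..a + b} - {a}. Polynomial.coeff p i * Polynomial.coeff q (a + b - i) = 0"
    proof
      fix i assume "i \<in> {..a + b} - {a}"
      then consider "i > a" | "a + b - i > b" by fastforce
      then show "Polynomial.coeff p i * Polynomial.coeff q (a + b - i) = 0"
        by cases (use assms in \<open>simp_all add: coeff_eq_0\<close>)
    qed
  qed auto
  finally show ?thesis by simp
qed

lemma eval_hom: "comm_ring_hom (mpeval (\<lambda>c. c) x)"
  by (rule mpeval_hom[OF comm_ring_hom_id])

text \<open>Restricting a form of degree k to lines in the given direction, the coefficient of X^k
  is the value of the form at the direction vector, whose i-th coordinate is 1.\<close>

lemma psi_hcomp_top:
  "pdeg i e (hcomp k p) \<le> k \<and>
    Polynomial.coeff (psi i e (hcomp k p)) k = mpoly_const (mpeval (\<lambda>c. c) (e(i := 1)) (hcomp k p))"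
proof -
  define x where "x = e(i := 1)"
  have xi: "x i = 1" and xl: "l \<noteq> i \<Longrightarrow> x l = e l" for l by (simp_all add: x_def)
  interpret ev: comm_ring_hom "mpeval (\<lambda>c. c) x" by (rule eval_hom)
  show ?thesis
    unfolding x_def[symmetric]
  proof (induction p arbitrary: k rule: mpoly_induct)
    case (const c) show ?case
      by (cases k) (simp_all add: mpeval_const[OF comm_ring_hom_id] mpeval_0[OF comm_ring_hom_id])
  next
    case (var l)
    have "k = 0 \<or> k = 1 \<or> (\<exists>k'. k = Suc (Suc k'))" by presburger
    then show ?case
      by (auto simp: coeff_pCons psi_var xi xl mpeval_var[OF comm_ring_hom_id] mpeval_0[OF comm_ring_hom_id] split: nat.splits)
  next
    case (add p q)
    then show ?case
      by (simp add: theta.hom_add psi.hom_add ev.hom_add mpoly_const_add degree_add_le)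
  next
    case (mult p q)
    have 1: "pdeg i e (hcomp j p * hcomp (k - j) q) \<le> k \<and>
        Polynomial.coeff (psi i e (hcomp j p * hcomp (k - j) q)) k =
        mpoly_const (mpeval (\<lambda>c. c) x (hcomp j p * hcomp (k - j) q))" if "j \<le> k" for j
    proof -
      have d: "pdeg i e (hcomp j p) \<le> j" "pdeg i e (hcomp (k - j) q) \<le> k - j" using mult by auto
      have "pdeg i e (hcomp j p * hcomp (k - j) q) \<le> pdeg i e (hcomp j p) + pdeg i e (hcomp (k - j) q)"
        unfolding psi.hom_mult by (rule degree_mult_le)
      moreover have "Polynomial.coeff (psi i e (hcomp j p * hcomp (k - j) q)) k =
          Polynomial.coeff (psi i e (hcomp j p)) j * Polynomial.coeff (psi i e (hcomp (k - j) q)) (k - j)"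
        using coeff_mult_top[OF d] that by (simp add: psi.hom_mult)
      moreover have "pdeg i e (hcomp j p) + pdeg i e (hcomp (k - j) q) \<le> k" using d that by linarith
      ultimately show ?thesis using mult by (simp add: ev.hom_mult mpoly_const_mult)
    qed
    have eq: "hcomp k (p * q) = (\<Sum>j\<le>k. hcomp j p * hcomp (k - j) q)"
      by (simp add: theta.hom_mult coeff_mult)
    show ?case
      unfolding eq psi.hom_sum ev.hom_sum mpoly_const.hom_sum coeff_sum
      using 1 by (auto intro!: degree_sum_le sum.cong)
  qed
qed

lemma psi_homog_top:
  assumes "homog k p"
  shows "pdeg i e p \<le> k"
    and "Polynomial.coeff (psi i e p) k = mpoly_const (mpeval (\<lambda>c. c) (e(i := 1)) p)"
  using psi_hcomp_top[of i e p k] homog_hcomp_eq[OF assms, of k] by simp_all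

text \<open>Subtracting the constant \<xi> leaves the top coefficient along the direction unchanged
  since d > 0, and that coefficient is the value of \<Omega> at the direction vector.\<close>

lemma monic_along_homog:
  assumes "homog d \<Omega>" "d > 0" "mpeval (\<lambda>c. c) (e(i := 1)) \<Omega> \<noteq> 0"
  shows "monic_along i e (\<Omega> - mpoly_const \<xi>)" "pdeg i e (\<Omega> - mpoly_const \<xi>) = d"
proof -
  let ?F = "\<Omega> - mpoly_const \<xi>"
  have c: "Polynomial.coeff (psi i e ?F) d = mpoly_const (mpeval (\<lambda>c. c) (e(i := 1)) \<Omega>)"
    using psi_homog_top(2)[OF assms(1), of i e] assms(2)
    by (simp add: psi.hom_minus coeff_pCons split: nat.split)
  have "pdeg i e ?F \<le> d"
    using psi_homog_top(1)[OF assms(1), of i e] unfolding psi.hom_minus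
    by (intro degree_diff_le) auto
  moreover have "d \<le> pdeg i e ?F" using c assms(3) by (intro le_degree) simp
  ultimately show deg: "pdeg i e ?F = d" by simp
  show "monic_along i e ?F" unfolding monic_along_def deg c using assms(3) by blast
qed

lemma eval_scale:
  assumes "homog k p"
  shows "mpeval (\<lambda>c. c) (\<lambda>l. s * x l) p = s ^ k * mpeval (\<lambda>c. c) x p"
proof -
  let ?ev = "mpeval (\<lambda>c::'a. c) x"
  interpret ev: comm_ring_hom ?ev by (rule eval_hom)
  have "(\<lambda>p. poly (map_poly ?ev (theta p)) s) = mpeval (\<lambda>c. c) (\<lambda>l. s * x l)"
    by (rule comm_ring_hom_eq[OF comm_ring_hom_comp[OF comm_ring_hom_comp[OF theta_hom
          comm_ring_hom_map_poly[OF eval_hom]] comm_ring_hom_poly] eval_hom])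
      (simp_all add: map_poly_pCons_hom[OF eval_hom] mpeval_const[OF comm_ring_hom_id] mpeval_var[OF comm_ring_hom_id])
  from fun_cong[OF this, of p] show ?thesis
    using assms by (simp add: homog_def map_poly_monom poly_monom mult.commute)
qed

lemma infinite_nonroots:
  fixes P :: "'k::field_char_0 poly"
  assumes "P \<noteq> 0"
  obtains a where "poly P a \<noteq> 0" "a \<noteq> 0"
proof -
  have "finite (insert 0 {a. poly P a = 0})" using poly_roots_finite[OF assms] by simp
  then obtain a where "a \<notin> insert 0 {a. poly P a = 0}"
    using ex_new_if_finite[OF infinite_UNIV_char_0] by blast
  then show ?thesis using that by auto
qed

lemma nonvanishing_point:
  fixes p :: "'k::field_char_0 mpoly"
  assumes "p \<noteq> 0"
  obtains x where "mpeval (\<lambda>c. c) x p \<noteq> 0"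
proof -
  have "\<exists>x. mpeval (\<lambda>c. c) x p \<noteq> 0" if "finite V" "p \<in> polys_in V" "p \<noteq> 0" for V and p :: "'k mpoly"
    using that
  proof (induction V arbitrary: p rule: finite_induct)
    case empty
    then obtain c where "p = mpoly_const c" using polys_in_empty by blast
    then show ?case using empty by (simp add: mpeval_const[OF comm_ring_hom_id])
  next
    case (insert i V)
    let ?P = "psi i (\<lambda>_. 0) p"
    have "Polynomial.lead_coeff ?P \<in> polys_in V"
      using coeff_psi_in[OF insert.prems(1)] insert.hyps(2) by (metis Diff_insert_absorb)
    moreover have "Polynomial.lead_coeff ?P \<noteq> 0" using insert.prems by simp
    ultimately obtain x where x: "mpeval (\<lambda>c. c) x (Polynomial.lead_coeff ?P) \<noteq> 0"
      using insert.IH by blast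
    interpret ev: comm_ring_hom "mpeval (\<lambda>c::'k. c) x" by (rule eval_hom)
    have "Polynomial.coeff (map_poly (mpeval (\<lambda>c. c) x) ?P) (Polynomial.degree ?P) \<noteq> 0"
      using x by (simp add: coeff_map_poly)
    then have "map_poly (mpeval (\<lambda>c. c) x) ?P \<noteq> 0" by (metis coeff_0)
    then obtain a where a: "poly (map_poly (mpeval (\<lambda>c. c) x) ?P) a \<noteq> 0"
      using infinite_nonroots by blast
    have "(\<lambda>p. poly (map_poly (mpeval (\<lambda>c. c) x) (psi i (\<lambda>_. 0) p)) a) = mpeval (\<lambda>c::'k. c) (x(i := a))"
      by (rule comm_ring_hom_eq[OF comm_ring_hom_comp[OF comm_ring_hom_comp[OF psi_hom
            comm_ring_hom_map_poly[OF eval_hom]] comm_ring_hom_poly] eval_hom])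
        (simp_all add: psi_var map_poly_pCons_hom[OF eval_hom] mpeval_const[OF comm_ring_hom_id] mpeval_var[OF comm_ring_hom_id])
    from fun_cong[OF this, of p] a show ?case by metis
  qed
  then show ?thesis using that finite_support_mpoly[of p] assms by blast
qed

lemma dirderiv_eq:
  assumes "p \<in> polys_in {..n}"
  shows "dirderiv n e p = mpderiv n p + (\<Sum>l<n. mpoly_const (e l) * mpderiv l p)"
proof -
  have der: "dirderiv n e (a + b) = dirderiv n e a + dirderiv n e b"
    "dirderiv n e (a * b) = a * dirderiv n e b + b * dirderiv n e a" for a b
    by (simp_all add: dirderiv_def psi.hom_add psi.hom_mult pderiv_add pderiv_mult chi.hom_add chi.hom_mult)
  show ?thesis
    using assms
  proof (induction rule: polys_in_induct)
    case (const c) show ?case by (simp add: dirderiv_def pderiv_pCons)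
  next
    case (var l)
    show ?case
    proof (cases "l = n")
      case True
      then show ?thesis by (simp add: dirderiv_def psi_var pderiv_pCons mpderiv_var chi_def map_poly_pCons_hom[OF tau_hom])
    next
      case False
      then have "l < n" using var by simp
      have "(\<Sum>j<n. mpoly_const (e j) * mpderiv j (mpvar l)) = (\<Sum>j<n. if j = l then mpoly_const (e j) else 0)"
        by (rule sum.cong) (auto simp: mpderiv_var)
      also have "\<dots> = mpoly_const (e l)" using \<open>l < n\<close> by simp
      finally show ?thesis using False by (simp add: dirderiv_def psi_var pderiv_pCons mpderiv_var)
    qed
  next
    case (add p q) then show ?case
      by (simp add: der mpderiv_add sum.distrib distrib_left)
  next
    case (mult p q) then show ?case
      by (simp add: der mpderiv_mult sum.distrib distrib_left sum_distrib_left mult.left_commute)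
  qed
qed


section \<open>Potentials with an isolated singularity\<close>

lemma mpvar_neq_0 [simp]: "(mpvar i :: 'k::field mpoly) \<noteq> 0"
  unfolding mpvar_def by (metis keys_single keys_zero one_neq_zero singleton_insert_inj_eq' insert_not_empty)

text \<open>\<open>pow\<close> is the form in which the isolated singularity is used: one exponent N
  for all variables, with cofactors from the whole ring. The bound on n provides three variables for
  the irreducibility of \<Omega> and two variables besides t_n for the regular sequence.\<close>

locale potential =
  fixes n :: nat and \<Omega> :: "'k::field_char_0 mpoly" and d N :: nat
  assumes n2: "2 \<le> n" and \<Omega>_in: "\<Omega> \<in> polys_in {..n}" and \<Omega>_homog: "homog d \<Omega>" and d: "n + 3 \<le> d"
    and pow: "\<And>j. j \<le> n \<Longrightarrow> \<exists>c. mpvar j ^ N = (\<Sum>i\<le>n. c i * mpderiv i \<Omega>)"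
begin

lemma \<Omega>_neq_0: "\<Omega> \<noteq> 0"
proof
  assume "\<Omega> = 0"
  then have "(mpvar 0 ^ N :: 'k mpoly) = 0" using pow[of 0] by auto
  then show False using mpvar_neq_0 by simp
qed

lemma homog_deriv: "homog (d - 1) (mpderiv i \<Omega>)"
  using homog_mpderiv[of "d - 1"] \<Omega>_homog d by simp

text \<open>Taking components of degree N fixes the degree of the cofactors at N - (d - 1), the
  number on which both the degree count and the pole count rest.\<close>

lemma pow_homog:
  assumes "j \<le> n"
  obtains c where "\<And>i. homog (N - (d - 1)) (c i)" "mpvar j ^ N = (\<Sum>i\<le>n. c i * mpderiv i \<Omega>)" "d - 1 \<le> N"
proof -
  obtain c where c: "mpvar j ^ N = (\<Sum>i\<le>n. c i * mpderiv i \<Omega>)" using pow[OF assms] by blast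
  have h: "homog N (mpvar j ^ N :: 'k mpoly)" using homog_power[OF homog_var, of N j] by simp
  have "mpvar j ^ N = hcomp N (mpvar j ^ N :: 'k mpoly)" using homog_hcomp_eq[OF h] by simp
  also have "\<dots> = (\<Sum>i\<le>n. hcomp N (c i * mpderiv i \<Omega>))"
    unfolding c by (simp add: theta.hom_sum coeff_sum)
  finally have *: "mpvar j ^ N = (\<Sum>i\<le>n. hcomp N (c i * mpderiv i \<Omega>))" .
  have le: "d - 1 \<le> N"
  proof (rule ccontr)
    assume "\<not> d - 1 \<le> N"
    then have "(mpvar j ^ N :: 'k mpoly) = 0" unfolding * by (simp add: hcomp_mult_homog[OF homog_deriv])
    then show False using mpvar_neq_0 by simp
  qed
  show ?thesis
  proof (rule that[of "\<lambda>i. hcomp (N - (d - 1)) (c i)"])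
    show "mpvar j ^ N = (\<Sum>i\<le>n. hcomp (N - (d - 1)) (c i) * mpderiv i \<Omega>)"
      unfolding * using le by (simp add: hcomp_mult_homog[OF homog_deriv])
  qed (use le homog_hcomp in auto)
qed

text \<open>If \<Omega> = f g, the Leibniz rule puts every derivative of \<Omega>, and with
  \<open>pow\<close> a power of every variable, into (f, g). For nonconstant forms f and g in at
  least three variables \<open>card_vars_le_2\<close> forbids this.\<close>

lemma irreducible_\<Omega>: "comm_semiring_1_class.irreducible \<Omega>"
proof (rule comm_semiring_1_class.irreducibleI)
  show "\<Omega> \<noteq> 0" by (rule \<Omega>_neq_0)
  show "\<not> \<Omega> dvd 1"
  proof
    assume "\<Omega> dvd 1"
    then obtain c where "\<Omega> = mpoly_const c" by (auto simp: is_unit_mpoly_iff)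
    then have "tdeg \<Omega> = 0" by simp
    then show False using homog_tdeg[OF \<Omega>_homog \<Omega>_neq_0] d by simp
  qed
  fix f g assume fg: "\<Omega> = f * g"
  show "f dvd 1 \<or> g dvd 1"
  proof (rule ccontr)
    assume "\<not> (f dvd 1 \<or> g dvd 1)"
    then have nu: "\<not> f dvd 1" "\<not> g dvd 1" by auto
    have n0: "f \<noteq> 0" "g \<noteq> 0" using fg \<Omega>_neq_0 by auto
    obtain a where a: "homog a f" using homog_factor[of d f g] \<Omega>_homog \<Omega>_neq_0 fg by auto
    obtain b where b: "homog b g" using homog_factor[of d g f] \<Omega>_homog \<Omega>_neq_0 fg by (auto simp: mult.commute)
    have pos: "k > 0" if h: "homog k h" "h \<noteq> 0" "\<not> h dvd 1" for k and h :: "'k mpoly"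
    proof (rule ccontr)
      assume "\<not> k > 0"
      then have "tdeg h = 0" using homog_tdeg[OF h(1,2)] by simp
      then obtain c where "h = mpoly_const c" using tdeg_0 by blast
      then show False using h is_unit_mpoly_const[of c] by auto
    qed
    have inV: "f \<in> polys_in {..n}" "g \<in> polys_in {..n}"
      using factor_in[of f g "{..n}"] factor_in[of g f "{..n}"] \<Omega>_in \<Omega>_neq_0 fg by (auto simp: mult.commute)
    have "\<exists>u v. mpvar j ^ N = u * f + v * g" if j: "j \<in> {..n}" for j
    proof -
      obtain c where c: "mpvar j ^ N = (\<Sum>i\<le>n. c i * mpderiv i \<Omega>)" using pow j by auto
      also have "\<dots> = (\<Sum>i\<le>n. c i * mpderiv i g) * f + (\<Sum>i\<le>n. c i * mpderiv i f) * g"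
        unfolding fg by (simp add: mpderiv_mult distrib_left sum.distrib sum_distrib_right sum_distrib_left mult_ac)
      finally show ?thesis by blast
    qed
    from card_vars_le_2[OF _ a pos[OF a n0(1) nu(1)] inV(1) b pos[OF b n0(2) nu(2)] inV(2) this, of "0" "1" "2"]
    show False using n2 by auto
  qed
qed

lemma prime_\<Omega>: "prime_elem \<Omega>"
  by (rule mpoly_irreducible_imp_prime_elem[OF irreducible_\<Omega>])

definition F :: "'k \<Rightarrow> 'k mpoly" where
  "F \<xi> = \<Omega> - mpoly_const \<xi>"

lemma F_in: "F \<xi> \<in> polys_in {..n}"
  unfolding F_def by (intro polys_in_diff \<Omega>_in) simp

lemma theta_F: "theta (F \<xi>) = Polynomial.monom \<Omega> d - [:mpoly_const \<xi>:]"
  using \<Omega>_homog by (simp add: F_def theta.hom_minus homog_def)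

lemma coeff_theta_F: "hcomp d (F \<xi>) = \<Omega>"
  using d by (simp add: theta_F coeff_pCons split: nat.split)

lemma tdeg_F: "tdeg (F \<xi>) = d"
proof (rule antisym)
  show "tdeg (F \<xi>) \<le> d" unfolding theta_F by (intro degree_diff_le degree_monom_le) simp
  show "d \<le> tdeg (F \<xi>)" using coeff_theta_F[of \<xi>] \<Omega>_neq_0 by (intro le_degree) simp
qed

lemma F_neq_0: "F \<xi> \<noteq> 0"
  using tdeg_F[of \<xi>] d by auto

lemma F_dvd_small:
  assumes "F \<xi> dvd s" "tdeg s < d"
  shows "s = 0"
proof (rule ccontr)
  assume "s \<noteq> 0"
  obtain c where c: "s = F \<xi> * c" using assms(1) by (auto elim: dvdE)
  then have "c \<noteq> 0" using \<open>s \<noteq> 0\<close> by auto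
  then have "tdeg s = d + tdeg c" unfolding c by (subst tdeg_mult[OF F_neq_0]) (simp_all add: tdeg_F)
  then show False using assms(2) by simp
qed

text \<open>F and \<Omega> differ only by a constant. If \<Omega> divides the leading form of a,
  subtracting the corresponding multiple of F removes that form and adds only terms of lower
  degree.\<close>

lemma reduce_top:
  assumes "a \<noteq> 0" "\<Omega> dvd hcomp (tdeg a) a"
  obtains c where "a \<in> polys_in {..n} \<Longrightarrow> c \<in> polys_in {..n}" "tdeg a > 0"
    "a - F \<xi> * c = 0 \<or> tdeg (a - F \<xi> * c) < tdeg a"
proof -
  let ?k = "tdeg a" and ?t = "hcomp (tdeg a) a"
  have t0: "?t \<noteq> 0" using assms(1) by simp
  obtain c where c: "?t = \<Omega> * c" using assms(2) by (auto elim: dvdE)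
  then have c0: "c \<noteq> 0" using t0 by auto
  have ht: "homog ?k ?t" by (rule homog_hcomp)
  then have "homog ?k (c * \<Omega>)" using c by (simp add: mult.commute)
  then obtain j where j: "homog j c" using homog_factor[of ?k c \<Omega>] c t0 by (metis mult.commute)
  have "homog (d + j) ?t" unfolding c by (rule homog_mult[OF \<Omega>_homog j])
  then have k: "?k = d + j" using homog_tdeg[OF ht t0] homog_tdeg[of "d + j" ?t] t0 by simp
  have "c \<in> polys_in {..n}" if "a \<in> polys_in {..n}"
  proof -
    have "c * \<Omega> \<in> polys_in {..n}" using hcomp_in[OF that, of ?k] c by (simp add: mult.commute)
    moreover have "c * \<Omega> \<noteq> 0" using c0 \<Omega>_neq_0 by simp
    ultimately show ?thesis by (rule factor_in)
  qed
  moreover have "?k > 0" using k d by simp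
  moreover have "a - F \<xi> * c = 0 \<or> tdeg (a - F \<xi> * c) < ?k"
  proof -
    have th: "theta (a - F \<xi> * c) = theta a - (Polynomial.monom ?t ?k - Polynomial.monom (mpoly_const \<xi> * c) j)"
    proof -
      have "theta (F \<xi> * c) = Polynomial.monom (\<Omega> * c) (d + j) - Polynomial.monom (mpoly_const \<xi> * c) j"
        using j by (simp add: theta.hom_mult theta_F homog_def left_diff_distrib mult_monom smult_monom)
      then show ?thesis by (simp only: theta.hom_minus c[symmetric] k[symmetric])
    qed
    have "Polynomial.degree (Polynomial.monom (mpoly_const \<xi> * c) j) \<le> ?k"
      by (rule order.trans[OF degree_monom_le]) (simp add: k)
    then have "Polynomial.degree (theta (a - F \<xi> * c)) \<le> ?k"
      unfolding th by (intro degree_diff_le degree_monom_le) auto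
    moreover have "Polynomial.coeff (theta (a - F \<xi> * c)) ?k = 0"
      unfolding th using k d by simp
    ultimately show ?thesis
      using eq_zero_or_degree_less[of "theta (a - F \<xi> * c)" ?k] by simp
  qed
  ultimately show ?thesis using that by blast
qed

text \<open>The leading form of F is the prime \<Omega>, so \<Omega> divides the leading form of a
  or of b. That factor can be reduced modulo F to smaller degree, whence the induction on the sum of
  the degrees.\<close>

lemma prime_F: "prime_elem (F \<xi>)"
proof (rule prime_elemI)
  show "F \<xi> \<noteq> 0" by (rule F_neq_0)
  show "\<not> F \<xi> dvd 1"
  proof
    assume "F \<xi> dvd 1"
    then obtain c where "F \<xi> = mpoly_const c" by (auto simp: is_unit_mpoly_iff)
    then have "tdeg (F \<xi>) = 0" by simp
    then show False using tdeg_F[of \<xi>] d by simp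
  qed
  fix a b assume "F \<xi> dvd a * b"
  then show "F \<xi> dvd a \<or> F \<xi> dvd b"
  proof (induction "tdeg a + tdeg b" arbitrary: a b rule: less_induct)
    case less
    show ?case
    proof (cases "a = 0 \<or> b = 0")
      case False
      then have ab: "a \<noteq> 0" "b \<noteq> 0" by auto
      obtain h where h: "a * b = F \<xi> * h" using less.prems by (auto elim: dvdE)
      have "Polynomial.lead_coeff (theta a) * Polynomial.lead_coeff (theta b) =
          Polynomial.lead_coeff (theta (F \<xi>)) * Polynomial.lead_coeff (theta h)"
        by (metis h lead_coeff_mult theta.hom_mult)
      then have "\<Omega> dvd Polynomial.lead_coeff (theta a) * Polynomial.lead_coeff (theta b)"
        by (simp add: tdeg_F coeff_theta_F)
      then consider "\<Omega> dvd Polynomial.lead_coeff (theta a)" | "\<Omega> dvd Polynomial.lead_coeff (theta b)"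
        using prime_elem_dvd_multD[OF prime_\<Omega>] by blast
      then show ?thesis
      proof cases
        case 1
        then obtain c where c: "tdeg a > 0" "a - F \<xi> * c = 0 \<or> tdeg (a - F \<xi> * c) < tdeg a"
          using reduce_top[OF ab(1)] by blast
        then have "tdeg (a - F \<xi> * c) < tdeg a" by auto
        moreover have "(a - F \<xi> * c) * b = F \<xi> * (h - c * b)" using h by (simp add: algebra_simps)
        then have "F \<xi> dvd (a - F \<xi> * c) * b" by simp
        ultimately have "F \<xi> dvd a - F \<xi> * c \<or> F \<xi> dvd b" using less.hyps by simp
        then show ?thesis by (simp add: dvd_diff_left_iff)
      next
        case 2
        then obtain c where c: "tdeg b > 0" "b - F \<xi> * c = 0 \<or> tdeg (b - F \<xi> * c) < tdeg b"
          using reduce_top[OF ab(2)] by blast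
        then have "tdeg (b - F \<xi> * c) < tdeg b" by auto
        moreover have "a * (b - F \<xi> * c) = F \<xi> * (h - c * a)" using h by (simp add: algebra_simps)
        then have "F \<xi> dvd a * (b - F \<xi> * c)" by simp
        ultimately have "F \<xi> dvd a \<or> F \<xi> dvd b - F \<xi> * c" using less.hyps by simp
        then show ?thesis by (simp add: dvd_diff_left_iff)
      qed
    qed auto
  qed
qed

text \<open>The indices other than i in increasing order; the bracket of these n variables is the
  i-th derivative of \<Omega> up to the sign computed in \<open>jac_vars\<close>.\<close>

definition idx :: "nat \<Rightarrow> nat list" where
  "idx i = filter (\<lambda>j. j \<noteq> i) [0..<n + 1]"

lemma set_idx: "set (idx i) = {..n} - {i}"
  by (auto simp: idx_def)

lemma length_idx: "i \<le> n \<Longrightarrow> length (idx i) = n"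
proof -
  assume i: "i \<le> n"
  have "distinct (idx i)" by (simp add: idx_def)
  then have "length (idx i) = card (set (idx i))" by (simp add: distinct_card)
  also have "\<dots> = n" unfolding set_idx using i by simp
  finally show ?thesis .
qed

lemma tdeg_jac:
  assumes len: "length us = n" and us: "\<And>x. x \<in> set us \<Longrightarrow> tdeg x \<le> Suc r" and w: "tdeg w \<le> Suc e"
  shows "tdeg (mp.jac n w us) \<le> n * r + e"
proof -
  have sg: "tdeg (signof p * x) \<le> tdeg x" for p and x :: "'a::field mpoly"
    by (auto simp: sign_def theta.hom_uminus)
  have "tdeg (\<Prod>i<n+1. mpderiv (p i) ((us @ [w]) ! i)) \<le> n * r + e" for p
  proof -
    have "tdeg (\<Prod>i<n+1. mpderiv (p i) ((us @ [w]) ! i)) \<le>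
        (\<Sum>i<n+1. tdeg (mpderiv (p i) ((us @ [w]) ! i)))"
      unfolding theta.hom_prod using degree_prod_sum_le[of "{..<n+1}"] by (simp add: o_def del: sum.lessThan_Suc prod.lessThan_Suc)
    also have "\<dots> = (\<Sum>i<n. tdeg (mpderiv (p i) (us ! i))) + tdeg (mpderiv (p n) w)"
      using len by (simp add: nth_append)
    also have "\<dots> \<le> (\<Sum>i<n. r) + e"
      using len us w by (intro add_mono sum_mono tdeg_mpderiv) auto
    finally show ?thesis by simp
  qed
  note pr = this
  have det: "mp.jac n w us = (\<Sum>p\<in>{p. p permutes {0..<n+1}}. signof p * (\<Prod>i<n+1. mpderiv (p i) ((us @ [w]) ! i)))"
    unfolding mp.jac_def mp.jacobian_def rdet_def det_def'[OF mat_carrier]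
    by (intro sum.cong refl arg_cong2[of _ _ _ _ "(*)"] prod.cong)
       (auto simp: atLeast0LessThan)
  show ?thesis
    unfolding det theta.hom_sum
    by (rule degree_sum_le) (use order.trans[OF sg pr] in \<open>auto simp: finite_permutations\<close>)
qed

lemma tdeg_mpeval_hcomp:
  assumes "\<And>j. tdeg (Y j) \<le> r"
  shows "tdeg (mpeval mpoly_const Y (hcomp k p)) \<le> r * k"
proof -
  interpret ev: comm_ring_hom "mpeval mpoly_const Y" by (rule mpeval_hom[OF mpoly_const_hom])
  show ?thesis
  proof (induction p arbitrary: k rule: mpoly_induct)
    case (const c) show ?case
      by (cases k) (simp_all add: mpeval_const[OF mpoly_const_hom])
  next
    case (var l)
    have "k = 0 \<or> k = 1 \<or> (\<exists>k'. k = Suc (Suc k'))" by presburger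
    then show ?case using assms[of l]
      by (auto simp: coeff_pCons mpeval_var[OF mpoly_const_hom] split: nat.splits)
  next
    case (add p q)
    then show ?case by (simp add: theta.hom_add ev.hom_add degree_add_le)
  next
    case (mult p q)
    have "tdeg (mpeval mpoly_const Y (hcomp j p * hcomp (k - j) q)) \<le> r * k" if "j \<le> k" for j
    proof -
      have "tdeg (mpeval mpoly_const Y (hcomp j p * hcomp (k - j) q)) \<le> r * j + r * (k - j)"
        unfolding ev.hom_mult theta.hom_mult
        by (rule order.trans[OF degree_mult_le add_mono[OF mult]])
      also have "\<dots> = r * k" using that by (simp flip: distrib_left)
      finally show ?thesis .
    qed
    then have le: "tdeg (mpeval mpoly_const Y (hcomp j p * hcomp (k - j) q)) \<le> r * k" if "j \<in> {..k}" for j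
      using that by simp
    have eq: "hcomp k (p * q) = (\<Sum>j\<le>k. hcomp j p * hcomp (k - j) q)"
      by (simp add: theta.hom_mult coeff_mult)
    show ?case unfolding eq ev.hom_sum theta.hom_sum by (rule degree_sum_le[OF finite_atMost le])
  qed
qed

text \<open>If \<open>r\<close> is the maximal degree of the \<open>Y\<^sub>j\<close>, the bracket relations bound the degree of
  \<open>Y\<^sub>j\<^sup>N\<close> modulo \<open>F\<close> by \<open>rN - (r - 1)(d - 1 - n)\<close>.\<close>

lemma tdeg_le_1:
  assumes min: "\<And>j c. j \<le> n \<Longrightarrow> c \<in> polys_in {..n} \<Longrightarrow> tdeg (Y j) \<le> tdeg (Y j - F \<xi> * c)"
    and Y_in: "\<And>j. j \<le> n \<Longrightarrow> Y j \<in> polys_in {..n}" and Y0: "\<And>j. n < j \<Longrightarrow> Y j = 0"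
    and bracket: "\<And>i. i \<le> n \<Longrightarrow>
      F \<xi> dvd mpeval mpoly_const Y (mpderiv i \<Omega>) - (- 1) ^ (n + i) * mp.jac n \<Omega> (map Y (idx i))"
    and j: "j \<le> n"
  shows "tdeg (Y j) \<le> 1"
proof -
  interpret ev: comm_ring_hom "mpeval mpoly_const Y" by (rule mpeval_hom[OF mpoly_const_hom])
  let ?\<Phi> = "mpeval mpoly_const Y"
  define r where "r = Max ((\<lambda>j. tdeg (Y j)) ` {..n})"
  have r: "tdeg (Y j) \<le> r" for j
    using Y0[of j] unfolding r_def by (cases "j \<le> n") (auto intro!: Max_ge)
  have "r \<in> (\<lambda>j. tdeg (Y j)) ` {..n}" unfolding r_def by (rule Max_in) auto
  then obtain l where l: "l \<le> n" "tdeg (Y l) = r" by auto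
  have "r \<le> 1"
  proof (rule ccontr)
    assume "\<not> r \<le> 1"
    then obtain r' where r': "r = Suc r'" "r' \<ge> 1" by (cases r) auto
    define J where "J i = (- 1) ^ (n + i) * mp.jac n \<Omega> (map Y (idx i))" for i
    have d1: "tdeg \<Omega> \<le> Suc (d - 1)" using homog_tdeg[OF \<Omega>_homog \<Omega>_neq_0] by simp
    have J: "tdeg (J i) \<le> n * r' + (d - 1)" if "i \<le> n" for i
    proof -
      have "tdeg (mp.jac n \<Omega> (map Y (idx i))) \<le> n * r' + (d - 1)"
        by (rule tdeg_jac[OF _ _ d1]) (use that r r' in \<open>auto simp: length_idx\<close>)
      then show ?thesis unfolding J_def
        by (cases "even (n + i)") (simp_all add: theta.hom_uminus)
    qed
    obtain c where c: "\<And>i. homog (N - (d - 1)) (c i)" "mpvar l ^ N = (\<Sum>i\<le>n. c i * mpderiv i \<Omega>)" "d - 1 \<le> N"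
      using pow_homog[OF l(1)] by blast
    have dc: "tdeg (?\<Phi> (c i)) \<le> r * (N - (d - 1))" for i
      using tdeg_mpeval_hcomp[where Y = Y and r = r and p = "c i" and k = "N - (d - 1)", OF r] homog_hcomp_eq[where j = "N - (d - 1)", OF c(1)[of i]] by simp
    define L where "L = (\<Sum>i\<le>n. ?\<Phi> (c i) * J i)"
    have "Y l ^ N = ?\<Phi> (mpvar l ^ N)" by (simp add: ev.hom_power mpeval_var[OF mpoly_const_hom])
    also have "\<dots> = (\<Sum>i\<le>n. ?\<Phi> (c i) * ?\<Phi> (mpderiv i \<Omega>))" unfolding c(2) by (simp add: ev.hom_sum ev.hom_mult)
    finally have "Y l ^ N - L = (\<Sum>i\<le>n. ?\<Phi> (c i) * (?\<Phi> (mpderiv i \<Omega>) - J i))"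
      by (simp add: L_def right_diff_distrib sum_subtractf)
    moreover have "F \<xi> dvd \<dots>" using bracket unfolding J_def by (intro dvd_sum dvd_mult) auto
    ultimately obtain g where g: "Y l ^ N - L = F \<xi> * g" by (auto elim: dvdE)
    have "tdeg L \<le> r * (N - (d - 1)) + (n * r' + (d - 1))"
      unfolding L_def theta.hom_sum
    proof (rule degree_sum_le)
      fix i assume "i \<in> {..n}"
      then show "tdeg (?\<Phi> (c i) * J i) \<le> r * (N - (d - 1)) + (n * r' + (d - 1))"
        unfolding theta.hom_mult by (intro order.trans[OF degree_mult_le add_mono[OF dc J]]) simp
    qed simp
    also have "\<dots> < r * N"
    proof -
      \<comment> \<open>Here r = r' + 1, and r' is positive because r > 1. Strictness comes from n <
        d - 1.\<close>
      have "n * r' < (d - 1) * r'" by (rule mult_strict_right_mono) (use r' d in auto)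
      then have "n * r' + (d - 1) < (d - 1) * r' + (d - 1)" by simp
      also have "\<dots> = r * (d - 1)" unfolding r'(1) by (simp only: mult_Suc mult.commute add.commute)
      finally have "r * (N - (d - 1)) + (n * r' + (d - 1)) < r * (N - (d - 1)) + r * (d - 1)" by simp
      also have "\<dots> = r * N" using c(3) by (simp flip: distrib_left)
      finally show ?thesis .
    qed
    finally have L: "tdeg L < r * N" .
    have Yl0: "Y l \<noteq> 0" using l(2) r' by auto
    have dY: "tdeg (Y l ^ N) = r * N" using Yl0 l(2) by (simp add: theta.hom_power degree_power_eq mult.commute)
    have "tdeg (Y l ^ N - L) = r * N"
      using degree_add_eq_left[of "theta (- L)" "theta (Y l ^ N)"] L dY
      by (simp add: theta.hom_minus theta.hom_uminus)
    \<comment> \<open>As L has smaller degree, the leading form of F g is that of Y_l^N. Hence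
      \<Omega> divides the leading form of Y_l, and \<open>reduce_top\<close> contradicts the
      minimality of its degree modulo F.\<close>
    then have "Polynomial.lead_coeff (theta (Y l ^ N - L)) = hcomp (r * N) (Y l ^ N)"
      using L by (simp add: theta.hom_minus coeff_eq_0)
    also have "\<dots> = Polynomial.lead_coeff (theta (Y l)) ^ N"
      using dY by (simp add: lead_coeff_power[symmetric] theta.hom_power)
    finally have lc: "Polynomial.lead_coeff (theta (Y l)) ^ N = Polynomial.lead_coeff (theta (F \<xi>)) * Polynomial.lead_coeff (theta g)"
      unfolding g by (simp add: theta.hom_mult lead_coeff_mult)
    then have "\<Omega> dvd Polynomial.lead_coeff (theta (Y l)) ^ N" by (simp add: tdeg_F coeff_theta_F)
    then have "\<Omega> dvd Polynomial.lead_coeff (theta (Y l))" by (rule prime_elem_dvd_power[OF prime_\<Omega>])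
    then obtain u where u: "Y l \<in> polys_in {..n} \<Longrightarrow> u \<in> polys_in {..n}" "tdeg (Y l) > 0"
      "Y l - F \<xi> * u = 0 \<or> tdeg (Y l - F \<xi> * u) < tdeg (Y l)"
      using reduce_top[OF Yl0] by blast
    then have "tdeg (Y l - F \<xi> * u) < tdeg (Y l)" by auto
    then show False using min[OF l(1) u(1)[OF Y_in[OF l(1)]]] by simp
  qed
  then show ?thesis using r[of j] by simp
qed

definition affs :: "'k mpoly set" where
  "affs = (\<lambda>m. Poly_Mapping.single m 1) ` {m. Poly_Mapping.keys m \<subseteq> {..n} \<and> monomial_degree m \<le> 1}"

lemma finite_affs: "finite affs"
proof -
  have "{m. Poly_Mapping.keys m \<subseteq> {..n} \<and> monomial_degree m \<le> 1} \<subseteq> insert 0 ((\<lambda>i. Poly_Mapping.single i 1) ` {..n})"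
  proof clarify
    fix m assume m: "Poly_Mapping.keys m \<subseteq> {..n}" "monomial_degree m \<le> 1" "m \<notin> (\<lambda>i. Poly_Mapping.single i 1) ` {..n}"
    show "m = 0"
    proof (rule ccontr)
      assume "m \<noteq> 0"
      then obtain i where i: "i \<in> Poly_Mapping.keys m" by (metis all_not_in_conv keys_eq_empty)
      define m' where "m' = m - Poly_Mapping.single i 1"
      have mm: "m = Poly_Mapping.single i 1 + m'"
        using i by (intro poly_mapping_eqI) (auto simp: m'_def lookup_add lookup_minus lookup_single when_def in_keys_iff)
      have "monomial_degree m' = 0"
        using m(2) unfolding mm monomial_degree_add monomial_degree_single by simp
      then have "m' = 0" by (intro poly_mapping_eqI) (auto simp: monomial_degree_def in_keys_iff)
      then show False using mm m(1,3) i by auto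
    qed
  qed
  then have "finite {m. Poly_Mapping.keys m \<subseteq> {..n} \<and> monomial_degree m \<le> 1}" by (rule finite_subset) simp
  then show ?thesis unfolding affs_def by simp
qed

lemma span_affs: "mpoly_vs.span affs = {p \<in> polys_in {..n}. tdeg p \<le> 1}"
proof
  show "mpoly_vs.span affs \<subseteq> {p \<in> polys_in {..n}. tdeg p \<le> 1}"
  proof (rule mpoly_vs.span_minimal)
    show "affs \<subseteq> {p \<in> polys_in {..n}. tdeg p \<le> 1}"
    proof clarify
      fix p assume "p \<in> affs"
      then obtain m where m: "p = Poly_Mapping.single m 1" "Poly_Mapping.keys m \<subseteq> {..n}" "monomial_degree m \<le> 1"
        by (auto simp: affs_def)
      have "tdeg p \<le> monomial_degree m" unfolding m(1) theta_single by (rule degree_monom_le)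
      then show "p \<in> polys_in {..n} \<and> tdeg p \<le> 1" using m by (auto simp: polys_in_def)
    qed
    show "mpoly_vs.subspace {p \<in> polys_in {..n}. tdeg p \<le> 1}"
      unfolding mpoly_vs.subspace_def
      by (auto simp: theta.hom_add theta.hom_mult intro!: polys_in_add polys_in_mult degree_add_le
          intro: order.trans[OF degree_smult_le])
  qed
  show "{p \<in> polys_in {..n}. tdeg p \<le> 1} \<subseteq> mpoly_vs.span affs"
  proof clarify
    fix p :: "'k mpoly" assume p: "p \<in> polys_in {..n}" "tdeg p \<le> 1"
    have "(\<Sum>m\<in>Poly_Mapping.keys p. mpoly_const (Poly_Mapping.lookup p m) * Poly_Mapping.single m 1) \<in> mpoly_vs.span affs"
    proof (intro mpoly_vs.span_sum mpoly_vs.span_scale mpoly_vs.span_base)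
      fix m assume m: "m \<in> Poly_Mapping.keys p"
      have "Poly_Mapping.lookup (hcomp (monomial_degree m) p) m = Poly_Mapping.lookup p m"
        using m by (simp add: hcomp_eq_sum lookup_sum lookup_single when_def sum.delta')
      then have "hcomp (monomial_degree m) p \<noteq> 0" using m by (auto simp: in_keys_iff)
      then have "monomial_degree m \<le> tdeg p" by (rule le_degree)
      then show "Poly_Mapping.single m 1 \<in> affs" using p m by (auto simp: affs_def polys_in_def)
    qed
    then show "p \<in> mpoly_vs.span affs"
      by (simp only: single_eq_const_mult[symmetric] poly_mapping_sum_single[symmetric])
  qed
qed

text \<open>The substitution acts linearly on the finite-dimensional space of polynomials of degree
  at most 1. It is injective there because no nonzero element of that space is a multiple of F,
  whose degree is d; so it is surjective there by dimension.\<close>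

lemma affine_surjective:
  assumes deg: "\<And>j. j \<le> n \<Longrightarrow> tdeg (Y j) \<le> 1" and Y_in: "\<And>j. j \<le> n \<Longrightarrow> Y j \<in> polys_in {..n}"
    and inj: "\<And>p. p \<in> polys_in {..n} \<Longrightarrow> F \<xi> dvd mpeval mpoly_const Y p \<Longrightarrow> F \<xi> dvd p"
    and j: "j \<le> n"
  shows "\<exists>z\<in>polys_in {..n}. mpeval mpoly_const Y z = mpvar j"
proof -
  let ?\<Phi> = "mpeval mpoly_const Y"
  interpret ev: comm_ring_hom ?\<Phi> by (rule mpeval_hom[OF mpoly_const_hom])
  interpret lin: Vector_Spaces.linear "\<lambda>c p. mpoly_const c * p :: 'k mpoly" "\<lambda>c p. mpoly_const c * p :: 'k mpoly" ?\<Phi>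
    by unfold_locales (simp_all add: ev.hom_add ev.hom_mult mpeval_const[OF mpoly_const_hom])
  have inj_span: "inj_on ?\<Phi> (mpoly_vs.span affs)"
  proof (rule inj_onI)
    fix x y assume x: "x \<in> mpoly_vs.span affs" and y: "y \<in> mpoly_vs.span affs" and eq: "?\<Phi> x = ?\<Phi> y"
    have xy: "x - y \<in> mpoly_vs.span affs" using x y by (rule mpoly_vs.span_diff)
    have "?\<Phi> (x - y) = 0" using eq by (simp add: ev.hom_minus)
    then have "F \<xi> dvd x - y" using inj[of "x - y"] xy by (simp add: span_affs)
    then have "x - y = 0" by (rule F_dvd_small) (use xy d in \<open>simp add: span_affs\<close>)
    then show "x = y" by simp
  qed
  have maps: "?\<Phi> p \<in> mpoly_vs.span affs" if pa: "p \<in> affs" for p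
  proof -
    obtain m where m: "p = Poly_Mapping.single m 1" "Poly_Mapping.keys m \<subseteq> {..n}" "monomial_degree m \<le> 1"
      using pa by (auto simp: affs_def)
    have hp: "hcomp (monomial_degree m) p = p" unfolding m(1) theta_single by simp
    \<comment> \<open>The degree estimate for substitutions needs a bound at every index, also
      beyond n; p does not notice the change.\<close>
    define Y' where "Y' j = (if j \<le> n then Y j else 0)" for j
    have pV: "p \<in> polys_in {..n}" using m by (auto simp: polys_in_def)
    have "?\<Phi> p = mpeval mpoly_const Y' p"
      by (rule comm_ring_hom_eq_on[OF mpeval_hom[OF mpoly_const_hom] mpeval_hom[OF mpoly_const_hom] pV])
        (simp_all add: mpeval_const[OF mpoly_const_hom] mpeval_var[OF mpoly_const_hom] Y'_def)
    moreover have "tdeg (mpeval mpoly_const Y' (hcomp (monomial_degree m) p)) \<le> 1 * monomial_degree m"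
      by (rule tdeg_mpeval_hcomp) (use deg in \<open>auto simp: Y'_def\<close>)
    ultimately have "tdeg (?\<Phi> p) \<le> 1" using hp m by simp
    moreover have "?\<Phi> p \<in> polys_in {..n}"
      by (rule mpeval_in[OF mpoly_const_hom pV]) (auto intro: Y_in polys_in_add polys_in_mult)
    ultimately show ?thesis by (simp add: span_affs)
  qed
  have ind: "mpoly_vs.independent affs" unfolding affs_def by (rule independent_monomials)
  have ind': "mpoly_vs.independent (?\<Phi> ` affs)"
    by (rule lin.independent_inj_on_image[OF ind inj_span])
  have card': "card (?\<Phi> ` affs) = card affs"
    by (rule card_image) (use inj_span mpoly_vs.span_superset inj_on_subset in blast)
  have "mpvar j \<in> mpoly_vs.span (?\<Phi> ` affs)"
  proof (rule ccontr)
    assume n: "mpvar j \<notin> mpoly_vs.span (?\<Phi> ` affs)"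
    then have i: "mpoly_vs.independent (insert (mpvar j) (?\<Phi> ` affs))"
      using ind' by (simp add: mpoly_vs.independent_insert)
    have "(mpvar j :: 'k mpoly) \<in> mpoly_vs.span affs" using j by (simp add: span_affs)
    then have "insert (mpvar j) (?\<Phi> ` affs) \<subseteq> mpoly_vs.span affs" using maps by auto
    then have "card (insert (mpvar j) (?\<Phi> ` affs)) \<le> card affs"
      using mpoly_vs.independent_span_bound[OF finite_affs i] by blast
    moreover have "mpvar j \<notin> ?\<Phi> ` affs" using n mpoly_vs.span_base by blast
    ultimately show False using card' finite_affs by simp
  qed
  then have "mpvar j \<in> ?\<Phi> ` mpoly_vs.span affs" by (simp add: lin.span_image)
  then obtain z where z: "z \<in> mpoly_vs.span affs" "mpvar j = ?\<Phi> z" by auto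
  then show ?thesis by (intro bexI[of _ z]) (simp_all add: span_affs)
qed

end

section \<open>Bracket-preserving substitutions of fractions have no poles on the fibre\<close>

section \<open>Poles of bracket-preserving substitutions\<close>

context potential
begin

abbreviation br :: "'k mpoly fract list \<Rightarrow> 'k mpoly fract" where
  "br \<equiv> fr.jac n (to_fract \<Omega>)"

text \<open>The localization at the prime F of the ring in all variables; \<open>NN\<close> below is
  its maximal ideal.\<close>

definition W :: "'k \<Rightarrow> 'k mpoly fract set" where
  "W \<xi> = {x. \<exists>a b. \<not> F \<xi> dvd b \<and> x = to_fract a / to_fract b}"

definition NN :: "'k \<Rightarrow> 'k mpoly fract set" where
  "NN \<xi> = {to_fract (F \<xi>) * w | w. w \<in> W \<xi>}"

text \<open>The elements of \<open>W\<close> whose residue class is that of a polynomial: modulo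
  \<open>NN\<close> they are the regular functions.\<close>

definition SS :: "'k \<Rightarrow> 'k mpoly fract set" where
  "SS \<xi> = {to_fract p + z | p z. z \<in> NN \<xi>}"

interpretation brm: multiderivation n br
  by (rule fr.multiderivation_jac)

context
  fixes \<xi> :: 'k
begin

lemma not_dvd_1: "\<not> F \<xi> dvd 1"
  using prime_F by (simp add: prime_elem_def)

lemma not_dvd_mult: "\<not> F \<xi> dvd a \<Longrightarrow> \<not> F \<xi> dvd b \<Longrightarrow> \<not> F \<xi> dvd a * b"
  using prime_elem_dvd_multD[OF prime_F] by blast

lemma not_dvd_0: "\<not> F \<xi> dvd b \<Longrightarrow> b \<noteq> 0" by auto

lemma W_to_fract: "to_fract a \<in> W \<xi>"
  unfolding W_def by (rule CollectI, rule exI[of _ a], rule exI[of _ 1]) (simp add: not_dvd_1)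

lemma W_0: "0 \<in> W \<xi>" and W_1: "1 \<in> W \<xi>"
  using W_to_fract[of 0] W_to_fract[of 1] by simp_all

lemma W_add: "x \<in> W \<xi> \<Longrightarrow> y \<in> W \<xi> \<Longrightarrow> x + y \<in> W \<xi>"
proof -
  assume "x \<in> W \<xi>" "y \<in> W \<xi>"
  then obtain a b a' b' where ab: "\<not> F \<xi> dvd b" "x = to_fract a / to_fract b"
    "\<not> F \<xi> dvd b'" "y = to_fract a' / to_fract b'" by (auto simp: W_def)
  have "b \<noteq> 0" "b' \<noteq> 0" using ab not_dvd_0 by blast+
  then have "x + y = to_fract (a * b' + a' * b) / to_fract (b * b')"
    by (simp add: ab to_fract_add to_fract_mult add_frac_eq)
  then show ?thesis using not_dvd_mult[OF ab(1,3)] unfolding W_def by blast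
qed

lemma W_mult: "x \<in> W \<xi> \<Longrightarrow> y \<in> W \<xi> \<Longrightarrow> x * y \<in> W \<xi>"
proof -
  assume "x \<in> W \<xi>" "y \<in> W \<xi>"
  then obtain a b a' b' where ab: "\<not> F \<xi> dvd b" "x = to_fract a / to_fract b"
    "\<not> F \<xi> dvd b'" "y = to_fract a' / to_fract b'" by (auto simp: W_def)
  then have "x * y = to_fract (a * a') / to_fract (b * b')" by (simp add: to_fract_mult)
  then show ?thesis using not_dvd_mult[OF ab(1,3)] unfolding W_def by blast
qed

lemma W_uminus: "x \<in> W \<xi> \<Longrightarrow> - x \<in> W \<xi>"
  using W_mult[OF W_to_fract[of "- 1"], of x] by (simp add: to_fract_uminus)

lemma W_divide: "x \<in> W \<xi> \<Longrightarrow> \<not> F \<xi> dvd b \<Longrightarrow> x / to_fract b \<in> W \<xi>"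
proof -
  assume x: "x \<in> W \<xi>" and b: "\<not> F \<xi> dvd b"
  have "1 / to_fract b \<in> W \<xi>" unfolding W_def
    by (rule CollectI, rule exI[of _ 1], rule exI[of _ b]) (simp add: b)
  from W_mult[OF x this] show ?thesis by simp
qed

lemma W_fract_deriv: "x \<in> W \<xi> \<Longrightarrow> fract_deriv (mpderiv j) x \<in> W \<xi>"
proof -
  assume x: "x \<in> W \<xi>"
  then obtain a b where ab: "\<not> F \<xi> dvd b" "x = to_fract a / to_fract b" by (auto simp: W_def)
  have "fract_deriv (mpderiv j) x = (to_fract (mpderiv j a) - x * to_fract (mpderiv j b)) / to_fract b"
    unfolding ab(2) by (rule fract_deriv_quotient[OF derivation_mpderiv not_dvd_0[OF ab(1)]])
  moreover have "to_fract (mpderiv j a) + - (x * to_fract (mpderiv j b)) \<in> W \<xi>"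
    by (intro W_add W_uminus W_mult W_to_fract x)
  ultimately show ?thesis using W_divide[OF _ ab(1)] by simp
qed

lemma br_W: "set us \<subseteq> W \<xi> \<Longrightarrow> length us = n \<Longrightarrow> br us \<in> W \<xi>"
  by (rule fr.jac_in) (auto intro: W_add W_mult W_uminus W_0 W_1 W_fract_deriv W_to_fract)

lemma NN_W: "z \<in> NN \<xi> \<Longrightarrow> z \<in> W \<xi>"
  by (auto simp: NN_def intro: W_mult W_to_fract)

lemma NN_0: "0 \<in> NN \<xi>"
  unfolding NN_def using W_0 by force

lemma NN_add: "x \<in> NN \<xi> \<Longrightarrow> y \<in> NN \<xi> \<Longrightarrow> x + y \<in> NN \<xi>"
proof -
  assume "x \<in> NN \<xi>" "y \<in> NN \<xi>"
  then obtain v w where "x = to_fract (F \<xi>) * v" "y = to_fract (F \<xi>) * w" "v \<in> W \<xi>" "w \<in> W \<xi>"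
    by (auto simp: NN_def)
  then show ?thesis using W_add unfolding NN_def by (auto simp flip: distrib_left)
qed

lemma NN_mult: "w \<in> W \<xi> \<Longrightarrow> z \<in> NN \<xi> \<Longrightarrow> w * z \<in> NN \<xi>"
proof -
  assume w: "w \<in> W \<xi>" and "z \<in> NN \<xi>"
  then obtain v where v: "z = to_fract (F \<xi>) * v" "v \<in> W \<xi>" by (auto simp: NN_def)
  then have "w * z = to_fract (F \<xi>) * (w * v)" by simp
  then show ?thesis using W_mult[OF w v(2)] unfolding NN_def by blast
qed

lemma NN_uminus: "z \<in> NN \<xi> \<Longrightarrow> - z \<in> NN \<xi>"
  using NN_mult[OF W_to_fract[of "- 1"], of z] by (simp add: to_fract_uminus)

lemma NN_diff: "x \<in> NN \<xi> \<Longrightarrow> y \<in> NN \<xi> \<Longrightarrow> x - y \<in> NN \<xi>"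
  using NN_add[of x "- y"] NN_uminus by simp

lemma NN_divide: "z \<in> NN \<xi> \<Longrightarrow> \<not> F \<xi> dvd b \<Longrightarrow> z / to_fract b \<in> NN \<xi>"
  using NN_mult[OF W_divide[OF W_1], of b z] by simp

lemma to_fract_NN: "to_fract a \<in> NN \<xi> \<longleftrightarrow> F \<xi> dvd a"
proof
  assume "to_fract a \<in> NN \<xi>"
  then obtain c b where cb: "to_fract a = to_fract (F \<xi>) * (to_fract c / to_fract b)" "\<not> F \<xi> dvd b"
    by (auto simp: NN_def W_def)
  have "to_fract b \<noteq> 0" using not_dvd_0[OF cb(2)] by simp
  then have "to_fract a * to_fract b = to_fract (F \<xi>) * to_fract c" unfolding cb(1) by simp
  then have "a * b = F \<xi> * c" by (simp only: to_fract_mult[symmetric] to_fract_eq_iff)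
  then have "F \<xi> dvd a * b" by simp
  then show "F \<xi> dvd a" using prime_elem_dvd_multD[OF prime_F] cb(2) by blast
next
  assume "F \<xi> dvd a"
  then obtain c where "a = F \<xi> * c" by (auto elim: dvdE)
  then show "to_fract a \<in> NN \<xi>" unfolding NN_def using W_to_fract[of c] by (auto simp: to_fract_mult)
qed

text \<open>\<Omega> repeats the last row of the Jacobian and the constant \<xi> has zero gradient,
  so F is a Casimir and can be pulled out of the bracket.\<close>

lemma br_NN:
  assumes us: "set us \<subseteq> W \<xi>" "length us = n" and k: "k < n" and z: "z \<in> NN \<xi>"
  shows "br (us[k := z]) \<in> NN \<xi>"
proof -
  interpret d: derivation "\<lambda>x. br (us[k := x])" by (rule brm.deriv[OF us(2) k])
  obtain v where v: "z = to_fract (F \<xi>) * v" "v \<in> W \<xi>" using z by (auto simp: NN_def)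
  have "br (us[k := to_fract \<Omega>]) = 0"
    by (rule fr.jac_casimir[of _ n k]) (use us k in auto)
  moreover have "br (us[k := to_fract (mpoly_const \<xi>)]) = 0"
    by (rule fr.jac_constant[OF us(2) k]) (simp add: derivation_mpderiv)
  ultimately have "br (us[k := to_fract (F \<xi>)]) = 0" by (simp add: F_def to_fract_diff d.diff)
  then have "br (us[k := z]) = to_fract (F \<xi>) * br (us[k := v])" unfolding v(1) by (simp add: d.leibniz)
  moreover have "br (us[k := v]) \<in> W \<xi>"
    by (rule br_W) (use us v in \<open>auto dest!: set_update_subset_insert[THEN subsetD]\<close>)
  ultimately show ?thesis by (auto simp: NN_def)
qed

lemma SS_to_fract: "to_fract p \<in> SS \<xi>"
  unfolding SS_def using NN_0 by force

lemma NN_SS: "z \<in> NN \<xi> \<Longrightarrow> z \<in> SS \<xi>"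
  unfolding SS_def by (intro CollectI exI[of _ 0] exI[of _ z]) simp

lemma SS_W: "x \<in> SS \<xi> \<Longrightarrow> x \<in> W \<xi>"
  unfolding SS_def using W_add W_to_fract NN_W by blast

lemma SS_iff: "x \<in> SS \<xi> \<longleftrightarrow> (\<exists>p. x - to_fract p \<in> NN \<xi>)"
  unfolding SS_def by (auto, metis add_diff_cancel_left' add.commute, metis add.commute diff_add_cancel)

lemma SS_add: "x \<in> SS \<xi> \<Longrightarrow> y \<in> SS \<xi> \<Longrightarrow> x + y \<in> SS \<xi>"
proof -
  assume "x \<in> SS \<xi>" "y \<in> SS \<xi>"
  then obtain p q where "x - to_fract p \<in> NN \<xi>" "y - to_fract q \<in> NN \<xi>" by (auto simp: SS_iff)
  from NN_add[OF this] have "x + y - to_fract (p + q) \<in> NN \<xi>" by (simp add: algebra_simps)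
  then show ?thesis using SS_iff by blast
qed

lemma SS_mult: "x \<in> SS \<xi> \<Longrightarrow> y \<in> SS \<xi> \<Longrightarrow> x * y \<in> SS \<xi>"
proof -
  assume x: "x \<in> SS \<xi>" and y: "y \<in> SS \<xi>"
  then obtain p q where "x - to_fract p \<in> NN \<xi>" "y - to_fract q \<in> NN \<xi>" by (auto simp: SS_iff)
  then have "y * (x - to_fract p) + to_fract p * (y - to_fract q) \<in> NN \<xi>"
    by (intro NN_add NN_mult SS_W[OF y] W_to_fract)
  then have "x * y - to_fract (p * q) \<in> NN \<xi>" by (simp add: algebra_simps)
  then show ?thesis using SS_iff by blast
qed

lemma SS_uminus: "x \<in> SS \<xi> \<Longrightarrow> - x \<in> SS \<xi>"
  using SS_mult[OF SS_to_fract[of "- 1"], of x] by (simp add: to_fract_uminus)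

lemma SS_0: "0 \<in> SS \<xi>" and SS_1: "1 \<in> SS \<xi>"
  using SS_to_fract[of 0] SS_to_fract[of 1] by simp_all

lemma SS_power: "x \<in> SS \<xi> \<Longrightarrow> x ^ k \<in> SS \<xi>"
  by (induction k) (auto intro: SS_1 SS_mult)

lemma SS_sum: "(\<And>i. i \<in> A \<Longrightarrow> f i \<in> SS \<xi>) \<Longrightarrow> sum f A \<in> SS \<xi>"
  by (induction A rule: infinite_finite_induct) (auto intro: SS_0 SS_add)

lemma br_to_fract: "br (map to_fract ps) = to_fract (mp.jac n \<Omega> ps)" if "length ps = n"
proof -
  have "to_fract (mp.jac n \<Omega> ps) =
      det (map_mat to_fract (mat (n+1) (n+1) (\<lambda>(i, j). mpderiv j ((ps @ [\<Omega>]) ! i))))"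
    unfolding mp.jac_def mp.jacobian_def rdet_def by (rule to_fract.hom_det[symmetric])
  also have "\<dots> = br (map to_fract ps)"
    unfolding fr.jac_def fr.jacobian_def rdet_def
    by (intro arg_cong[of _ _ det] eq_matI)
      (use that in \<open>auto simp: derivation_mpderiv nth_append\<close>)
  finally show ?thesis by simp
qed

lemma br_SS:
  assumes us: "set us \<subseteq> SS \<xi>" "length us = n"
  shows "br us \<in> SS \<xi>"
proof -
  have "\<forall>x\<in>set us. \<exists>p. x - to_fract p \<in> NN \<xi>" using us by (auto simp: SS_iff)
  then obtain f where f: "\<And>x. x \<in> set us \<Longrightarrow> x - to_fract (f x) \<in> NN \<xi>" by metis
  let ?ps = "map f us"
  have "br us - br (map to_fract ?ps) \<in> NN \<xi>"
  proof (rule brm.congruence[where W = "W \<xi>", OF NN_add NN_0 br_NN us(2)])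
    show "set us \<subseteq> W \<xi>" using us SS_W by blast
  qed (use us f in \<open>auto simp: W_to_fract\<close>)
  moreover have "br (map to_fract ?ps) = to_fract (mp.jac n \<Omega> ?ps)" by (rule br_to_fract) (use us in simp)
  ultimately show ?thesis using SS_iff by metis
qed

text \<open>A minimal common pole order \<open>r \<ge> 1\<close> of the \<open>Y\<^sub>j\<close> along \<open>q\<close> is impossible: the derivatives of
  \<open>\<Omega>\<close> at \<open>Y\<close> are brackets of the \<open>Y\<^sub>j\<close>, hence have poles of order at most \<open>nr + 1\<close>, and the
  expression of \<open>t\<^sub>j\<^sup>N\<close> by these derivatives gives \<open>Y\<^sub>j\<^sup>N\<close> a pole of order less than \<open>rN\<close>.\<close>

lemma core_step:
  fixes Y :: "nat \<Rightarrow> 'k mpoly fract"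
  assumes R: "\<And>a b. a \<in> R \<Longrightarrow> b \<in> R \<Longrightarrow> a + b \<in> R" "\<And>a b. a \<in> R \<Longrightarrow> b \<in> R \<Longrightarrow> a * b \<in> R"
    "\<And>a. a \<in> R \<Longrightarrow> - a \<in> R" "0 \<in> R" "1 \<in> R" "\<And>p. to_fract p \<in> R"
    and B: "\<And>us. set us \<subseteq> R \<Longrightarrow> length us = n \<Longrightarrow> br us \<in> R"
    and q: "q \<in> R" "q \<noteq> 0"
    and red: "\<And>u v m. u \<in> R \<Longrightarrow> v \<in> R \<Longrightarrow> u ^ m = q * v \<Longrightarrow> \<exists>w\<in>R. u = q * w"
    and Y0: "\<And>j. n < j \<Longrightarrow> Y j = 0"
    and bracket: "\<And>i. i \<le> n \<Longrightarrow>
      mpeval (\<lambda>c. to_fract (mpoly_const c)) Y (mpderiv i \<Omega>) - (- 1) ^ (n + i) * br (map Y (idx i)) \<in> R"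
    and pole: "\<And>j. j \<le> n \<Longrightarrow> q ^ r0 * Y j \<in> R"
    and j: "j \<le> n"
  shows "Y j \<in> R"
proof -
  have ch: "comm_ring_hom (\<lambda>c::'k. to_fract (mpoly_const c))"
    by (rule comm_ring_hom_comp[OF mpoly_const_hom to_fract_hom])
  let ?\<Phi> = "mpeval (\<lambda>c. to_fract (mpoly_const c)) Y"
  interpret ev: comm_ring_hom ?\<Phi> by (rule mpeval_hom[OF ch])
  have Rsum: "sum f A \<in> R" if "\<And>i. i \<in> A \<Longrightarrow> f i \<in> R" for f and A :: "nat set"
    using that by (induction A rule: infinite_finite_induct) (auto intro: R)
  have Rpow: "x ^ k \<in> R" if "x \<in> R" for x k
    using that by (induction k) (auto intro: R)
  define P where "P r \<longleftrightarrow> (\<forall>j\<le>n. q ^ r * Y j \<in> R)" for r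
  define r where "r = (LEAST r. P r)"
  have "P r0" using pole by (simp add: P_def)
  then have Pr: "P r" and least: "\<And>s. s < r \<Longrightarrow> \<not> P s"
    unfolding r_def by (rule LeastI, blast dest: not_less_Least)
  have "r = 0"
  proof (rule ccontr)
    assume "r \<noteq> 0"
    then obtain r' where r': "r = Suc r'" by (cases r) auto
    have qY: "q ^ r * Y j \<in> R" for j
      using Pr Y0[of j] R(4) by (cases "j \<le> n") (auto simp: P_def)
    have hc: "q ^ (r * k) * ?\<Phi> (hcomp k p) \<in> R" for k p
    proof (induction p arbitrary: k rule: mpoly_induct)
      case (const c) show ?case
        by (cases k) (auto simp: mpeval_const[OF ch] R)
    next
      case (var l)
      have "k = 0 \<or> k = 1 \<or> (\<exists>k'. k = Suc (Suc k'))" by presburger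
      then show ?case using qY[of l]
        by (auto simp: coeff_pCons mpeval_var[OF ch] R split: nat.splits)
    next
      case (add p q')
      then show ?case by (simp add: theta.hom_add ev.hom_add distrib_left R)
    next
      case (mult p p')
      have eq: "hcomp k (p * p') = (\<Sum>j\<le>k. hcomp j p * hcomp (k - j) p')"
        by (simp add: theta.hom_mult coeff_mult)
      have "q ^ (r * k) * ?\<Phi> (hcomp j p * hcomp (k - j) p') \<in> R" if "j \<le> k" for j
      proof -
        have "r * k = r * j + r * (k - j)" using that by (simp flip: distrib_left)
        then have "q ^ (r * k) * ?\<Phi> (hcomp j p * hcomp (k - j) p') =
            (q ^ (r * j) * ?\<Phi> (hcomp j p)) * (q ^ (r * (k - j)) * ?\<Phi> (hcomp (k - j) p'))"
          by (simp add: ev.hom_mult power_add mult_ac)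
        then show ?thesis using R(2)[OF mult(1)[of j] mult(2)[of "k - j"]] by simp
      qed
      then show ?case unfolding eq ev.hom_sum sum_distrib_left by (intro Rsum) auto
    qed
    have om: "q ^ (n * r + 1) * ?\<Phi> (mpderiv i \<Omega>) \<in> R" if i: "i \<le> n" for i
    proof -
      let ?us = "map Y (idx i)"
      have b: "q ^ (n * r + 1) * br ?us \<in> R"
        by (rule brm.denominators[OF R(1-5) B q(1)]) (use qY i in \<open>auto simp: length_idx\<close>)
      have s: "(- 1) ^ (n + i) \<in> R" by (intro Rpow R)
      have "q ^ (n * r + 1) * ?\<Phi> (mpderiv i \<Omega>) =
          q ^ (n * r + 1) * (?\<Phi> (mpderiv i \<Omega>) - (- 1) ^ (n + i) * br ?us) + (- 1) ^ (n + i) * (q ^ (n * r + 1) * br ?us)"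
        by (simp add: algebra_simps)
      also have "\<dots> \<in> R" by (intro R(1)[OF R(2)[OF Rpow[OF q(1)] bracket[OF i]] R(2)[OF s b]])
      finally show ?thesis .
    qed
    have "q ^ r' * Y l \<in> R" if l: "l \<le> n" for l
    proof -
      obtain c where c: "\<And>i. homog (N - (d - 1)) (c i)" "mpvar l ^ N = (\<Sum>i\<le>n. c i * mpderiv i \<Omega>)" "d - 1 \<le> N"
        using pow_homog[OF l] by blast
      let ?a = "r * (N - (d - 1))" and ?b = "n * r + 1"
      have "Y l ^ N = (\<Sum>i\<le>n. ?\<Phi> (c i) * ?\<Phi> (mpderiv i \<Omega>))"
        using arg_cong[OF c(2), of ?\<Phi>] by (simp add: ev.hom_power ev.hom_sum ev.hom_mult mpeval_var[OF ch])
      then have "q ^ (?a + ?b) * Y l ^ N = (\<Sum>i\<le>n. (q ^ ?a * ?\<Phi> (c i)) * (q ^ ?b * ?\<Phi> (mpderiv i \<Omega>)))"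
        by (simp only: sum_distrib_left power_add) (simp add: mult_ac)
      also have "\<dots> \<in> R"
      proof (rule Rsum)
        fix i assume "i \<in> {..n}"
        then have "q ^ ?b * ?\<Phi> (mpderiv i \<Omega>) \<in> R" by (intro om) simp
        moreover have "q ^ ?a * ?\<Phi> (c i) \<in> R"
          using hc[of "N - (d - 1)" "c i"] homog_hcomp_eq[OF c(1)[of i], where j = "N - (d - 1)"] by simp
        ultimately show "(q ^ ?a * ?\<Phi> (c i)) * (q ^ ?b * ?\<Phi> (mpderiv i \<Omega>)) \<in> R" using R(2) by blast
      qed
      finally have 1: "q ^ (?a + ?b) * Y l ^ N \<in> R" .
      \<comment> \<open>From d - 1 >= n + 2 and r >= 1 follows r(d - 1) >= nr + 2r >= nr + 2, so at
        least one factor q is left over beyond the exponent a + b that clears the pole.\<close>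
      have "\<exists>f. r * N = Suc f + (?a + ?b)"
      proof -
        have "r * N = ?a + r * (d - 1)" using c(3) by (simp flip: distrib_left)
        moreover have "r * (n + 2) \<le> r * (d - 1)" by (rule mult_left_mono) (use d in auto)
        moreover have "r * (n + 2) = n * r + r + r" by (simp add: algebra_simps)
        ultimately have "Suc (?a + ?b) \<le> r * N" using r' by linarith
        then show ?thesis by (metis add.commute add_Suc_right le_iff_add)
      qed
      then obtain f where f: "r * N = Suc f + (?a + ?b)" by blast
      have "(q ^ r * Y l) ^ N = q ^ (r * N) * Y l ^ N" by (simp only: power_mult_distrib power_mult)
      also have "\<dots> = q * (q ^ f * (q ^ (?a + ?b) * Y l ^ N))"
        unfolding f by (simp only: power_add[of q "Suc f"] power_Suc mult.assoc)
      finally have "(q ^ r * Y l) ^ N = q * (q ^ f * (q ^ (?a + ?b) * Y l ^ N))" .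
      moreover have "q ^ f * (q ^ (?a + ?b) * Y l ^ N) \<in> R" by (intro R(2) Rpow q 1)
      \<comment> \<open>The spare q shows that q divides a power of q^r Y_l. Reducedness makes q
        divide q^r Y_l itself, so the pole order r - 1 would do, against minimality.\<close>
      ultimately obtain w where w: "w \<in> R" "q ^ r * Y l = q * w" using red[OF qY] by blast
      then have "q * (q ^ r' * Y l) = q * w" by (simp add: r' mult_ac)
      then show ?thesis using q(2) w(1) by simp
    qed
    then have "P r'" by (simp add: P_def)
    then show False using least[of r'] r' by simp
  qed
  then show ?thesis using Pr j by (simp add: P_def)
qed

text \<open>The functions regular on the part of the fibre where g does not vanish. Lying in
  \<open>W\<close> is demanded explicitly, since g may be 0 modulo F; for g = 0 the set is all of
  \<open>W\<close>.\<close>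

definition Loc :: "'k mpoly \<Rightarrow> 'k mpoly fract set" where
  "Loc g = {x \<in> W \<xi>. \<exists>m. to_fract g ^ m * x \<in> SS \<xi>}"

lemma Loc_mono: "to_fract g ^ m * x \<in> SS \<xi> \<Longrightarrow> m \<le> m' \<Longrightarrow> to_fract g ^ m' * x \<in> SS \<xi>"
proof -
  assume x: "to_fract g ^ m * x \<in> SS \<xi>" and "m \<le> m'"
  then obtain k where "m' = k + m" by (metis le_iff_add add.commute)
  then have "to_fract g ^ m' * x = to_fract g ^ k * (to_fract g ^ m * x)" by (simp add: power_add mult.assoc)
  then show ?thesis using SS_mult[OF SS_power[OF SS_to_fract] x] by (simp only:)
qed

lemma Loc_common:
  assumes "finite A" "\<And>x. x \<in> A \<Longrightarrow> f x \<in> Loc g"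
  shows "\<exists>m. \<forall>x\<in>A. to_fract g ^ m * f x \<in> SS \<xi>"
proof -
  have "\<forall>x\<in>A. \<exists>m. to_fract g ^ m * f x \<in> SS \<xi>" using assms by (auto simp: Loc_def)
  then obtain h where h: "\<And>x. x \<in> A \<Longrightarrow> to_fract g ^ h x * f x \<in> SS \<xi>" by metis
  have "to_fract g ^ Max (h ` A) * f x \<in> SS \<xi>" if "x \<in> A" for x
    by (rule Loc_mono[OF h[OF that]]) (use assms(1) that in auto)
  then show ?thesis by blast
qed

lemma SS_Loc: "x \<in> SS \<xi> \<Longrightarrow> x \<in> Loc g"
  unfolding Loc_def by (auto intro: SS_W exI[of _ 0])

lemma Loc_W: "x \<in> Loc g \<Longrightarrow> x \<in> W \<xi>"
  by (simp add: Loc_def)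

lemma Loc_add: "x \<in> Loc g \<Longrightarrow> y \<in> Loc g \<Longrightarrow> x + y \<in> Loc g"
proof -
  assume x: "x \<in> Loc g" and y: "y \<in> Loc g"
  then obtain m m' where m: "to_fract g ^ m * x \<in> SS \<xi>" "to_fract g ^ m' * y \<in> SS \<xi>" by (auto simp: Loc_def)
  have "to_fract g ^ (m + m') * x + to_fract g ^ (m + m') * y \<in> SS \<xi>"
    by (intro SS_add Loc_mono[OF m(1)] Loc_mono[OF m(2)]) auto
  then have "to_fract g ^ (m + m') * (x + y) \<in> SS \<xi>" by (simp only: distrib_left)
  moreover have "x + y \<in> W \<xi>" by (rule W_add[OF Loc_W[OF x] Loc_W[OF y]])
  ultimately show ?thesis unfolding Loc_def by blast
qed

lemma Loc_mult: "x \<in> Loc g \<Longrightarrow> y \<in> Loc g \<Longrightarrow> x * y \<in> Loc g"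
proof -
  assume x: "x \<in> Loc g" and y: "y \<in> Loc g"
  then obtain m m' where m: "to_fract g ^ m * x \<in> SS \<xi>" "to_fract g ^ m' * y \<in> SS \<xi>" by (auto simp: Loc_def)
  from SS_mult[OF this] have "to_fract g ^ (m + m') * (x * y) \<in> SS \<xi>" by (simp add: power_add mult_ac)
  moreover have "x * y \<in> W \<xi>" by (rule W_mult[OF Loc_W[OF x] Loc_W[OF y]])
  ultimately show ?thesis unfolding Loc_def by blast
qed

lemma Loc_uminus: "x \<in> Loc g \<Longrightarrow> - x \<in> Loc g"
  using Loc_mult[OF SS_Loc[OF SS_to_fract[of "- 1"]], of x g] by (simp add: to_fract_uminus)

lemma br_Loc:
  assumes us: "set us \<subseteq> Loc g" "length us = n"
  shows "br us \<in> Loc g"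
proof -
  have "finite (set us)" "\<And>x. x \<in> set us \<Longrightarrow> x \<in> Loc g" using us by auto
  then obtain m where m: "\<And>x. x \<in> set us \<Longrightarrow> to_fract g ^ m * x \<in> SS \<xi>"
    using Loc_common[of "set us" "\<lambda>x. x" g] by meson
  have "to_fract g ^ (n * m + 1) * br us \<in> SS \<xi>"
    by (rule brm.denominators[OF SS_add SS_mult SS_uminus SS_0 SS_1 br_SS SS_to_fract us(2) m])
  moreover have "br us \<in> W \<xi>" by (rule br_W[OF _ us(2)]) (use us(1) Loc_W in blast)
  ultimately show ?thesis unfolding Loc_def by blast
qed

context
  fixes e :: "nat \<Rightarrow> 'k"
  assumes monic: "monic_along n e (F \<xi>)" and pdegF: "pdeg n e (F \<xi>) = d"
begin

lemma not_dvd_pdeg: "c \<noteq> 0 \<Longrightarrow> pdeg n e c < d \<Longrightarrow> \<not> F \<xi> dvd c"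
  using pdegF pdeg_mult[OF F_neq_0] by (auto elim!: dvdE)

abbreviation G :: "'k mpoly" where
  "G \<equiv> dirderiv n e (F \<xi>)"

text \<open>In characteristic 0 the derivative along the direction is nonzero of degree below d: the
  projection is generically etale.\<close>

lemma not_dvd_G: "\<not> F \<xi> dvd G"
proof (rule not_dvd_pdeg)
  have "pderiv (psi n e (F \<xi>)) \<noteq> 0" using pdegF d by (simp add: pderiv_eq_0_iff)
  then show "G \<noteq> 0" by (metis psi.hom_zero psi_dirderiv)
  have "pdeg n e G \<le> d - 1" unfolding psi_dirderiv using degree_pderiv_le[of "psi n e (F \<xi>)"] pdegF by simp
  then show "pdeg n e G < d" using d by simp
qed

text \<open>Clearing denominators turns u^m = q v into a congruence of polynomials modulo F and q,
  the situation of \<open>reduced_along\<close>. The factor G which that lemma costs divides p * G,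
  whose powers may be inverted here.\<close>

lemma Loc_reduced:
  assumes q: "prime_elem q" "pdeg n e q = 0" and p: "\<not> F \<xi> dvd p"
    and uv: "u \<in> Loc (p * G)" "v \<in> Loc (p * G)" "u ^ m = to_fract q * v"
  shows "\<exists>w\<in>Loc (p * G). u = to_fract q * w"
proof -
  let ?g = "p * G"
  have g: "\<not> F \<xi> dvd ?g" by (rule not_dvd_mult[OF p not_dvd_G])
  have qF: "\<not> F \<xi> dvd q" by (rule not_dvd_pdeg) (use q d in auto)
  obtain a b where a: "to_fract ?g ^ a * u \<in> SS \<xi>" and b: "to_fract ?g ^ b * v \<in> SS \<xi>"
    using uv by (auto simp: Loc_def)
  obtain p1 where p1: "to_fract ?g ^ a * u - to_fract p1 \<in> NN \<xi>" using a by (auto simp: SS_iff)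
  have uW: "u \<in> W \<xi>" by (rule Loc_W[OF uv(1)])
  have pw: "x ^ k - y ^ k \<in> NN \<xi>" if "x - y \<in> NN \<xi>" "x \<in> W \<xi>" "y \<in> W \<xi>" for x y k
  proof (induction k)
    case (Suc k)
    have yk: "y ^ k \<in> W \<xi>" using that(3) by (induction k) (auto intro: W_1 W_mult)
    have "x * (x ^ k - y ^ k) + y ^ k * (x - y) \<in> NN \<xi>"
      by (intro NN_add NN_mult that Suc yk)
    then show ?case by (simp add: algebra_simps)
  qed (simp add: NN_0)
  have gW: "to_fract ?g ^ k \<in> W \<xi>" for k using W_to_fract[of "?g ^ k"] by (simp add: to_fract.hom_power)
  have "(to_fract ?g ^ a * u) ^ m - to_fract p1 ^ m \<in> NN \<xi>"
    by (rule pw[OF p1 W_mult[OF gW uW] W_to_fract])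
  then have "to_fract ?g ^ b * ((to_fract ?g ^ a * u) ^ m - to_fract p1 ^ m) \<in> NN \<xi>" by (rule NN_mult[OF gW])
  moreover
  have "to_fract ?g ^ (a * m) * (to_fract ?g ^ b * v) \<in> SS \<xi>" by (intro SS_mult SS_power SS_to_fract b)
  then obtain p2 where p2: "to_fract ?g ^ (a * m) * (to_fract ?g ^ b * v) - to_fract p2 \<in> NN \<xi>" by (auto simp: SS_iff)
  have "to_fract q * (to_fract ?g ^ (a * m) * (to_fract ?g ^ b * v) - to_fract p2) \<in> NN \<xi>"
    by (rule NN_mult[OF W_to_fract p2])
  ultimately have D: "to_fract q * (to_fract ?g ^ (a * m) * (to_fract ?g ^ b * v) - to_fract p2) -
      to_fract ?g ^ b * ((to_fract ?g ^ a * u) ^ m - to_fract p1 ^ m) \<in> NN \<xi>" by (rule NN_diff[rotated])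
  have U: "(to_fract ?g ^ a * u) ^ m = to_fract ?g ^ (a * m) * (to_fract q * v)"
    by (simp only: power_mult_distrib uv(3) power_mult)
  have "x * (y * (z * w) - s) - z * (y * (x * w) - t) = z * t - x * s" for x y z w s t :: "'k mpoly fract"
    by (simp add: algebra_simps)
  from D[unfolded U this] have "to_fract ?g ^ b * to_fract p1 ^ m - to_fract q * to_fract p2 \<in> NN \<xi>" .
  then have "to_fract (?g ^ b * p1 ^ m - q * p2) \<in> NN \<xi>"
    by (simp only: to_fract_diff to_fract_mult to_fract.hom_power)
  then obtain z where z: "?g ^ b * p1 ^ m - q * p2 = F \<xi> * z" unfolding to_fract_NN by (rule dvdE)
  \<comment> \<open>The congruence concerns g^b p1^m with unequal exponents. Multiplying by g^m p1^b
    makes it a single power, as \<open>reduced_along\<close> requires.\<close>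
  have "(?g * p1) ^ (b + m) = ?g ^ m * p1 ^ b * (?g ^ b * p1 ^ m)"
    by (simp add: power_mult_distrib power_add mult_ac)
  also have "?g ^ b * p1 ^ m = F \<xi> * z + q * p2" using z by (simp add: algebra_simps)
  also have "?g ^ m * p1 ^ b * (F \<xi> * z + q * p2) = F \<xi> * (?g ^ m * p1 ^ b * z) + q * (?g ^ m * p1 ^ b * p2)"
    by (simp add: algebra_simps)
  finally obtain g' h' where gh: "G * (?g * p1) = F \<xi> * g' + q * h'"
    using reduced_along[OF monic q] by blast
  have "?g ^ 2 * p1 = p * (G * (?g * p1))" by (simp add: power2_eq_square mult_ac)
  also have "\<dots> = F \<xi> * (p * g') + q * (p * h')" unfolding gh by (simp add: algebra_simps)
  finally have g2: "?g ^ 2 * p1 = F \<xi> * (p * g') + q * (p * h')" .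
  have ig0: "to_fract ?g \<noteq> 0" and iq0: "to_fract q \<noteq> 0" using not_dvd_0[OF g] q by auto
  define w where "w = u / to_fract q"
  have u: "u = to_fract q * w" using iq0 by (simp add: w_def)
  have wW: "w \<in> W \<xi>" unfolding w_def by (rule W_divide[OF uW qF])
  have "to_fract ?g ^ 2 * (to_fract ?g ^ a * u - to_fract p1) + to_fract (F \<xi> * (p * g')) \<in> NN \<xi>"
    by (intro NN_add NN_mult gW p1 to_fract_NN[THEN iffD2]) simp
  also have "to_fract ?g ^ 2 * (to_fract ?g ^ a * u - to_fract p1) + to_fract (F \<xi> * (p * g')) =
      to_fract ?g ^ (a + 2) * u - to_fract (?g ^ 2 * p1 - F \<xi> * (p * g'))"
    by (simp add: to_fract_diff to_fract_mult to_fract.hom_power power_add power2_eq_square algebra_simps)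
  also have "?g ^ 2 * p1 - F \<xi> * (p * g') = q * (p * h')" using g2 by simp
  also have "to_fract ?g ^ (a + 2) * u - to_fract (q * (p * h')) =
      to_fract q * (to_fract ?g ^ (a + 2) * w - to_fract (p * h'))"
    unfolding u by (simp add: to_fract_mult algebra_simps)
  finally have "to_fract q * (to_fract ?g ^ (a + 2) * w - to_fract (p * h')) \<in> NN \<xi>" .
  from NN_divide[OF this qF] have "to_fract ?g ^ (a + 2) * w - to_fract (p * h') \<in> NN \<xi>"
    using iq0 by simp
  then have "to_fract ?g ^ (a + 2) * w \<in> SS \<xi>" using SS_iff by blast
  then have "w \<in> Loc ?g" using wW unfolding Loc_def by blast
  then show ?thesis using u by blast
qed

context
  fixes Y :: "nat \<Rightarrow> 'k mpoly fract"
  assumes Y0: "\<And>j. n < j \<Longrightarrow> Y j = 0" and Y_W: "\<And>j. j \<le> n \<Longrightarrow> Y j \<in> W \<xi>"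
    and bracket: "\<And>i. i \<le> n \<Longrightarrow>
      mpeval (\<lambda>c. to_fract (mpoly_const c)) Y (mpderiv i \<Omega>) - (- 1) ^ (n + i) * br (map Y (idx i)) \<in> NN \<xi>"
begin

text \<open>\<open>core_step\<close> over the ring \<open>Loc (p * G)\<close> with the divisor q:
  after inverting p * G, powers of q are the only denominators left, and \<open>Loc_reduced\<close>
  supplies the reducedness.\<close>

lemma remove_prime:
  assumes q: "prime_elem q" "pdeg n e q = 0" and p: "\<not> F \<xi> dvd p"
    and Y: "\<And>j. j \<le> n \<Longrightarrow> Y j \<in> Loc (q * p * G)" and j: "j \<le> n"
  shows "Y j \<in> Loc (p * G)"
proof -
  obtain r where r: "\<And>j. j \<in> {..n} \<Longrightarrow> to_fract (q * p * G) ^ r * Y j \<in> SS \<xi>"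
    using Loc_common[of "{..n}" Y "q * p * G"] Y by (meson atMost_iff finite_atMost)
  have "to_fract q ^ r * Y j \<in> Loc (p * G)" if "j \<le> n" for j
  proof -
    have "to_fract (p * G) ^ r * (to_fract q ^ r * Y j) \<in> SS \<xi>"
      using r[of j] that by (simp add: to_fract_mult power_mult_distrib mult_ac)
    moreover have "to_fract q ^ r * Y j \<in> W \<xi>"
      using W_mult[OF W_to_fract[of "q ^ r"] Y_W[OF that]] by (simp add: to_fract.hom_power)
    ultimately show ?thesis unfolding Loc_def by blast
  qed
  note pole = this
  show ?thesis
  proof (rule core_step[where R = "Loc (p * G)" and q = "to_fract q", OF Loc_add Loc_mult Loc_uminus
        SS_Loc[OF SS_0] SS_Loc[OF SS_1] SS_Loc[OF SS_to_fract] br_Loc SS_Loc[OF SS_to_fract] _ _ Y0 _ pole j])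
    show "to_fract q \<noteq> 0" using q by auto
    show "\<exists>w\<in>Loc (p * G). u = to_fract q * w"
      if "u \<in> Loc (p * G)" "v \<in> Loc (p * G)" "u ^ m = to_fract q * v" for u v m
      by (rule Loc_reduced[OF q p that])
    show "mpeval (\<lambda>c. to_fract (mpoly_const c)) Y (mpderiv i \<Omega>) - (- 1) ^ (n + i) * br (map Y (idx i)) \<in> Loc (p * G)"
      if "i \<le> n" for i
      by (rule SS_Loc[OF NN_SS[OF bracket[OF that]]])
  qed
qed

lemma remove_denominator:
  assumes "b \<noteq> 0" "pdeg n e b = 0" "\<And>j. j \<le> n \<Longrightarrow> Y j \<in> Loc (b * G)" "j \<le> n"
  shows "Y j \<in> Loc G"
proof -
  have "pdeg n e b = 0 \<longrightarrow> (\<forall>j\<le>n. Y j \<in> Loc (b * G)) \<longrightarrow> (\<forall>j\<le>n. Y j \<in> Loc G)"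
    using assms(1)
  proof (induction rule: prime_factor_induct)
    case (unit u)
    then obtain c where c: "u = mpoly_const c" "c \<noteq> 0" by (auto simp: is_unit_mpoly_iff)
    show ?case
    proof (intro impI allI)
      fix j assume "\<forall>j\<le>n. Y j \<in> Loc (u * G)" "j \<le> n"
      then obtain m where m: "to_fract (u * G) ^ m * Y j \<in> SS \<xi>" "Y j \<in> W \<xi>" by (auto simp: Loc_def)
      let ?v = "mpoly_const (inverse c)"
      have "to_fract (?v ^ m) * (to_fract (u * G) ^ m * Y j) \<in> SS \<xi>" by (rule SS_mult[OF SS_to_fract m(1)])
      also have "to_fract (?v ^ m) * (to_fract (u * G) ^ m * Y j) = (to_fract (u * ?v) * to_fract G) ^ m * Y j"
        by (simp add: to_fract.hom_power to_fract_mult power_mult_distrib mult_ac)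
      also have "u * ?v = 1" unfolding c(1) by (rule mpoly_const_inverse[OF c(2)])
      finally have "to_fract G ^ m * Y j \<in> SS \<xi>" by simp
      then show "Y j \<in> Loc G" using m(2) unfolding Loc_def by blast
    qed
  next
    case (prime q p)
    show ?case
    proof (intro impI)
      assume deg: "pdeg n e (q * p) = 0" and Y: "\<forall>j\<le>n. Y j \<in> Loc (q * p * G)"
      have "q \<noteq> 0" using prime(1) by auto
      then have dg: "pdeg n e q = 0" "pdeg n e p = 0" using deg prime(2) by (simp_all add: pdeg_mult)
      have "\<not> F \<xi> dvd p" by (rule not_dvd_pdeg) (use prime(2) dg d in auto)
      then have "\<forall>j\<le>n. Y j \<in> Loc (p * G)" using remove_prime[OF prime(1) dg(1)] Y by blast
      then show "\<forall>j\<le>n. Y j \<in> Loc G" using prime(3) dg(2) by blast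
    qed
  qed
  then show ?thesis using assms by blast
qed

text \<open>Eliminating the direction between a common denominator B and F gives a denominator of
  degree 0 along it, that is, one pulled back from the affine space below. Its prime factors are
  then removed one by one.\<close>

lemma Y_in_Loc_G: "j \<le> n \<Longrightarrow> Y j \<in> Loc G"
proof -
  have "\<forall>j\<in>{..n}. \<exists>a b. \<not> F \<xi> dvd b \<and> Y j = to_fract a / to_fract b" using Y_W by (auto simp: W_def)
  then obtain a b where ab: "\<And>j. j \<le> n \<Longrightarrow> \<not> F \<xi> dvd b j" "\<And>j. j \<le> n \<Longrightarrow> Y j = to_fract (a j) / to_fract (b j)"
    by (metis atMost_iff)
  define B where "B = (\<Prod>j\<le>n. b j)"
  have "\<not> F \<xi> dvd (\<Prod>j\<in>A. b j)" if "A \<subseteq> {..n}" for A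
  proof -
    have "finite A" using finite_subset[OF that] by simp
    then show ?thesis using that
    proof (induction A rule: finite_induct)
      case (insert i A)
      then have "\<not> F \<xi> dvd b i * prod b A" by (intro not_dvd_mult ab(1)) auto
      then show ?case using insert.hyps by simp
    qed (simp add: not_dvd_1)
  qed
  then have B: "\<not> F \<xi> dvd B" by (simp add: B_def)
  have "pdeg n e (F \<xi>) > 0" using pdegF d by simp
  then obtain x z where xz: "B * x + F \<xi> * z \<noteq> 0" "pdeg n e (B * x + F \<xi> * z) = 0"
    using elimination[OF prime_F _ B] by blast
  let ?c = "B * x + F \<xi> * z"
  have "Y j \<in> Loc (?c * G)" if j: "j \<le> n" for j
  proof -
    have b0: "to_fract (b j) \<noteq> 0" using ab(1)[OF j] not_dvd_0 by simp
    have "B = b j * (\<Prod>i\<in>{..n} - {j}. b i)" unfolding B_def using j by (subst prod.remove[of _ j]) auto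
    then have 1: "to_fract B * Y j = to_fract (a j * (\<Prod>i\<in>{..n} - {j}. b i))"
      using b0 by (simp add: ab(2)[OF j] to_fract_mult)
    have 2: "to_fract ?c * Y j = to_fract x * (to_fract B * Y j) + (to_fract z * Y j) * to_fract (F \<xi>)"
      by (simp add: to_fract_add to_fract_mult algebra_simps)
    have "to_fract (F \<xi>) \<in> NN \<xi>" by (simp add: to_fract_NN)
    then have "to_fract ?c * Y j \<in> SS \<xi>"
      unfolding 2 1 by (intro SS_add SS_mult SS_to_fract NN_SS[OF NN_mult] W_mult W_to_fract Y_W[OF j])
    then have "to_fract G * (to_fract ?c * Y j) \<in> SS \<xi>" by (rule SS_mult[OF SS_to_fract])
    then have "to_fract (?c * G) ^ 1 * Y j \<in> SS \<xi>" by (simp add: to_fract_mult mult_ac)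
    then show ?thesis using Y_W[OF j] unfolding Loc_def by blast
  qed
  from remove_denominator[OF xz this] show "j \<le> n \<Longrightarrow> Y j \<in> Loc G" by blast
qed

end

text \<open>Depth two: the forms \<open>tau n e (mpvar 0)\<close> and \<open>tau n e (mpvar 1)\<close> and \<open>F\<close> are a regular
  sequence, since \<open>F\<close> is monic along \<open>e\<close>.\<close>

lemma depth_two:
  assumes y: "y \<in> W \<xi>" and s: "y \<in> Loc (tau n e (mpvar 0))" "y \<in> Loc (tau n e (mpvar 1))"
  shows "y \<in> SS \<xi>"
proof -
  let ?s = "\<lambda>l. tau n e (mpvar l) :: 'k mpoly"
  obtain a b where "to_fract (?s 0) ^ a * y \<in> SS \<xi>" "to_fract (?s 1) ^ b * y \<in> SS \<xi>"
    using s by (auto simp: Loc_def)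
  then have m: "to_fract (?s 0) ^ (a + b) * y \<in> SS \<xi>" "to_fract (?s 1) ^ (a + b) * y \<in> SS \<xi>"
    using Loc_mono by auto
  let ?m = "a + b"
  obtain p0 p1 where p: "to_fract (?s 0) ^ ?m * y - to_fract p0 \<in> NN \<xi>" "to_fract (?s 1) ^ ?m * y - to_fract p1 \<in> NN \<xi>"
    using m by (auto simp: SS_iff)
  have sW: "to_fract (?s l) ^ ?m \<in> W \<xi>" for l using W_to_fract[of "?s l ^ ?m"] by (simp add: to_fract.hom_power)
  have "to_fract (?s 0) ^ ?m * (to_fract (?s 1) ^ ?m * y - to_fract p1) -
      to_fract (?s 1) ^ ?m * (to_fract (?s 0) ^ ?m * y - to_fract p0) \<in> NN \<xi>"
    by (intro NN_diff NN_mult sW p)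
  also have "to_fract (?s 0) ^ ?m * (to_fract (?s 1) ^ ?m * y - to_fract p1) -
      to_fract (?s 1) ^ ?m * (to_fract (?s 0) ^ ?m * y - to_fract p0) =
      to_fract (?s 1 ^ ?m * p0 - ?s 0 ^ ?m * p1)"
    by (simp add: to_fract_diff to_fract_mult to_fract.hom_power algebra_simps)
  finally obtain z where z: "?s 1 ^ ?m * p0 - ?s 0 ^ ?m * p1 = F \<xi> * z" unfolding to_fract_NN by (rule dvdE)
  obtain Q0 R0 where Q0: "p0 = F \<xi> * Q0 + chi n e R0" "Polynomial.degree R0 < pdeg n e (F \<xi>) \<or> R0 = 0"
    "psi n e p0 = psi n e (F \<xi>) * psi n e Q0 + R0" by (rule monic_division[OF monic])
  obtain Q1 R1 where Q1: "p1 = F \<xi> * Q1 + chi n e R1" "Polynomial.degree R1 < pdeg n e (F \<xi>) \<or> R1 = 0"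
    "psi n e p1 = psi n e (F \<xi>) * psi n e Q1 + R1" by (rule monic_division[OF monic])
  have psis: "psi n e (?s l ^ ?m) = [:mpvar l ^ ?m:]" if "l < n" for l
    unfolding psi.hom_power psi_tau using that by (simp add: tau_var poly_const_pow)
  let ?P = "psi n e (F \<xi>)"
  have "psi n e (?s 1 ^ ?m) * psi n e p0 - psi n e (?s 0 ^ ?m) * psi n e p1 = ?P * psi n e z"
    using arg_cong[OF z, of "psi n e"] by (simp only: psi.hom_minus psi.hom_mult)
  then have "[:mpvar 1 ^ ?m:] * (?P * psi n e Q0 + R0) - [:mpvar 0 ^ ?m:] * (?P * psi n e Q1 + R1) = ?P * psi n e z"
    using n2 by (simp only: psis Q0(3) Q1(3))
  then have eq: "[:mpvar 1 ^ ?m:] * R0 - [:mpvar 0 ^ ?m:] * R1 =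
      ?P * (psi n e z - [:mpvar 1 ^ ?m:] * psi n e Q0 + [:mpvar 0 ^ ?m:] * psi n e Q1)"
    by (simp only: algebra_simps)
  \<comment> \<open>Both remainders have degree below d, while their combination is a multiple of F,
    of degree d along the direction. So the congruence modulo F is an equality of
    remainders.\<close>
  have "[:mpvar 1 ^ ?m:] * R0 - [:mpvar 0 ^ ?m:] * R1 = 0"
  proof (rule ccontr)
    assume n0: "\<not> ?thesis"
    have "Polynomial.degree ([:mpvar 1 ^ ?m:] * R0 - [:mpvar 0 ^ ?m:] * R1) < d"
    proof -
      have "Polynomial.degree ([:c:] * R0) < d" "Polynomial.degree ([:c:] * R1) < d" for c
        using Q0(2) Q1(2) pdegF d degree_smult_le[of c R0] degree_smult_le[of c R1] by auto
      then show ?thesis by (rule degree_diff_less)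
    qed
    moreover have "?P dvd [:mpvar 1 ^ ?m:] * R0 - [:mpvar 0 ^ ?m:] * R1" unfolding eq by simp
    from dvd_imp_degree_le[OF this n0]
    have "d \<le> Polynomial.degree ([:mpvar 1 ^ ?m:] * R0 - [:mpvar 0 ^ ?m:] * R1)" unfolding pdegF .
    ultimately show False by simp
  qed
  then have "[:mpvar 1 ^ ?m:] * R0 = [:mpvar 0 ^ ?m:] * R1" by simp
  then have "mpvar 1 ^ ?m * Polynomial.coeff R0 k = mpvar 0 ^ ?m * Polynomial.coeff R1 k" for k
    by (metis coeff_smult mult_pCons_left pCons_0_0 add.right_neutral mult_zero_left)
  \<comment> \<open>In the straightened coordinates the two forms are t_0 and t_1. As t_0 is prime
    and does not divide t_1^m, its m-th power divides every coefficient of R0, and the quotient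
    gives the polynomial representing y.\<close>
  then have dvd1: "mpvar 0 ^ ?m dvd mpvar 1 ^ ?m * Polynomial.coeff R0 k" for k by simp
  have nd: "\<not> (mpvar 0 :: 'k mpoly) dvd mpvar 1 ^ ?m"
  proof
    assume "(mpvar 0 :: 'k mpoly) dvd mpvar 1 ^ ?m"
    then have "(mpvar 0 :: 'k mpoly) dvd mpvar 1" by (rule prime_elem_dvd_power[OF prime_mpvar])
    then have "tau 0 (\<lambda>_. 0) (mpvar 0 :: 'k mpoly) dvd tau 0 (\<lambda>_. 0) (mpvar 1)" by (rule tau.hom_dvd)
    then have "(mpvar 1 :: 'k mpoly) = 0" by (simp add: tau_var)
    then show False using mpvar_neq_0 by blast
  qed
  have "mpvar 0 ^ ?m dvd Polynomial.coeff R0 k" for k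
    by (rule prime_elem_power_dvd_cancel[OF prime_mpvar nd dvd1])
  then have "[:mpvar 0 ^ ?m:] dvd R0" by (simp add: const_poly_dvd_iff)
  then obtain R' where "R0 = [:mpvar 0 ^ ?m:] * R'" by (auto elim: dvdE)
  then have chi: "chi n e R0 = ?s 0 ^ ?m * chi n e R'"
    by (simp only: chi.hom_mult chi_const_poly tau.hom_power)
  have s0: "\<not> F \<xi> dvd ?s 0 ^ ?m"
  proof (rule not_dvd_pdeg)
    have "psi n e (?s 0 ^ ?m) = [:mpvar 0 ^ ?m:]" using psis n2 by simp
    then show "pdeg n e (?s 0 ^ ?m) < d" using d by simp
    show "?s 0 ^ ?m \<noteq> 0" using \<open>psi n e (?s 0 ^ ?m) = [:mpvar 0 ^ ?m:]\<close> mpvar_neq_0[of 0]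
      by (metis pCons_eq_0_iff power_not_zero psi.hom_zero)
  qed
  have "(to_fract (?s 0) ^ ?m * y - to_fract p0) + to_fract (F \<xi> * Q0) \<in> NN \<xi>"
    by (intro NN_add p to_fract_NN[THEN iffD2]) simp
  also have "(to_fract (?s 0) ^ ?m * y - to_fract p0) + to_fract (F \<xi> * Q0) =
      to_fract (?s 0 ^ ?m) * (y - to_fract (chi n e R'))"
    unfolding Q0(1) chi by (simp add: to_fract_add to_fract_mult to_fract.hom_power algebra_simps)
  finally have "to_fract (?s 0 ^ ?m) * (y - to_fract (chi n e R')) \<in> NN \<xi>" .
  from NN_divide[OF this s0] have "to_fract (?s 0 ^ ?m) * (y - to_fract (chi n e R')) / to_fract (?s 0 ^ ?m) \<in> NN \<xi>" .
  moreover have "to_fract (?s 0 ^ ?m) \<noteq> 0" using not_dvd_0[OF s0] to_fract_eq_0_iff by blast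
  ultimately have "y - to_fract (chi n e R') \<in> NN \<xi>" by (simp only: nonzero_mult_div_cancel_left not_False_eq_True)
  then show ?thesis using SS_iff by blast
qed

end

text \<open>Every term of the expansion of (g + h)^(a + b) contains g^a or h^b. With the next
  lemmas, the polynomials g for which a fixed y of \<open>W\<close> lies in \<open>Loc g\<close>
  form a radical ideal.\<close>

lemma Loc_ideal_add:
  assumes "y \<in> Loc g" "y \<in> Loc h"
  shows "y \<in> Loc (g + h)"
proof -
  obtain a b where a: "to_fract g ^ a * y \<in> SS \<xi>" and b: "to_fract h ^ b * y \<in> SS \<xi>"
    using assms by (auto simp: Loc_def)
  have "to_fract (g + h) ^ (a + b) * y =
      (\<Sum>k\<le>a + b. of_nat ((a + b) choose k) * to_fract g ^ k * to_fract h ^ (a + b - k) * y)"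
    by (simp add: to_fract_add binomial_ring sum_distrib_right)
  also have "\<dots> \<in> SS \<xi>"
  proof (rule SS_sum)
    fix k assume "k \<in> {..a + b}"
    then consider "a \<le> k" | "b \<le> a + b - k" by fastforce
    then have "to_fract g ^ k * to_fract h ^ (a + b - k) * y \<in> SS \<xi>"
    proof cases
      case 1
      from SS_mult[OF SS_power[OF SS_to_fract[of h], of "a + b - k"] Loc_mono[OF a 1]] show ?thesis by (simp add: mult_ac)
    next
      case 2
      from SS_mult[OF SS_power[OF SS_to_fract[of g], of k] Loc_mono[OF b 2]] show ?thesis by (simp add: mult_ac)
    qed
    from SS_mult[OF SS_to_fract[of "of_nat ((a + b) choose k)"] this]
    show "of_nat ((a + b) choose k) * to_fract g ^ k * to_fract h ^ (a + b - k) * y \<in> SS \<xi>"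
      by (simp add: to_fract.hom_of_nat mult_ac)
  qed
  finally show ?thesis using assms unfolding Loc_def by blast
qed

lemma Loc_ideal_mult: "y \<in> Loc g \<Longrightarrow> y \<in> Loc (c * g)"
proof -
  assume y: "y \<in> Loc g"
  then obtain a where a: "to_fract g ^ a * y \<in> SS \<xi>" by (auto simp: Loc_def)
  from SS_mult[OF SS_power[OF SS_to_fract[of c]] this, of a]
  have "to_fract (c * g) ^ a * y \<in> SS \<xi>" by (simp add: to_fract_mult power_mult_distrib mult_ac)
  then show ?thesis using y unfolding Loc_def by blast
qed

lemma Loc_ideal_power: "y \<in> Loc (g ^ k) \<Longrightarrow> y \<in> Loc g"
proof -
  assume y: "y \<in> Loc (g ^ k)"
  then obtain a where "to_fract (g ^ k) ^ a * y \<in> SS \<xi>" by (auto simp: Loc_def)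
  then have "to_fract g ^ (k * a) * y \<in> SS \<xi>" by (simp add: to_fract.hom_power power_mult)
  then show ?thesis using y unfolding Loc_def by blast
qed

lemma Loc_ideal_0: "y \<in> W \<xi> \<Longrightarrow> y \<in> Loc 0"
  unfolding Loc_def by (auto intro!: exI[of _ 1] SS_0)

lemma Loc_ideal_sum:
  assumes "y \<in> W \<xi>" "\<And>i. i \<in> A \<Longrightarrow> y \<in> Loc (f i)"
  shows "y \<in> Loc (sum f A)"
  using assms(2) by (induction A rule: infinite_finite_induct) (auto intro: Loc_ideal_0 Loc_ideal_add assms(1))

lemma good_direction:
  assumes "mpeval (\<lambda>c. c) (e(n := 1)) \<Omega> \<noteq> 0"
  shows "monic_along n e (F \<xi>)" "pdeg n e (F \<xi>) = d"
  using monic_along_homog[OF \<Omega>_homog _ assms, of \<xi>] d by (simp_all add: F_def)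

lemma exists_good_direction: "\<exists>e. mpeval (\<lambda>c. c) (e(n := 1)) \<Omega> \<noteq> 0"
proof -
  \<comment> \<open>The extra factor forces a point with nonzero n-th coordinate, which homogeneity
    allows to be scaled to 1.\<close>
  have "\<Omega> * mpvar n \<noteq> 0" using \<Omega>_neq_0 mpvar_neq_0 by simp
  then obtain x where "mpeval (\<lambda>c. c) x (\<Omega> * mpvar n) \<noteq> 0" using nonvanishing_point by blast
  then have x: "mpeval (\<lambda>c. c) x \<Omega> \<noteq> 0" "x n \<noteq> 0"
    by (simp_all add: mpeval_mult[OF comm_ring_hom_id] mpeval_var[OF comm_ring_hom_id])
  let ?e = "\<lambda>l. inverse (x n) * x l"
  have "mpeval (\<lambda>c. c) ?e \<Omega> \<noteq> 0" using eval_scale[OF \<Omega>_homog, of "inverse (x n)" x] x by simp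
  moreover have "?e = ?e(n := 1)" using x(2) by auto
  ultimately show ?thesis by metis
qed

text \<open>Along one coordinate of e, \<Omega> is a nonzero univariate polynomial and has finitely
  many zeros. Subtracting the derivatives of F in two such directions isolates a single partial
  derivative of \<Omega>.\<close>

lemma nearby_good_direction:
  assumes "mpeval (\<lambda>c. c) (e(n := 1)) \<Omega> \<noteq> 0" "l < n"
  shows "\<exists>x. x \<noteq> 0 \<and> mpeval (\<lambda>c. c) ((e(l := e l + x))(n := 1)) \<Omega> \<noteq> 0"
proof -
  let ?h = "\<lambda>j. if j = l then [:e l, 1:] else [:(e(n := 1)) j:]"
  let ?P = "mpeval (\<lambda>c. [:c:]) ?h \<Omega>"
  have "(\<lambda>p. poly (mpeval (\<lambda>c. [:c:]) ?h p) x) = mpeval (\<lambda>c::'k. c) ((e(l := e l + x))(n := 1))" for x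
    by (rule comm_ring_hom_eq[OF comm_ring_hom_comp[OF mpeval_hom[OF comm_ring_hom_const_poly] comm_ring_hom_poly] eval_hom])
      (use assms(2) in \<open>auto simp: mpeval_const[OF comm_ring_hom_const_poly] mpeval_var[OF comm_ring_hom_const_poly]
        mpeval_const[OF comm_ring_hom_id] mpeval_var[OF comm_ring_hom_id]\<close>)
  from fun_cong[OF this, of \<Omega>]
  have P: "poly ?P x = mpeval (\<lambda>c. c) ((e(l := e l + x))(n := 1)) \<Omega>" for x by simp
  have "poly ?P 0 \<noteq> 0" unfolding P using assms(1) by simp
  then have "?P \<noteq> 0" by (metis poly_0)
  then obtain x where "poly ?P x \<noteq> 0" "x \<noteq> 0" using infinite_nonroots by blast
  then show ?thesis unfolding P by blast
qed

text \<open>The g with Y_j in \<open>Loc g\<close> form a radical ideal. It contains the derivatives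
  of F in all good directions, hence by differences all partial derivatives of \<Omega>, hence by
  \<open>pow\<close> all variables; \<open>depth_two\<close> then leaves no denominator.\<close>

theorem substitution_regular:
  fixes Y :: "nat \<Rightarrow> 'k mpoly fract"
  assumes Y0: "\<And>j. n < j \<Longrightarrow> Y j = 0" and Y_W: "\<And>j. j \<le> n \<Longrightarrow> Y j \<in> W \<xi>"
    and bracket: "\<And>i. i \<le> n \<Longrightarrow>
      mpeval (\<lambda>c. to_fract (mpoly_const c)) Y (mpderiv i \<Omega>) - (- 1) ^ (n + i) * br (map Y (idx i)) \<in> NN \<xi>"
    and j: "j \<le> n"
  shows "Y j \<in> SS \<xi>"
proof -
  let ?y = "Y j"
  have yW: "?y \<in> W \<xi>" by (rule Y_W[OF j])
  have dirF: "dirderiv n e (F \<xi>) = mpderiv n \<Omega> + (\<Sum>l<n. mpoly_const (e l) * mpderiv l \<Omega>)" for e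
    unfolding dirderiv_eq[OF F_in] by (simp add: F_def derivation.diff[OF derivation_mpderiv])
  have dir: "?y \<in> Loc (mpderiv n \<Omega> + (\<Sum>l<n. mpoly_const (e l) * mpderiv l \<Omega>))"
    if "mpeval (\<lambda>c. c) (e(n := 1)) \<Omega> \<noteq> 0" for e
    using Y_in_Loc_G[OF good_direction[OF that] Y0 Y_W bracket j] by (simp only: dirF)
  obtain e where e: "mpeval (\<lambda>c. c) (e(n := 1)) \<Omega> \<noteq> 0" using exists_good_direction by blast
  have l: "?y \<in> Loc (mpderiv l \<Omega>)" if l: "l < n" for l
  proof -
    obtain x where x: "x \<noteq> 0" "mpeval (\<lambda>c. c) ((e(l := e l + x))(n := 1)) \<Omega> \<noteq> 0"
      using nearby_good_direction[OF e l] by blast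
    let ?D = "\<lambda>e. mpderiv n \<Omega> + (\<Sum>l<n. mpoly_const (e l) * mpderiv l \<Omega>)"
    have sum: "(\<Sum>i<n. mpoly_const ((e(l := y)) i) * mpderiv i \<Omega>) =
        mpoly_const y * mpderiv l \<Omega> + (\<Sum>i\<in>{..<n} - {l}. mpoly_const (e i) * mpderiv i \<Omega>)" for y
      using l by (subst sum.remove[of _ l]) (auto intro!: sum.cong)
    have "?D (e(l := e l + x)) + (- 1) * ?D e = mpoly_const x * mpderiv l \<Omega>"
      using sum[of "e l + x"] sum[of "e l"] by (simp add: mpoly_const_add algebra_simps)
    moreover have "?y \<in> Loc (?D (e(l := e l + x)) + (- 1) * ?D e)"
      by (rule Loc_ideal_add[OF dir[OF x(2)] Loc_ideal_mult[OF dir[OF e]]])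
    ultimately have "?y \<in> Loc (mpoly_const x * mpderiv l \<Omega>)" by simp
    then have "?y \<in> Loc (mpoly_const (inverse x) * (mpoly_const x * mpderiv l \<Omega>))" by (rule Loc_ideal_mult)
    moreover have "mpoly_const (inverse x) * (mpoly_const x * mpderiv l \<Omega>) =
        (mpoly_const x * mpoly_const (inverse x)) * mpderiv l \<Omega>"
      by (simp only: mult_ac)
    ultimately show ?thesis by (simp only: mpoly_const_inverse[OF x(1)] mult_1_left)
  qed
  have nn: "?y \<in> Loc (mpderiv n \<Omega>)"
  proof -
    have "?y \<in> Loc ((mpderiv n \<Omega> + (\<Sum>l<n. mpoly_const (e l) * mpderiv l \<Omega>)) +
        (- 1) * (\<Sum>l<n. mpoly_const (e l) * mpderiv l \<Omega>))"
      by (intro Loc_ideal_add[OF dir[OF e]] Loc_ideal_mult Loc_ideal_sum yW l) simp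
    then show ?thesis by simp
  qed
  have all: "?y \<in> Loc (mpderiv l \<Omega>)" if "l \<le> n" for l
    using l[of l] nn that by (cases "l = n") auto
  have t: "?y \<in> Loc (mpvar i)" if i: "i \<le> n" for i
  proof -
    obtain c where "mpvar i ^ N = (\<Sum>l\<le>n. c l * mpderiv l \<Omega>)" using pow[OF i] by blast
    moreover have "?y \<in> Loc (\<Sum>l\<le>n. c l * mpderiv l \<Omega>)"
      by (intro Loc_ideal_sum yW Loc_ideal_mult all) simp
    ultimately show ?thesis using Loc_ideal_power[of ?y "mpvar i" N] by simp
  qed
  have s: "?y \<in> Loc (tau n e (mpvar i))" if "i < n" for i
  proof -
    have "?y \<in> Loc (mpvar i + (- mpoly_const (e i)) * mpvar n)"
      by (intro Loc_ideal_add Loc_ideal_mult t) (use that in auto)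
    then show ?thesis using that by (simp add: tau_var)
  qed
  show ?thesis
    by (rule depth_two[OF good_direction[OF e] yW s s]) (use n2 in auto)
qed

end

end

section \<open>Algebras given as records, and powers of the variables from finite dimension\<close>

section \<open>Algebras and Nambu-Poisson algebras as images of subrings\<close>

lemma list_of_images:
  assumes "set us \<subseteq> f ` C"
  obtains vs where "us = map f vs" "set vs \<subseteq> C"
proof -
  have "us \<in> lists (f ` C)" using assms by auto
  then obtain vs where "vs \<in> lists C" "us = map f vs" unfolding lists_image by auto
  then show ?thesis using that by auto
qed

text \<open>A record algebra presented by representatives in a type-class ring, with h as the class
  map, in general not injective. Its axioms then follow from computations with representatives;
  polynomial rings, fibres and their fraction fields all have this shape.\<close>

locale algebra_image =
  fixes C :: "'r::comm_ring_1 set" and cst :: "'k::field \<Rightarrow> 'r" and h :: "'r \<Rightarrow> 'b"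
    and P :: "('k, 'b, 'm) module_scheme"
  assumes C_add: "a \<in> C \<Longrightarrow> b \<in> C \<Longrightarrow> a + b \<in> C" and C_mult: "a \<in> C \<Longrightarrow> b \<in> C \<Longrightarrow> a * b \<in> C"
    and C_uminus: "a \<in> C \<Longrightarrow> - a \<in> C" and C_0: "0 \<in> C" and C_1: "1 \<in> C"
    and cst_hom: "comm_ring_hom cst" and cst_C: "cst c \<in> C"
    and carrier: "carrier P = h ` C"
    and add: "a \<in> C \<Longrightarrow> b \<in> C \<Longrightarrow> h a \<oplus>\<^bsub>P\<^esub> h b = h (a + b)"
    and mult: "a \<in> C \<Longrightarrow> b \<in> C \<Longrightarrow> h a \<otimes>\<^bsub>P\<^esub> h b = h (a * b)"
    and zero: "\<zero>\<^bsub>P\<^esub> = h 0" and one: "\<one>\<^bsub>P\<^esub> = h 1"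
    and smult: "a \<in> C \<Longrightarrow> c \<odot>\<^bsub>P\<^esub> h a = h (cst c * a)"
begin

lemma cring_P: "cring P"
proof (rule cringI)
  show "abelian_group P"
  proof (rule abelian_groupI)
    fix x assume "x \<in> carrier P"
    then obtain a where a: "x = h a" "a \<in> C" by (auto simp: carrier)
    then have "h (- a) \<oplus>\<^bsub>P\<^esub> x = \<zero>\<^bsub>P\<^esub>" by (simp add: add C_uminus zero)
    then show "\<exists>y\<in>carrier P. y \<oplus>\<^bsub>P\<^esub> x = \<zero>\<^bsub>P\<^esub>" using a C_uminus by (auto simp: carrier)
  qed (auto simp: carrier add zero C_0 C_add add.assoc add.commute add.left_commute)
  show "comm_monoid P"
    by (rule comm_monoidI) (auto simp: carrier mult one C_1 C_mult mult.assoc mult.commute mult.left_commute)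
qed (auto simp: carrier add mult C_add C_mult distrib_right)

lemma algebra_P: "algebra class_ring P"
proof -
  interpret cst: comm_ring_hom cst by (rule cst_hom)
  show ?thesis
  proof (rule algebraI[OF _ cring_P])
    show "cring (class_ring :: 'k ring)" by (rule domain.axioms(1)[OF field.axioms(1)[OF class_field]])
  qed (auto simp: carrier add mult smult C_add C_mult cst_C cst.hom_add cst.hom_mult cst.hom_one
      distrib_right distrib_left mult.assoc)
qed

lemma finsum_image:
  assumes "finite A" "\<And>a. a \<in> A \<Longrightarrow> f a \<in> C"
  shows "(\<Oplus>\<^bsub>P\<^esub>a\<in>A. h (f a)) = h (sum f A)"
proof -
  interpret P: cring P by (rule cring_P)
  have "(\<Oplus>\<^bsub>P\<^esub>a\<in>A. h (f a)) = h (sum f A) \<and> sum f A \<in> C"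
    using assms
  proof (induction A rule: finite_induct)
    case (insert a A)
    have fa: "f a \<in> C" using insert.prems by simp
    have c: "(\<lambda>a. h (f a)) \<in> A \<rightarrow> carrier P" using insert.prems by (auto simp: carrier)
    have "h (f a) \<in> carrier P" using fa by (auto simp: carrier)
    from P.finsum_insert[OF insert.hyps(1,2) c this] show ?case
      using insert fa by (simp add: add C_add)
  qed (simp add: zero C_0)
  then show ?thesis ..
qed

end

locale nambu_image = algebra_image C cst h P + D: commuting_derivations D
  for C :: "'r::comm_ring_1 set" and cst :: "'k::field \<Rightarrow> 'r" and h :: "'r \<Rightarrow> 'b"
    and P :: "('k, 'b, 'm) nambu_scheme" and D :: "nat \<Rightarrow> 'r \<Rightarrow> 'r" +
  fixes n :: nat and w :: 'r
  assumes n: "0 < n" and D_C: "a \<in> C \<Longrightarrow> D j a \<in> C" and w_C: "w \<in> C" and D_cst: "D j (cst c) = 0"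
    and bracket: "set us \<subseteq> C \<Longrightarrow> length us = n \<Longrightarrow> bracket P (map h us) = h (D.jac n w us)"
begin

lemma jac_C: "set us \<subseteq> C \<Longrightarrow> length us = n \<Longrightarrow> D.jac n w us \<in> C"
  by (rule D.jac_in) (auto intro: C_add C_mult C_uminus C_0 C_1 D_C w_C)

lemma update_C: "set us \<subseteq> C \<Longrightarrow> x \<in> C \<Longrightarrow> set (us[i := x]) \<subseteq> C"
  using set_update_subset_insert[of us i x] by blast

lemma nambu_P: "nambu_poisson_algebra n P"
proof -
  interpret algebra class_ring P by (rule algebra_P)
  show ?thesis
  proof (rule nambu_poisson_algebra.intro[OF algebra_P], rule nambu_poisson_algebra_axioms.intro)
    fix us :: "'b list" assume us: "set us \<subseteq> carrier P" and len: "length us = n"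
    obtain vs where vs: "us = map h vs" "set vs \<subseteq> C" by (rule list_of_images[OF us[unfolded carrier]])
    have lvs: "length vs = n" using len vs by simp
    have upd: "bracket P (us[i := h a]) = h (D.jac n w (vs[i := a]))" if "a \<in> C" for a i
    proof -
      have "us[i := h a] = map h (vs[i := a])" by (simp add: vs map_update)
      then show ?thesis using bracket[OF update_C[OF vs(2) that], of i] lvs by simp
    qed
    have jC: "D.jac n w (vs[i := a]) \<in> C" if "a \<in> C" for a i
      by (rule jac_C[OF update_C[OF vs(2) that]]) (simp add: lvs)
    show "bracket P us \<in> carrier P"
      using bracket[OF vs(2) lvs] jac_C[OF vs(2) lvs] by (simp add: vs carrier)
    {
      fix i assume i: "i < n"
      interpret d: derivation "\<lambda>x. D.jac n w (vs[i := x])" by (rule D.derivation_jac[OF lvs i])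
      fix x assume "x \<in> carrier P"
      then obtain a where a: "x = h a" "a \<in> C" by (auto simp: carrier)
      show "bracket P (us[i := c \<odot>\<^bsub>P\<^esub> x]) = c \<odot>\<^bsub>P\<^esub> bracket P (us[i := x])" for c
      proof -
        have "D.jac n w (vs[i := cst c]) = 0" by (rule D.jac_constant[OF lvs i D_cst])
        then show ?thesis using a by (simp add: smult upd C_mult cst_C jC d.leibniz)
      qed
      fix y assume "y \<in> carrier P"
      then obtain b where b: "y = h b" "b \<in> C" by (auto simp: carrier)
      show "bracket P (us[i := x \<oplus>\<^bsub>P\<^esub> y]) = bracket P (us[i := x]) \<oplus>\<^bsub>P\<^esub> bracket P (us[i := y])"
        using a b by (simp add: add upd C_add jC d.add)
      show "bracket P (us[i := x \<otimes>\<^bsub>P\<^esub> y]) =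
          x \<otimes>\<^bsub>P\<^esub> bracket P (us[i := y]) \<oplus>\<^bsub>P\<^esub> y \<otimes>\<^bsub>P\<^esub> bracket P (us[i := x])"
        using a b by (simp add: add mult upd C_mult C_add jC d.leibniz)
    }
    show "bracket P us = \<zero>\<^bsub>P\<^esub>" if i: "i < n" "j < n" "i \<noteq> j" "us ! i = us ! j" for i j
    proof -
      have viC: "vs ! i \<in> C" using vs(2) lvs i(1) by (auto simp: subset_iff)
      have "us = us[j := h (vs ! i)]" using i lvs by (metis list_update_id nth_map vs(1))
      then have "bracket P us = h (D.jac n w (vs[j := vs ! i]))" using upd[OF viC, of j] by metis
      also have "D.jac n w (vs[j := vs ! i]) = 0"
        by (rule D.jac_alternating[of _ n i j]) (use i lvs in auto)
      finally show ?thesis by (simp add: algebra_image.zero[OF algebra_image_axioms])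
    qed
    fix us' :: "'b list" assume us': "set us' \<subseteq> carrier P" and len': "length us' = n - 1"
    obtain vs' where vs': "us' = map h vs'" "set vs' \<subseteq> C" by (rule list_of_images[OF us'[unfolded carrier]])
    have l': "length vs' = n - 1" using len' vs' by simp
    have cons: "bracket P (h a # us') = h (D.jac n w (a # vs'))" "D.jac n w (a # vs') \<in> C" if "a \<in> C" for a
      using bracket[of "a # vs'"] jac_C[of "a # vs'"] that vs' l' n by simp_all
    have "bracket P (bracket P us # us') = h (D.jac n w (D.jac n w vs # vs'))"
      using bracket[OF vs(2) lvs] cons(1)[OF jac_C[OF vs(2) lvs]] by (simp add: vs)
    also have "D.jac n w (D.jac n w vs # vs') = (\<Sum>s<n. D.jac n w (vs[s := D.jac n w (vs ! s # vs')]))"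
      by (rule D.jac_fundamental_identity[OF lvs l' n])
    also have "h \<dots> = (\<Oplus>\<^bsub>P\<^esub>s\<in>{..<n}. h (D.jac n w (vs[s := D.jac n w (vs ! s # vs')])))"
    proof (rule finsum_image[symmetric])
      fix s assume "s \<in> {..<n}"
      then have "vs ! s \<in> C" using vs(2) lvs by (auto simp: subset_iff)
      then show "D.jac n w (vs[s := D.jac n w (vs ! s # vs')]) \<in> C" by (intro jC cons)
    qed simp
    also have "\<dots> = (\<Oplus>\<^bsub>P\<^esub>s\<in>{..<n}. bracket P (us[s := bracket P (us ! s # us')]))"
    proof (rule finsum_cong')
      fix s assume "s \<in> {..<n}"
      then have s: "vs ! s \<in> C" "us ! s = h (vs ! s)" using vs lvs by (auto simp: subset_iff)
      show "h (D.jac n w (vs[s := D.jac n w (vs ! s # vs')])) = bracket P (us[s := bracket P (us ! s # us')])"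
        unfolding s(2) cons(1)[OF s(1)] by (rule upd[OF cons(2)[OF s(1)], symmetric])
    next
      show "(\<lambda>s. bracket P (us[s := bracket P (us ! s # us')])) \<in> {..<n} \<rightarrow> carrier P"
      proof
        fix s assume "s \<in> {..<n}"
        then have s: "vs ! s \<in> C" "us ! s = h (vs ! s)" using vs lvs by (auto simp: subset_iff)
        show "bracket P (us[s := bracket P (us ! s # us')]) \<in> carrier P"
          unfolding s(2) cons(1)[OF s(1)] upd[OF cons(2)[OF s(1)]]
          using jC[OF cons(2)[OF s(1)]] by (auto simp: carrier)
      qed
    qed simp
    finally show "bracket P (bracket P us # us') = (\<Oplus>\<^bsub>P\<^esub>s\<in>{..<n}. bracket P (us[s := bracket P (us ! s # us')]))" .
  qed
qed

end


section \<open>Quotients of polynomial algebras\<close>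

text \<open>Formulated for an arbitrary record extension because it is applied both to
  \<open>mpoly_algebra\<close> and to \<open>jacobian_nambu\<close>.\<close>

locale typed_mpoly_algebra =
  fixes m :: nat and A :: "('k::field, 'k mpoly, 'x) module_scheme"
  assumes carrier: "carrier A = polys_in {..<m}" and mult: "monoid.mult A = (*)" and one: "monoid.one A = 1"
    and zero: "ring.zero A = 0" and add: "ring.add A = (+)" and smult: "module.smult A = (\<lambda>c p. mpoly_const c * p)"
begin

lemma image_id: "algebra_image (polys_in {..<m}) mpoly_const (\<lambda>p. p) A"
  by unfold_locales
    (auto simp: carrier mult one zero add smult polys_in_add polys_in_mult mpoly_const_add mpoly_const_mult)

lemma cring_A: "cring A"
  by (rule algebra_image.cring_P[OF image_id])

lemma ring_A: "ring A"
  using cring_A by (rule cring.axioms)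

lemma idealI_typed:
  assumes "I \<subseteq> polys_in {..<m}" "0 \<in> I" "\<And>a b. a \<in> I \<Longrightarrow> b \<in> I \<Longrightarrow> a + b \<in> I"
    "\<And>a c. a \<in> I \<Longrightarrow> c \<in> polys_in {..<m} \<Longrightarrow> c * a \<in> I"
  shows "ideal I A"
proof (rule idealI[OF ring_A])
  interpret A: cring A by (rule cring_A)
  have um: "- a \<in> I" if "a \<in> I" for a using assms(4)[OF that, of "- 1"] by simp
  show "subgroup I (add_monoid A)"
  proof
    fix x assume x: "x \<in> I"
    have "\<ominus>\<^bsub>A\<^esub> x = - x"
      by (rule A.minus_equality) (use x assms(1) um in \<open>auto simp: carrier add zero\<close>)
    then show "inv\<^bsub>add_monoid A\<^esub> x \<in> I" using um[OF x] by (simp add: a_inv_def)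
  qed (use assms in \<open>auto simp: carrier add zero\<close>)
qed (use assms in \<open>auto simp: carrier mult mult.commute\<close>)

lemma coset: "I +>\<^bsub>A\<^esub> a = (\<lambda>h. h + a) ` I"
  by (auto simp: a_r_coset_def' add)

context
  fixes I assumes I: "ideal I A"
begin

interpretation I: ideal I A by (rule I)
interpretation A: cring A by (rule cring_A)

lemma I_0: "0 \<in> I"
  using additive_subgroup.zero_closed[OF I.is_additive_subgroup] by (simp add: zero)

lemma I_add: "a \<in> I \<Longrightarrow> b \<in> I \<Longrightarrow> a + b \<in> I"
  using additive_subgroup.a_closed[OF I.is_additive_subgroup] by (simp add: add)

lemma I_mult: "a \<in> I \<Longrightarrow> c \<in> polys_in {..<m} \<Longrightarrow> c * a \<in> I"
  using I.I_l_closed by (simp add: mult carrier)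

lemma I_uminus: "a \<in> I \<Longrightarrow> - a \<in> I"
  using I_mult[of a "- 1"] by simp

lemma I_diff: "a \<in> I \<Longrightarrow> b \<in> I \<Longrightarrow> a - b \<in> I"
  using I_add[of a "- b"] I_uminus by simp

lemma mem_coset: "x \<in> I +>\<^bsub>A\<^esub> a \<longleftrightarrow> x - a \<in> I"
  unfolding coset by (auto intro: image_eqI[of _ _ "x - a"])

lemma coset_eq: "I +>\<^bsub>A\<^esub> a = I +>\<^bsub>A\<^esub> b \<longleftrightarrow> a - b \<in> I"
proof
  assume "I +>\<^bsub>A\<^esub> a = I +>\<^bsub>A\<^esub> b"
  moreover have "a \<in> I +>\<^bsub>A\<^esub> a" by (simp add: mem_coset I_0)
  ultimately show "a - b \<in> I" by (simp add: mem_coset)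
next
  assume ab: "a - b \<in> I"
  have "x - a \<in> I \<longleftrightarrow> x - b \<in> I" for x
    using I_add[OF _ ab, of "x - a"] I_diff[OF _ ab, of "x - b"] by auto
  then show "I +>\<^bsub>A\<^esub> a = I +>\<^bsub>A\<^esub> b" by (auto simp: mem_coset)
qed

lemma image_quotient: "algebra_image (polys_in {..<m}) mpoly_const (\<lambda>a. I +>\<^bsub>A\<^esub> a) (quotient_algebra A I)"
proof
  show "carrier (quotient_algebra A I) = (\<lambda>a. I +>\<^bsub>A\<^esub> a) ` polys_in {..<m}"
    by (auto simp: quotient_algebra_def ring.defs module.defs FactRing_def A_RCOSETS_def' carrier)
  fix a b :: "'k mpoly" and c :: 'k assume ab: "a \<in> polys_in {..<m}"
  show "c \<odot>\<^bsub>quotient_algebra A I\<^esub> (I +>\<^bsub>A\<^esub> a) = I +>\<^bsub>A\<^esub> (mpoly_const c * a)"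
  proof -
    have "I +>\<^bsub>A\<^esub> (c \<odot>\<^bsub>A\<^esub> x) = I +>\<^bsub>A\<^esub> (mpoly_const c * a)" if "x \<in> I +>\<^bsub>A\<^esub> a" for x
    proof -
      have "mpoly_const c * (x - a) \<in> I" using that by (intro I_mult) (auto simp: mem_coset)
      then show ?thesis by (simp add: coset_eq smult right_diff_distrib)
    qed
    moreover have "a \<in> I +>\<^bsub>A\<^esub> a" by (simp add: mem_coset I_0)
    ultimately have "(\<Union>x\<in>I +>\<^bsub>A\<^esub> a. I +>\<^bsub>A\<^esub> (c \<odot>\<^bsub>A\<^esub> x)) = I +>\<^bsub>A\<^esub> (mpoly_const c * a)" by blast
    then show ?thesis by (simp add: quotient_algebra_def ring.defs module.defs)
  qed
  assume b: "b \<in> polys_in {..<m}"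
  show "(I +>\<^bsub>A\<^esub> a) \<oplus>\<^bsub>quotient_algebra A I\<^esub> (I +>\<^bsub>A\<^esub> b) = I +>\<^bsub>A\<^esub> (a + b)"
    using I.a_rcos_sum[of a b] ab b by (simp add: quotient_algebra_def ring.defs module.defs FactRing_def carrier add)
  show "(I +>\<^bsub>A\<^esub> a) \<otimes>\<^bsub>quotient_algebra A I\<^esub> (I +>\<^bsub>A\<^esub> b) = I +>\<^bsub>A\<^esub> (a * b)"
    using I.rcoset_mult_add[of a b] ab b by (simp add: quotient_algebra_def ring.defs module.defs FactRing_def carrier mult)
next
  show "\<zero>\<^bsub>quotient_algebra A I\<^esub> = I +>\<^bsub>A\<^esub> 0"
    by (simp add: quotient_algebra_def ring.defs module.defs FactRing_def coset)
  show "\<one>\<^bsub>quotient_algebra A I\<^esub> = I +>\<^bsub>A\<^esub> 1"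
    by (simp add: quotient_algebra_def ring.defs module.defs FactRing_def one)
qed (auto simp: polys_in_add polys_in_mult mpoly_const_hom)

end

end

lemma typed_mpoly_algebra: "typed_mpoly_algebra m (mpoly_algebra m)"
  by unfold_locales (simp_all add: mpoly_algebra_def polys_in_def)

lemma typed_jacobian_nambu: "typed_mpoly_algebra (n + 1) (jacobian_nambu n \<Omega>)"
  by unfold_locales (simp_all add: jacobian_nambu_def module.defs nambu.defs mpoly_algebra_def polys_in_def)

lemma bracket_jacobian_nambu: "bracket (jacobian_nambu n \<Omega>) us = mp.jac n \<Omega> us"
  by (simp add: jacobian_nambu_def module.defs nambu.defs mp.jac_def mp.jacobian_def rdet_def)


section \<open>Powers of the variables in the Jacobian ideal\<close>

text \<open>Cofactors range over the ring in all variables, so this is an ideal of that ring; it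
  contains the Jacobian ideal, which is generated inside m variables.\<close>

definition deriv_span :: "nat \<Rightarrow> 'k::field mpoly \<Rightarrow> 'k mpoly set" where
  "deriv_span m \<Omega> = {p. \<exists>c. p = (\<Sum>i<m. c i * mpderiv i \<Omega>)}"

lemma deriv_spanI: "(\<Sum>i<m. c i * mpderiv i \<Omega>) \<in> deriv_span m \<Omega>"
  by (auto simp: deriv_span_def)

lemma deriv_span_hcomp:
  assumes "homog d \<Omega>" "d > 0" "p \<in> deriv_span m \<Omega>"
  shows "hcomp k p \<in> deriv_span m \<Omega>"
proof -
  obtain c where c: "p = (\<Sum>i<m. c i * mpderiv i \<Omega>)" using assms(3) by (auto simp: deriv_span_def)
  have h: "homog (d - 1) (mpderiv i \<Omega>)" for i using homog_mpderiv[of "d - 1" \<Omega> i] assms by simp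
  have "hcomp k p = (\<Sum>i<m. (if d - 1 \<le> k then hcomp (k - (d - 1)) (c i) else 0) * mpderiv i \<Omega>)"
    unfolding c by (simp add: theta.hom_sum coeff_sum hcomp_mult_homog[OF h] if_distrib[of "\<lambda>x. x * _"] cong: if_cong)
  then show ?thesis by (simp only: deriv_spanI)
qed

lemma deriv_span_mult: "p \<in> deriv_span m \<Omega> \<Longrightarrow> q * p \<in> deriv_span m \<Omega>"
proof -
  assume "p \<in> deriv_span m \<Omega>"
  then obtain c where "p = (\<Sum>i<m. c i * mpderiv i \<Omega>)" by (auto simp: deriv_span_def)
  then have "q * p = (\<Sum>i<m. (q * c i) * mpderiv i \<Omega>)" by (simp add: sum_distrib_left mult.assoc)
  then show ?thesis by (simp only: deriv_spanI)
qed

lemma deriv_span_add: "p \<in> deriv_span m \<Omega> \<Longrightarrow> q \<in> deriv_span m \<Omega> \<Longrightarrow> p + q \<in> deriv_span m \<Omega>"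
proof -
  assume "p \<in> deriv_span m \<Omega>" "q \<in> deriv_span m \<Omega>"
  then obtain b c where "p = (\<Sum>i<m. b i * mpderiv i \<Omega>)" "q = (\<Sum>i<m. c i * mpderiv i \<Omega>)" by (auto simp: deriv_span_def)
  then have "p + q = (\<Sum>i<m. (b i + c i) * mpderiv i \<Omega>)" by (simp add: distrib_right sum.distrib)
  then show ?thesis by (simp only: deriv_spanI)
qed

text \<open>In a finite-dimensional quotient the powers of t_j satisfy a linear relation. The ideal
  is homogeneous and distinct powers have distinct degrees, so each power occurring in the relation
  lies in the ideal by itself.\<close>

lemma isolated_singularity_powers:
  fixes \<Omega> :: "'k::field mpoly"
  assumes iso: "isolated_singularity_potential m \<Omega>" and hom: "homog d \<Omega>" "d > 0" and j: "j < m"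
  shows "\<exists>k. mpvar j ^ k \<in> deriv_span m \<Omega>"
proof -
  interpret A: typed_mpoly_algebra m "mpoly_algebra m :: ('k, 'k mpoly) module"
    by (rule typed_mpoly_algebra)
  interpret cr: cring "mpoly_algebra m :: ('k, 'k mpoly) module" by (rule A.cring_A)
  let ?J = "jacobian_ideal m \<Omega>"
  have \<Omega>: "\<Omega> \<in> polys_in {..<m}"
    and fd: "vectorspace.fin_dim class_ring (quotient_algebra (mpoly_algebra m) ?J)"
    using iso by (simp_all add: isolated_singularity_potential_def)
  have gen: "(\<lambda>i. mpderiv i \<Omega>) ` {..<m} \<subseteq> carrier (mpoly_algebra m)"
    using mpderiv_in[OF \<Omega>] by auto
  have J: "ideal ?J (mpoly_algebra m)"
    unfolding jacobian_ideal_def by (rule cr.genideal_ideal[OF gen])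
  have JD: "?J \<subseteq> deriv_span m \<Omega>"
  proof -
    have "ideal (deriv_span m \<Omega> \<inter> polys_in {..<m}) (mpoly_algebra m)"
    proof (rule A.idealI_typed)
      show "0 \<in> deriv_span m \<Omega> \<inter> polys_in {..<m}" using deriv_spanI[of "\<lambda>_. 0" \<Omega> m] by simp
    qed (auto intro: deriv_span_add deriv_span_mult polys_in_add polys_in_mult)
    moreover have "(\<lambda>i. mpderiv i \<Omega>) ` {..<m} \<subseteq> deriv_span m \<Omega> \<inter> polys_in {..<m}"
    proof clarify
      fix i assume i: "i < m"
      have "(\<Sum>l<m. (if l = i then 1 else 0) * mpderiv l \<Omega>) = mpderiv i \<Omega>"
        using i by (simp add: if_distrib[of "\<lambda>x. x * _"] cong: if_cong)
      then show "mpderiv i \<Omega> \<in> deriv_span m \<Omega> \<inter> polys_in {..<m}"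
        using mpderiv_in[OF \<Omega>, of i] deriv_spanI[of "\<lambda>l. if l = i then 1 else 0" \<Omega> m] by simp
    qed
    ultimately show ?thesis
      unfolding jacobian_ideal_def using cr.genideal_minimal by blast
  qed
  let ?V = "quotient_algebra (mpoly_algebra m) ?J"
  let ?h = "\<lambda>a. ?J +>\<^bsub>mpoly_algebra m\<^esub> a"
  interpret im: algebra_image "polys_in {..<m}" mpoly_const ?h ?V
    by (rule A.image_quotient[OF J])
  interpret alg: algebra class_ring ?V by (rule im.algebra_P)
  interpret V: vectorspace class_ring ?V
    by (rule vectorspace.intro[OF alg.module class_field])
  have tin: "mpvar j ^ k \<in> polys_in {..<m}" for k using j by (intro polys_in_power) simp
  have hc: "hcomp k (mpvar j ^ l :: 'k mpoly) = (if k = l then mpvar j ^ l else 0)" for k l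
    using homog_hcomp_eq[OF homog_power[OF homog_var, of l j], of k] by simp
  define v where "v k = ?h (mpvar j ^ k)" for k
  show ?thesis
  \<comment> \<open>The indices 0, ..., dim give dim + 1 powers: either two of their classes
    coincide, which is already a relation, or the classes are too many to be independent.\<close>
  proof (cases "inj_on v {..V.dim}")
    case False
    then obtain k l where kl: "k \<noteq> l" "v k = v l" by (auto simp: inj_on_def)
    then have "mpvar j ^ k - mpvar j ^ l \<in> deriv_span m \<Omega>" using JD by (auto simp: v_def A.coset_eq[OF J])
    then have "hcomp k (mpvar j ^ k - mpvar j ^ l) \<in> deriv_span m \<Omega>" by (rule deriv_span_hcomp[OF hom])
    then have "mpvar j ^ k \<in> deriv_span m \<Omega>" using kl(1) by (simp add: theta.hom_minus hc)
    then show ?thesis by blast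
  next
    case True
    have vc: "v ` {..V.dim} \<subseteq> carrier ?V" using tin by (auto simp: v_def im.carrier)
    have "alg.lin_dep (v ` {..V.dim})"
    proof (rule ccontr)
      assume "\<not> ?thesis"
      from V.li_le_dim(2)[OF fd vc this] show False using card_image[OF True] by simp
    qed
    then obtain B a x where B: "finite B" "B \<subseteq> v ` {..V.dim}" "alg.lincomb a B = \<zero>\<^bsub>?V\<^esub>" "x \<in> B" "a x \<noteq> 0"
      unfolding alg.lin_dep_def by (auto simp: class_ring_simps)
    define K where "K = {k \<in> {..V.dim}. v k \<in> B}"
    have BK: "B = v ` K" using B(2) by (auto simp: K_def)
    have injK: "inj_on v K" using True by (rule inj_on_subset) (auto simp: K_def)
    have "alg.lincomb a B = (\<Oplus>\<^bsub>?V\<^esub>k\<in>K. a (v k) \<odot>\<^bsub>?V\<^esub> v k)"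
      unfolding alg.lincomb_def BK
    proof (rule alg.M.finsum_reindex[OF _ injK])
      show "(\<lambda>x. a x \<odot>\<^bsub>?V\<^esub> x) \<in> v ` K \<rightarrow> carrier ?V"
      proof
        fix x assume "x \<in> v ` K"
        then obtain k where k: "x = ?h (mpvar j ^ k)" by (auto simp: v_def)
        show "a x \<odot>\<^bsub>?V\<^esub> x \<in> carrier ?V"
          unfolding k im.smult[OF tin] im.carrier by (intro imageI polys_in_mult tin) simp
      qed
    qed
    also have "\<dots> = (\<Oplus>\<^bsub>?V\<^esub>k\<in>K. ?h (mpoly_const (a (v k)) * mpvar j ^ k))"
      by (simp add: v_def im.smult[OF tin])
    also have "\<dots> = ?h (\<Sum>k\<in>K. mpoly_const (a (v k)) * mpvar j ^ k)"
      by (rule im.finsum_image) (auto simp: K_def intro!: polys_in_mult tin)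
    finally have "?h (\<Sum>k\<in>K. mpoly_const (a (v k)) * mpvar j ^ k) = ?h 0" using B(3) by (simp add: im.zero)
    then have "(\<Sum>k\<in>K. mpoly_const (a (v k)) * mpvar j ^ k) \<in> deriv_span m \<Omega>"
      using JD by (auto simp: A.coset_eq[OF J])
    moreover obtain k where k: "k \<in> K" "a (v k) \<noteq> 0" using B(4,5) BK by auto
    ultimately have 1: "hcomp k (\<Sum>k\<in>K. mpoly_const (a (v k)) * mpvar j ^ k) \<in> deriv_span m \<Omega>"
      using deriv_span_hcomp[OF hom] by blast
    have "hcomp k (\<Sum>l\<in>K. mpoly_const (a (v l)) * mpvar j ^ l) =
        (\<Sum>l\<in>K. if l = k then mpoly_const (a (v k)) * mpvar j ^ k else 0)"
      unfolding theta.hom_sum coeff_sum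
      by (rule sum.cong) (auto simp: theta.hom_mult hc)
    also have "\<dots> = mpoly_const (a (v k)) * mpvar j ^ k" using k by (simp add: K_def)
    finally have "mpoly_const (a (v k)) * mpvar j ^ k \<in> deriv_span m \<Omega>" using 1 by simp
    then have "mpoly_const (inverse (a (v k))) * (mpoly_const (a (v k)) * mpvar j ^ k) \<in> deriv_span m \<Omega>"
      by (rule deriv_span_mult)
    also have "mpoly_const (inverse (a (v k))) * (mpoly_const (a (v k)) * mpvar j ^ k) =
        (mpoly_const (a (v k)) * mpoly_const (inverse (a (v k)))) * mpvar j ^ k"
      by (simp only: mult_ac)
    also have "\<dots> = mpvar j ^ k" by (simp only: mpoly_const_inverse[OF k(2)] mult_1_left)
    finally show ?thesis by blast
  qed
qed

lemma isolated_singularity_imp_potential: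
  fixes \<Omega> :: "'k::field_char_0 mpoly"
  assumes "2 \<le> n" "isolated_singularity_potential (n + 1) \<Omega>" "total_degree \<Omega> \<ge> n + 3"
  shows "\<exists>N. potential n \<Omega> (total_degree \<Omega>) N"
proof -
  have \<Omega>: "\<Omega> \<in> polys_in {..n}" and ex: "\<exists>d. homogeneous d \<Omega>"
    using assms(2) by (simp_all add: isolated_singularity_potential_def lessThan_Suc_atMost)
  then have hom: "homog (total_degree \<Omega>) \<Omega>"
    using total_degree_homogeneous[of _ \<Omega>] assms(3) by (auto simp: homog_iff)
  have "\<forall>j\<in>{..n}. \<exists>k. mpvar j ^ k \<in> deriv_span (n + 1) \<Omega>"
    using isolated_singularity_powers[OF assms(2) hom] assms(3) by auto
  then obtain k where k: "\<And>j. j \<le> n \<Longrightarrow> mpvar j ^ k j \<in> deriv_span (n + 1) \<Omega>" by (metis atMost_iff)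
  define N where "N = Max (k ` {..n})"
  have "\<exists>c. mpvar j ^ N = (\<Sum>i\<le>n. c i * mpderiv i \<Omega>)" if j: "j \<le> n" for j
  proof -
    have "k j \<le> N" unfolding N_def using j by (intro Max_ge) auto
    then have "mpvar j ^ N = mpvar j ^ (N - k j) * (mpvar j ^ k j :: 'k mpoly)" by (simp flip: power_add)
    also have "\<dots> \<in> deriv_span (n + 1) \<Omega>" by (rule deriv_span_mult[OF k[OF j]])
    finally show ?thesis by (auto simp: deriv_span_def lessThan_Suc_atMost)
  qed
  then have "potential n \<Omega> (total_degree \<Omega>) N"
    by unfold_locales (use assms \<Omega> hom in auto)
  then show ?thesis by blast
qed

section \<open>The Dixmier property of the fibre and of its fraction field\<close>

section \<open>Fibres\<close>

text \<open>With representatives Y_j of the images of the variables, a morphism is substitution of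
  the Y_j on every polynomial. The map g embeds polynomials among the representatives: the identity
  for the fibre, \<open>to_fract\<close> for its fraction field.\<close>

lemma (in nambu_image) hom_polynomial:
  fixes g :: "'k mpoly \<Rightarrow> 'r"
  assumes \<phi>: "\<phi> \<in> nambu_hom n P P" and g: "comm_ring_hom g" "\<And>c. g (mpoly_const c) = cst c"
    and gV: "\<And>j. j \<in> V \<Longrightarrow> g (mpvar j) \<in> C"
    and Y: "\<And>j. j \<in> V \<Longrightarrow> Y j \<in> C" "\<And>j. j \<in> V \<Longrightarrow> \<phi> (h (g (mpvar j))) = h (Y j)"
    and p: "p \<in> polys_in V"
  shows "g p \<in> C" "mpeval cst Y p \<in> C" "\<phi> (h (g p)) = h (mpeval cst Y p)"
proof -
  interpret g: comm_ring_hom g by (rule g(1))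
  interpret ev: comm_ring_hom "mpeval cst Y" by (rule mpeval_hom[OF cst_hom])
  have \<phi>': "\<phi> (h a \<oplus>\<^bsub>P\<^esub> h b) = \<phi> (h a) \<oplus>\<^bsub>P\<^esub> \<phi> (h b)" "\<phi> (h a \<otimes>\<^bsub>P\<^esub> h b) = \<phi> (h a) \<otimes>\<^bsub>P\<^esub> \<phi> (h b)"
    "\<phi> \<one>\<^bsub>P\<^esub> = \<one>\<^bsub>P\<^esub>" "\<phi> (c \<odot>\<^bsub>P\<^esub> h a) = c \<odot>\<^bsub>P\<^esub> \<phi> (h a)" if "a \<in> C" "b \<in> C" for a b c
    using \<phi> that by (auto simp: nambu_hom_def Ring.ring_hom_def carrier)
  have "g p \<in> C \<and> mpeval cst Y p \<in> C \<and> \<phi> (h (g p)) = h (mpeval cst Y p)"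
    using p
  proof (induction rule: polys_in_induct)
    case (const c)
    have "\<phi> (h (cst c * 1)) = h (cst c * 1)"
      using \<phi>'(3)[OF C_1 C_1] \<phi>'(4)[OF C_1 C_1, of c] smult[OF C_1, of c] by (simp add: one)
    then show ?case by (simp add: g(2) cst_C mpeval_const[OF cst_hom])
  next
    case (var i) then show ?case using gV Y by (simp add: mpeval_var[OF cst_hom])
  next
    case (add p q)
    then have "\<phi> (h (g p + g q)) = h (mpeval cst Y p + mpeval cst Y q)"
      using \<phi>'(1)[of "g p" "g q"] by (simp add: algebra_image.add[OF algebra_image_axioms])
    then show ?case using add by (simp add: g.hom_add ev.hom_add C_add)
  next
    case (mult p q)
    then have "\<phi> (h (g p * g q)) = h (mpeval cst Y p * mpeval cst Y q)"
      using \<phi>'(2)[of "g p" "g q"] by (simp add: algebra_image.mult[OF algebra_image_axioms])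
    then show ?case using mult by (simp add: g.hom_mult ev.hom_mult C_mult)
  qed
  then show "g p \<in> C" "mpeval cst Y p \<in> C" "\<phi> (h (g p)) = h (mpeval cst Y p)" by auto
qed

lemma (in nambu_image) hom_bracket:
  assumes \<phi>: "\<phi> \<in> nambu_hom n P P" and len: "length js = n"
    and x: "\<And>j. j \<in> set js \<Longrightarrow> x j \<in> C" and Y: "\<And>j. j \<in> set js \<Longrightarrow> Y j \<in> C"
    and xY: "\<And>j. j \<in> set js \<Longrightarrow> \<phi> (h (x j)) = h (Y j)"
  shows "\<phi> (h (D.jac n w (map x js))) = h (D.jac n w (map Y js))"
proof -
  have 1: "set (map x js) \<subseteq> C" "set (map Y js) \<subseteq> C" using x Y by auto
  have br: "\<phi> (bracket P us) = bracket P (map \<phi> us)" if "set us \<subseteq> h ` C" "length us = n" for us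
    using \<phi> that unfolding nambu_hom_def carrier by simp
  have "\<phi> (bracket P (map h (map x js))) = bracket P (map \<phi> (map h (map x js)))"
    by (rule br) (use x len in auto)
  also have "map \<phi> (map h (map x js)) = map h (map Y js)" using xY by simp
  finally show ?thesis using bracket[OF 1(1)] bracket[OF 1(2)] len by simp
qed

context potential
begin

lemma idx_alt: "i \<le> n \<Longrightarrow> idx i = [0..<i] @ [Suc i..<n + 1]"
proof -
  assume i: "i \<le> n"
  have "[0..<n + 1] = [0..<i] @ i # [Suc i..<n + 1]"
    using i upt_add_eq_append[of 0 i "n + 1 - i"] by (simp add: upt_conv_Cons)
  moreover have "filter (\<lambda>j. j \<noteq> i) [0..<i] = [0..<i]" "filter (\<lambda>j. j \<noteq> i) [Suc i..<n + 1] = [Suc i..<n + 1]"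
    by (auto simp: filter_id_conv)
  ultimately show ?thesis by (simp add: idx_def)
qed

text \<open>Variable i is missing from the list, so column i of the matrix is zero except in the
  gradient row of \<Omega>. Deleting that row and column leaves the identity matrix.\<close>

lemma jac_vars:
  assumes i: "i \<le> n"
  shows "mp.jac n \<Omega> (map mpvar (idx i)) = (- 1) ^ (n + i) * mpderiv i \<Omega>"
proof -
  let ?us = "map mpvar (idx i) @ [\<Omega>]"
  let ?A = "mat (n + 1) (n + 1) (\<lambda>(r, j). mpderiv j (?us ! r))"
  have len: "length (idx i) = n" by (rule length_idx[OF i])
  have nth: "idx i ! r = insert_index i r" if "r < n" for r
    using that i by (simp add: idx_alt nth_append insert_index_def del: upt_Suc)
  have "mp.jac n \<Omega> (map mpvar (idx i)) = (\<Sum>r<n+1. ?A $$ (r, i) * cofactor ?A r i)"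
    unfolding mp.jac_def mp.jacobian_def rdet_def
    by (rule laplace_expansion_column) (use i in auto)
  also have "\<dots> = (\<Sum>r<n+1. if r = n then mpderiv i \<Omega> * cofactor ?A n i else 0)"
  proof (rule sum.cong)
    fix r assume r: "r \<in> {..<n + 1}"
    have "mpderiv i (?us ! r) = 0" if "r < n"
      using that len set_idx[of i] nth_mem[of r "idx i"] by (auto simp: nth_append mpderiv_var)
    then show "?A $$ (r, i) * cofactor ?A r i = (if r = n then mpderiv i \<Omega> * cofactor ?A n i else 0)"
      using r i len by (auto simp: nth_append)
  qed simp
  also have "\<dots> = mpderiv i \<Omega> * cofactor ?A n i" by simp
  also have "mat_delete ?A n i = 1\<^sub>m n"
  proof (rule eq_matI)
    fix r s assume rs: "r < dim_row (1\<^sub>m n :: 'k mpoly mat)" "s < dim_col (1\<^sub>m n :: 'k mpoly mat)"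
    then have "mat_delete ?A n i $$ (r, s) = mpderiv (insert_index i s) (mpvar (insert_index i r))"
      using i len nth[of r] by (auto simp: mat_delete_def nth_append insert_index_def)
    also have "\<dots> = (1\<^sub>m n :: 'k mpoly mat) $$ (r, s)"
      using rs by (auto simp: mpderiv_var insert_index_def)
    finally show "mat_delete ?A n i $$ (r, s) = (1\<^sub>m n :: 'k mpoly mat) $$ (r, s)" .
  qed auto
  then have "cofactor ?A n i = (- 1) ^ (n + i)" by (simp add: cofactor_def)
  finally show ?thesis by (simp add: mult.commute)
qed

text \<open>The step common to both halves of the theorem. E is the class of a polynomial, in the
  fibre or in its fraction field, and \<psi> is an endomorphism composed with E. \<open>gen\<close>
  says that the endomorphism sends the variables to classes of polynomials.\<close>

lemma surjective_if_on_generators: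
  fixes E \<psi> :: "'k mpoly \<Rightarrow> 'b"
  assumes E: "\<And>a b. a \<in> polys_in {..n} \<Longrightarrow> b \<in> polys_in {..n} \<Longrightarrow> E a = E b \<longleftrightarrow> F \<xi> dvd a - b"
    and gen: "\<And>j. j \<le> n \<Longrightarrow> \<exists>y\<in>polys_in {..n}. \<psi> (mpvar j) = E y"
    and poly: "\<And>Y p. (\<And>j. j \<le> n \<Longrightarrow> Y j \<in> polys_in {..n} \<and> \<psi> (mpvar j) = E (Y j)) \<Longrightarrow>
      p \<in> polys_in {..n} \<Longrightarrow> \<psi> p = E (mpeval mpoly_const Y p)"
    and brk: "\<And>Y i. (\<And>j. j \<le> n \<Longrightarrow> Y j \<in> polys_in {..n} \<and> \<psi> (mpvar j) = E (Y j)) \<Longrightarrow> i \<le> n \<Longrightarrow>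
      \<psi> (mp.jac n \<Omega> (map mpvar (idx i))) = E (mp.jac n \<Omega> (map Y (idx i)))"
    and inj: "\<And>a b. a \<in> polys_in {..n} \<Longrightarrow> b \<in> polys_in {..n} \<Longrightarrow> \<psi> a = \<psi> b \<Longrightarrow> F \<xi> dvd a - b"
    and p: "p \<in> polys_in {..n}"
  shows "\<exists>q\<in>polys_in {..n}. \<psi> q = E p"
proof -
  let ?C = "polys_in {..n} :: 'k mpoly set"
  \<comment> \<open>Representatives of least total degree modulo F are chosen, as the leading form
    argument of \<open>tdeg_le_1\<close> demands.\<close>
  have "\<exists>y. (y \<in> ?C \<and> \<psi> (mpvar j) = E y) \<and> (\<forall>y'. y' \<in> ?C \<and> \<psi> (mpvar j) = E y' \<longrightarrow> tdeg y \<le> tdeg y')"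
    if j: "j \<le> n" for j
  proof -
    obtain y where "y \<in> ?C \<and> \<psi> (mpvar j) = E y" using gen[OF j] by blast
    from ex_has_least_nat[of "\<lambda>y. y \<in> ?C \<and> \<psi> (mpvar j) = E y", OF this, of tdeg] show ?thesis by blast
  qed
  then obtain Y' where Y': "\<And>j. j \<le> n \<Longrightarrow> Y' j \<in> ?C \<and> \<psi> (mpvar j) = E (Y' j)"
    "\<And>j y. j \<le> n \<Longrightarrow> y \<in> ?C \<Longrightarrow> \<psi> (mpvar j) = E y \<Longrightarrow> tdeg (Y' j) \<le> tdeg y" by metis
  \<comment> \<open>The value 0 beyond n keeps the degrees bounded at all indices of the ambient
    polynomial type.\<close>
  define Y where "Y j = (if j \<le> n then Y' j else 0)" for j
  have Y: "Y j \<in> ?C \<and> \<psi> (mpvar j) = E (Y j)" if "j \<le> n" for j using Y'(1)[OF that] that by (simp add: Y_def)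
  have min: "tdeg (Y j) \<le> tdeg (Y j - F \<xi> * c)" if "j \<le> n" "c \<in> ?C" for j c
  proof -
    have "Y j - F \<xi> * c \<in> ?C" using Y[OF that(1)] that(2) by (intro polys_in_diff polys_in_mult F_in) auto
    moreover from this have "E (Y j) = E (Y j - F \<xi> * c)" using Y[OF that(1)] E[of "Y j" "Y j - F \<xi> * c"] by simp
    ultimately show ?thesis using Y'(2)[OF that(1), of "Y j - F \<xi> * c"] Y[OF that(1)] that(1) by (simp add: Y_def)
  qed
  let ?\<Phi> = "mpeval mpoly_const Y"
  interpret ev: comm_ring_hom ?\<Phi> by (rule mpeval_hom[OF mpoly_const_hom])
  have \<Phi>C: "?\<Phi> p \<in> ?C" if "p \<in> ?C" for p
    by (rule mpeval_in[OF mpoly_const_hom that]) (use Y in \<open>auto intro: polys_in_add polys_in_mult\<close>)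
  have bracket: "F \<xi> dvd ?\<Phi> (mpderiv i \<Omega>) - (- 1) ^ (n + i) * mp.jac n \<Omega> (map Y (idx i))" if i: "i \<le> n" for i
  proof -
    let ?J = "mp.jac n \<Omega> (map Y (idx i))" and ?s = "(- 1) ^ (n + i) :: 'k mpoly"
    have sC: "?s \<in> ?C" by (intro polys_in_power) simp
    have dC: "?s * mpderiv i \<Omega> \<in> ?C" by (intro polys_in_mult sC mpderiv_in \<Omega>_in)
    have JC: "?J \<in> ?C"
      by (rule mp.jac_in) (use Y set_idx[of i] length_idx[OF i] in
        \<open>auto intro: polys_in_add polys_in_mult mpderiv_in \<Omega>_in\<close>)
    have "E (?\<Phi> (?s * mpderiv i \<Omega>)) = E ?J"
      using brk[of Y i, OF Y i] poly[of Y, OF Y dC] by (simp add: jac_vars[OF i])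
    then have "F \<xi> dvd ?\<Phi> (?s * mpderiv i \<Omega>) - ?J" using E[OF \<Phi>C[OF dC] JC] by simp
    then have "F \<xi> dvd ?s * (?\<Phi> (?s * mpderiv i \<Omega>) - ?J)" by simp
    also have "?s * (?\<Phi> (?s * mpderiv i \<Omega>) - ?J) = (?s * ?s) * ?\<Phi> (mpderiv i \<Omega>) - ?s * ?J"
      by (simp add: ev.hom_mult ev.hom_power ev.hom_uminus right_diff_distrib mult.assoc)
    also have "?s * ?s = 1" by (simp flip: power_add power_mult_distrib)
    finally show ?thesis by simp
  qed
  have deg: "tdeg (Y j) \<le> 1" if "j \<le> n" for j
    by (rule tdeg_le_1[OF min _ _ bracket that]) (use Y in \<open>auto simp: Y_def\<close>)
  have "\<exists>z\<in>?C. ?\<Phi> z = mpvar j" if "j \<le> n" for j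
  proof (rule affine_surjective[OF deg _ _ that])
    fix p assume p: "p \<in> ?C" "F \<xi> dvd ?\<Phi> p"
    have "E (?\<Phi> p) = E (?\<Phi> 0)" using E[OF \<Phi>C[OF p(1)] \<Phi>C[of 0]] p(2) by (simp add: ev.hom_zero)
    then have "\<psi> p = \<psi> 0" using poly[of Y, OF Y p(1)] poly[of Y 0, OF Y] by simp
    then show "F \<xi> dvd p" using inj[OF p(1), of 0] by simp
  qed (use Y in auto)
  then obtain z where z: "\<And>j. j \<le> n \<Longrightarrow> z j \<in> ?C \<and> ?\<Phi> (z j) = mpvar j" by metis
  let ?q = "mpeval mpoly_const z p"
  have qC: "?q \<in> ?C"
    by (rule mpeval_in[OF mpoly_const_hom p]) (use z in \<open>auto intro: polys_in_add polys_in_mult\<close>)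
  have "?\<Phi> ?q = p"
    by (rule comm_ring_hom_eq_on[of "\<lambda>p. ?\<Phi> (mpeval mpoly_const z p)" "\<lambda>p. p", OF _ _ p])
      (use z in \<open>auto simp: comm_ring_hom_id mpeval_const[OF mpoly_const_hom] mpeval_var[OF mpoly_const_hom]
        intro: comm_ring_hom_comp[OF mpeval_hom[OF mpoly_const_hom] mpeval_hom[OF mpoly_const_hom]]\<close>)
  then show ?thesis using poly[of Y, OF Y qC] qC by auto
qed

context
  fixes \<xi> :: 'k
begin

abbreviation PC :: "'k mpoly set" where "PC \<equiv> polys_in {..n}"

definition FI :: "'k mpoly set" where
  "FI = genideal (jacobian_nambu n \<Omega>) {F \<xi>}"

definition cl :: "'k mpoly \<Rightarrow> 'k mpoly set" where
  "cl a = FI +>\<^bsub>jacobian_nambu n \<Omega>\<^esub> a"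

abbreviation Fib :: "('k, 'k mpoly set) nambu" where
  "Fib \<equiv> fibre_nambu n \<Omega> \<xi>"

interpretation A: typed_mpoly_algebra "n + 1" "jacobian_nambu n \<Omega>"
  by (rule typed_jacobian_nambu)

lemma F_dvd_in:
  assumes "F \<xi> dvd a" "a \<in> PC"
  obtains c where "c \<in> PC" "a = F \<xi> * c"
proof (cases "a = 0")
  case True then show ?thesis using that[of 0] by simp
next
  case False
  obtain c where c: "a = F \<xi> * c" using assms(1) by (rule dvdE)
  then have "c * F \<xi> \<in> PC" "c * F \<xi> \<noteq> 0" using assms(2) False by (simp_all add: mult.commute)
  then have "c \<in> PC" by (rule factor_in)
  then show ?thesis using that c by blast
qed

lemma ideal_FI: "ideal FI (jacobian_nambu n \<Omega>)"
proof -
  interpret cr: cring "jacobian_nambu n \<Omega>" by (rule A.cring_A)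
  show ?thesis unfolding FI_def
    by (rule cr.genideal_ideal) (use F_in[of \<xi>] in \<open>simp add: A.carrier lessThan_Suc_atMost\<close>)
qed

lemma mem_FI: "a \<in> FI \<longleftrightarrow> a \<in> PC \<and> F \<xi> dvd a"
proof -
  interpret cr: cring "jacobian_nambu n \<Omega>" by (rule A.cring_A)
  have Fc: "{F \<xi>} \<subseteq> carrier (jacobian_nambu n \<Omega>)"
    using F_in[of \<xi>] by (simp add: A.carrier lessThan_Suc_atMost)
  have "ideal {a \<in> PC. F \<xi> dvd a} (jacobian_nambu n \<Omega>)"
    by (rule A.idealI_typed) (auto simp: lessThan_Suc_atMost intro: polys_in_add polys_in_mult)
  then have "FI \<subseteq> {a \<in> PC. F \<xi> dvd a}"
    unfolding FI_def by (rule cr.genideal_minimal) (simp add: F_in)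
  moreover have "a \<in> FI" if aF: "a \<in> PC" "F \<xi> dvd a"
  proof -
    obtain c where c: "c \<in> PC" "a = F \<xi> * c" by (rule F_dvd_in[OF aF(2,1)])
    have "F \<xi> \<in> FI" using cr.genideal_self[OF Fc] unfolding FI_def by simp
    then have "c * F \<xi> \<in> FI" by (rule A.I_mult[OF ideal_FI]) (use c in \<open>simp add: lessThan_Suc_atMost\<close>)
    then show ?thesis using c by (simp add: mult.commute)
  qed
  ultimately show ?thesis by auto
qed

lemma cl_eq: "a \<in> PC \<Longrightarrow> b \<in> PC \<Longrightarrow> cl a = cl b \<longleftrightarrow> F \<xi> dvd a - b"
  unfolding cl_def A.coset_eq[OF ideal_FI] mem_FI by (auto intro: polys_in_diff)

lemma jac_PC: "set us \<subseteq> PC \<Longrightarrow> length us = n \<Longrightarrow> mp.jac n \<Omega> us \<in> PC"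
  by (rule mp.jac_in) (use \<Omega>_in in \<open>auto intro: polys_in_add polys_in_mult mpderiv_in\<close>)

lemma jac_FI:
  assumes us: "set us \<subseteq> PC" "length us = n" and k: "k < n" and z: "z \<in> FI"
  shows "mp.jac n \<Omega> (us[k := z]) \<in> FI"
proof -
  interpret d: derivation "\<lambda>x. mp.jac n \<Omega> (us[k := x])" by (rule mp.derivation_jac[OF us(2) k])
  have "F \<xi> dvd z" "z \<in> PC" using z by (auto simp: mem_FI)
  then obtain v where v: "v \<in> PC" "z = F \<xi> * v" by (rule F_dvd_in)
  have "mp.jac n \<Omega> (us[k := \<Omega>]) = 0"
    by (rule mp.jac_casimir[of _ n k]) (use us k in auto)
  moreover have "mp.jac n \<Omega> (us[k := mpoly_const \<xi>]) = 0"
    by (rule mp.jac_constant[OF us(2) k]) simp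
  ultimately have "mp.jac n \<Omega> (us[k := F \<xi>]) = 0" by (simp add: F_def d.diff)
  then have eq: "mp.jac n \<Omega> (us[k := z]) = F \<xi> * mp.jac n \<Omega> (us[k := v])" unfolding v(2) by (simp add: d.leibniz)
  have "mp.jac n \<Omega> (us[k := v]) \<in> PC"
    by (rule jac_PC) (use us v set_update_subset_insert[of us k v] in auto)
  then show ?thesis unfolding eq mem_FI by (auto intro: polys_in_mult F_in)
qed

text \<open>The bracket of cosets is a union over all tuples of representatives. It collapses to one
  coset because F is a Casimir, so that congruent tuples have congruent Jacobians.\<close>

lemma bracket_Fib:
  assumes us: "set us \<subseteq> PC" "length us = n"
  shows "bracket Fib (map cl us) = cl (mp.jac n \<Omega> us)"
proof -
  interpret m: multiderivation n "mp.jac n \<Omega>" by (rule mp.multiderivation_jac)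
  have "FI +>\<^bsub>jacobian_nambu n \<Omega>\<^esub> bracket (jacobian_nambu n \<Omega>) xs = cl (mp.jac n \<Omega> us)"
    if xs: "list_all2 (\<in>) xs (map cl us)" for xs
  proof -
    have len: "length xs = n" using xs us by (simp add: list_all2_lengthD)
    have d: "xs ! i - us ! i \<in> FI" if "i < n" for i
      using xs that us len by (auto simp: list_all2_conv_all_nth cl_def A.mem_coset[OF ideal_FI])
    have "xs ! i \<in> PC" if "i < n" for i
    proof -
      have "(xs ! i - us ! i) + us ! i \<in> PC"
        using d[OF that] us that by (intro polys_in_add) (auto simp: mem_FI subset_iff)
      then show ?thesis by simp
    qed
    then have xsC: "set xs \<subseteq> PC" using len by (auto simp: in_set_conv_nth)
    have "mp.jac n \<Omega> xs - mp.jac n \<Omega> us \<in> FI"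
      by (rule m.congruence[OF A.I_add[OF ideal_FI] A.I_0[OF ideal_FI] jac_FI len xsC us(2,1) d])
    then show ?thesis by (simp add: bracket_jacobian_nambu cl_def A.coset_eq[OF ideal_FI])
  qed
  moreover have "list_all2 (\<in>) us (map cl us)"
    by (auto simp: list_all2_conv_all_nth cl_def A.mem_coset[OF ideal_FI] A.I_0[OF ideal_FI])
  ultimately have "(\<Union>xs\<in>{xs. list_all2 (\<in>) xs (map cl us)}. FI +>\<^bsub>jacobian_nambu n \<Omega>\<^esub> bracket (jacobian_nambu n \<Omega>) xs) =
      cl (mp.jac n \<Omega> us)" by blast
  then show ?thesis
    by (simp add: fibre_nambu_def quotient_nambu_def module.defs nambu.defs FI_def F_def)
qed

lemma image_Fib: "nambu_image PC mpoly_const cl Fib mpderiv n \<Omega>"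
proof -
  interpret q: algebra_image "polys_in {..<n + 1}" mpoly_const cl "quotient_algebra (jacobian_nambu n \<Omega>) FI"
    using A.image_quotient[OF ideal_FI] unfolding cl_def[abs_def] .
  have Fib: "Fib = quotient_nambu (jacobian_nambu n \<Omega>) FI" by (simp add: fibre_nambu_def FI_def F_def)
  show ?thesis
  proof (intro nambu_image.intro nambu_image_axioms.intro commuting_derivations_mpderiv)
    show "algebra_image PC mpoly_const cl Fib"
      unfolding Fib
      by (unfold_locales)
        (use q.carrier q.add q.mult q.zero q.one q.smult in
          \<open>simp_all add: lessThan_Suc_atMost quotient_nambu_def module.defs nambu.defs polys_in_add polys_in_mult
            mpoly_const_add mpoly_const_mult\<close>)
    show "0 < n" using n2 by simp
  qed (use \<Omega>_in bracket_Fib mpderiv_in in auto)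
qed

interpretation Fib: nambu_image PC mpoly_const cl Fib mpderiv n \<Omega>
  by (rule image_Fib)

theorem dixmier_Fib: "dixmier_property n Fib"
  unfolding dixmier_property_def
proof (intro conjI ballI impI)
  show "nambu_poisson_algebra n Fib" by (rule Fib.nambu_P)
  fix \<phi> assume \<phi>: "\<phi> \<in> nambu_hom n Fib Fib" and inj: "inj_on \<phi> (carrier Fib)"
  have closed: "\<phi> (cl a) \<in> cl ` PC" if "a \<in> PC" for a
    using \<phi> that by (auto simp: nambu_hom_def Ring.ring_hom_def Fib.carrier)
  have "\<exists>q\<in>PC. \<phi> (cl q) = cl p" if p: "p \<in> PC" for p
  proof (rule surjective_if_on_generators[where \<xi> = \<xi> and E = cl and \<psi> = "\<lambda>p. \<phi> (cl p)", OF cl_eq _ _ _ _ p])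
    fix j assume "j \<le> n"
    then show "\<exists>y\<in>PC. \<phi> (cl (mpvar j)) = cl y" using closed[of "mpvar j"] by auto
  next
    fix Y p assume Y: "\<And>j. j \<le> n \<Longrightarrow> Y j \<in> PC \<and> \<phi> (cl (mpvar j)) = cl (Y j)" and p: "p \<in> PC"
    show "\<phi> (cl p) = cl (mpeval mpoly_const Y p)"
      by (rule Fib.hom_polynomial(3)[OF \<phi>, where g = "\<lambda>p. p", OF comm_ring_hom_id _ _ _ _ p]) (use Y in auto)
  next
    fix Y i assume Y: "\<And>j. j \<le> n \<Longrightarrow> Y j \<in> PC \<and> \<phi> (cl (mpvar j)) = cl (Y j)" and i: "i \<le> n"
    show "\<phi> (cl (mp.jac n \<Omega> (map mpvar (idx i)))) = cl (mp.jac n \<Omega> (map Y (idx i)))"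
      by (rule Fib.hom_bracket[OF \<phi> length_idx[OF i]]) (use Y set_idx[of i] in auto)
  next
    fix a b assume ab: "a \<in> PC" "b \<in> PC" "\<phi> (cl a) = \<phi> (cl b)"
    then have "cl a = cl b" using inj by (auto simp: inj_on_def Fib.carrier)
    then show "F \<xi> dvd a - b" using cl_eq ab by simp
  qed auto
  then show "bij_betw \<phi> (carrier Fib) (carrier Fib)"
    unfolding bij_betw_def using inj closed by (auto simp: Fib.carrier image_iff) metis
qed

end

end

section \<open>Fraction fields of the fibres\<close>

lemma UN_pair_const:
  assumes "Z \<noteq> {}" "\<And>a b. (a, b) \<in> Z \<Longrightarrow> f a b = c"
  shows "(\<Union>(a, b)\<in>Z. f a b) = c"
  using assms by (auto simp: split_def)

context potential
begin

text \<open>The part of \<open>W\<close> that involves only t_0, ..., t_n; its residue classes are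
  the fractions of the fibre.\<close>

definition WC :: "'k \<Rightarrow> 'k mpoly fract set" where
  "WC \<xi> = {to_fract a / to_fract b | a b. a \<in> PC \<and> b \<in> PC \<and> \<not> F \<xi> dvd b}"

text \<open>Reduction modulo the maximal ideal \<^term>\<open>NN \<xi>\<close> of the localization of the polynomial ring
  at the prime \<^term>\<open>F \<xi>\<close>, whose residue field is the fraction field of the fibre.\<close>

definition res :: "'k \<Rightarrow> 'k mpoly fract \<Rightarrow> ('k mpoly set \<times> 'k mpoly set) set" where
  "res \<xi> x = {(cl \<xi> a, cl \<xi> b) | a b.
     a \<in> PC \<and> b \<in> PC \<and> \<not> F \<xi> dvd b \<and> x - to_fract a / to_fract b \<in> NN \<xi>}"

context
  fixes \<xi> :: 'k
begin

interpretation Fib: nambu_image PC mpoly_const "cl \<xi>" "Fib \<xi>" mpderiv n \<Omega>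
  by (rule image_Fib)

lemma WC_quotient: "a \<in> PC \<Longrightarrow> b \<in> PC \<Longrightarrow> \<not> F \<xi> dvd b \<Longrightarrow> to_fract a / to_fract b \<in> WC \<xi>"
  unfolding WC_def by blast

lemma WC_cases:
  assumes "x \<in> WC \<xi>"
  obtains a b where "x = to_fract a / to_fract b" "a \<in> PC" "b \<in> PC" "\<not> F \<xi> dvd b"
  using assms unfolding WC_def by blast

lemma WC_W: "x \<in> WC \<xi> \<Longrightarrow> x \<in> W \<xi>"
  unfolding WC_def W_def by blast

lemma WC_to_fract: "a \<in> PC \<Longrightarrow> to_fract a \<in> WC \<xi>"
  using WC_quotient[of a 1] not_dvd_1 by simp

lemma WC_add: "x \<in> WC \<xi> \<Longrightarrow> y \<in> WC \<xi> \<Longrightarrow> x + y \<in> WC \<xi>"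
proof (elim WC_cases)
  fix a b a' b'
  assume x: "x = to_fract a / to_fract b" "a \<in> PC" "b \<in> PC" "\<not> F \<xi> dvd b"
    and y: "y = to_fract a' / to_fract b'" "a' \<in> PC" "b' \<in> PC" "\<not> F \<xi> dvd b'"
  have "b \<noteq> 0" "b' \<noteq> 0" using x y not_dvd_0 by blast+
  then have "x + y = to_fract (a * b' + a' * b) / to_fract (b * b')"
    unfolding x(1) y(1) by (simp add: add_frac_eq)
  also have "\<dots> \<in> WC \<xi>" by (intro WC_quotient polys_in_add polys_in_mult x y not_dvd_mult)
  finally show ?thesis .
qed

lemma WC_mult: "x \<in> WC \<xi> \<Longrightarrow> y \<in> WC \<xi> \<Longrightarrow> x * y \<in> WC \<xi>"
proof (elim WC_cases)
  fix a b a' b'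
  assume x: "x = to_fract a / to_fract b" "a \<in> PC" "b \<in> PC" "\<not> F \<xi> dvd b"
    and y: "y = to_fract a' / to_fract b'" "a' \<in> PC" "b' \<in> PC" "\<not> F \<xi> dvd b'"
  have "x * y = to_fract (a * a') / to_fract (b * b')" unfolding x(1) y(1) by simp
  also have "\<dots> \<in> WC \<xi>" by (intro WC_quotient polys_in_mult x y not_dvd_mult)
  finally show ?thesis .
qed

lemma WC_uminus: "x \<in> WC \<xi> \<Longrightarrow> - x \<in> WC \<xi>"
proof -
  assume x: "x \<in> WC \<xi>"
  have "to_fract (mpoly_const (- 1)) * x \<in> WC \<xi>" by (intro WC_mult x WC_to_fract) simp
  then show ?thesis by (simp add: mpoly_const_uminus)
qed

lemma WC_divide: "x \<in> WC \<xi> \<Longrightarrow> b \<in> PC \<Longrightarrow> \<not> F \<xi> dvd b \<Longrightarrow> x / to_fract b \<in> WC \<xi>"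
  using WC_mult[OF _ WC_quotient[of 1 b], of x] by simp

lemma WC_fract_deriv: "x \<in> WC \<xi> \<Longrightarrow> fract_deriv (mpderiv j) x \<in> WC \<xi>"
proof -
  assume x: "x \<in> WC \<xi>"
  then obtain a b where ab: "x = to_fract a / to_fract b" "a \<in> PC" "b \<in> PC" "\<not> F \<xi> dvd b" by (rule WC_cases)
  have "fract_deriv (mpderiv j) x = (to_fract (mpderiv j a) + - (x * to_fract (mpderiv j b))) / to_fract b"
    unfolding ab(1) fract_deriv_quotient[OF derivation_mpderiv not_dvd_0[OF ab(4)]] by simp
  also have "\<dots> \<in> WC \<xi>"
    by (intro WC_divide WC_add WC_uminus WC_mult WC_to_fract x ab mpderiv_in)
  finally show ?thesis .
qed

lemma WC_0: "0 \<in> WC \<xi>" and WC_1: "1 \<in> WC \<xi>"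
  using WC_to_fract[of 0] WC_to_fract[of 1] by simp_all

lemma br_WC: "set us \<subseteq> WC \<xi> \<Longrightarrow> length us = n \<Longrightarrow> br us \<in> WC \<xi>"
  by (rule fr.jac_in[OF WC_add WC_mult WC_uminus WC_0 WC_1 WC_fract_deriv _ WC_to_fract[OF \<Omega>_in]])

lemma quotient_NN:
  assumes b: "\<not> F \<xi> dvd b" and e: "\<not> F \<xi> dvd e"
  shows "to_fract a / to_fract b - to_fract c / to_fract e \<in> NN \<xi> \<longleftrightarrow> F \<xi> dvd a * e - c * b"
proof -
  let ?x = "to_fract a / to_fract b - to_fract c / to_fract e"
  have nz: "to_fract b \<noteq> 0" "to_fract e \<noteq> 0" using not_dvd_0[OF b] not_dvd_0[OF e] by simp_all
  have eq: "to_fract (a * e - c * b) = to_fract (b * e) * ?x" using nz by (simp add: field_simps)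
  show ?thesis
  proof
    assume "?x \<in> NN \<xi>"
    then have "to_fract (a * e - c * b) \<in> NN \<xi>" unfolding eq by (rule NN_mult[OF W_to_fract])
    then show "F \<xi> dvd a * e - c * b" by (rule to_fract_NN[THEN iffD1])
  next
    assume "F \<xi> dvd a * e - c * b"
    then have "to_fract (a * e - c * b) \<in> NN \<xi>" by (rule to_fract_NN[THEN iffD2])
    then have "to_fract (a * e - c * b) / to_fract (b * e) \<in> NN \<xi>" by (rule NN_divide[OF _ not_dvd_mult[OF b e]])
    then show "?x \<in> NN \<xi>" unfolding eq using nz by simp
  qed
qed

lemma res_cong:
  assumes "x - y \<in> NN \<xi>"
  shows "res \<xi> x = res \<xi> y"
proof -
  have "x - z \<in> NN \<xi> \<longleftrightarrow> y - z \<in> NN \<xi>" for z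
    using NN_diff[OF _ assms, of "x - z"] NN_add[OF _ assms, of "y - z"] by auto
  then show ?thesis unfolding res_def by simp
qed

text \<open>Equality of fractions over the fibre means that F divides a d - c b, which by
  \<open>quotient_NN\<close> is congruence modulo \<open>NN\<close>. So \<open>res\<close> returns
  exactly the classes of \<open>fraction_rel\<close>.\<close>

lemma res_quotient:
  assumes a: "a \<in> PC" and b: "b \<in> PC" "\<not> F \<xi> dvd b"
  shows "res \<xi> (to_fract a / to_fract b) = fraction (Fib \<xi>) (cl \<xi> a) (cl \<xi> b)"
proof -
  have nz: "cl \<xi> d \<noteq> cl \<xi> 0 \<longleftrightarrow> \<not> F \<xi> dvd d" if "d \<in> PC" for d
    using cl_eq[OF that, of 0] by simp
  have eq: "cl \<xi> a \<otimes>\<^bsub>Fib \<xi>\<^esub> cl \<xi> d = cl \<xi> c \<otimes>\<^bsub>Fib \<xi>\<^esub> cl \<xi> b \<longleftrightarrow> F \<xi> dvd a * d - c * b"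
    if "c \<in> PC" "d \<in> PC" for c d
    using that a b cl_eq[of "a * d" "c * b"] by (simp add: Fib.mult polys_in_mult)
  have "fraction (Fib \<xi>) (cl \<xi> a) (cl \<xi> b) = {(cl \<xi> c, cl \<xi> d) | c d.
      c \<in> PC \<and> d \<in> PC \<and> \<not> F \<xi> dvd d \<and> F \<xi> dvd a * d - c * b}"
    unfolding fraction_def fraction_rel_def Fib.carrier Fib.zero
    using a b by (auto simp: nz eq) (use nz eq in blast)+
  then show ?thesis unfolding res_def using quotient_NN[OF b(2)] by blast
qed

lemma res_memE:
  assumes "(A, B) \<in> res \<xi> x"
  obtains a b where "A = cl \<xi> a" "B = cl \<xi> b" "a \<in> PC" "b \<in> PC" "\<not> F \<xi> dvd b"
    "x - to_fract a / to_fract b \<in> NN \<xi>"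
  using assms unfolding res_def by blast

lemma res_mem: "a \<in> PC \<Longrightarrow> b \<in> PC \<Longrightarrow> \<not> F \<xi> dvd b \<Longrightarrow> (cl \<xi> a, cl \<xi> b) \<in> res \<xi> (to_fract a / to_fract b)"
  unfolding res_def using NN_0 by force

lemma res_nonempty: "x \<in> WC \<xi> \<Longrightarrow> res \<xi> x \<noteq> {}"
  by (elim WC_cases) (use res_mem in blast)

lemma res_eq:
  assumes x: "x \<in> WC \<xi>"
  shows "res \<xi> x = res \<xi> y \<longleftrightarrow> x - y \<in> NN \<xi>"
proof
  assume eq: "res \<xi> x = res \<xi> y"
  obtain a b where ab: "x = to_fract a / to_fract b" "a \<in> PC" "b \<in> PC" "\<not> F \<xi> dvd b" using x by (rule WC_cases)
  have "(cl \<xi> a, cl \<xi> b) \<in> res \<xi> y" using res_mem[OF ab(2-4)] unfolding ab(1)[symmetric] eq .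
  then obtain c d where cd: "cl \<xi> a = cl \<xi> c" "cl \<xi> b = cl \<xi> d" "c \<in> PC" "d \<in> PC" "\<not> F \<xi> dvd d"
    "y - to_fract c / to_fract d \<in> NN \<xi>" by (rule res_memE)
  have "res \<xi> x = res \<xi> (to_fract c / to_fract d)"
    unfolding ab(1) res_quotient[OF ab(2-4)] res_quotient[OF cd(3-5)] cd(1,2) ..
  have "F \<xi> dvd a - c" "F \<xi> dvd b - d" using cd cl_eq ab by simp_all
  then have "F \<xi> dvd (a - c) * d - c * (b - d)" by simp
  also have "(a - c) * d - c * (b - d) = a * d - c * b" by (simp add: algebra_simps)
  finally have "x - to_fract c / to_fract d \<in> NN \<xi>" unfolding ab(1) quotient_NN[OF ab(4) cd(5)] .
  from NN_diff[OF this cd(6)] show "x - y \<in> NN \<xi>" by simp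
qed (rule res_cong)

lemma res_bilinear:
  assumes x: "x \<in> WC \<xi>" and y: "y \<in> WC \<xi>"
    and f: "\<And>a b c d. a \<in> PC \<Longrightarrow> b \<in> PC \<Longrightarrow> \<not> F \<xi> dvd b \<Longrightarrow> c \<in> PC \<Longrightarrow> d \<in> PC \<Longrightarrow> \<not> F \<xi> dvd d \<Longrightarrow>
      x - to_fract a / to_fract b \<in> NN \<xi> \<Longrightarrow> y - to_fract c / to_fract d \<in> NN \<xi> \<Longrightarrow>
      f (cl \<xi> a) (cl \<xi> b) (cl \<xi> c) (cl \<xi> d) = r"
  shows "(\<Union>(a, b)\<in>res \<xi> x. \<Union>(c, d)\<in>res \<xi> y. f a b c d) = r"
  by (intro UN_pair_const res_nonempty x y) (elim res_memE, simp add: f)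

lemma carrier_fraction_field: "carrier (fraction_field (Fib \<xi>)) = res \<xi> ` WC \<xi>"
proof -
  have nz: "cl \<xi> d \<noteq> cl \<xi> 0 \<longleftrightarrow> \<not> F \<xi> dvd d" if "d \<in> PC" for d
    using cl_eq[OF that, of 0] by simp
  have "carrier (fraction_field (Fib \<xi>)) =
      {fraction (Fib \<xi>) (cl \<xi> a) (cl \<xi> b) | a b. a \<in> PC \<and> b \<in> PC \<and> \<not> F \<xi> dvd b}"
    unfolding fraction_field_def fraction_def quotient_def Fib.carrier Fib.zero
    by (auto simp: nz) (use nz in blast)+
  also have "\<dots> = res \<xi> ` WC \<xi>"
    unfolding WC_def using res_quotient by (auto simp: image_iff) blast+
  finally show ?thesis .
qed

lemma res_to_fract: "a \<in> PC \<Longrightarrow> res \<xi> (to_fract a) = fraction (Fib \<xi>) (cl \<xi> a) (cl \<xi> 1)"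
  using res_quotient[of a 1] not_dvd_1 by simp

lemma image_fraction_field:
  "algebra_image (WC \<xi>) (\<lambda>c. to_fract (mpoly_const c)) (res \<xi>)
    (module.extend (fraction_field (Fib \<xi>)) (nambu.fields b))" (is "algebra_image _ _ _ ?K")
proof (rule algebra_image.intro)
  show "comm_ring_hom (\<lambda>c::'k. to_fract (mpoly_const c))"
    by (rule comm_ring_hom_comp[OF mpoly_const_hom to_fract_hom])
  show "to_fract (mpoly_const c) \<in> WC \<xi>" for c by (rule WC_to_fract) simp
  show "carrier ?K = res \<xi> ` WC \<xi>"
    unfolding carrier_fraction_field[symmetric] by (simp add: module.defs nambu.defs)
  show "\<zero>\<^bsub>?K\<^esub> = res \<xi> 0" "\<one>\<^bsub>?K\<^esub> = res \<xi> 1"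
    using res_to_fract[of 0] res_to_fract[of 1]
    by (simp_all add: module.defs nambu.defs fraction_field_def Fib.zero Fib.one)
  fix x y assume x: "x \<in> WC \<xi>"
  {
    fix c
    have "(\<Union>(a, b)\<in>res \<xi> x. fraction (Fib \<xi>) (c \<odot>\<^bsub>Fib \<xi>\<^esub> a) b) = res \<xi> (to_fract (mpoly_const c) * x)"
    proof (rule UN_pair_const[OF res_nonempty[OF x]], elim res_memE)
      fix A B a b
      assume ab: "A = cl \<xi> a" "B = cl \<xi> b" "a \<in> PC" "b \<in> PC" "\<not> F \<xi> dvd b" "x - to_fract a / to_fract b \<in> NN \<xi>"
      have "to_fract (mpoly_const c) * (x - to_fract a / to_fract b) \<in> NN \<xi>"
        by (rule NN_mult[OF W_to_fract ab(6)])
      then have "to_fract (mpoly_const c) * x - to_fract (mpoly_const c * a) / to_fract b \<in> NN \<xi>"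
        by (simp add: right_diff_distrib)
      then have "res \<xi> (to_fract (mpoly_const c) * x) = res \<xi> (to_fract (mpoly_const c * a) / to_fract b)"
        by (rule res_cong)
      also have "\<dots> = fraction (Fib \<xi>) (cl \<xi> (mpoly_const c * a)) (cl \<xi> b)"
        by (rule res_quotient[OF _ ab(4,5)]) (simp add: polys_in_mult ab(3))
      finally show "fraction (Fib \<xi>) (c \<odot>\<^bsub>Fib \<xi>\<^esub> A) B = res \<xi> (to_fract (mpoly_const c) * x)"
        by (simp add: ab(1,2) Fib.smult[OF ab(3)])
    qed
    then show "c \<odot>\<^bsub>?K\<^esub> res \<xi> x = res \<xi> (to_fract (mpoly_const c) * x)"
      by (simp add: module.defs nambu.defs fraction_field_def)
  }
  assume y: "y \<in> WC \<xi>"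
  have "(\<Union>(a, b)\<in>res \<xi> x. \<Union>(c, d)\<in>res \<xi> y. fraction (Fib \<xi>) (a \<otimes>\<^bsub>Fib \<xi>\<^esub> c) (b \<otimes>\<^bsub>Fib \<xi>\<^esub> d)) = res \<xi> (x * y)"
  proof (rule res_bilinear[OF x y])
    fix a b c d
    assume ab: "a \<in> PC" "b \<in> PC" "\<not> F \<xi> dvd b" and cd: "c \<in> PC" "d \<in> PC" "\<not> F \<xi> dvd d"
      and xa: "x - to_fract a / to_fract b \<in> NN \<xi>" and yc: "y - to_fract c / to_fract d \<in> NN \<xi>"
    have "to_fract c / to_fract d \<in> W \<xi>" by (rule WC_W[OF WC_quotient[OF cd]])
    then have "to_fract c / to_fract d * (x - to_fract a / to_fract b) + x * (y - to_fract c / to_fract d) \<in> NN \<xi>"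
      by (intro NN_add NN_mult xa yc WC_W[OF x])
    then have "x * y - to_fract (a * c) / to_fract (b * d) \<in> NN \<xi>" by (simp add: algebra_simps)
    then have "res \<xi> (x * y) = res \<xi> (to_fract (a * c) / to_fract (b * d))" by (rule res_cong)
    also have "\<dots> = fraction (Fib \<xi>) (cl \<xi> (a * c)) (cl \<xi> (b * d))"
      by (intro res_quotient polys_in_mult not_dvd_mult ab cd)
    finally show "fraction (Fib \<xi>) (cl \<xi> a \<otimes>\<^bsub>Fib \<xi>\<^esub> cl \<xi> c) (cl \<xi> b \<otimes>\<^bsub>Fib \<xi>\<^esub> cl \<xi> d) = res \<xi> (x * y)"
      by (simp add: Fib.mult ab cd)
  qed
  then show "res \<xi> x \<otimes>\<^bsub>?K\<^esub> res \<xi> y = res \<xi> (x * y)"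
    by (simp add: module.defs nambu.defs fraction_field_def)
  have "(\<Union>(a, b)\<in>res \<xi> x. \<Union>(c, d)\<in>res \<xi> y. fraction (Fib \<xi>) (a \<otimes>\<^bsub>Fib \<xi>\<^esub> d \<oplus>\<^bsub>Fib \<xi>\<^esub> c \<otimes>\<^bsub>Fib \<xi>\<^esub> b) (b \<otimes>\<^bsub>Fib \<xi>\<^esub> d)) = res \<xi> (x + y)"
  proof (rule res_bilinear[OF x y])
    fix a b c d
    assume ab: "a \<in> PC" "b \<in> PC" "\<not> F \<xi> dvd b" and cd: "c \<in> PC" "d \<in> PC" "\<not> F \<xi> dvd d"
      and xa: "x - to_fract a / to_fract b \<in> NN \<xi>" and yc: "y - to_fract c / to_fract d \<in> NN \<xi>"
    have nz: "to_fract b \<noteq> 0" "to_fract d \<noteq> 0" using not_dvd_0[OF ab(3)] not_dvd_0[OF cd(3)] by simp_all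
    have "to_fract (a * d + c * b) / to_fract (b * d) = to_fract a / to_fract b + to_fract c / to_fract d"
      using nz by (simp add: add_frac_eq)
    moreover have "(x - to_fract a / to_fract b) + (y - to_fract c / to_fract d) \<in> NN \<xi>"
      by (intro NN_add xa yc)
    ultimately have "(x + y) - to_fract (a * d + c * b) / to_fract (b * d) \<in> NN \<xi>" by (simp only: add_diff_add)
    then have "res \<xi> (x + y) = res \<xi> (to_fract (a * d + c * b) / to_fract (b * d))" by (rule res_cong)
    also have "\<dots> = fraction (Fib \<xi>) (cl \<xi> (a * d + c * b)) (cl \<xi> (b * d))"
      by (intro res_quotient polys_in_mult polys_in_add not_dvd_mult ab cd)
    finally show "fraction (Fib \<xi>) (cl \<xi> a \<otimes>\<^bsub>Fib \<xi>\<^esub> cl \<xi> d \<oplus>\<^bsub>Fib \<xi>\<^esub> cl \<xi> c \<otimes>\<^bsub>Fib \<xi>\<^esub> cl \<xi> b)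
        (cl \<xi> b \<otimes>\<^bsub>Fib \<xi>\<^esub> cl \<xi> d) = res \<xi> (x + y)"
      by (simp add: Fib.mult Fib.add ab cd polys_in_mult)
  qed
  then show "res \<xi> x \<oplus>\<^bsub>?K\<^esub> res \<xi> y = res \<xi> (x + y)"
    by (simp add: module.defs nambu.defs fraction_field_def)
qed (fact WC_add WC_mult WC_uminus WC_0 WC_1)+

end

end

context potential
begin

text \<open>The bracket of chosen preimages; \<open>fbr_res\<close> shows independence of the
  choice. The value \<open>undefined\<close> elsewhere matches the extensionality in the description
  of \<open>fraction_bracket\<close>.\<close>

definition fbr :: "'k \<Rightarrow> ('k mpoly set \<times> 'k mpoly set) set list \<Rightarrow> ('k mpoly set \<times> 'k mpoly set) set" where
  "fbr \<xi> Zs = (if set Zs \<subseteq> res \<xi> ` WC \<xi> \<and> length Zs = n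
     then res \<xi> (br (map (inv_into (WC \<xi>) (res \<xi>)) Zs)) else undefined)"

context
  fixes \<xi> :: 'k
begin

interpretation Fib: nambu_image PC mpoly_const "cl \<xi>" "Fib \<xi>" mpderiv n \<Omega>
  by (rule image_Fib)

abbreviation KK :: "(('k mpoly set \<times> 'k mpoly set) set list \<Rightarrow> ('k mpoly set \<times> 'k mpoly set) set) \<Rightarrow>
    ('k, ('k mpoly set \<times> 'k mpoly set) set) nambu" where
  "KK b \<equiv> module.extend (fraction_field (Fib \<xi>)) (nambu.fields b)"

lemma bracket_KK: "bracket (KK b) = b"
  by (simp add: module.defs nambu.defs)

lemma fbr_res:
  assumes us: "set us \<subseteq> WC \<xi>" "length us = n"
  shows "fbr \<xi> (map (res \<xi>) us) = res \<xi> (br us)"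
proof -
  interpret m: multiderivation n br by (rule fr.multiderivation_jac)
  let ?vs = "map (inv_into (WC \<xi>) (res \<xi>)) (map (res \<xi>) us)"
  have vs: "set ?vs \<subseteq> WC \<xi>" "length ?vs = n" using us by (auto intro!: inv_into_into)
  have W: "set us \<subseteq> W \<xi>" "set ?vs \<subseteq> W \<xi>" using us(1) vs(1) WC_W by blast+
  have "br ?vs - br us \<in> NN \<xi>"
  proof (rule m.congruence[OF NN_add NN_0 br_NN vs(2) W(2) us(2) W(1)])
    fix i assume "i < n"
    then have i: "us ! i \<in> WC \<xi>" "?vs ! i = inv_into (WC \<xi>) (res \<xi>) (res \<xi> (us ! i))"
      using us by (auto simp: subset_iff)
    have "?vs ! i \<in> WC \<xi>" unfolding i(2) using i(1) by (intro inv_into_into imageI)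
    moreover have "res \<xi> (?vs ! i) = res \<xi> (us ! i)" unfolding i(2) using i(1) by (intro f_inv_into_f imageI)
    ultimately show "?vs ! i - us ! i \<in> NN \<xi>" by (simp only: res_eq)
  qed
  then have "res \<xi> (br ?vs) = res \<xi> (br us)" by (rule res_cong)
  moreover have "set (map (res \<xi>) us) \<subseteq> res \<xi> ` WC \<xi>" "length (map (res \<xi>) us) = n" using us by auto
  ultimately show ?thesis unfolding fbr_def by (simp only: if_True simp_thms)
qed

lemma image_KK:
  "nambu_image (WC \<xi>) (\<lambda>c. to_fract (mpoly_const c)) (res \<xi>) (KK (fbr \<xi>))
    (\<lambda>j. fract_deriv (mpderiv j)) n (to_fract \<Omega>)"
proof (intro nambu_image.intro nambu_image_axioms.intro commuting_derivations_fract_deriv image_fraction_field)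
  show "0 < n" using n2 by simp
qed (simp_all add: WC_fract_deriv WC_to_fract \<Omega>_in derivation_mpderiv fbr_res bracket_KK)

lemma embedded_generators:
  assumes ps: "set ps \<subseteq> PC" "length ps = n"
  shows "map (\<lambda>A. fraction (Fib \<xi>) A \<one>\<^bsub>Fib \<xi>\<^esub>) (map (cl \<xi>) ps) = map (res \<xi>) (map to_fract ps)"
    "fraction (Fib \<xi>) (bracket (Fib \<xi>) (map (cl \<xi>) ps)) \<one>\<^bsub>Fib \<xi>\<^esub> = res \<xi> (br (map to_fract ps))"
proof -
  show "map (\<lambda>A. fraction (Fib \<xi>) A \<one>\<^bsub>Fib \<xi>\<^esub>) (map (cl \<xi>) ps) = map (res \<xi>) (map to_fract ps)"
    using ps by (auto simp: res_to_fract Fib.one subset_iff)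
  show "fraction (Fib \<xi>) (bracket (Fib \<xi>) (map (cl \<xi>) ps)) \<one>\<^bsub>Fib \<xi>\<^esub> = res \<xi> (br (map to_fract ps))"
    unfolding Fib.bracket[OF ps] br_to_fract[OF ps(2)] res_to_fract[OF jac_PC[OF ps]] Fib.one ..
qed

text \<open>The entries are replaced by fractions one at a time: if \<open>x = a / b\<close>, the Leibniz rule for
  \<open>b x = a\<close> determines the bracket with entry \<open>x\<close> from those with entries \<open>a\<close> and \<open>b\<close>.\<close>

lemma bracket_unique:
  assumes N: "nambu_poisson_algebra n (KK b)"
    and ext: "\<And>ps. set ps \<subseteq> PC \<Longrightarrow> length ps = n \<Longrightarrow> b (map (res \<xi>) (map to_fract ps)) = res \<xi> (br (map to_fract ps))"
    and us: "set us \<subseteq> WC \<xi>" "length us = n"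
  shows "b (map (res \<xi>) us) = res \<xi> (br us)"
proof -
  interpret K: nambu_poisson_algebra n "KK b" by (rule N)
  interpret im: algebra_image "WC \<xi>" "\<lambda>c. to_fract (mpoly_const c)" "res \<xi>" "KK b" by (rule image_fraction_field)
  \<comment> \<open>Induction on k: the first k entries are arbitrary fractions, the later ones
    images of polynomials, where both brackets agree by assumption.\<close>
  have "b (map (res \<xi>) us) = res \<xi> (br us)"
    if "k \<le> n" "set us \<subseteq> WC \<xi>" "length us = n" "\<And>i. k \<le> i \<Longrightarrow> i < n \<Longrightarrow> us ! i \<in> to_fract ` PC" for k us
    using that
  proof (induction k arbitrary: us)
    case 0
    then have "set us \<subseteq> to_fract ` PC" by (auto simp: in_set_conv_nth)
    then obtain ps where ps: "us = map to_fract ps" "set ps \<subseteq> PC" by (rule list_of_images)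
    then show ?case using ext[of ps] 0 by simp
  next
    case (Suc k us)
    have k: "k < n" using Suc.prems by simp
    have len: "length us = n" and usC: "set us \<subseteq> WC \<xi>" by fact+
    have x: "us ! k \<in> WC \<xi>" using usC k len by (auto simp: subset_iff)
    then obtain a c where ac: "us ! k = to_fract a / to_fract c" "a \<in> PC" "c \<in> PC" "\<not> F \<xi> dvd c" by (rule WC_cases)
    have a: "to_fract a = to_fract c * us ! k" unfolding ac(1) using not_dvd_0[OF ac(4)] by simp
    have cW: "to_fract c \<in> WC \<xi>" by (rule WC_to_fract[OF ac(3)])
    have upd: "set (us[k := t]) \<subseteq> WC \<xi>" if "t \<in> WC \<xi>" for t
      using usC that set_update_subset_insert[of us k t] by blast
    have IH: "b (map (res \<xi>) (us[k := to_fract p])) = res \<xi> (br (us[k := to_fract p]))" if p: "p \<in> PC" for p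
    proof (rule Suc.IH)
      show "us[k := to_fract p] ! i \<in> to_fract ` PC" if "k \<le> i" "i < n" for i
        using that p len Suc.prems(4)[of i] by (cases "i = k") auto
    qed (use k len upd[OF WC_to_fract[OF p]] in auto)
    interpret d: derivation "\<lambda>x. br (us[k := x])"
      by (rule multiderivation.deriv[OF fr.multiderivation_jac len k])
    have cl: "set (map (res \<xi>) us) \<subseteq> carrier (KK b)" "length (map (res \<xi>) us) = n"
      "res \<xi> (to_fract c) \<in> carrier (KK b)" "res \<xi> (us ! k) \<in> carrier (KK b)"
      using usC len x cW unfolding im.carrier by auto
    have self: "us[k := us ! k] = us" by simp
    have "b (map (res \<xi>) us) \<in> carrier (KK b)" using K.bracket_closed[OF cl(1,2)] unfolding bracket_KK .
    then obtain z where z: "b (map (res \<xi>) us) = res \<xi> z" "z \<in> WC \<xi>" unfolding im.carrier by blast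
    let ?w = "br (us[k := to_fract c])"
    have wW: "?w \<in> WC \<xi>" by (rule br_WC[OF upd[OF cW]]) (simp add: len)
    have "b (map (res \<xi>) (us[k := to_fract c * us ! k])) =
        res \<xi> (to_fract c) \<otimes>\<^bsub>KK b\<^esub> b (map (res \<xi>) (us[k := us ! k])) \<oplus>\<^bsub>KK b\<^esub>
        res \<xi> (us ! k) \<otimes>\<^bsub>KK b\<^esub> b (map (res \<xi>) (us[k := to_fract c]))"
      using K.leibniz[OF cl(1,2) k cl(3,4)] unfolding bracket_KK im.mult[OF cW x] map_update[symmetric] .
    also have "\<dots> = res \<xi> (to_fract c * z + us ! k * ?w)"
      unfolding self z(1) IH[OF ac(3)] im.mult[OF cW z(2)] im.mult[OF x wW]
      by (rule im.add[OF WC_mult[OF cW z(2)] WC_mult[OF x wW]])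
    also have "b (map (res \<xi>) (us[k := to_fract c * us ! k])) = res \<xi> (br (us[k := to_fract c * us ! k]))"
      unfolding a[symmetric] by (rule IH[OF ac(2)])
    also have "br (us[k := to_fract c * us ! k]) = to_fract c * br us + us ! k * ?w"
      unfolding d.leibniz self ..
    finally have "(to_fract c * br us + us ! k * ?w) - (to_fract c * z + us ! k * ?w) \<in> NN \<xi>"
      using res_eq[OF WC_add[OF WC_mult[OF cW br_WC[OF usC len]] WC_mult[OF x wW]]] by blast
    then have "to_fract c * (br us - z) \<in> NN \<xi>" by (simp add: right_diff_distrib)
    then have "to_fract c * (br us - z) / to_fract c \<in> NN \<xi>" by (rule NN_divide[OF _ ac(4)])
    then have "br us - z \<in> NN \<xi>" using not_dvd_0[OF ac(4)] by simp
    then show ?case unfolding z(1) by (rule res_cong[symmetric])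
  qed
  from this[of n] show ?thesis using us by simp
qed

lemma fraction_bracket_Fib: "fraction_bracket n (Fib \<xi>) = fbr \<xi>"
  unfolding fraction_bracket_def
proof (rule the_equality, intro conjI allI impI)
  let ?S = "{Zs. set Zs \<subseteq> carrier (fraction_field (Fib \<xi>)) \<and> length Zs = n}"
  show "fbr \<xi> \<in> extensional ?S"
    unfolding carrier_fraction_field by (auto simp: extensional_def fbr_def)
  show "nambu_poisson_algebra n (KK (fbr \<xi>))" by (rule nambu_image.nambu_P[OF image_KK])
  fix As assume As: "set As \<subseteq> carrier (Fib \<xi>) \<and> length As = n"
  then obtain ps where ps: "As = map (cl \<xi>) ps" "set ps \<subseteq> PC"
    unfolding Fib.carrier using list_of_images[of As "cl \<xi>" PC] by blast
  then have len: "length ps = n" using As by simp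
  have "set (map to_fract ps) \<subseteq> WC \<xi>" using ps(2) WC_to_fract by auto
  then show "fbr \<xi> (map (\<lambda>A. fraction (Fib \<xi>) A \<one>\<^bsub>Fib \<xi>\<^esub>) As) = fraction (Fib \<xi>) (bracket (Fib \<xi>) As) \<one>\<^bsub>Fib \<xi>\<^esub>"
    unfolding ps(1) embedded_generators[OF ps(2) len] by (rule fbr_res) (simp add: len)
next
  let ?S = "{Zs. set Zs \<subseteq> carrier (fraction_field (Fib \<xi>)) \<and> length Zs = n}"
  fix b assume b: "b \<in> extensional ?S \<and> nambu_poisson_algebra n (KK b) \<and>
    (\<forall>us. set us \<subseteq> carrier (Fib \<xi>) \<and> length us = n \<longrightarrow>
      b (map (\<lambda>A. fraction (Fib \<xi>) A \<one>\<^bsub>Fib \<xi>\<^esub>) us) = fraction (Fib \<xi>) (bracket (Fib \<xi>) us) \<one>\<^bsub>Fib \<xi>\<^esub>)"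
  have ext: "b (map (res \<xi>) (map to_fract ps)) = res \<xi> (br (map to_fract ps))" if ps: "set ps \<subseteq> PC" "length ps = n" for ps
  proof -
    have "set (map (cl \<xi>) ps) \<subseteq> carrier (Fib \<xi>) \<and> length (map (cl \<xi>) ps) = n"
      unfolding Fib.carrier using ps by auto
    then show ?thesis using b unfolding embedded_generators[OF ps, symmetric] by blast
  qed
  show "b = fbr \<xi>"
  proof
    fix Zs show "b Zs = fbr \<xi> Zs"
    proof (cases "set Zs \<subseteq> res \<xi> ` WC \<xi> \<and> length Zs = n")
      case True
      then obtain us where us: "Zs = map (res \<xi>) us" "set us \<subseteq> WC \<xi>"
        using list_of_images[of Zs "res \<xi>" "WC \<xi>"] by blast
      then have len: "length us = n" using True by simp
      have "nambu_poisson_algebra n (KK b)" by (rule conjunct1[OF conjunct2[OF b]])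
      from bracket_unique[OF this ext us(2) len] show ?thesis unfolding us(1) fbr_res[OF us(2) len] .
    next
      case False
      then have "Zs \<notin> ?S" unfolding carrier_fraction_field by blast
      then have "b Zs = undefined" by (rule extensional_arb[OF conjunct1[OF b]])
      then show ?thesis unfolding fbr_def if_not_P[OF False] .
    qed
  qed
qed

lemma res_SS:
  assumes x: "x \<in> WC \<xi>" "x \<in> SS \<xi>"
  shows "\<exists>p\<in>PC. res \<xi> x = res \<xi> (to_fract p)"
proof -
  obtain a b where ab: "x = to_fract a / to_fract b" "a \<in> PC" "b \<in> PC" "\<not> F \<xi> dvd b" using x(1) by (rule WC_cases)
  obtain p where p: "x - to_fract p \<in> NN \<xi>" using x(2) SS_iff by blast
  then have "F \<xi> dvd a * 1 - p * b"
    using quotient_NN[OF ab(4) not_dvd_1, of a p] unfolding ab(1) by simp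
  \<comment> \<open>The polynomial p may involve variables beyond t_n. Setting these to 0 preserves
    divisibility by F, and F, a and b are unaffected.\<close>
  then have "restrict_vars {..n} (F \<xi>) dvd restrict_vars {..n} (a * 1 - p * b)" by (elim dvdE) (simp add: restrict_vars.hom_mult)
  then have "F \<xi> dvd a * 1 - restrict_vars {..n} p * b"
    using F_in[of \<xi>] ab by (simp add: restrict_vars.hom_mult restrict_vars.hom_minus)
  then have "x - to_fract (restrict_vars {..n} p) \<in> NN \<xi>"
    using quotient_NN[OF ab(4) not_dvd_1, of a "restrict_vars {..n} p"] unfolding ab(1) by simp
  then show ?thesis using res_cong restrict_vars_in by blast
qed

lemma res_to_fract_eq: "a \<in> PC \<Longrightarrow> b \<in> PC \<Longrightarrow> res \<xi> (to_fract a) = res \<xi> (to_fract b) \<longleftrightarrow> F \<xi> dvd a - b"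
  unfolding res_eq[OF WC_to_fract] to_fract_diff[symmetric] to_fract_NN ..

text \<open>Since the images of the variables have no poles, the endomorphism restricts to the fibre
  and is onto there. A fraction a/b is then the image of p/q, where p and q are preimages of a and b
  and q is nonzero on the fibre because b is.\<close>

theorem dixmier_fraction_Fib: "dixmier_property n (fraction_nambu n (Fib \<xi>))"
proof -
  interpret K: nambu_image "WC \<xi>" "\<lambda>c. to_fract (mpoly_const c)" "res \<xi>" "KK (fbr \<xi>)"
    "\<lambda>j. fract_deriv (mpderiv j)" n "to_fract \<Omega>" by (rule image_KK)
  let ?K = "KK (fbr \<xi>)" and ?c = "\<lambda>c. to_fract (mpoly_const c)"
  have bij: "bij_betw \<phi> (carrier ?K) (carrier ?K)"
    if \<phi>: "\<phi> \<in> nambu_hom n ?K ?K" and inj: "inj_on \<phi> (carrier ?K)" for \<phi>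
  proof -
    let ?\<psi> = "\<lambda>p. \<phi> (res \<xi> (to_fract p))"
    have "\<phi> \<in> carrier ?K \<rightarrow> carrier ?K" using \<phi> by (simp add: nambu_hom_def Ring.ring_hom_def)
    then have closed: "\<exists>y\<in>WC \<xi>. \<phi> (res \<xi> x) = res \<xi> y" if "x \<in> WC \<xi>" for x
      using funcset_mem[of \<phi> "carrier ?K" "carrier ?K" "res \<xi> x"] that unfolding K.carrier by blast
    have inj': "res \<xi> x = res \<xi> y" if "\<phi> (res \<xi> x) = \<phi> (res \<xi> y)" "x \<in> WC \<xi>" "y \<in> WC \<xi>" for x y
      using inj_onD[OF inj that(1)] that(2,3) unfolding K.carrier by blast
    have poly: "mpeval ?c Y p \<in> WC \<xi>" "?\<psi> p = res \<xi> (mpeval ?c Y p)"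
      if Y: "\<And>j. j \<le> n \<Longrightarrow> Y j \<in> WC \<xi> \<and> ?\<psi> (mpvar j) = res \<xi> (Y j)" and p: "p \<in> PC" for Y p
      by (rule K.hom_polynomial(2,3)[OF \<phi>, where g = to_fract, OF to_fract_hom refl _ _ _ p];
          use Y WC_to_fract in auto)+
    have brk: "?\<psi> (mp.jac n \<Omega> (map mpvar (idx i))) = res \<xi> (br (map Y (idx i)))"
      if Y: "\<And>j. j \<le> n \<Longrightarrow> Y j \<in> WC \<xi> \<and> ?\<psi> (mpvar j) = res \<xi> (Y j)" and i: "i \<le> n" for Y i
    proof -
      have "\<phi> (res \<xi> (br (map (\<lambda>j. to_fract (mpvar j)) (idx i)))) = res \<xi> (br (map Y (idx i)))"
        by (rule K.hom_bracket[OF \<phi> length_idx[OF i]]) (use Y set_idx[of i] WC_to_fract in auto)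
      then show ?thesis using br_to_fract[of "map mpvar (idx i)"] length_idx[OF i] by (simp add: comp_def)
    qed
    have "\<forall>j\<in>{..n}. \<exists>y\<in>WC \<xi>. ?\<psi> (mpvar j) = res \<xi> y" using closed WC_to_fract by simp
    then obtain Y0 where Y0: "\<And>j. j \<le> n \<Longrightarrow> Y0 j \<in> WC \<xi> \<and> ?\<psi> (mpvar j) = res \<xi> (Y0 j)" by (metis atMost_iff)
    define Y where "Y j = (if j \<le> n then Y0 j else 0)" for j
    have Y: "Y j \<in> WC \<xi> \<and> ?\<psi> (mpvar j) = res \<xi> (Y j)" if "j \<le> n" for j using Y0[OF that] that by (simp add: Y_def)
    interpret ev: comm_ring_hom "mpeval ?c Y" by (rule mpeval_hom[OF K.cst_hom])
    have rel: "mpeval ?c Y (mpderiv i \<Omega>) - (- 1) ^ (n + i) * br (map Y (idx i)) \<in> NN \<xi>" if i: "i \<le> n" for i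
    proof -
      let ?p = "(- 1) ^ (n + i) * mpderiv i \<Omega>" and ?J = "br (map Y (idx i))" and ?s = "(- 1) ^ (n + i) :: 'k mpoly fract"
      have pC: "?p \<in> PC" by (intro polys_in_mult polys_in_power mpderiv_in \<Omega>_in) simp
      have "res \<xi> (mpeval ?c Y ?p) = res \<xi> ?J"
        using brk[of Y i, OF Y i] poly(2)[of Y, OF Y pC] by (simp only: jac_vars[OF i])
      then have "mpeval ?c Y ?p - ?J \<in> NN \<xi>" using res_eq[OF poly(1)[of Y, OF Y pC]] by blast
      then have "to_fract ((- 1) ^ (n + i)) * (mpeval ?c Y ?p - ?J) \<in> NN \<xi>" by (rule NN_mult[OF W_to_fract])
      also have "to_fract ((- 1) ^ (n + i)) = ?s" by (simp add: to_fract.hom_power to_fract.hom_uminus)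
      also have "?s * (mpeval ?c Y ?p - ?J) = (?s * ?s) * mpeval ?c Y (mpderiv i \<Omega>) - ?s * ?J"
        by (simp add: ev.hom_mult ev.hom_power ev.hom_uminus right_diff_distrib mult.assoc)
      also have "?s * ?s = 1" by (simp flip: power_add power_mult_distrib)
      finally show ?thesis by simp
    qed
    have gen: "\<exists>y\<in>PC. ?\<psi> (mpvar j) = res \<xi> (to_fract y)" if j: "j \<le> n" for j
    proof -
      have "Y j \<in> SS \<xi>"
        by (rule substitution_regular[OF _ _ rel j]) (use Y WC_W in \<open>auto simp: Y_def\<close>)
      then show ?thesis using res_SS[of "Y j"] Y[OF j] by simp
    qed
    have surj: "\<exists>q\<in>PC. ?\<psi> q = res \<xi> (to_fract p)" if p: "p \<in> PC" for p
    proof (rule surjective_if_on_generators[where \<xi> = \<xi> and E = "\<lambda>p. res \<xi> (to_fract p)" and \<psi> = ?\<psi>,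
          OF res_to_fract_eq gen _ _ _ p])
      fix Z and p :: "'k mpoly"
      assume Z: "\<And>j. j \<le> n \<Longrightarrow> Z j \<in> PC \<and> ?\<psi> (mpvar j) = res \<xi> (to_fract (Z j))"
      have Z': "to_fract (Z j) \<in> WC \<xi> \<and> ?\<psi> (mpvar j) = res \<xi> (to_fract (Z j))" if "j \<le> n" for j
        using Z[OF that] WC_to_fract by blast
      have "mpeval ?c (\<lambda>j. to_fract (Z j)) = (\<lambda>p. to_fract (mpeval mpoly_const Z p))"
        by (rule comm_ring_hom_eq[OF mpeval_hom[OF K.cst_hom] comm_ring_hom_comp[OF mpeval_hom[OF mpoly_const_hom] to_fract_hom]])
          (simp_all only: mpeval_const[OF K.cst_hom] mpeval_const[OF mpoly_const_hom]
            mpeval_var[OF K.cst_hom] mpeval_var[OF mpoly_const_hom])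
      then show "?\<psi> p = res \<xi> (to_fract (mpeval mpoly_const Z p))" if "p \<in> PC"
        using poly(2)[of "\<lambda>j. to_fract (Z j)", OF Z' that] by simp
      show "?\<psi> (mp.jac n \<Omega> (map mpvar (idx i))) = res \<xi> (to_fract (mp.jac n \<Omega> (map Z (idx i))))" if i: "i \<le> n" for i
        using brk[of "\<lambda>j. to_fract (Z j)", OF Z' i] br_to_fract[of "map Z (idx i)"] length_idx[OF i]
        by (simp add: comp_def)
    next
      fix a b assume ab: "a \<in> PC" "b \<in> PC" "?\<psi> a = ?\<psi> b"
      then have "res \<xi> (to_fract a) = res \<xi> (to_fract b)" by (intro inj' WC_to_fract)
      then show "F \<xi> dvd a - b" using res_to_fract_eq ab by blast
    qed
    have "\<exists>w\<in>WC \<xi>. \<phi> (res \<xi> w) = res \<xi> z" if zW: "z \<in> WC \<xi>" for z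
    proof -
      obtain a b where ab: "z = to_fract a / to_fract b" "a \<in> PC" "b \<in> PC" "\<not> F \<xi> dvd b" using zW by (rule WC_cases)
      obtain p where p: "p \<in> PC" "?\<psi> p = res \<xi> (to_fract a)" using surj[OF ab(2)] by blast
      obtain q where q: "q \<in> PC" "?\<psi> q = res \<xi> (to_fract b)" using surj[OF ab(3)] by blast
      have qF: "\<not> F \<xi> dvd q"
      proof
        assume "F \<xi> dvd q"
        then have "res \<xi> (to_fract q) = res \<xi> (to_fract 0)" using res_to_fract_eq[OF q(1), of 0] by simp
        then have "res \<xi> (to_fract b) = ?\<psi> 0" using q(2) by simp
        also have "\<dots> = res \<xi> (to_fract 0)" using poly(2)[of Y, OF Y, of 0] by (simp add: ev.hom_zero)
        finally show False using res_to_fract_eq[OF ab(3), of 0] ab(4) by simp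
      qed
      let ?w = "to_fract p / to_fract q"
      have wW: "?w \<in> WC \<xi>" by (rule WC_quotient[OF p(1) q(1) qF])
      obtain v where v: "v \<in> WC \<xi>" "\<phi> (res \<xi> ?w) = res \<xi> v" using closed[OF wW] by blast
      have qW: "to_fract q \<in> WC \<xi>" and bW: "to_fract b \<in> WC \<xi>" using WC_to_fract q(1) ab(3) by blast+
      have "\<phi> (res \<xi> ?w \<otimes>\<^bsub>?K\<^esub> res \<xi> (to_fract q)) = \<phi> (res \<xi> ?w) \<otimes>\<^bsub>?K\<^esub> ?\<psi> q"
        using \<phi> wW qW unfolding nambu_hom_def Ring.ring_hom_def K.carrier by simp
      then have "\<phi> (res \<xi> (?w * to_fract q)) = res \<xi> (v * to_fract b)"
        unfolding v(2) q(2) K.mult[OF wW qW] K.mult[OF v(1) bW] .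
      moreover have "?w * to_fract q = to_fract p" using not_dvd_0[OF qF] by simp
      ultimately have "res \<xi> (v * to_fract b) = res \<xi> (to_fract a)" using p(2) by simp
      then have "v * to_fract b - to_fract a \<in> NN \<xi>" using res_eq[OF WC_mult[OF v(1) bW]] by blast
      then have "(v * to_fract b - to_fract a) / to_fract b \<in> NN \<xi>" by (rule NN_divide[OF _ ab(4)])
      moreover have "(v * to_fract b - to_fract a) / to_fract b = v - z"
        unfolding ab(1) using not_dvd_0[OF ab(4)] by (simp add: diff_divide_distrib)
      ultimately have "res \<xi> v = res \<xi> z" by (simp add: res_cong)
      then show ?thesis using wW v(2) by auto
    qed
    then show ?thesis
      unfolding bij_betw_def K.carrier
      using inj[unfolded K.carrier] closed by (auto simp: image_iff) metis
  qed
  show ?thesis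
    unfolding fraction_nambu_def fraction_bracket_Fib dixmier_property_def
    using K.nambu_P bij by blast
qed

end

end

theorem theorem0p8:
  fixes n :: nat and \<Omega> :: "'k::field_char_0 mpoly" and \<xi> :: 'k
  assumes "n \<ge> 3"
    and "isolated_singularity_potential (n + 1) \<Omega>"
    and "total_degree \<Omega> \<ge> n + 3"
  shows "dixmier_property n (fibre_nambu n \<Omega> \<xi>) \<and>
         dixmier_property n (fraction_nambu n (fibre_nambu n \<Omega> \<xi>))"
proof -
  obtain N where "potential n \<Omega> (total_degree \<Omega>) N"
    using isolated_singularity_imp_potential[OF _ assms(2,3)] assms(1) by auto
  then interpret potential n \<Omega> "total_degree \<Omega>" N .
  show ?thesis using dixmier_Fib dixmier_fraction_Fib by blast
qed

end
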